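(* Let $\beta,\gamma\in[0,1+\alpha)$ with $\beta\le\gamma$. Then there exists a constant $C>0$ such that $$\|P_t\|_{\mathcal{L}(C^\beta_{b,d},\,C^\gamma_{b,d})}\le C\big(1+t^{\frac{\beta-\gamma}{\alpha}}\big),\qquad t>0,$$ where the left-hand side is the norm of $P_t$ as a linear operator from $C^\beta_{b,d}(\mathbb{R}^N)$ to $C^\gamma_{b,d}(\mathbb{R}^N)$.
   Context: Setting. Let $1\le d\le N$ be integers, $A\in\mathbb{R}^{N\times N}$, $B\in\mathbb{R}^{N\times d}$ with $\mathrm{rank}(B)=d$, $b\in\mathbb{R}^d$, $Q\in\mathbb{R}^{d\times d}$ symmetric and non-negative definite, and $\nu$ a Lévy measure on $\mathbb{R}^d_0:=\mathbb{R}^d\setminus\{0\}$ (i.e. $\sigma$-finite with $\int(1\wedge|z|^2)\,\nu(dz)<\infty$). Standing assumptions: [ND]: there exist $r_0>0$, $\alpha\in(0,2)$ and a finite measure $\mu$ on the unit sphere $\mathbb{S}^{d-1}$ which is non-degenerate (there is $\eta\ge1$ with $\eta^{-1}|p|^\alpha\le\int_{\mathbb{S}^{d-1}}|p\cdot s|^\alpha\mu(ds)\le\eta|p|^\alpha$ for all $p\in\mathbb{R}^d$) such that $\nu(C)\ge\int_0^{r_0}\int_{\mathbb{S}^{d-1}}\mathbf{1}_C(r\theta)\,\mu(d\theta)\frac{dr}{r^{1+\alpha}}$ for all Borel $C\subset\mathbb{R}^d_0$; these are fixed. [K]: $\mathrm{rank}[B,AB,\dots,A^{N-1}B]=N$.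 Semigroup. Let $\{Z_t\}_{t\ge0}$ be a Lévy process on $\mathbb{R}^d$ with $\mathbb{E}[e^{ip\cdot Z_t}]=e^{-t\Phi(p)}$, $\Phi(p)=-ib\cdot p+\frac12p\cdot Qp+\int_{\mathbb{R}^d_0}(1-e^{ip\cdot z}+ip\cdot z\mathbf{1}_{B(0,1)}(z))\nu(dz)$. For $x\in\mathbb{R}^N$ let $X_t=e^{tA}x+\int_0^te^{(t-s)A}B\,dZ_s$ and $P_t\phi(x)=\mathbb{E}[\phi(X_t)]$ for bounded Borel $\phi$. Decomposition of $\mathbb{R}^N$. Let $n:=\min\{r:\mathrm{rank}[B,AB,\dots,A^{r-1}B]=N\}$, $V_h:=\mathrm{Im}(B)+\mathrm{Im}(AB)+\dots+\mathrm{Im}(A^{h-1}B)$ for $1\le h\le n$; $E_1$ is the orthogonal projection onto $V_1$ and, for $2\le h\le n$, $E_h$ is the orthogonal projection onto $V_{h-1}^\perp\cap V_h$. Spaces. $C_b(\mathbb{R}^N)$: bounded uniformly continuous real functions with the supremum norm. On a Euclidean space, for $k\in\mathbb{N}_0$ and $\beta'\in(0,1]$ put $[\phi]_{C^{k+\beta'}}:=\sup_{|\vartheta|=k}\sup_{x\ne y}\frac{|D^\vartheta\phi(x)-D^\vartheta\phi(y)|}{|x-y|^{\beta'}}$ if $\beta'\neq1$, and $[\phi]_{C^{k+1}}:=\sup_{|\vartheta|=k}\sup_{x\ne y}\frac{|D^\vartheta\phi(x)+D^\vartheta\phi(y)-2D^\vartheta\phi(\frac{x+y}{2})|}{|x-y|}$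 if $\beta'=1$. $C_b^{k+\beta'}$ consists of the $\phi$ with continuous derivatives up to order $k$ and $\|\phi\|_{C_b^{k+\beta'}}:=\sum_{i=0}^k\sup_{|\vartheta|=i}\|D^\vartheta\phi\|_\infty+[\phi]_{C^{k+\beta'}}<\infty$. For $\gamma>0$, $C^\gamma_{b,d}(\mathbb{R}^N)$ is the set of $\phi\colon\mathbb{R}^N\to\mathbb{R}$ such that for every $h\in\{1,\dots,n\}$ and $x_0\in\mathbb{R}^N$ the function $z\in E_h(\mathbb{R}^N)\mapsto\phi(x_0+z)$ is in $C_b^{\gamma/(1+\alpha(h-1))}(E_h(\mathbb{R}^N))$ with norm bounded independently of $x_0$, with norm $$\|\phi\|_{C^\gamma_{b,d}}:=\sum_{h=1}^n\sup_{x_0\in\mathbb{R}^N}\|\phi(x_0+\cdot)\|_{C_b^{\gamma/(1+\alpha(h-1))}(E_h(\mathbb{R}^N))}.$$ By convention $C^0_{b,d}(\mathbb{R}^N):=C_b(\mathbb{R}^N)$. *)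

theory Defs
  imports "HOL-Probability.Probability"
begin

section \<open>Matrices and the Kalman filtration\<close>

text \<open>
  The operations \<open>(*)\<close>, \<open>(^)\<close> and \<open>exp\<close> of the library do not give the matrix product, its
  powers and the matrix exponential on \<open>real^'n^'n\<close>, so the latter two are introduced here.
\<close>

primrec mat_pow :: "real^'n^'n \<Rightarrow> nat \<Rightarrow> real^'n^'n" where
  "mat_pow A 0 = mat 1"
| "mat_pow A (Suc k) = A ** mat_pow A k"

definition mat_exp :: "real^'n^'n \<Rightarrow> real^'n^'n" where
  "mat_exp A = (\<Sum>k. (1 / fact k) *\<^sub>R mat_pow A k)"

text \<open>
  The rank of the block matrix \<open>[B, AB, \<dots>, A\<^sup>r\<^sup>-\<^sup>1 B]\<close>. Its number of columns depends on \<open>r\<close>, so it is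
  not a value of a matrix type; its set of columns is the union of those of the blocks
  (for a single matrix, compare \<open>column_rank_def\<close>).
\<close>

definition kalman_rank :: "real^'n^'n \<Rightarrow> real^'d^'n \<Rightarrow> nat \<Rightarrow> nat" where
  "kalman_rank A B r = dim (\<Union>k<r. columns (mat_pow A k ** B))"

definition kalman_index :: "real^'n^'n \<Rightarrow> real^'d^'n \<Rightarrow> nat" where
  "kalman_index A B = (LEAST r. kalman_rank A B r = CARD('n))"

definition V_space :: "real^'n^'n \<Rightarrow> real^'d^'n \<Rightarrow> nat \<Rightarrow> (real^'n) set" where
  "V_space A B h = {\<Sum>k<h. (mat_pow A k ** B) *v u k | u. True}"

text \<open>The range \<open>E\<^sub>h(\<real>\<^sup>N)\<close> of the orthogonal projection \<open>E\<^sub>h\<close>.\<close>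

definition E_space :: "real^'n^'n \<Rightarrow> real^'d^'n \<Rightarrow> nat \<Rightarrow> (real^'n) set" where
  "E_space A B h =
     (if h = 1 then V_space A B 1
      else orthogonal_comp (V_space A B (h - 1)) \<inter> V_space A B h)"

definition orthonormal_basis_of :: "'a::euclidean_space set \<Rightarrow> 'a set \<Rightarrow> bool" where
  "orthonormal_basis_of S E \<longleftrightarrow>
     pairwise orthogonal S \<and> (\<forall>u\<in>S. norm u = 1) \<and> span S = E"


section \<open>Hoelder--Zygmund spaces on a Euclidean subspace\<close>

text \<open>
  A subspace \<open>E\<close> is regarded as a Euclidean space through an orthonormal basis \<open>S\<close> of \<open>E\<close>.
  For \<open>vs = [v\<^sub>1, \<dots>, v\<^sub>k]\<close> with \<open>v\<^sub>i \<in> S\<close>, the function \<open>partials vs f\<close> is the iterated partial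
  derivative of \<open>f\<close> along \<open>v\<^sub>k\<close>, \<dots>, \<open>v\<^sub>1\<close>; on \<open>E\<close> it only depends on the values of \<open>f\<close> on \<open>E\<close>.
  Lists of length \<open>k\<close> over \<open>S\<close> play the role of the multi-indices of order \<open>k\<close>: for functions of
  class \<open>C\<^sup>k\<close> the order of differentiation is irrelevant.
\<close>

primrec partials :: "'a list \<Rightarrow> ('a::real_normed_vector \<Rightarrow> real) \<Rightarrow> 'a \<Rightarrow> real" where
  "partials [] f = f"
| "partials (v # vs) f = (\<lambda>x. deriv (\<lambda>s. partials vs f (x + s *\<^sub>R v)) 0)"

definition multi_indices :: "'a set \<Rightarrow> nat \<Rightarrow> 'a list set" where
  "multi_indices S k = {vs. set vs \<subseteq> S \<and> length vs = k}"

definition Ck_on :: "'a::real_normed_vector set \<Rightarrow> 'a set \<Rightarrow> nat \<Rightarrow> ('a \<Rightarrow> real) \<Rightarrow> bool" where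
  "Ck_on E S k f \<longleftrightarrow>
     (\<forall>i<k. \<forall>vs\<in>multi_indices S i. \<forall>v\<in>S. \<forall>x\<in>E.
        (\<lambda>s. partials vs f (x + s *\<^sub>R v)) differentiable (at (0::real))) \<and>
     (\<forall>i\<le>k. \<forall>vs\<in>multi_indices S i. continuous_on E (partials vs f))"

text \<open>Every \<open>s > 0\<close> is uniquely \<open>k + \<beta>'\<close> with \<open>k \<in> \<nat>\<close> and \<open>\<beta>' \<in> (0,1]\<close>.\<close>

definition int_order :: "real \<Rightarrow> nat" where
  "int_order s = nat (\<lceil>s\<rceil> - 1)"

definition frac_order :: "real \<Rightarrow> real" where
  "frac_order s = s - real (int_order s)"

definition hz_seminorm ::
  "'a::real_normed_vector set \<Rightarrow> 'a set \<Rightarrow> real \<Rightarrow> ('a \<Rightarrow> real) \<Rightarrow> ennreal" where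
  "hz_seminorm E S s f =
     (SUP vs\<in>multi_indices S (int_order s). SUP (x, y)\<in>{(x, y). x \<in> E \<and> y \<in> E \<and> x \<noteq> y}.
        let D = partials vs f in
        if frac_order s \<noteq> 1
        then ennreal (\<bar>D x - D y\<bar> / norm (x - y) powr frac_order s)
        else ennreal (\<bar>D x + D y - 2 * D ((1/2) *\<^sub>R (x + y))\<bar> / norm (x - y)))"

definition sup_norm_on :: "'a set \<Rightarrow> ('a \<Rightarrow> real) \<Rightarrow> ennreal" where
  "sup_norm_on E f = (SUP x\<in>E. ennreal \<bar>f x\<bar>)"

definition hz_norm ::
  "'a::real_normed_vector set \<Rightarrow> 'a set \<Rightarrow> real \<Rightarrow> ('a \<Rightarrow> real) \<Rightarrow> ennreal" where
  "hz_norm E S s f =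
     (\<Sum>i\<le>int_order s. SUP vs\<in>multi_indices S i. sup_norm_on E (partials vs f)) + hz_seminorm E S s f"

definition hz_space ::
  "'a::real_normed_vector set \<Rightarrow> 'a set \<Rightarrow> real \<Rightarrow> ('a \<Rightarrow> real) set" where
  "hz_space E S s = {f. Ck_on E S (int_order s) f \<and> hz_norm E S s f < \<infinity>}"


section \<open>Anisotropic Hoelder--Zygmund spaces\<close>

text \<open>
  \<open>S h\<close> is an orthonormal basis of \<open>E_space A B h\<close> for \<open>1 \<le> h \<le> kalman_index A B\<close>.
\<close>

definition Cb :: "('a::metric_space \<Rightarrow> real) set" where
  "Cb = {\<phi>. uniformly_continuous_on UNIV \<phi> \<and> bounded (range \<phi>)}"

definition aniso_order :: "real \<Rightarrow> real \<Rightarrow> nat \<Rightarrow> real" where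
  "aniso_order \<alpha> \<gamma> h = \<gamma> / (1 + \<alpha> * (real h - 1))"

definition aniso_space ::
  "real^'n^'n \<Rightarrow> real^'d^'n \<Rightarrow> real \<Rightarrow> (nat \<Rightarrow> (real^'n) set) \<Rightarrow> real \<Rightarrow> (real^'n \<Rightarrow> real) set" where
  "aniso_space A B \<alpha> S \<gamma> =
     (if \<gamma> = 0 then Cb
      else {\<phi>. \<forall>h\<in>{1..kalman_index A B}.
              (\<forall>x0. (\<lambda>z. \<phi> (x0 + z)) \<in> hz_space (E_space A B h) (S h) (aniso_order \<alpha> \<gamma> h)) \<and>
              (\<exists>K::real. \<forall>x0.
                 hz_norm (E_space A B h) (S h) (aniso_order \<alpha> \<gamma> h) (\<lambda>z. \<phi> (x0 + z)) \<le> ennreal K)})"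

definition aniso_norm ::
  "real^'n^'n \<Rightarrow> real^'d^'n \<Rightarrow> real \<Rightarrow> (nat \<Rightarrow> (real^'n) set) \<Rightarrow> real \<Rightarrow> (real^'n \<Rightarrow> real) \<Rightarrow> ennreal" where
  "aniso_norm A B \<alpha> S \<gamma> \<phi> =
     (if \<gamma> = 0 then sup_norm_on UNIV \<phi>
      else \<Sum>h=1..kalman_index A B.
             SUP x0. hz_norm (E_space A B h) (S h) (aniso_order \<alpha> \<gamma> h) (\<lambda>z. \<phi> (x0 + z)))"

definition operator_norm ::
  "'f set \<Rightarrow> ('f \<Rightarrow> ennreal) \<Rightarrow> ('g \<Rightarrow> ennreal) \<Rightarrow> ('f \<Rightarrow> 'g) \<Rightarrow> ennreal" where
  "operator_norm X nX nY T = (SUP f\<in>{f\<in>X. nX f \<le> 1}. nY (T f))"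


section \<open>The driving Levy process\<close>

definition levy_measure :: "(real^'d) measure \<Rightarrow> bool" where
  "levy_measure \<nu> \<longleftrightarrow>
     sets \<nu> = sets (restrict_space borel (- {0})) \<and> sigma_finite_measure \<nu> \<and>
     (\<integral>\<^sup>+z. ennreal (min 1 ((norm z)\<^sup>2)) \<partial>\<nu>) < \<infinity>"

definition nondegenerate_spherical :: "real \<Rightarrow> (real^'d) measure \<Rightarrow> bool" where
  "nondegenerate_spherical \<alpha> \<mu> \<longleftrightarrow>
     sets \<mu> = sets (restrict_space borel (sphere 0 1)) \<and> finite_measure \<mu> \<and>
     (\<exists>\<eta>\<ge>1. \<forall>p. norm p powr \<alpha> / \<eta> \<le> (\<integral>s. \<bar>p \<bullet> s\<bar> powr \<alpha> \<partial>\<mu>) \<and>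
                 (\<integral>s. \<bar>p \<bullet> s\<bar> powr \<alpha> \<partial>\<mu>) \<le> \<eta> * norm p powr \<alpha>)"

definition stable_lower_bound ::
  "(real^'d) measure \<Rightarrow> real \<Rightarrow> real \<Rightarrow> (real^'d) measure \<Rightarrow> bool" where
  "stable_lower_bound \<nu> r0 \<alpha> \<mu> \<longleftrightarrow>
     (\<forall>C\<in>sets \<nu>.
        (\<integral>\<^sup>+r\<in>{0<..<r0}. (\<integral>\<^sup>+\<theta>. indicator C (r *\<^sub>R \<theta>) \<partial>\<mu>) * ennreal (1 / r powr (1 + \<alpha>)) \<partial>lborel)
        \<le> emeasure \<nu> C)"

definition levy_symbol ::
  "real^'d \<Rightarrow> real^'d^'d \<Rightarrow> (real^'d) measure \<Rightarrow> real^'d \<Rightarrow> complex" where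
  "levy_symbol b Q \<nu> p =
     - \<i> * complex_of_real (b \<bullet> p) + complex_of_real (1/2 * (p \<bullet> (Q *v p))) +
     (\<integral>z. (1 - iexp (p \<bullet> z) + \<i> * complex_of_real (p \<bullet> z * indicator (ball 0 1) z)) \<partial>\<nu>)"

definition levy_process :: "'w measure \<Rightarrow> (real \<Rightarrow> 'w \<Rightarrow> 'a::euclidean_space) \<Rightarrow> bool" where
  "levy_process M Z \<longleftrightarrow>
     prob_space M \<and>
     (\<forall>t\<ge>0. Z t \<in> borel_measurable M) \<and>
     (AE \<omega> in M. Z 0 \<omega> = 0) \<and>
     (\<forall>(m::nat) (\<tau>::nat \<Rightarrow> real). 0 \<le> \<tau> 0 \<and> (\<forall>i<m. \<tau> i < \<tau> (Suc i)) \<longrightarrow>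
        prob_space.indep_vars M (\<lambda>_. borel) (\<lambda>i \<omega>. Z (\<tau> (Suc i)) \<omega> - Z (\<tau> i) \<omega>) {..<m}) \<and>
     (\<forall>s\<ge>0. \<forall>t\<ge>0. distr M borel (\<lambda>\<omega>. Z (s + t) \<omega> - Z s \<omega>) = distr M borel (Z t)) \<and>
     (\<forall>s\<ge>0. \<forall>\<epsilon>>0.
        ((\<lambda>t. measure M {\<omega>\<in>space M. norm (Z t \<omega> - Z s \<omega>) > \<epsilon>}) \<longlongrightarrow> 0) (at s within {0..}))"

text \<open>
  \<open>I\<close> is (a version of) the stochastic integral \<open>\<integral>\<^sub>0\<^sup>t F(s) dZ\<^sub>s\<close> of a continuous deterministic \<open>F\<close>: the limit
  in probability of the Riemann sums over partitions of \<open>[0,t]\<close> as the mesh tends to 0.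
\<close>

definition is_stoch_integral ::
  "'w measure \<Rightarrow> (real \<Rightarrow> 'w \<Rightarrow> real^'d) \<Rightarrow> (real \<Rightarrow> real^'d^'n) \<Rightarrow> real \<Rightarrow> ('w \<Rightarrow> real^'n) \<Rightarrow> bool" where
  "is_stoch_integral M Z F t I \<longleftrightarrow>
     I \<in> borel_measurable M \<and>
     (\<forall>\<epsilon>>0. \<exists>\<delta>>0. \<forall>(m::nat) (\<tau>::nat \<Rightarrow> real).
        \<tau> 0 = 0 \<and> \<tau> m = t \<and> (\<forall>i<m. \<tau> i < \<tau> (Suc i) \<and> \<tau> (Suc i) - \<tau> i < \<delta>) \<longrightarrow>
        measure M {\<omega>\<in>space M.
          norm ((\<Sum>i<m. F (\<tau> i) *v (Z (\<tau> (Suc i)) \<omega> - Z (\<tau> i) \<omega>)) - I \<omega>) > \<epsilon>} < \<epsilon>)"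

definition ou_process ::
  "real^'n^'n \<Rightarrow> (real \<Rightarrow> 'w \<Rightarrow> real^'n) \<Rightarrow> real^'n \<Rightarrow> real \<Rightarrow> 'w \<Rightarrow> real^'n" where
  "ou_process A Y x t \<omega> = mat_exp (t *\<^sub>R A) *v x + Y t \<omega>"

definition ou_semigroup ::
  "'w measure \<Rightarrow> real^'n^'n \<Rightarrow> (real \<Rightarrow> 'w \<Rightarrow> real^'n) \<Rightarrow> real \<Rightarrow> (real^'n \<Rightarrow> real) \<Rightarrow> real^'n \<Rightarrow> real" where
  "ou_semigroup M A Y t \<phi> x = (\<integral>\<omega>. \<phi> (ou_process A Y x t \<omega>) \<partial>M)"

end

theory Submission
  imports Defs
begin

text \<open>
  On trigonometric polynomials \<open>P\<^sub>t\<close> is a Fourier multiplier followed by a linear change of variables;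
  its symbol is a limit of products over Riemann sums of \<open>\<integral>\<^sub>0\<^sup>t \<Phi>(B\<^sup>* e\<^sup>s\<^sup>A\<^sup>* p) ds\<close>. Splitting off the stable lower
  bound of \<open>\<nu>\<close>, truncated to jump sizes between \<open>2\<^sup>-\<^sup>j \<epsilon>\<close> and \<open>\<epsilon> = t\<^sup>1\<^sup>/\<^sup>\<alpha>\<close>, leaves a contraction of the supremum
  norm. The truncated part is a product of compound Poisson multipliers, one for each dyadic scale. At one
  scale \<open>\<epsilon>'\<close> the gradient of the image is at most \<open>C / \<epsilon>'\<close> times the supremum plus a quarter of the gradient
  of the argument: the Kalman condition makes the covariance of the jump directions, in coordinates scaled
  by \<open>\<epsilon> t\<^sup>h\<^sup>-\<^sup>1\<close> on \<open>E\<^sub>h\<close>, uniformly nondegenerate, so that up to a martingale difference a derivative is an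
  integral over the size of the jump. Summing over the scales gives, for at most three increments,
  \<open>|\<Delta>\<^sub>z\<^sub>1 \<dots> \<Delta>\<^sub>z\<^sub>m P\<^sub>t \<phi>| \<le> C \<parallel>\<phi>\<parallel>\<^sub>\<infinity> \<Prod> |z\<^sub>i| \<epsilon>\<^sup>-\<^sup>d\<close> for \<open>z\<^sub>i \<in> E\<^sub>h\<close> and \<open>d = 1 + \<alpha>(h - 1)\<close>, first for trigonometric
  polynomials and then for \<open>\<phi> \<in> C\<^sub>b\<close> by approximation.

  For \<open>\<phi> \<in> C\<^sup>\<beta>\<^sub>b\<^sub>,\<^sub>d\<close> one writes \<open>\<phi> = g + h\<close> with \<open>h\<close> an anisotropic mollification of \<open>\<phi>\<close> at scale \<open>\<epsilon>\<close>. The bound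
  above applied to \<open>g\<close>, which is of size \<open>\<epsilon>\<^sup>\<beta>\<close>, and the regularity of \<open>h\<close> itself give
  \<open>|\<Delta>\<^sub>z\<^sub>1 \<dots> \<Delta>\<^sub>z\<^sub>m P\<^sub>t \<phi>| \<le> C (1 + t\<^sup>(\<^sup>\<beta>\<^sup>-\<^sup>\<gamma>\<^sup>)\<^sup>/\<^sup>\<alpha>) \<rho>\<^sup>\<gamma>\<close> for \<open>z\<^sub>i \<in> E\<^sub>h\<close> with \<open>|z\<^sub>i| \<le> \<rho>\<^sup>d\<close>. The Hoelder--Zygmund norms
  are equivalent to such bounds on differences.
\<close>


section \<open>Fourier multipliers on trigonometric polynomials\<close>

text \<open>The law of the noise is accessible only through \<open>levy_symbol\<close> and through
  Riemann sums that converge in probability. There is no density to work with, and the parts into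
  which \<nu> is split are not given as independent processes. Hence every step is a bound on
  multipliers: \<open>bdd m C\<close> survives products, averages, exponentials and pointwise
  limits, and a factor that does not serve for smoothing only has to satisfy \<open>bdd _ 1\<close>.
  The price is that all constants must be uniform in the number of grid points.

  A single scale cannot bound the gradient by the supremum alone: a jump need not be parallel to the
  direction of the derivative, so a remainder with the gradient of the argument is left. Many jumps
  make it small, and the factor 1/4 beats the doubling of the other constant from one scale to the
  next. Three increments suffice because \<gamma> < 1 + \<alpha> < 3. Uniform nondegeneracy is known
  only for small t, where e^(-sA) B is governed by its leading terms; for larger t only an initial
  piece of the time interval is used for smoothing.\<close>

definition tp :: "(complex \<times> 'a::real_inner) list \<Rightarrow> 'a \<Rightarrow> complex" where
  "tp xs x = (\<Sum>(c, p)\<leftarrow>xs. c * iexp (p \<bullet> x))"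

text \<open>Acts on the list of coefficients and frequencies. Repeated frequencies are harmless,
  because the factor depends on the frequency alone and \<open>tp\<close> adds up the
  coefficients.\<close>

definition mult :: "('a \<Rightarrow> complex) \<Rightarrow> (complex \<times> 'a::real_inner) list \<Rightarrow> (complex \<times> 'a) list" where
  "mult m xs = map (\<lambda>(c, p). (m p * c, p)) xs"

text \<open>Operator norm at most \<open>C\<close> for the supremum norm on trigonometric
  polynomials. The model case is the Fourier transform of a complex measure of total variation
  \<open>C\<close>; the definition stands in for that measure, so that factors of an infinitely
  divisible law can be treated without constructing their distributions.\<close>

definition bdd :: "('a::real_inner \<Rightarrow> complex) \<Rightarrow> real \<Rightarrow> bool" where
  "bdd m C \<longleftrightarrow> (\<forall>xs K. (\<forall>x. cmod (tp xs x) \<le> K) \<longrightarrow> (\<forall>x. cmod (tp (mult m xs) x) \<le> C * K))"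

lemma bddI:
  assumes "\<And>xs K x. (\<And>y. cmod (tp xs y) \<le> K) \<Longrightarrow> 0 \<le> K \<Longrightarrow> cmod (tp (mult m xs) x) \<le> C * K"
  shows "bdd m C"
  unfolding bdd_def
proof (intro allI impI)
  fix xs :: "(complex \<times> 'a) list" and K x
  assume *: "\<forall>x. cmod (tp xs x) \<le> K"
  then have "0 \<le> K" using norm_ge_zero order_trans by blast
  with * show "cmod (tp (mult m xs) x) \<le> C * K" using assms by blast
qed

lemma bddD: "bdd m C \<Longrightarrow> (\<And>y. cmod (tp xs y) \<le> K) \<Longrightarrow> cmod (tp (mult m xs) x) \<le> C * K"
  unfolding bdd_def by blast

lemma tp_Nil [simp]: "tp [] x = 0" by (simp add: tp_def)

lemma tp_Cons [simp]: "tp (cp # xs) x = fst cp * iexp (snd cp \<bullet> x) + tp xs x"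
  by (simp add: tp_def case_prod_unfold)

lemma tp_append [simp]: "tp (xs @ ys) x = tp xs x + tp ys x"
  by (induction xs) auto

lemma mult_Nil [simp]: "mult m [] = []" by (simp add: mult_def)

lemma mult_Cons [simp]: "mult m (cp # xs) = (m (snd cp) * fst cp, snd cp) # mult m xs"
  by (simp add: mult_def case_prod_unfold)

lemma mult_mult: "mult m1 (mult m2 xs) = mult (\<lambda>p. m1 p * m2 p) xs"
  by (induction xs) (auto simp: mult_ac)

lemma mult_one [simp]: "mult (\<lambda>p. 1) xs = xs"
  by (induction xs) auto

lemma tp_mult_add: "tp (mult (\<lambda>p. m1 p + m2 p) xs) x = tp (mult m1 xs) x + tp (mult m2 xs) x"
  by (induction xs) (auto simp: algebra_simps)

lemma tp_mult_cmult: "tp (mult (\<lambda>p. c * m p) xs) x = c * tp (mult m xs) x"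
  by (induction xs) (auto simp: algebra_simps)

lemma tp_mult_diff: "tp (mult (\<lambda>p. m1 p - m2 p) xs) x = tp (mult m1 xs) x - tp (mult m2 xs) x"
  by (induction xs) (auto simp: algebra_simps)

lemma tp_mult_sum: "tp (mult (\<lambda>p. \<Sum>i\<in>I. m i p) xs) x = (\<Sum>i\<in>I. tp (mult (m i) xs) x)"
  by (induction xs) (auto simp: algebra_simps sum.distrib sum_distrib_left sum_distrib_right)

lemma tp_mult_shift: "tp (mult (\<lambda>p. iexp (p \<bullet> a)) xs) x = tp xs (x + a)"
  by (induction xs) (auto simp: algebra_simps inner_add_right exp_add)

lemma tendsto_tp_mult:
  assumes "\<And>p. ((\<lambda>n. m n p) \<longlongrightarrow> m' p) F"
  shows "((\<lambda>n. tp (mult (m n) xs) x) \<longlongrightarrow> tp (mult m' xs) x) F"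
  by (induction xs) (auto intro!: tendsto_intros assms)

lemma has_integral_tp_mult:
  assumes "\<And>p. integrable M (\<lambda>\<omega>. m \<omega> p)"
  shows "integrable M (\<lambda>\<omega>. tp (mult (m \<omega>) xs) x)"
    and "(\<integral>\<omega>. tp (mult (m \<omega>) xs) x \<partial>M) = tp (mult (\<lambda>p. \<integral>\<omega>. m \<omega> p \<partial>M) xs) x"
proof (induction xs)
  case (Cons a xs)
  { case 1 with Cons(1) show ?case by (auto intro!: Bochner_Integration.integrable_add integrable_mult_right integrable_mult_left assms) }
  { case 2 with Cons show ?case
      by (simp add: Bochner_Integration.integral_add assms) }
qed auto

lemma bdd_one: "bdd (\<lambda>p. 1) 1" by (rule bddI) simp

lemma bdd_mono: "bdd m C \<Longrightarrow> C \<le> C' \<Longrightarrow> bdd m C'"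
  by (rule bddI) (meson bddD mult_right_mono order_trans)

lemma bdd_mult:
  assumes "bdd m1 C1" "bdd m2 C2"
  shows "bdd (\<lambda>p. m1 p * m2 p) (C1 * C2)"
proof (rule bddI)
  fix xs :: "(complex \<times> 'a) list" and K x
  assume K: "\<And>y. cmod (tp xs y) \<le> K"
  have "cmod (tp (mult m1 (mult m2 xs)) x) \<le> C1 * (C2 * K)"
    by (intro bddD[OF assms(1)] bddD[OF assms(2)] K)
  then show "cmod (tp (mult (\<lambda>p. m1 p * m2 p) xs) x) \<le> C1 * C2 * K" by (simp add: mult_mult mult.assoc)
qed

lemma bdd_prod:
  assumes "\<And>i. i \<in> I \<Longrightarrow> bdd (m i) 1"
  shows "bdd (\<lambda>p. \<Prod>i\<in>I. m i p) 1"
  using assms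
proof (induction I rule: infinite_finite_induct)
  case (insert i I)
  with bdd_mult[of "m i" 1 "\<lambda>p. \<Prod>i\<in>I. m i p" 1] show ?case by auto
qed (auto simp: bdd_one)

lemma bdd_power: "bdd m 1 \<Longrightarrow> bdd (\<lambda>p. m p ^ k) 1"
  using bdd_prod[of "{..<k}" "\<lambda>i. m"] by simp

text \<open>A trigonometric polynomial has finitely many frequencies, so pointwise convergence of
  the symbols already gives convergence of the images at every point.\<close>

lemma bdd_limit:
  assumes "\<And>n. bdd (m n) (C n)" "\<And>p. (\<lambda>n. m n p) \<longlonglongrightarrow> m' p" "C \<longlonglongrightarrow> C'"
  shows "bdd m' C'"
proof (rule bddI)
  fix xs :: "(complex \<times> 'a) list" and K x
  assume K: "\<And>y. cmod (tp xs y) \<le> K"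
  have "(\<lambda>n. cmod (tp (mult (m n) xs) x)) \<longlonglongrightarrow> cmod (tp (mult m' xs) x)"
    by (intro tendsto_norm tendsto_tp_mult assms)
  moreover have "(\<lambda>n. C n * K) \<longlonglongrightarrow> C' * K" by (intro tendsto_intros assms)
  moreover have "cmod (tp (mult (m n) xs) x) \<le> C n * K" for n by (intro bddD assms K)
  ultimately show "cmod (tp (mult m' xs) x) \<le> C' * K" using LIMSEQ_le by blast
qed

lemma bdd_limit_eventually:
  assumes "\<forall>\<^sub>F n in sequentially. bdd (m n) C" "\<And>p. (\<lambda>n. m n p) \<longlonglongrightarrow> m' p"
  shows "bdd m' C"
proof -
  obtain N where N: "\<And>n. n \<ge> N \<Longrightarrow> bdd (m n) C" using assms(1) by (auto simp: eventually_sequentially)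
  show ?thesis by (rule bdd_limit[of "\<lambda>n. m (n + N)" "\<lambda>n. C"]) (auto intro!: N LIMSEQ_ignore_initial_segment assms)
qed

lemma bdd_shift: "bdd (\<lambda>p. iexp (p \<bullet> a)) 1"
  by (rule bddI) (simp add: tp_mult_shift)

lemma tp_map_snd:
  assumes "\<And>p y. L p \<bullet> y = p \<bullet> L' y"
  shows "tp (map (\<lambda>(c, p). (c, L p)) xs) y = tp xs (L' y)"
  by (induction xs) (auto simp: assms)

lemma mult_map_snd: "mult m (map (\<lambda>(c, p). (c, L p)) xs) = map (\<lambda>(c, p). (c, L p)) (mult (\<lambda>p. m (L p)) xs)"
  by (induction xs) auto

lemma bdd_comp:
  fixes m :: "'a::real_inner \<Rightarrow> complex" and L :: "'b::real_inner \<Rightarrow> 'a"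
  assumes "bdd m C" and adj: "\<And>p y. L p \<bullet> y = p \<bullet> L' y" and L': "linear L'"
  shows "bdd (\<lambda>p. m (L p)) C"
proof (rule bddI)
  fix xs :: "(complex \<times> 'b) list" and K x
  assume K: "\<And>y. cmod (tp xs y) \<le> K"
  \<comment> \<open>\<open>L'\<close> need not be onto, so \<open>x\<close> need not be one of its
    values. Multiplying the coefficients by \<open>iexp (p \<bullet> x)\<close> translates
    \<open>x\<close> to the origin, and \<open>L' 0 = 0\<close>.\<close>
  define ys where "ys = map (\<lambda>(c, p). (c, L p)) (mult (\<lambda>p. iexp (p \<bullet> x)) xs)"
  have ys: "tp ys y = tp xs (L' y + x)" for y
    unfolding ys_def tp_map_snd[of L L', OF adj] by (rule tp_mult_shift)
  have "cmod (tp (mult m ys) 0) \<le> C * K" by (rule bddD[OF assms(1)]) (simp add: ys K)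
  also have "tp (mult m ys) 0 = tp (mult (\<lambda>p. m (L p)) xs) x"
    unfolding ys_def mult_map_snd tp_map_snd[of L L', OF adj] mult_mult
    using tp_mult_shift[of x "mult (\<lambda>p. m (L p)) xs" 0]
    by (simp add: mult_mult mult.commute linear_0[OF L'])
  finally show "cmod (tp (mult (\<lambda>p. m (L p)) xs) x) \<le> C * K" .
qed

lemma bdd_integral:
  fixes m :: "'w \<Rightarrow> 'a::real_inner \<Rightarrow> complex"
  assumes bdd: "\<And>\<omega>. \<omega> \<in> space M \<Longrightarrow> bdd (m \<omega>) (C \<omega>)"
    and int: "\<And>p. integrable M (\<lambda>\<omega>. m \<omega> p)" "integrable M C"
  shows "bdd (\<lambda>p. \<integral>\<omega>. m \<omega> p \<partial>M) (\<integral>\<omega>. C \<omega> \<partial>M)"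
proof (rule bddI)
  fix xs :: "(complex \<times> 'a) list" and K x
  assume K: "\<And>y. cmod (tp xs y) \<le> K"
  have "cmod (\<integral>\<omega>. tp (mult (m \<omega>) xs) x \<partial>M) \<le> (\<integral>\<omega>. cmod (tp (mult (m \<omega>) xs) x) \<partial>M)"
    by (rule integral_norm_bound)
  also have "\<dots> \<le> (\<integral>\<omega>. C \<omega> * K \<partial>M)"
    by (intro integral_mono integrable_norm has_integral_tp_mult int integrable_mult_left bddD[OF bdd] K)
  finally show "cmod (tp (mult (\<lambda>p. \<integral>\<omega>. m \<omega> p \<partial>M) xs) x) \<le> (\<integral>\<omega>. C \<omega> \<partial>M) * K"
    by (simp add: has_integral_tp_mult int)
qed

lemma bdd_sum:
  fixes m :: "'i \<Rightarrow> 'a::real_inner \<Rightarrow> complex"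
  assumes "\<And>i. i \<in> I \<Longrightarrow> bdd (m i) (C i)"
  shows "bdd (\<lambda>p. \<Sum>i\<in>I. m i p) (\<Sum>i\<in>I. C i)"
proof (rule bddI)
  fix xs :: "(complex \<times> 'a) list" and K x
  assume K: "\<And>y. cmod (tp xs y) \<le> K"
  have "cmod (tp (mult (\<lambda>p. \<Sum>i\<in>I. m i p) xs) x) \<le> (\<Sum>i\<in>I. cmod (tp (mult (m i) xs) x))"
    by (simp add: tp_mult_sum norm_sum)
  also have "\<dots> \<le> (\<Sum>i\<in>I. C i * K)" by (intro sum_mono bddD[OF assms] K)
  finally show "cmod (tp (mult (\<lambda>p. \<Sum>i\<in>I. m i p) xs) x) \<le> sum C I * K"
    by (simp add: sum_distrib_right)
qed

lemma bdd_cmult: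
  assumes "bdd m C"
  shows "bdd (\<lambda>p. c * m p) (cmod c * C)"
proof (rule bddI)
  fix xs :: "(complex \<times> 'a) list" and K x
  assume K: "\<And>y. cmod (tp xs y) \<le> K"
  show "cmod (tp (mult (\<lambda>p. c * m p) xs) x) \<le> cmod c * C * K"
    using bddD[OF assms K, where x=x] by (simp add: tp_mult_cmult norm_mult mult.assoc mult_left_mono)
qed

lemma bdd_norm_le:
  assumes "bdd m C"
  shows "cmod (m p) \<le> C"
  using bddD[OF assms, of "[(1, p)]" 1 0] by simp

lemma bdd_series:
  fixes a :: "nat \<Rightarrow> real"
  assumes m: "bdd m 1" and a: "\<And>j. 0 \<le> a j" "summable a" "suminf a \<le> 1"
  shows "bdd (\<lambda>p. \<Sum>j. complex_of_real (a j) * m p ^ j) 1"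
proof (rule bdd_mono[OF bdd_limit])
  fix n
  show "bdd (\<lambda>p. \<Sum>j<n. complex_of_real (a j) * m p ^ j) (\<Sum>j<n. cmod (complex_of_real (a j)) * 1)"
    by (intro bdd_sum bdd_cmult bdd_power m)
next
  fix p
  have "summable (\<lambda>j. complex_of_real (a j) * m p ^ j)"
  proof (rule summable_comparison_test')
    show "summable a" by fact
    fix n show "norm (complex_of_real (a n) * m p ^ n) \<le> a n"
      using bdd_norm_le[OF bdd_power[OF m, of n], of p] a(1)[of n] by (simp add: norm_mult mult_left_le)
  qed
  then show "(\<lambda>n. \<Sum>j<n. complex_of_real (a j) * m p ^ j) \<longlonglongrightarrow> (\<Sum>j. complex_of_real (a j) * m p ^ j)"
    by (rule summable_LIMSEQ)
next
  show "(\<lambda>n. \<Sum>j<n. cmod (complex_of_real (a j)) * 1) \<longlonglongrightarrow> suminf a"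
    using summable_LIMSEQ[OF a(2)] a(1) by simp
qed (rule a)

text \<open>A Poisson mixture of the powers of \<open>m\<close>: the weights
  \<open>exp (- l) * l ^ j / fact j\<close> are nonnegative and sum to 1. This is how compound
  Poisson factors become contractions.\<close>

lemma bdd_exp:
  assumes m: "bdd m 1" and l: "0 \<le> l"
  shows "bdd (\<lambda>p. exp (complex_of_real l * (m p - 1))) 1"
proof -
  define a where "a j = exp (-l) * (l ^ j / fact j)" for j
  have s: "(\<lambda>j. l ^ j / fact j) sums exp l" using exp_converges[of l] by (simp add: field_simps)
  have a: "a sums 1" unfolding a_def using sums_mult[OF s, of "exp (-l)"] by (simp add: exp_minus)
  have "(\<Sum>j. complex_of_real (a j) * m p ^ j) = exp (complex_of_real l * (m p - 1))" for p
  proof -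
    have "(\<lambda>j. exp (-complex_of_real l) * ((complex_of_real l * m p) ^ j /\<^sub>R fact j)) sums (exp (-complex_of_real l) * exp (complex_of_real l * m p))"
      by (intro sums_mult exp_converges)
    moreover have "exp (-complex_of_real l) * ((complex_of_real l * m p) ^ j /\<^sub>R fact j) = complex_of_real (a j) * m p ^ j" for j
      by (simp add: a_def exp_of_real[symmetric] power_mult_distrib scaleR_conv_of_real field_simps)
    ultimately show ?thesis by (simp add: sums_iff exp_add[symmetric] algebra_simps)
  qed
  moreover have "bdd (\<lambda>p. \<Sum>j. complex_of_real (a j) * m p ^ j) 1"
    using a l by (intro bdd_series m) (simp_all add: sums_iff, simp add: a_def)
  ultimately show ?thesis by simp
qed

section \<open>The gradient bound for a single scale of jumps\<close>

text \<open>Symbol of the derivative in direction \<open>z\<close>.\<close>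

definition dirm :: "'a::real_inner \<Rightarrow> 'a \<Rightarrow> complex" where
  "dirm z p = \<i> * complex_of_real (p \<bullet> z)"

definition grad_bdd :: "(complex \<times> 'a::real_inner) list \<Rightarrow> real \<Rightarrow> bool" where
  "grad_bdd xs L \<longleftrightarrow> (\<forall>z x. cmod (tp (mult (dirm z) xs) x) \<le> L * norm z)"

lemma dirm_add: "dirm (y + z) p = dirm y p + dirm z p"
  by (simp add: dirm_def inner_add_right algebra_simps)

lemma dirm_diff: "dirm (y - z) p = dirm y p - dirm z p"
  by (simp add: dirm_def inner_diff_right algebra_simps)

lemma dirm_0 [simp]: "dirm 0 p = 0"
  by (simp add: dirm_def)

lemma grad_bddD: "grad_bdd xs L \<Longrightarrow> cmod (tp (mult (dirm z) xs) x) \<le> L * norm z"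
  by (simp add: grad_bdd_def)

lemma grad_bdd_mult:
  assumes "bdd m C" "grad_bdd xs L"
  shows "grad_bdd (mult m xs) (C * L)"
  unfolding grad_bdd_def
proof (intro allI)
  fix z x
  have "cmod (tp (mult m (mult (dirm z) xs)) x) \<le> C * (L * norm z)"
    by (intro bddD[OF assms(1)] grad_bddD assms)
  then show "cmod (tp (mult (dirm z) (mult m xs)) x) \<le> C * L * norm z"
    by (simp add: mult_mult mult.commute mult.left_commute)
qed

section \<open>Jumps whose size is uniformly distributed on an interval\<close>

definition avg_iexp :: "real \<Rightarrow> real \<Rightarrow> real \<Rightarrow> complex" where
  "avg_iexp a b y = (\<integral>r. iexp (y * r) \<partial>uniform_measure lborel {a..b})"

lemma prob_space_uniform_Icc: "a < b \<Longrightarrow> prob_space (uniform_measure lborel {a..b::real})"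
  by (rule prob_space_uniform_measure) auto

lemma measurable_avg_iexp [measurable]:
  assumes "a < b"
  shows "avg_iexp a b \<in> borel_measurable borel"
proof -
  interpret prob_space "uniform_measure lborel {a..b}" by (rule prob_space_uniform_Icc[OF assms])
  have "(\<lambda>y. \<integral>r. iexp (y * r) \<partial>uniform_measure lborel {a..b}) \<in> borel_measurable borel"
    by (rule borel_measurable_lebesgue_integral) measurable
  then show ?thesis unfolding avg_iexp_def[abs_def] .
qed

lemma avg_iexp_bdd:
  assumes "a < b"
  shows "bdd (\<lambda>p. avg_iexp a b (p \<bullet> v)) 1"
proof -
  interpret prob_space "uniform_measure lborel {a..b}" by (rule prob_space_uniform_Icc[OF assms])
  have "bdd (\<lambda>p. \<integral>r. iexp (p \<bullet> (r *\<^sub>R v)) \<partial>uniform_measure lborel {a..b}) (\<integral>r. 1 \<partial>uniform_measure lborel {a..b})"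
    by (intro bdd_integral bdd_shift integrable_const integrable_const_bound[of _ 1])
      (auto simp: norm_exp_i_times)
  moreover have "prob UNIV = 1" using prob_space by simp
  ultimately show ?thesis by (simp add: avg_iexp_def mult.commute)
qed

lemma norm_avg_iexp_le: "a < b \<Longrightarrow> cmod (avg_iexp a b y) \<le> 1"
  using bdd_norm_le[OF avg_iexp_bdd, of a b y "1::real"] by simp

text \<open>Averaging over the size of a jump turns the derivative along the jump into a difference
  quotient. This is the only place where a derivative is exchanged for a bound by the supremum; the
  cost is 2 divided by the length of the interval of sizes.\<close>

lemma avg_iexp_FTC:
  assumes "a < b"
  shows "\<i> * complex_of_real y * avg_iexp a b y = (iexp (y * b) - iexp (y * a)) / complex_of_real (b - a)"
proof -
  have D: "((\<lambda>r. iexp (y * r)) has_vector_derivative \<i> * complex_of_real y * iexp (y * r)) (at r within {a..b})" for r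
  proof -
    have "((\<lambda>z. exp (\<i> * (complex_of_real y * z))) has_field_derivative \<i> * complex_of_real y * iexp (y * r)) (at (complex_of_real r))"
      by (auto intro!: derivative_eq_intros)
    then have "((\<lambda>r. exp (\<i> * (complex_of_real y * complex_of_real r))) has_vector_derivative \<i> * complex_of_real y * iexp (y * r)) (at r within {a..b})"
      by (rule has_vector_derivative_real_field)
    then show ?thesis by simp
  qed
  have *: "has_bochner_integral lborel (\<lambda>r. indicator {a..b} r *\<^sub>R (\<i> * complex_of_real y * iexp (y * r))) (iexp (y * b) - iexp (y * a))"
    by (rule has_bochner_integral_FTC_Icc)
      (use assms in \<open>auto intro!: D[simplified] continuous_intros\<close>)
  have "\<i> * complex_of_real y * avg_iexp a b y = (\<integral>r. \<i> * complex_of_real y * iexp (y * r) \<partial>uniform_measure lborel {a..b})"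
    by (simp add: avg_iexp_def)
  also have "\<dots> = (\<integral>r. indicator {a..b} r *\<^sub>R (\<i> * complex_of_real y * iexp (y * r)) \<partial>lborel) /\<^sub>R (b - a)"
  proof -
    have "uniform_measure lborel {a..b} = density lborel (\<lambda>r. ennreal (indicator {a..b} r / (b - a)))"
      unfolding uniform_measure_def using assms divide_ennreal[of 1 "b - a"]
      by (intro density_cong) (auto simp: indicator_def)
    then show ?thesis
      using assms by (simp add: integral_density scaleR_conv_of_real flip: integral_scaleR_right)
        (simp add: mult_ac divide_inverse)
  qed
  also have "\<dots> = (iexp (y * b) - iexp (y * a)) /\<^sub>R (b - a)"
    using * by (simp add: has_bochner_integral_iff)
  finally show ?thesis by (simp add: scaleR_conv_of_real field_simps)
qed

locale jump_directions = prob_space P for P :: "'w measure" +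
  fixes v :: "'w \<Rightarrow> 'a::euclidean_space" and R c :: real
  assumes meas_v [measurable]: "v \<in> borel_measurable P"
    and v_le: "\<And>\<omega>. norm (v \<omega>) \<le> R"
    and c_pos: "0 < c"
    and nondeg: "\<And>p. c * (norm p)\<^sup>2 \<le> (\<integral>\<omega>. (p \<bullet> v \<omega>)\<^sup>2 \<partial>P)"
begin

lemma R_nonneg: "0 \<le> R"
  using v_le norm_ge_zero order_trans by blast

lemma integrable_bounded:
  fixes f :: "'w \<Rightarrow> 'b::{banach, second_countable_topology}"
  shows "f \<in> borel_measurable P \<Longrightarrow> (\<And>\<omega>. norm (f \<omega>) \<le> C) \<Longrightarrow> integrable P f"
  by (rule integrable_const_bound[of _ C]) auto

text \<open>Characteristic function of a jump \<open>r *\<^sub>R v\<close> with \<open>r\<close>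
  uniform on the interval and independent of the direction \<open>v\<close>.\<close>

definition jump_char :: "real \<Rightarrow> real \<Rightarrow> 'a \<Rightarrow> complex" where
  "jump_char a b p = (\<integral>\<omega>. avg_iexp a b (p \<bullet> v \<omega>) \<partial>P)"

lemma integrable_avg_iexp: "a < b \<Longrightarrow> integrable P (\<lambda>\<omega>. avg_iexp a b (p \<bullet> v \<omega>))"
  by (rule integrable_bounded[of _ 1]) (auto simp: norm_avg_iexp_le)

lemma jump_char_bdd: "a < b \<Longrightarrow> bdd (jump_char a b) 1"
  using bdd_integral[of P "\<lambda>\<omega> p. avg_iexp a b (p \<bullet> v \<omega>)" "\<lambda>_. 1"]
  by (simp add: jump_char_def[abs_def] avg_iexp_bdd integrable_avg_iexp prob_space)

text \<open>Jensen's inequality for the square root, in the form that the variance of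
  \<open>sqrt (f \<omega>)\<close> is nonnegative.\<close>

lemma expectation_sqrt_le:
  assumes "f \<in> borel_measurable P" "\<And>\<omega>. 0 \<le> f \<omega>" "\<And>\<omega>. f \<omega> \<le> C"
  shows "(\<integral>\<omega>. sqrt (f \<omega>) \<partial>P) \<le> sqrt (\<integral>\<omega>. f \<omega> \<partial>P)"
proof (rule real_le_rsqrt)
  have [measurable]: "f \<in> borel_measurable P" by fact
  have i1: "integrable P (\<lambda>\<omega>. sqrt (f \<omega>))" by (rule integrable_bounded[of _ "sqrt C"]) (auto simp: assms)
  have i2: "integrable P (\<lambda>\<omega>. (sqrt (f \<omega>))\<^sup>2)" by (rule integrable_bounded[of _ C]) (auto simp: assms)
  have "0 \<le> variance (\<lambda>\<omega>. sqrt (f \<omega>))" by (rule variance_positive)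
  also have "\<dots> = (\<integral>\<omega>. (sqrt (f \<omega>))\<^sup>2 \<partial>P) - (\<integral>\<omega>. sqrt (f \<omega>) \<partial>P)\<^sup>2"
    by (rule variance_eq[OF i1 i2])
  finally show "(\<integral>\<omega>. sqrt (f \<omega>) \<partial>P)\<^sup>2 \<le> (\<integral>\<omega>. f \<omega> \<partial>P)" by (simp add: assms)
qed

text \<open>
  In terms of \<open>n\<close> independent copies of the jump \<open>X = r v\<close> and of \<open>W\<close>, the multiplier below is that of
  the operator \<open>f \<mapsto> E ((c + W\<^sub>1 + \<dots> + W\<^sub>n) \<bullet> \<nabla>f(x + X\<^sub>1 + \<dots> + X\<^sub>n))\<close>. The induction over \<open>n\<close> replaces the
  product space.
\<close>
lemma martingale_multiplier:
  assumes ab: "a < b" and L: "grad_bdd xs L" "0 \<le> L"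
    and W [measurable]: "W \<in> borel_measurable P" and W_le: "\<And>\<omega>. norm (W \<omega>) \<le> CW"
    and W0: "(\<integral>\<omega>. W \<omega> \<partial>P) = 0" and W2: "(\<integral>\<omega>. (norm (W \<omega>))\<^sup>2 \<partial>P) \<le> s"
  defines "w \<equiv> \<lambda>p. \<integral>\<omega>. dirm (W \<omega>) p * avg_iexp a b (p \<bullet> v \<omega>) \<partial>P"
  shows "cmod (tp (mult (\<lambda>p. dirm u p * jump_char a b p ^ n + of_nat n * jump_char a b p ^ (n - 1) * w p) xs) x)
    \<le> L * sqrt ((norm u)\<^sup>2 + n * s)"
proof (induction n arbitrary: u x)
  case 0
  show ?case using grad_bddD[OF L(1)] by (simp add: real_sqrt_abs)
next
  case (Suc n)
  note avg_meas [measurable] = measurable_avg_iexp[OF ab]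
  let ?T = "jump_char a b" and ?t = "\<lambda>\<omega> p. avg_iexp a b (p \<bullet> v \<omega>)"
  let ?m = "\<lambda>u p. dirm u p * ?T p ^ n + of_nat n * ?T p ^ (n - 1) * w p"
  have CW: "0 \<le> CW" using W_le norm_ge_zero order_trans by blast
  have s: "0 \<le> s" using W2 by (rule order_trans[rotated]) simp
  have int_d: "integrable P (\<lambda>\<omega>. dirm (W \<omega>) p * ?t \<omega> p)" for p
  proof (rule integrable_bounded[of _ "norm p * CW"])
    show "(\<lambda>\<omega>. dirm (W \<omega>) p * ?t \<omega> p) \<in> borel_measurable P" unfolding dirm_def by measurable
    fix \<omega>
    have "\<bar>p \<bullet> W \<omega>\<bar> \<le> norm p * CW"
      by (rule order_trans[OF Cauchy_Schwarz_ineq2]) (simp add: W_le mult_left_mono)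
    then show "cmod (dirm (W \<omega>) p * ?t \<omega> p) \<le> norm p * CW"
      using norm_avg_iexp_le[OF ab] by (auto simp: dirm_def norm_mult intro: order_trans[OF mult_left_le])
  qed
  \<comment> \<open>Conditioning on one more jump: the induction hypothesis is used at the random
    vector \<open>u + W \<omega>\<close>, which is why \<open>u\<close> is arbitrary in the
    induction.\<close>
  have expand: "?t \<omega> p * ?m (u + W \<omega>) p = (dirm u p * ?T p ^ n + of_nat n * ?T p ^ (n - 1) * w p) * ?t \<omega> p
      + ?T p ^ n * (dirm (W \<omega>) p * ?t \<omega> p)" for \<omega> p
    by (simp add: dirm_add algebra_simps)
  have int_m: "integrable P (\<lambda>\<omega>. ?t \<omega> p * ?m (u + W \<omega>) p)" for p
    unfolding expand by (intro Bochner_Integration.integrable_add integrable_mult_right int_d integrable_avg_iexp ab)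
  have step: "(\<integral>\<omega>. ?t \<omega> p * ?m (u + W \<omega>) p \<partial>P) = dirm u p * ?T p ^ Suc n + of_nat (Suc n) * ?T p ^ (Suc n - 1) * w p" for p
  proof -
    have "(\<integral>\<omega>. ?t \<omega> p * ?m (u + W \<omega>) p \<partial>P) = (dirm u p * ?T p ^ n + of_nat n * ?T p ^ (n - 1) * w p) * ?T p + ?T p ^ n * w p"
      unfolding expand
      by (subst Bochner_Integration.integral_add)
        (auto intro!: integrable_mult_right int_d integrable_avg_iexp ab simp: w_def jump_char_def)
    also have "\<dots> = dirm u p * ?T p ^ Suc n + of_nat (Suc n) * ?T p ^ (Suc n - 1) * w p"
      by (cases n) (auto simp: algebra_simps)
    finally show ?thesis .
  qed
  let ?f = "\<lambda>\<omega>. (norm (u + W \<omega>))\<^sup>2 + n * s"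
  have f_le: "?f \<omega> \<le> (norm u + CW)\<^sup>2 + n * s" for \<omega>
    using norm_triangle_ineq[of u "W \<omega>"] W_le[of \<omega>] by (intro add_mono power_mono) auto
  have int_W: "integrable P W" by (rule integrable_bounded[OF W W_le])
  have int_W2: "integrable P (\<lambda>\<omega>. (norm (W \<omega>))\<^sup>2)"
    by (rule integrable_bounded[of _ "CW\<^sup>2"]) (auto intro!: power_mono W_le)
  have f_int: "(\<integral>\<omega>. ?f \<omega> \<partial>P) \<le> (norm u)\<^sup>2 + Suc n * s"
  proof -
    \<comment> \<open>The cross term vanishes because \<open>W\<close> has mean 0. Squares of norms
      add up instead of norms, so \<open>n\<close> copies of \<open>W\<close> cost
      \<open>sqrt n\<close> and not \<open>n\<close>.\<close>
    have "(\<integral>\<omega>. ?f \<omega> \<partial>P) = (\<integral>\<omega>. ((norm u)\<^sup>2 + n * s) + 2 * (u \<bullet> W \<omega>) + (norm (W \<omega>))\<^sup>2 \<partial>P)"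
      by (simp add: power2_norm_eq_inner inner_add_left inner_add_right inner_commute algebra_simps)
    also have "\<dots> = ((norm u)\<^sup>2 + n * s) + 2 * (u \<bullet> (\<integral>\<omega>. W \<omega> \<partial>P)) + (\<integral>\<omega>. (norm (W \<omega>))\<^sup>2 \<partial>P)"
      using int_W int_W2 by (simp add: prob_space)
    also have "\<dots> \<le> (norm u)\<^sup>2 + Suc n * s" using W2 by (simp add: W0 algebra_simps)
    finally show ?thesis .
  qed
  have "cmod (tp (mult (\<lambda>p. dirm u p * ?T p ^ Suc n + of_nat (Suc n) * ?T p ^ (Suc n - 1) * w p) xs) x)
    = cmod (\<integral>\<omega>. tp (mult (\<lambda>p. ?t \<omega> p * ?m (u + W \<omega>) p) xs) x \<partial>P)"
    unfolding step[symmetric] by (simp only: has_integral_tp_mult(2)[OF int_m])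
  also have "\<dots> \<le> (\<integral>\<omega>. cmod (tp (mult (\<lambda>p. ?t \<omega> p * ?m (u + W \<omega>) p) xs) x) \<partial>P)"
    by (rule integral_norm_bound)
  also have "\<dots> \<le> (\<integral>\<omega>. L * sqrt (?f \<omega>) \<partial>P)"
  proof (rule integral_mono)
    show "integrable P (\<lambda>\<omega>. cmod (tp (mult (\<lambda>p. ?t \<omega> p * ?m (u + W \<omega>) p) xs) x))"
      by (intro integrable_norm has_integral_tp_mult int_m)
    show "integrable P (\<lambda>\<omega>. L * sqrt (?f \<omega>))"
      by (rule integrable_bounded[of _ "L * sqrt ((norm u + CW)\<^sup>2 + n * s)"])
        (use L(2) f_le s in \<open>auto simp: abs_mult mult_left_mono\<close>)
    fix \<omega>
    show "cmod (tp (mult (\<lambda>p. ?t \<omega> p * ?m (u + W \<omega>) p) xs) x) \<le> L * sqrt (?f \<omega>)"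
      using bddD[OF avg_iexp_bdd[OF ab, of "v \<omega>"] Suc.IH[of "u + W \<omega>"], of x]
      by (simp add: mult_mult)
  qed
  also have "\<dots> \<le> L * sqrt (\<integral>\<omega>. ?f \<omega> \<partial>P)"
    using s f_le by (simp, intro mult_left_mono expectation_sqrt_le[of _ "(norm u + CW)\<^sup>2 + n * s"] L) auto
  also have "\<dots> \<le> L * sqrt ((norm u)\<^sup>2 + Suc n * s)"
    using f_int by (intro mult_left_mono L real_sqrt_le_mono)
  finally show ?case .
qed

text \<open>The second moment matrix of the directions is coercive, hence invertible with inverse of
  norm at most \<open>1 / c\<close>. Thus every \<open>z\<close> is the mean of a random multiple of
  the random direction.\<close>

lemma representation:
  obtains q where "(\<integral>\<omega>. (v \<omega> \<bullet> q) *\<^sub>R v \<omega> \<partial>P) = z" "norm q \<le> norm z / c"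
proof -
  define H where "H q = (\<integral>\<omega>. (v \<omega> \<bullet> q) *\<^sub>R v \<omega> \<partial>P)" for q
  have int: "integrable P (\<lambda>\<omega>. (v \<omega> \<bullet> q) *\<^sub>R v \<omega>)" for q
  proof (rule integrable_bounded)
    fix \<omega>
    have "\<bar>v \<omega> \<bullet> q\<bar> \<le> R * norm q"
      by (rule order_trans[OF Cauchy_Schwarz_ineq2]) (simp add: v_le mult_right_mono)
    then show "norm ((v \<omega> \<bullet> q) *\<^sub>R v \<omega>) \<le> R * norm q * R"
      using v_le[of \<omega>] by (auto intro!: mult_mono R_nonneg)
  qed simp
  have lin: "linear H"
  proof (rule linearI)
    show "H (x + y) = H x + H y" for x y
      unfolding H_def by (simp add: inner_add_right scaleR_add_left int)
    show "H (r *\<^sub>R x) = r *\<^sub>R H x" for r x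
      unfolding H_def by (simp flip: integral_scaleR_right)
  qed
  have coer: "c * (norm q)\<^sup>2 \<le> q \<bullet> H q" for q
  proof -
    have "q \<bullet> H q = (\<integral>\<omega>. q \<bullet> ((v \<omega> \<bullet> q) *\<^sub>R v \<omega>) \<partial>P)"
      unfolding H_def by (rule integral_inner_right[symmetric]) (rule int)
    also have "\<dots> = (\<integral>\<omega>. (q \<bullet> v \<omega>)\<^sup>2 \<partial>P)" by (simp add: power2_eq_square inner_commute)
    finally show ?thesis using nondeg by simp
  qed
  have "inj H"
  proof (subst linear_injective_0[OF lin], intro allI impI)
    fix q assume "H q = 0"
    then show "q = 0" using coer[of q] c_pos by (simp add: mult_le_0_iff)
  qed
  then have "surj H" by (rule linear_inj_imp_surj[OF lin])
  then obtain q where q: "H q = z" by (metis surj_def)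
  have "c * norm q * norm q \<le> norm z * norm q"
    using coer[of q] Cauchy_Schwarz_ineq2[of q z] by (simp add: q power2_eq_square mult_ac)
  then have "norm q \<le> norm z / c"
    using c_pos by (cases "q = 0") (auto simp: field_simps)
  with q that show thesis by (auto simp: H_def)
qed

text \<open>Write \<open>z = Y + W\<close>, where \<open>Y\<close> is parallel to the direction of
  the jump and has mean \<open>z\<close>. The derivative along \<open>Y\<close> is integrated over
  the size of the jump and costs \<open>K\<close>. The centred rest \<open>W\<close> can be attached
  to any of the \<open>n\<close> jumps; by the martingale bound the sum of these \<open>n\<close>
  equal terms is of order \<open>sqrt n * L\<close>, so a single one is of order
  \<open>L / sqrt n\<close>.\<close>

lemma jump_power_gradient:
  assumes ab: "a < b" and K: "\<And>x. cmod (tp xs x) \<le> K" and L: "grad_bdd xs L" "0 \<le> L" and n: "0 < n"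
  shows "cmod (tp (mult (\<lambda>p. dirm z p * jump_char a b p ^ n) xs) x)
    \<le> (2 * R / (c * (b - a)) * K + R\<^sup>2 / (c * sqrt n) * L) * norm z"
proof -
  note avg_meas [measurable] = measurable_avg_iexp[OF ab]
  obtain q where q: "(\<integral>\<omega>. (v \<omega> \<bullet> q) *\<^sub>R v \<omega> \<partial>P) = z" "norm q \<le> norm z / c" by (rule representation)
  define Y where "Y \<omega> = (v \<omega> \<bullet> q) *\<^sub>R v \<omega>" for \<omega>
  define W where "W \<omega> = z - Y \<omega>" for \<omega>
  have [measurable]: "Y \<in> borel_measurable P" "W \<in> borel_measurable P"
    unfolding Y_def[abs_def] W_def[abs_def] by measurable
  let ?T = "jump_char a b" and ?t = "\<lambda>\<omega> p. avg_iexp a b (p \<bullet> v \<omega>)"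
  have vq: "\<bar>v \<omega> \<bullet> q\<bar> \<le> R * norm q" for \<omega>
    by (rule order_trans[OF Cauchy_Schwarz_ineq2]) (simp add: v_le mult_right_mono)
  have Y_le: "norm (Y \<omega>) \<le> R\<^sup>2 * norm q" for \<omega>
    using mult_mono[OF vq v_le, of \<omega> \<omega>] R_nonneg unfolding Y_def by (simp add: power2_eq_square mult_ac)
  have int_Y: "integrable P Y" by (rule integrable_bounded[OF _ Y_le]) simp
  have int_Y2: "integrable P (\<lambda>\<omega>. (norm (Y \<omega>))\<^sup>2)"
    by (rule integrable_bounded[of _ "(R\<^sup>2 * norm q)\<^sup>2"]) (auto intro!: power_mono Y_le)
  have EY: "(\<integral>\<omega>. Y \<omega> \<partial>P) = z" using q by (simp add: Y_def)
  have EW: "(\<integral>\<omega>. W \<omega> \<partial>P) = 0" using int_Y by (simp add: W_def EY prob_space)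
  have W_le: "norm (W \<omega>) \<le> norm z + R\<^sup>2 * norm q" for \<omega>
    unfolding W_def using norm_triangle_ineq4[of z "Y \<omega>"] Y_le[of \<omega>] by linarith
  have W2: "(\<integral>\<omega>. (norm (W \<omega>))\<^sup>2 \<partial>P) \<le> (R\<^sup>2 * norm q)\<^sup>2"
  proof -
    have "(\<integral>\<omega>. (norm (W \<omega>))\<^sup>2 \<partial>P) = (\<integral>\<omega>. (norm z)\<^sup>2 - 2 * (z \<bullet> Y \<omega>) + (norm (Y \<omega>))\<^sup>2 \<partial>P)"
      by (simp add: W_def power2_norm_eq_inner inner_diff_left inner_diff_right inner_commute algebra_simps)
    also have "\<dots> = (norm z)\<^sup>2 - 2 * (z \<bullet> (\<integral>\<omega>. Y \<omega> \<partial>P)) + (\<integral>\<omega>. (norm (Y \<omega>))\<^sup>2 \<partial>P)"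
      using int_Y int_Y2 by (simp add: prob_space)
    also have "\<dots> \<le> (\<integral>\<omega>. (norm (Y \<omega>))\<^sup>2 \<partial>P)" by (simp add: EY power2_norm_eq_inner)
    also have "\<dots> \<le> (\<integral>\<omega>. (R\<^sup>2 * norm q)\<^sup>2 \<partial>P)"
      by (intro integral_mono int_Y2 power_mono Y_le integrable_const) auto
    finally show ?thesis by (simp add: prob_space)
  qed
  define w where "w p = (\<integral>\<omega>. dirm (W \<omega>) p * ?t \<omega> p \<partial>P)" for p
  define U where "U p = (\<integral>\<omega>. dirm (Y \<omega>) p * ?t \<omega> p \<partial>P)" for p
  have int_Yt: "integrable P (\<lambda>\<omega>. dirm (Y \<omega>) p * ?t \<omega> p)" for p
  proof (rule integrable_bounded[of _ "norm p * (R\<^sup>2 * norm q)"])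
    show "(\<lambda>\<omega>. dirm (Y \<omega>) p * ?t \<omega> p) \<in> borel_measurable P" unfolding dirm_def by measurable
    fix \<omega>
    have "\<bar>p \<bullet> Y \<omega>\<bar> \<le> norm p * (R\<^sup>2 * norm q)"
      by (rule order_trans[OF Cauchy_Schwarz_ineq2]) (simp only: Y_le mult_left_mono norm_ge_zero)
    then show "cmod (dirm (Y \<omega>) p * ?t \<omega> p) \<le> norm p * (R\<^sup>2 * norm q)"
      using norm_avg_iexp_le[OF ab] by (auto simp: dirm_def norm_mult intro: order_trans[OF mult_left_le])
  qed
  have decomp: "dirm z p * ?T p = U p + w p" for p
    unfolding U_def w_def W_def jump_char_def dirm_diff
    using int_Yt integrable_avg_iexp[OF ab, of p] by (simp add: left_diff_distrib)
  have split: "dirm z p * ?T p ^ n = U p * ?T p ^ (n - 1) + ?T p ^ (n - 1) * w p" for p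
  proof -
    have "?T p ^ n = ?T p * ?T p ^ (n - 1)" using n by (cases n) auto
    then show ?thesis using decomp[of p] by (simp add: algebra_simps mult.assoc[symmetric])
  qed
  have U_bdd: "bdd U (2 * R * norm q / (b - a))"
  proof -
    let ?u = "\<lambda>\<omega> p. complex_of_real ((v \<omega> \<bullet> q) / (b - a)) * (iexp (p \<bullet> (b *\<^sub>R v \<omega>)) - iexp (p \<bullet> (a *\<^sub>R v \<omega>)))"
    have eq: "dirm (Y \<omega>) p * ?t \<omega> p = ?u \<omega> p" for \<omega> p
    proof -
      have "dirm (Y \<omega>) p * ?t \<omega> p = complex_of_real (v \<omega> \<bullet> q) * (\<i> * complex_of_real (p \<bullet> v \<omega>) * ?t \<omega> p)"
        by (simp add: Y_def dirm_def mult_ac)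
      also have "\<dots> = ?u \<omega> p" unfolding avg_iexp_FTC[OF ab] using ab by (simp add: mult_ac)
      finally show ?thesis .
    qed
    have "bdd (\<lambda>p. \<integral>\<omega>. ?u \<omega> p \<partial>P) (\<integral>\<omega>. 2 * R * norm q / (b - a) \<partial>P)"
    proof (rule bdd_integral)
      fix \<omega>
      have "bdd (\<lambda>p. iexp (p \<bullet> (b *\<^sub>R v \<omega>)) - iexp (p \<bullet> (a *\<^sub>R v \<omega>))) 2"
      proof (rule bddI)
        fix xs :: "(complex \<times> 'a) list" and K x
        assume K: "\<And>y. cmod (tp xs y) \<le> K"
        show "cmod (tp (mult (\<lambda>p. iexp (p \<bullet> (b *\<^sub>R v \<omega>)) - iexp (p \<bullet> (a *\<^sub>R v \<omega>))) xs) x) \<le> 2 * K"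
          unfolding tp_mult_diff tp_mult_shift
          by (rule order_trans[OF norm_triangle_ineq4]) (use K[of "x + b *\<^sub>R v \<omega>"] K[of "x + a *\<^sub>R v \<omega>"] in linarith)
      qed
      then have "bdd (?u \<omega>) (cmod (complex_of_real ((v \<omega> \<bullet> q) / (b - a))) * 2)" by (rule bdd_cmult)
      then show "bdd (?u \<omega>) (2 * R * norm q / (b - a))"
      proof (rule bdd_mono)
        show "cmod (complex_of_real ((v \<omega> \<bullet> q) / (b - a))) * 2 \<le> 2 * R * norm q / (b - a)"
          unfolding norm_of_real using divide_right_mono[OF mult_left_mono[OF vq[of \<omega>], of 2], of "b - a"] ab
          by (simp add: abs_mult mult_ac)
      qed
    qed (use int_Yt in \<open>auto simp: eq\<close>)
    then show ?thesis by (simp add: U_def[abs_def] eq prob_space)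
  qed
  have K0: "0 \<le> K" using K norm_ge_zero order_trans by blast
  have "cmod (tp (mult (\<lambda>p. dirm z p * ?T p ^ n) xs) x) \<le>
      cmod (tp (mult (\<lambda>p. U p * ?T p ^ (n - 1)) xs) x) + cmod (tp (mult (\<lambda>p. ?T p ^ (n - 1) * w p) xs) x)"
    unfolding split tp_mult_add by (rule norm_triangle_ineq)
  also have "cmod (tp (mult (\<lambda>p. U p * ?T p ^ (n - 1)) xs) x) \<le> (2 * R * norm q / (b - a) * 1) * K"
    by (intro bddD[OF bdd_mult[OF U_bdd bdd_power]] jump_char_bdd ab K)
  also have "cmod (tp (mult (\<lambda>p. ?T p ^ (n - 1) * w p) xs) x) \<le> L * (R\<^sup>2 * norm q) / sqrt n"
  proof -
    \<comment> \<open>With \<open>u = 0\<close> the martingale bound controls exactly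
      \<open>n\<close> times the term in question.\<close>
    have "cmod (tp (mult (\<lambda>p. dirm 0 p * ?T p ^ n + of_nat n * ?T p ^ (n - 1) * w p) xs) x)
        \<le> L * sqrt ((norm (0::'a))\<^sup>2 + n * (R\<^sup>2 * norm q)\<^sup>2)"
      unfolding w_def by (rule martingale_multiplier[OF ab L _ W_le EW W2]) measurable
    also have "\<dots> = sqrt n * (L * (R\<^sup>2 * norm q))"
      by (simp add: real_sqrt_mult real_sqrt_abs R_nonneg)
    also have "(\<lambda>p. dirm 0 p * ?T p ^ n + of_nat n * ?T p ^ (n - 1) * w p) = (\<lambda>p. of_nat n * (?T p ^ (n - 1) * w p))"
      by (simp add: mult.assoc)
    finally have "n * cmod (tp (mult (\<lambda>p. ?T p ^ (n - 1) * w p) xs) x) \<le> sqrt n * (L * (R\<^sup>2 * norm q))"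
      by (simp add: tp_mult_cmult norm_mult)
    then have "sqrt n * cmod (tp (mult (\<lambda>p. ?T p ^ (n - 1) * w p) xs) x) \<le> L * (R\<^sup>2 * norm q)"
    proof -
      assume "n * cmod (tp (mult (\<lambda>p. ?T p ^ (n - 1) * w p) xs) x) \<le> sqrt n * (L * (R\<^sup>2 * norm q))"
      moreover have "real n = sqrt n * sqrt n" by simp
      ultimately have "sqrt n * (sqrt n * cmod (tp (mult (\<lambda>p. ?T p ^ (n - 1) * w p) xs) x)) \<le> sqrt n * (L * (R\<^sup>2 * norm q))"
        by (metis mult.assoc)
      then show ?thesis using n by simp
    qed
    then show ?thesis using n by (simp add: field_simps)
  qed
  also have "2 * R * norm q / (b - a) * 1 * K + L * (R\<^sup>2 * norm q) / sqrt n
      = (2 * R / (b - a) * K + L * R\<^sup>2 / sqrt n) * norm q" by (simp add: algebra_simps)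
  also have "\<dots> \<le> (2 * R / (b - a) * K + L * R\<^sup>2 / sqrt n) * (norm z / c)"
    using K0 R_nonneg ab L by (intro mult_left_mono q) auto
  also have "\<dots> = (2 * R / (c * (b - a)) * K + R\<^sup>2 / (c * sqrt n) * L) * norm z"
    by (simp add: divide_inverse distrib_right distrib_left mult_ac)
  finally show ?thesis by simp
qed

end

section \<open>Superposition of dyadic scales\<close>

context jump_directions
begin

text \<open>
  The first \<open>n\<close> terms of the exponential series carry little mass, and all the others contain the factor
  \<open>jump_char a b ^ n\<close>.
\<close>
lemma jump_exp_gradient:
  assumes ab: "a < b" and K: "\<And>x. cmod (tp xs x) \<le> K" and L: "grad_bdd xs L" "0 \<le> L" and n: "0 < n"
    and n_large: "R\<^sup>2 / (c * sqrt n) \<le> 1/8"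
    and l: "0 \<le> l" "exp (- l) * (\<Sum>j<n. l ^ j / fact j) \<le> 1/8"
  shows "cmod (tp (mult (\<lambda>p. dirm z p * exp (complex_of_real l * (jump_char a b p - 1))) xs) x)
    \<le> (2 * R / (c * (b - a)) * K + L / 4) * norm z"
proof -
  let ?T = "jump_char a b"
  define e where "e j = exp (-l) * (l ^ j / fact j)" for j
  have e0: "0 \<le> e j" for j using l by (simp add: e_def)
  have s: "(\<lambda>j. l ^ j / fact j) sums exp l" using exp_converges[of l] by (simp add: field_simps)
  have e: "e sums 1" unfolding e_def using sums_mult[OF s, of "exp (-l)"] by (simp add: exp_minus)
  have e_le: "(\<Sum>j<n. e j) \<le> 1/8" using l(2) by (simp add: e_def sum_distrib_left)
  define r where "r p = (\<Sum>j. complex_of_real (e (j + n)) * ?T p ^ j)" for p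
  have e_n: "summable (\<lambda>j. e (j + n))" "suminf (\<lambda>j. e (j + n)) \<le> 1"
    using e sums_split_initial_segment[OF e, of n] sum_nonneg[of "{..<n}" e] e0 by (auto simp: sums_iff)
  have r: "bdd r 1" unfolding r_def[abs_def]
    by (rule bdd_series[OF jump_char_bdd[OF ab]]) (use e0 e_n in auto)
  have summ: "summable (\<lambda>j. complex_of_real (e (j + i)) * ?T p ^ j)" for p i
  proof (rule summable_comparison_test')
    show "summable (\<lambda>j. e (j + i))" using e by (simp add: summable_iff_shift sums_iff)
    fix n show "norm (complex_of_real (e (n + i)) * ?T p ^ n) \<le> e (n + i)"
      using bdd_norm_le[OF bdd_power[OF jump_char_bdd[OF ab], of n], of p] e0[of "n + i"]
      by (simp add: norm_mult mult_left_le)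
  qed
  have split: "exp (complex_of_real l * (?T p - 1)) = (\<Sum>j<n. complex_of_real (e j) * ?T p ^ j) + ?T p ^ n * r p" for p
  proof -
    have "(\<lambda>j. exp (-complex_of_real l) * ((complex_of_real l * ?T p) ^ j /\<^sub>R fact j)) sums (exp (-complex_of_real l) * exp (complex_of_real l * ?T p))"
      by (intro sums_mult exp_converges)
    moreover have "exp (-complex_of_real l) * ((complex_of_real l * ?T p) ^ j /\<^sub>R fact j) = complex_of_real (e j) * ?T p ^ j" for j
      by (simp add: e_def exp_of_real[symmetric] power_mult_distrib scaleR_conv_of_real field_simps)
    ultimately have "exp (complex_of_real l * (?T p - 1)) = (\<Sum>j. complex_of_real (e j) * ?T p ^ j)"
      by (simp add: sums_iff exp_add[symmetric] algebra_simps)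
    also have "\<dots> = (\<Sum>j. complex_of_real (e (j + n)) * ?T p ^ (j + n)) + (\<Sum>j<n. complex_of_real (e j) * ?T p ^ j)"
      using summ[of 0 p] by (intro suminf_split_initial_segment) simp
    also have "(\<Sum>j. complex_of_real (e (j + n)) * ?T p ^ (j + n)) = ?T p ^ n * r p"
      unfolding r_def using suminf_mult[OF summ[of n p], of "?T p ^ n"] by (simp add: power_add mult_ac)
    finally show ?thesis by simp
  qed
  \<comment> \<open>Fewer than \<open>n\<close> jumps have Poisson probability at most 1/8, and
    there the derivative stays on \<open>xs\<close>. The remaining terms are \<open>?T p ^ n\<close>
    times the contraction \<open>r\<close>, and the derivative is taken by the \<open>n\<close>
    jumps with a second loss of 1/8. Together this is the quarter of \<open>L\<close>.\<close>
  have "tp (mult (\<lambda>p. dirm z p * exp (complex_of_real l * (?T p - 1))) xs) x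
    = tp (mult (\<lambda>p. (\<Sum>j<n. complex_of_real (e j) * ?T p ^ j)) (mult (dirm z) xs)) x
      + tp (mult (\<lambda>p. dirm z p * ?T p ^ n) (mult r xs)) x"
    unfolding mult_mult tp_mult_add[symmetric] split by (simp add: algebra_simps)
  then have "cmod (tp (mult (\<lambda>p. dirm z p * exp (complex_of_real l * (?T p - 1))) xs) x)
    \<le> cmod (tp (mult (\<lambda>p. (\<Sum>j<n. complex_of_real (e j) * ?T p ^ j)) (mult (dirm z) xs)) x)
      + cmod (tp (mult (\<lambda>p. dirm z p * ?T p ^ n) (mult r xs)) x)"
    by (simp only: norm_triangle_ineq)
  also have "cmod (tp (mult (\<lambda>p. (\<Sum>j<n. complex_of_real (e j) * ?T p ^ j)) (mult (dirm z) xs)) x)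
    \<le> (\<Sum>j<n. cmod (complex_of_real (e j)) * 1) * (L * norm z)"
    by (intro bddD[OF bdd_sum[OF bdd_cmult[OF bdd_power]]] jump_char_bdd ab grad_bddD L)
  also have "\<dots> \<le> 1/8 * (L * norm z)"
    using e_le e0 L by (intro mult_right_mono) auto
  also have "cmod (tp (mult (\<lambda>p. dirm z p * ?T p ^ n) (mult r xs)) x)
    \<le> (2 * R / (c * (b - a)) * K + R\<^sup>2 / (c * sqrt n) * L) * norm z"
    using bddD[OF r K] grad_bdd_mult[OF r L(1)] by (intro jump_power_gradient ab L n) auto
  also have "\<dots> \<le> (2 * R / (c * (b - a)) * K + 1/8 * L) * norm z"
    by (intro mult_right_mono add_left_mono n_large L) auto
  finally show ?thesis by (simp add: algebra_simps)
qed

definition dyadic_char :: "(nat \<Rightarrow> real) \<Rightarrow> nat \<Rightarrow> nat \<Rightarrow> 'a \<Rightarrow> complex" where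
  "dyadic_char l k0 j p = (\<Prod>i<j. exp (complex_of_real (l (k0 + i)) *
      (jump_char (1 / 2 ^ (k0 + i + 1)) (1 / 2 ^ (k0 + i)) p - 1)))"

lemma dyadic_char_bdd:
  assumes "\<And>k. k0 \<le> k \<Longrightarrow> 0 \<le> l k"
  shows "bdd (dyadic_char l k0 j) 1"
  unfolding dyadic_char_def[abs_def]
  by (intro bdd_prod bdd_exp jump_char_bdd assms) (auto simp: field_simps)

text \<open>The induction peels off the finest scale. Its cost, of order
  \<open>2 ^ (k0 + j) * K\<close>, is multiplied by 1/4 for each of the \<open>j\<close> coarser
  scales, which leaves \<open>2 ^ k0 / 2 ^ j\<close> and hence a convergent series. Only the cost of
  the coarsest scale survives, while the dependence on the gradient of \<open>xs\<close> decays like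
  \<open>1 / 4 ^ j\<close>.\<close>

lemma dyadic_gradient:
  assumes n: "0 < n" "R\<^sup>2 / (c * sqrt n) \<le> 1/8"
    and l: "\<And>k. k0 \<le> k \<Longrightarrow> 0 \<le> l k" "\<And>k. k0 \<le> k \<Longrightarrow> exp (- l k) * (\<Sum>j<n. l k ^ j / fact j) \<le> 1/8"
    and K: "\<And>x. cmod (tp xs x) \<le> K" and L: "grad_bdd xs L" "0 \<le> L"
  shows "cmod (tp (mult (\<lambda>p. dirm z p * dyadic_char l k0 j p) xs) x)
    \<le> (8 * R / c * 2 ^ k0 * (1 - 1 / 2 ^ j) * K + L / 4 ^ j) * norm z"
  using K L
proof (induction j arbitrary: xs K L z x)
  case 0
  then show ?case by (simp add: dyadic_char_def grad_bddD)
next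
  case (Suc j)
  let ?S = "\<lambda>p. exp (complex_of_real (l (k0 + j)) * (jump_char (1 / 2 ^ (k0 + j + 1)) (1 / 2 ^ (k0 + j)) p - 1))"
  have K0: "0 \<le> K" using Suc.prems(1) norm_ge_zero order_trans by blast
  have ab: "1 / 2 ^ (k0 + j + 1) < (1 / 2 ^ (k0 + j) :: real)" by (simp add: field_simps)
  have S: "bdd ?S 1" by (intro bdd_exp jump_char_bdd ab l) simp
  \<comment> \<open>The value of the one-scale bound for an interval of sizes of length
    \<open>1 / 2 ^ (k0 + j + 1)\<close>.\<close>
  define L' where "L' = 4 * R / c * 2 ^ (k0 + j) * K + L / 4"
  have L'0: "0 \<le> L'" unfolding L'_def using R_nonneg c_pos K0 Suc.prems(3) by simp
  have grad: "grad_bdd (mult ?S xs) L'"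
    unfolding grad_bdd_def mult_mult
  proof (intro allI)
    fix z x
    have "cmod (tp (mult (\<lambda>p. dirm z p * ?S p) xs) x)
      \<le> (2 * R / (c * (1 / 2 ^ (k0 + j) - 1 / 2 ^ (k0 + j + 1))) * K + L / 4) * norm z"
      by (rule jump_exp_gradient[OF ab Suc.prems n l]) auto
    also have "1 / 2 ^ (k0 + j) - 1 / 2 ^ (k0 + j + 1) = 1 / (2 * 2 ^ (k0 + j) :: real)"
      by (simp add: field_simps)
    also have "2 * R / (c * (1 / (2 * 2 ^ (k0 + j)))) * K + L / 4 = L'"
      unfolding L'_def by simp
    finally show "cmod (tp (mult (\<lambda>p. dirm z p * ?S p) xs) x) \<le> L' * norm z" .
  qed
  have "cmod (tp (mult (\<lambda>p. dirm z p * dyadic_char l k0 j p) (mult ?S xs)) x)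
    \<le> (8 * R / c * 2 ^ k0 * (1 - 1 / 2 ^ j) * K + L' / 4 ^ j) * norm z"
    using bddD[OF S Suc.prems(1)] by (intro Suc.IH grad L'0) auto
  also have "8 * R / c * 2 ^ k0 * (1 - 1 / 2 ^ j) * K + L' / 4 ^ j
    = 8 * R / c * 2 ^ k0 * (1 - 1 / 2 ^ Suc j) * K + L / 4 ^ Suc j"
  proof -
    have four: "(4::real) ^ j = 2 ^ j * 2 ^ j" by (simp flip: power_mult_distrib)
    show ?thesis using c_pos unfolding L'_def power_add four power_Suc by (simp add: field_simps)
  qed
  finally show ?case by (simp add: dyadic_char_def mult_mult mult.assoc)
qed

end

section \<open>Derivatives of higher order\<close>

definition dirs :: "'a::real_inner list \<Rightarrow> 'a \<Rightarrow> complex" where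
  "dirs zs p = (\<Prod>z\<leftarrow>zs. dirm z p)"

lemma dirs_simps [simp]: "dirs [] p = 1" "dirs (z # zs) p = dirm z p * dirs zs p"
  by (simp_all add: dirs_def)

lemma norm_tp_le: "cmod (tp xs x) \<le> (\<Sum>(c, p)\<leftarrow>xs. cmod c)"
proof (induction xs)
  case (Cons a xs)
  have "cmod (tp (a # xs) x) \<le> cmod (fst a * iexp (snd a \<bullet> x)) + cmod (tp xs x)"
    unfolding tp_Cons by (rule norm_triangle_ineq)
  with Cons show ?case by (simp add: norm_mult case_prod_unfold)
qed auto

lemma grad_bdd_exists:
  fixes xs :: "(complex \<times> 'a::real_inner) list"
  obtains L where "0 \<le> L" "grad_bdd xs L"
proof
  define L where "L = (\<Sum>(c, p)\<leftarrow>xs. cmod c * norm p)"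
  show "0 \<le> L" unfolding L_def by (intro sum_list_nonneg) auto
  have *: "(\<Sum>(c, p)\<leftarrow>mult (dirm z) ys. cmod c) \<le> (\<Sum>(c, p)\<leftarrow>ys. cmod c * norm p) * norm z" for z and ys :: "(complex \<times> 'a) list"
  proof (induction ys)
    case (Cons a ys)
    have "cmod (dirm z (snd a) * fst a) \<le> cmod (fst a) * norm (snd a) * norm z"
      using mult_left_mono[OF Cauchy_Schwarz_ineq2[of "snd a" z], of "cmod (fst a)"]
      by (simp add: dirm_def norm_mult mult_ac)
    with Cons show ?case by (simp add: case_prod_unfold algebra_simps)
  qed auto
  show "grad_bdd xs L" unfolding grad_bdd_def L_def
    using norm_tp_le * order_trans by blast
qed

text \<open>\<open>\<Psi>\<close> contains \<open>m\<close> copies of \<open>Q j\<close>, one for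
  each derivative. The gradient \<open>L\<close> that enters at each application is finite but
  uncontrolled; since \<open>\<Psi>\<close> does not depend on \<open>j\<close>, letting
  \<open>j\<close> tend to infinity removes the terms \<open>e j * L\<close>.\<close>

lemma smoothing_all_orders:
  fixes Q m0 :: "nat \<Rightarrow> 'a::real_inner \<Rightarrow> complex"
  assumes Q: "\<And>j. bdd (Q j) 1"
    and grad: "\<And>xs K L z j x. (\<And>x. cmod (tp xs x) \<le> K) \<Longrightarrow> grad_bdd xs L \<Longrightarrow> 0 \<le> L \<Longrightarrow>
      cmod (tp (mult (\<lambda>p. dirm z p * Q j p) xs) x) \<le> (C * K + e j * L) * norm z"
    and e: "e \<longlonglongrightarrow> 0" and C: "0 \<le> C"
    and m0: "\<And>j. bdd (m0 j) 1" and fact: "\<And>j p. \<Psi> p = m0 j p * Q j p ^ m"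
    and zs: "length zs \<le> m"
    and K: "\<And>x. cmod (tp xs x) \<le> K"
  shows "cmod (tp (mult (\<lambda>p. dirs zs p * \<Psi> p) xs) x) \<le> (\<Prod>z\<leftarrow>zs. C * norm z) * K"
proof -
  have step: "\<forall>\<^sub>F j in sequentially. \<forall>x. cmod (tp (mult (\<lambda>p. dirs zs p * Q j p ^ length zs) xs) x) \<le> (\<Prod>z\<leftarrow>zs. C * norm z) * K + d"
    if "0 < d" for d and zs :: "'a list"
    using that
  proof (induction zs arbitrary: d)
    case Nil
    then show ?case using K by (auto intro!: always_eventually intro: add_increasing2)
  next
    case (Cons z zs)
    obtain L where L: "0 \<le> L" "grad_bdd (mult (dirs zs) xs) L" by (rule grad_bdd_exists)
    define P where "P = (\<Prod>z\<leftarrow>zs. C * norm z) * K"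
    \<comment> \<open>The slack of the induction hypothesis is multiplied by
      \<open>C * norm z\<close> and may then use up half of \<open>d\<close>. The summand 1 keeps
      the denominator positive when \<open>C * norm z = 0\<close>.\<close>
    define d' where "d' = d / 2 / (C * norm z + 1)"
    have Cz: "0 \<le> C * norm z" using C by simp
    then have d': "0 < d'" using Cons.prems by (simp add: d'_def)
    have d'_le: "C * d' * norm z \<le> d / 2"
      using Cz Cons.prems mult_right_mono[of "C * norm z" "C * norm z + 1" "d / 2"]
      by (simp add: d'_def field_simps)
    have "(\<lambda>j. e j * L * norm z) \<longlonglongrightarrow> 0 * L * norm z" by (intro tendsto_intros e)
    then have ev: "\<forall>\<^sub>F j in sequentially. e j * L * norm z < d / 2"
      using Cons.prems by (intro order_tendstoD(2)) auto
    show ?case using Cons.IH[OF d'] ev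
    proof eventually_elim
      case (elim j)
      show ?case
      proof
        fix x
        define ys where "ys = mult (\<lambda>p. dirs zs p * Q j p ^ length zs) xs"
        have "grad_bdd (mult (\<lambda>p. Q j p ^ length zs) (mult (dirs zs) xs)) (1 * L)"
          by (intro grad_bdd_mult bdd_power Q L)
        then have "grad_bdd ys L" by (simp add: ys_def mult_mult mult.commute)
        then have "cmod (tp (mult (\<lambda>p. dirm z p * Q j p) ys) x) \<le> (C * (P + d') + e j * L) * norm z"
          using elim L by (intro grad) (auto simp: ys_def P_def)
        also have "\<dots> = (C * norm z) * P + C * d' * norm z + e j * L * norm z" by (simp add: algebra_simps)
        also have "\<dots> \<le> (C * norm z) * P + d" using d'_le elim by linarith
        finally show "cmod (tp (mult (\<lambda>p. dirs (z # zs) p * Q j p ^ length (z # zs)) xs) x) \<le> (\<Prod>z\<leftarrow>z # zs. C * norm z) * K + d"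
          by (simp add: ys_def mult_mult P_def mult_ac)
      qed
    qed
  qed
  show ?thesis
  proof (rule field_le_epsilon)
    fix d :: real assume "0 < d"
    from step[OF this, of zs] obtain j where
      j: "\<And>x. cmod (tp (mult (\<lambda>p. dirs zs p * Q j p ^ length zs) xs) x) \<le> (\<Prod>z\<leftarrow>zs. C * norm z) * K + d"
      by (auto simp: eventually_sequentially)
    \<comment> \<open>The copies of \<open>Q j\<close> that received no derivative and the factor
      \<open>m0 j\<close> are contractions.\<close>
    have "bdd (\<lambda>p. m0 j p * Q j p ^ (m - length zs)) (1 * 1)" by (intro bdd_mult bdd_power m0 Q)
    from bddD[OF this j]
    have "cmod (tp (mult (\<lambda>p. m0 j p * Q j p ^ (m - length zs)) (mult (\<lambda>p. dirs zs p * Q j p ^ length zs) xs)) x)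
      \<le> (\<Prod>z\<leftarrow>zs. C * norm z) * K + d" by simp
    also have "mult (\<lambda>p. m0 j p * Q j p ^ (m - length zs)) (mult (\<lambda>p. dirs zs p * Q j p ^ length zs) xs)
      = mult (\<lambda>p. dirs zs p * \<Psi> p) xs"
    proof -
      have "m0 j p * Q j p ^ (m - length zs) * (dirs zs p * Q j p ^ length zs) = dirs zs p * \<Psi> p" for p
        unfolding fact[of p j] using power_add[of "Q j p" "m - length zs" "length zs"] zs by (simp add: mult_ac)
      then show ?thesis by (simp only: mult_mult)
    qed
    finally show "cmod (tp (mult (\<lambda>p. dirs zs p * \<Psi> p) xs) x) \<le> (\<Prod>z\<leftarrow>zs. C * norm z) * K + d" .
  qed
qed

text \<open>The probability that a Poisson variable of mean \<open>l\<close> is below a fixed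
  \<open>n\<close> tends to 0 as \<open>l\<close> grows.\<close>

lemma poisson_head_small:
  "\<exists>l0\<ge>0. \<forall>l\<ge>l0. exp (- l) * (\<Sum>j<n. l ^ j / fact j) \<le> (1/8 :: real)"
proof -
  have "((\<lambda>l::real. \<Sum>j<n. l ^ j / exp l / fact j) \<longlongrightarrow> (\<Sum>j<n. 0 / fact j)) at_top"
    by (intro tendsto_intros tendsto_power_div_exp_0) auto
  then have "\<forall>\<^sub>F l in at_top. (\<Sum>j<n. l ^ j / exp l / fact j) < (1/8 :: real)"
    by (intro order_tendstoD(2)) auto
  then obtain l0 where "\<And>l. l \<ge> l0 \<Longrightarrow> (\<Sum>j<n. l ^ j / exp l / fact j) < (1/8 :: real)"
    by (auto simp: eventually_at_top_linorder)
  then show ?thesis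
    by (intro exI[of _ "max 0 l0"]) (auto simp: sum_distrib_left exp_minus field_simps intro: less_imp_le)
qed

section \<open>Subtracting a finite measure from a Levy measure\<close>

lemma nn_integral_measure_le:
  assumes sets: "sets N = sets N'" and le: "\<And>A. A \<in> sets N \<Longrightarrow> emeasure N A \<le> emeasure N' A"
    and f: "f \<in> borel_measurable N"
  shows "(\<integral>\<^sup>+x. f x \<partial>N) \<le> (\<integral>\<^sup>+x. f x \<partial>N')"
  using f
proof (induction rule: borel_measurable_induct)
  case (cong f g)
  have sp: "space N = space N'" by (rule sets_eq_imp_space_eq[OF sets])
  have "(\<integral>\<^sup>+x. f x \<partial>N) = (\<integral>\<^sup>+x. g x \<partial>N)" "(\<integral>\<^sup>+x. f x \<partial>N') = (\<integral>\<^sup>+x. g x \<partial>N')"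
    using cong(3) by (auto intro!: nn_integral_cong simp: sp)
  with cong show ?case by simp
next
  case (set A)
  then show ?case using le[of A] sets by simp
next
  case (mult u c)
  moreover have "u \<in> borel_measurable N'" using mult(2) unfolding measurable_cong_sets[OF sets refl] .
  ultimately show ?case by (simp add: nn_integral_cmult mult_left_mono)
next
  case (add u v)
  moreover have "u \<in> borel_measurable N'" "v \<in> borel_measurable N'"
    using add unfolding measurable_cong_sets[OF sets refl] by blast+
  ultimately show ?case by (simp add: nn_integral_add add_mono)
next
  case (seq U)
  have U': "U i \<in> borel_measurable N'" for i using seq(1)[of i] unfolding measurable_cong_sets[OF sets refl] .
  have "(\<integral>\<^sup>+x. (SUP i. U i) x \<partial>N) = (SUP i. \<integral>\<^sup>+x. U i x \<partial>N)"
    unfolding SUP_apply by (rule nn_integral_monotone_convergence_SUP) (use seq in auto)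
  moreover have "(\<integral>\<^sup>+x. (SUP i. U i) x \<partial>N') = (SUP i. \<integral>\<^sup>+x. U i x \<partial>N')"
    unfolding SUP_apply by (rule nn_integral_monotone_convergence_SUP) (use seq U' in auto)
  ultimately show ?case using seq(5) by (simp only:) (intro SUP_mono, auto)
qed

text \<open>The symbol belongs to the positive measure \<open>N' - N\<close>, whose total variation
  is the difference of the masses. Instead of constructing it, the inequality
  \<open>N \<le> N'\<close> is tested on the nonnegative function \<open>K - Re (u * F z)\<close>,
  where the phase \<open>u\<close> rotates the value to be estimated onto the positive real
  axis.\<close>

lemma bdd_measure_diff:
  fixes N N' :: "'a::euclidean_space measure"
  assumes fin: "finite_measure N'" and sets: "sets N = sets borel" "sets N' = sets borel"
    and le: "\<And>A. A \<in> sets borel \<Longrightarrow> emeasure N A \<le> emeasure N' A"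
  shows "bdd (\<lambda>p. (\<integral>z. iexp (p \<bullet> z) \<partial>N') - (\<integral>z. iexp (p \<bullet> z) \<partial>N)) (measure N' UNIV - measure N UNIV)"
    and "finite_measure N" "measure N UNIV \<le> measure N' UNIV"
proof -
  have sp: "space N = UNIV" "space N' = UNIV" using sets[THEN sets_eq_imp_space_eq] by auto
  have N'f: "emeasure N' UNIV < \<infinity>" using finite_measure.emeasure_finite[OF fin] by (simp add: less_top)
  show fN: "finite_measure N"
    using le[of UNIV] N'f by (intro finite_measureI) (auto simp: sp dest: order_le_less_trans)
  interpret N: finite_measure N by fact
  interpret N': finite_measure N' by fact
  have meas: "f \<in> borel_measurable borel \<Longrightarrow> f \<in> borel_measurable N" 
    "f \<in> borel_measurable borel \<Longrightarrow> f \<in> borel_measurable N'" for f :: "'a \<Rightarrow> 'c::topological_space"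
    using measurable_cong_sets[OF sets(1) refl] measurable_cong_sets[OF sets(2) refl] by auto
  show "measure N UNIV \<le> measure N' UNIV"
    using le[of UNIV] by (simp add: N.emeasure_eq_measure N'.emeasure_eq_measure)
  have le_int: "(\<integral>z. f z \<partial>N) \<le> (\<integral>z. f z \<partial>N')"
    if f: "f \<in> borel_measurable borel" "\<And>z. 0 \<le> f z" "\<And>z. f z \<le> C" for f :: "'a \<Rightarrow> real" and C
  proof -
    have i: "integrable N f" "integrable N' f"
      using f by (auto intro!: N.integrable_const_bound[of _ C] N'.integrable_const_bound[of _ C] meas)
    have "(\<integral>\<^sup>+z. ennreal (f z) \<partial>N) \<le> (\<integral>\<^sup>+z. ennreal (f z) \<partial>N')"
      by (rule nn_integral_measure_le) (use sets le f meas in auto)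
    moreover have "(\<integral>\<^sup>+z. ennreal (f z) \<partial>N) = ennreal (\<integral>z. f z \<partial>N)"
      "(\<integral>\<^sup>+z. ennreal (f z) \<partial>N') = ennreal (\<integral>z. f z \<partial>N')"
      by (rule nn_integral_eq_integral[OF i(1)] nn_integral_eq_integral[OF i(2)], simp add: f)+
    moreover have "0 \<le> (\<integral>z. f z \<partial>N')" by (simp add: f)
    ultimately show ?thesis by (simp add: ennreal_le_iff)
  qed
  show "bdd (\<lambda>p. (\<integral>z. iexp (p \<bullet> z) \<partial>N') - (\<integral>z. iexp (p \<bullet> z) \<partial>N)) (measure N' UNIV - measure N UNIV)"
  proof (rule bddI)
    fix xs :: "(complex \<times> 'a) list" and K x
    assume K: "\<And>y. cmod (tp xs y) \<le> K"
    define F where "F z = tp (mult (\<lambda>p. iexp (p \<bullet> z)) xs) x" for z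
    have F_le: "cmod (F z) \<le> K" for z unfolding F_def tp_mult_shift by (rule K)
    have F_meas: "F \<in> borel_measurable borel"
      unfolding F_def[abs_def] by (induction xs) auto
    have int: "integrable N (\<lambda>z. iexp (p \<bullet> z))" "integrable N' (\<lambda>z. iexp (p \<bullet> z))" for p
      by (auto intro!: N.integrable_const_bound[of _ 1] N'.integrable_const_bound[of _ 1] meas)
    have intF: "integrable N F" "integrable N' F"
      using F_le by (auto intro!: N.integrable_const_bound[of _ K] N'.integrable_const_bound[of _ K] meas F_meas)
    define I where "I = (\<integral>z. F z \<partial>N') - (\<integral>z. F z \<partial>N)"
    have I: "tp (mult (\<lambda>p. (\<integral>z. iexp (p \<bullet> z) \<partial>N') - (\<integral>z. iexp (p \<bullet> z) \<partial>N)) xs) x = I"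
      unfolding tp_mult_diff I_def F_def using int by (simp add: has_integral_tp_mult)
    obtain u where u: "cmod u = 1" "u * I = complex_of_real (cmod I)"
    proof (cases "I = 0")
      case True
      then show ?thesis using that[of 1] by simp
    next
      case False
      then show ?thesis using that[of "cnj I / complex_of_real (cmod I)"]
        by (simp add: norm_divide complex_norm_square[symmetric] power2_eq_square field_simps)
    qed
    have Re_le: "\<bar>Re (u * F z)\<bar> \<le> K" for z
      using abs_Re_le_cmod[of "u * F z"] F_le[of z] by (simp add: norm_mult u)
    have "(\<integral>z. K - Re (u * F z) \<partial>N) \<le> (\<integral>z. K - Re (u * F z) \<partial>N')"
    proof (rule le_int[of _ "2 * K"])
      show "(\<lambda>z. K - Re (u * F z)) \<in> borel_measurable borel" using F_meas by measurable
      fix z show "0 \<le> K - Re (u * F z)" "K - Re (u * F z) \<le> 2 * K" using Re_le[of z] by auto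
    qed
    moreover have "(\<integral>z. K - Re (u * F z) \<partial>N) = K * measure N UNIV - Re (u * (\<integral>z. F z \<partial>N))"
      using intF by (simp add: sp)
    moreover have "(\<integral>z. K - Re (u * F z) \<partial>N') = K * measure N' UNIV - Re (u * (\<integral>z. F z \<partial>N'))"
      using intF by (simp add: sp)
    ultimately have "Re (u * I) \<le> K * (measure N' UNIV - measure N UNIV)"
      unfolding I_def by (simp add: algebra_simps)
    then show "cmod (tp (mult (\<lambda>p. (\<integral>z. iexp (p \<bullet> z) \<partial>N') - (\<integral>z. iexp (p \<bullet> z) \<partial>N)) xs) x)
      \<le> (measure N' UNIV - measure N UNIV) * K"
      unfolding I u by (simp add: mult.commute)
  qed
qed

text \<open>Compound Poisson exponent with total intensity \<open>k\<close>: dividing by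
  \<open>k\<close> gives a contraction to which \<open>bdd_exp\<close> applies. For
  \<open>k = 0\<close> the bound forces \<open>m\<close> to vanish.\<close>

lemma bdd_exp_diff:
  assumes m: "bdd m k" and k: "0 \<le> k" and t: "0 \<le> t"
  shows "bdd (\<lambda>p. exp (complex_of_real t * (m p - complex_of_real k))) 1"
proof (cases "k = 0")
  case True
  then have "m p = 0" for p using bdd_norm_le[OF m, of p] by simp
  with True show ?thesis by (simp add: bdd_one)
next
  case False
  have "bdd (\<lambda>p. complex_of_real (1 / k) * m p) (cmod (complex_of_real (1 / k)) * k)"
    by (rule bdd_cmult[OF m])
  then have "bdd (\<lambda>p. complex_of_real (1 / k) * m p) 1" using k False by (simp add: norm_divide)
  then have "bdd (\<lambda>p. exp (complex_of_real (t * k) * (complex_of_real (1 / k) * m p - 1))) 1"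
    using k t by (intro bdd_exp) auto
  moreover have "complex_of_real (t * k) * (complex_of_real (1 / k) * m p - 1) = complex_of_real t * (m p - complex_of_real k)" for p
    using False by (simp add: right_diff_distrib)
  ultimately show ?thesis by (simp only:)
qed

section \<open>The integrand of the Levy-Khintchine formula\<close>

definition levy_integrand :: "'a::euclidean_space \<Rightarrow> 'a \<Rightarrow> complex" where
  "levy_integrand p z = 1 - iexp (p \<bullet> z) + \<i> * complex_of_real (p \<bullet> z * indicator (ball 0 1) z)"

lemma measurable_levy_integrand [measurable]: "levy_integrand p \<in> borel_measurable borel"
proof -
  have [measurable]: "ball (0::'a) 1 \<in> sets borel" by simp
  show ?thesis unfolding levy_integrand_def[abs_def] by measurable
qed

lemma norm_levy_integrand:
  shows "norm z < 1 \<Longrightarrow> cmod (levy_integrand p z) \<le> (p \<bullet> z)\<^sup>2 / 2"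
    and "\<not> norm z < 1 \<Longrightarrow> cmod (levy_integrand p z) \<le> 2"
    and "cmod (levy_integrand p z) \<le> 2 + \<bar>p \<bullet> z\<bar>"
proof -
  assume "norm z < 1"
  then have "cmod (levy_integrand p z) = cmod (iexp (p \<bullet> z) - (\<Sum>k\<le>1. (\<i> * (p \<bullet> z)) ^ k / fact k))"
    by (subst norm_minus_commute) (simp add: levy_integrand_def algebra_simps)
  also have "\<dots> \<le> (p \<bullet> z)\<^sup>2 / 2" using iexp_approx1[of "p \<bullet> z" 1] by (simp add: numeral_2_eq_2)
  finally show "cmod (levy_integrand p z) \<le> (p \<bullet> z)\<^sup>2 / 2" .
next
  assume "\<not> norm z < 1"
  then have "cmod (levy_integrand p z) = cmod (1 - iexp (p \<bullet> z))" by (simp add: levy_integrand_def)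
  also have "\<dots> \<le> 2" by (rule order_trans[OF norm_triangle_ineq4]) (simp add: norm_exp_i_times)
  finally show "cmod (levy_integrand p z) \<le> 2" .
next
  have "cmod (levy_integrand p z) \<le> cmod (1 - iexp (p \<bullet> z)) + cmod (\<i> * complex_of_real (p \<bullet> z * indicator (ball 0 1) z))"
    unfolding levy_integrand_def by (rule norm_triangle_ineq)
  also have "\<dots> \<le> 2 + \<bar>p \<bullet> z\<bar>"
    by (intro add_mono order_trans[OF norm_triangle_ineq4]) (auto simp: norm_mult indicator_def)
  finally show "cmod (levy_integrand p z) \<le> 2 + \<bar>p \<bullet> z\<bar>" .
qed

lemma norm_levy_integrand_le:
  "cmod (levy_integrand p z) \<le> (2 + (norm p)\<^sup>2) * min 1 ((norm z)\<^sup>2)"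
proof (cases "norm z < 1")
  case True
  have "(p \<bullet> z)\<^sup>2 \<le> (norm p)\<^sup>2 * (norm z)\<^sup>2"
    using power_mono[OF Cauchy_Schwarz_ineq2, of p z 2] by (simp add: power_mult_distrib)
  moreover have "0 \<le> (norm p)\<^sup>2 * (norm z)\<^sup>2" "0 \<le> (norm z)\<^sup>2" by simp_all
  moreover have "min 1 ((norm z)\<^sup>2) = (norm z)\<^sup>2" using True by (intro min.absorb2) (simp add: power_le_one)
  ultimately show ?thesis
    using norm_levy_integrand(1)[OF True, of p] by (simp only: distrib_right)
next
  case False
  then have "1 \<le> (norm z)\<^sup>2" by simp
  then have "min 1 ((norm z)\<^sup>2) = 1" by simp
  moreover have "0 \<le> (norm p)\<^sup>2" by simp
  moreover have "cmod (levy_integrand p z) \<le> 2 + (norm p)\<^sup>2"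
    using norm_levy_integrand(2)[OF False, of p] zero_le_power2[of "norm p"] by linarith
  ultimately show ?thesis by simp
qed

text \<open>Both bounds serve dominated convergence as \<open>s\<close> tends to infinity: the first
  gives the pointwise limit 0, the second an integrable majorant that does not depend on
  \<open>s\<close>.\<close>

lemma scaled_levy_integrand:
  fixes s :: real
  assumes "1 \<le> s"
  shows "cmod (levy_integrand (s *\<^sub>R p) z / complex_of_real (s\<^sup>2)) \<le> 2 * (1 / s * (1 / s)) + \<bar>p \<bullet> z\<bar> * (1 / s)"
    and "cmod (levy_integrand (s *\<^sub>R p) z / complex_of_real (s\<^sup>2)) \<le> (2 + (norm p)\<^sup>2) * min 1 ((norm z)\<^sup>2)"
proof -
  have eq: "cmod (levy_integrand (s *\<^sub>R p) z / complex_of_real (s\<^sup>2)) = cmod (levy_integrand (s *\<^sub>R p) z) / s\<^sup>2"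
    by (simp only: norm_divide norm_of_real abs_power2)
  have "cmod (levy_integrand (s *\<^sub>R p) z) / s\<^sup>2 \<le> (2 + s * \<bar>p \<bullet> z\<bar>) / s\<^sup>2"
    using norm_levy_integrand(3)[of "s *\<^sub>R p" z] assms by (intro divide_right_mono) (auto simp: abs_mult)
  also have "\<dots> = 2 * (1 / s * (1 / s)) + \<bar>p \<bullet> z\<bar> * (1 / s)"
    using assms by (simp add: add_divide_distrib power2_eq_square)
  finally show "cmod (levy_integrand (s *\<^sub>R p) z / complex_of_real (s\<^sup>2)) \<le> 2 * (1 / s * (1 / s)) + \<bar>p \<bullet> z\<bar> * (1 / s)"
    unfolding eq .
  have s1: "1 \<le> s\<^sup>2" using assms by simp
  have m0: "0 \<le> min 1 ((norm z)\<^sup>2)" by simp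
  have "cmod (levy_integrand (s *\<^sub>R p) z) \<le> (2 + s\<^sup>2 * (norm p)\<^sup>2) * min 1 ((norm z)\<^sup>2)"
    using norm_levy_integrand_le[of "s *\<^sub>R p" z] by (simp add: power_mult_distrib)
  also have "\<dots> \<le> ((2 + (norm p)\<^sup>2) * s\<^sup>2) * min 1 ((norm z)\<^sup>2)"
    using s1 by (intro mult_right_mono m0) (simp add: algebra_simps)
  finally have "cmod (levy_integrand (s *\<^sub>R p) z) / s\<^sup>2 \<le> ((2 + (norm p)\<^sup>2) * s\<^sup>2) * min 1 ((norm z)\<^sup>2) / s\<^sup>2"
    by (rule divide_right_mono) simp
  also have "\<dots> = (2 + (norm p)\<^sup>2) * min 1 ((norm z)\<^sup>2)" using assms by simp
  finally show "cmod (levy_integrand (s *\<^sub>R p) z / complex_of_real (s\<^sup>2)) \<le> (2 + (norm p)\<^sup>2) * min 1 ((norm z)\<^sup>2)"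
    unfolding eq .
qed

locale levy_semigroup = prob_space M for M :: "'w measure" +
  fixes b :: "real^'d" and Q :: "real^'d^'d" and \<nu> :: "(real^'d) measure" and Z :: "real \<Rightarrow> 'w \<Rightarrow> real^'d"
  assumes levy_measure: "levy_measure \<nu>"
    and meas_Z: "\<And>t. 0 \<le> t \<Longrightarrow> Z t \<in> borel_measurable M"
    and symbol: "\<And>t p. 0 \<le> t \<Longrightarrow>
      (\<integral>\<omega>. iexp (p \<bullet> Z t \<omega>) \<partial>M) = exp (- (complex_of_real t * levy_symbol b Q \<nu> p))"
begin

text \<open>\<nu> lives on the punctured space. Its image on the whole space charges the same sets
  and allows Borel functions and sets to be used without restriction.\<close>

definition \<nu>' :: "(real^'d) measure" where "\<nu>' = distr \<nu> borel (\<lambda>z. z)"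

lemma measurable_id_\<nu> [measurable]: "(\<lambda>z. z) \<in> measurable \<nu> borel"
proof -
  have "sets \<nu> = sets (restrict_space borel (- {0}))" using levy_measure by (simp add: levy_measure_def)
  then show ?thesis using measurable_cong_sets[of \<nu> "restrict_space borel (- {0})" borel borel]
    by (auto intro!: measurable_restrict_space1)
qed

lemma sets_\<nu>' [simp, measurable_cong]: "sets \<nu>' = sets borel" and space_\<nu>' [simp]: "space \<nu>' = UNIV"
  by (simp_all add: \<nu>'_def)

lemma levy_symbol_eq:
  "levy_symbol b Q \<nu> p = - \<i> * complex_of_real (b \<bullet> p) + complex_of_real (1/2 * (p \<bullet> (Q *v p))) + (\<integral>z. levy_integrand p z \<partial>\<nu>')"
  unfolding levy_symbol_def \<nu>'_def
  by (subst integral_distr[OF measurable_id_\<nu> measurable_levy_integrand])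
    (simp only: levy_integrand_def[abs_def])

lemma integrable_min: "integrable \<nu>' (\<lambda>z. min 1 ((norm z)\<^sup>2))"
proof (rule integrableI_bounded)
  have "(\<integral>\<^sup>+z. ennreal (norm (min 1 ((norm z)\<^sup>2))) \<partial>\<nu>') = (\<integral>\<^sup>+z. ennreal (min 1 ((norm z)\<^sup>2)) \<partial>\<nu>)"
    unfolding \<nu>'_def by (subst nn_integral_distr) (auto simp: min_def)
  then show "(\<integral>\<^sup>+z. ennreal (norm (min 1 ((norm z)\<^sup>2))) \<partial>\<nu>') < \<infinity>"
    using levy_measure by (simp add: levy_measure_def)
  show "(\<lambda>z. min 1 ((norm z)\<^sup>2)) \<in> borel_measurable \<nu>'"
    unfolding measurable_cong_sets[OF sets_\<nu>' refl] by measurable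
qed

lemma measurable_\<nu>'I: "f \<in> borel_measurable borel \<Longrightarrow> f \<in> borel_measurable \<nu>'"
  unfolding measurable_cong_sets[OF sets_\<nu>' refl] .

lemma integrable_levy_integrand: "integrable \<nu>' (levy_integrand p)"
  by (rule Bochner_Integration.integrable_bound[OF integrable_mult_right[OF integrable_min, of "2 + (norm p)\<^sup>2"]])
    (auto intro!: measurable_\<nu>'I measurable_levy_integrand norm_levy_integrand_le)

lemma bdd_levy: "0 \<le> t \<Longrightarrow> bdd (\<lambda>p. exp (- (complex_of_real t * levy_symbol b Q \<nu> p))) 1"
proof -
  assume t: "0 \<le> t"
  have "bdd (\<lambda>p. \<integral>\<omega>. iexp (p \<bullet> Z t \<omega>) \<partial>M) (\<integral>\<omega>. 1 \<partial>M)"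
    using meas_Z[OF t]
    by (intro bdd_integral bdd_shift integrable_const integrable_const_bound[of _ 1]) auto
  then show ?thesis by (simp add: symbol[OF t] prob_space)
qed

text \<open>The drift grows linearly and the jump part more slowly than quadratically, by dominated
  convergence; only the Gaussian part survives the division by the square of the scaling.\<close>

lemma symbol_scaling_limit:
  "(\<lambda>n. levy_symbol b Q \<nu> (real (Suc n) *\<^sub>R p) / complex_of_real ((real (Suc n))\<^sup>2))
    \<longlonglongrightarrow> complex_of_real (1/2 * (p \<bullet> (Q *v p)))"
proof -
  let ?s = "\<lambda>n. real (Suc n)"
  have lim0: "(\<lambda>n. 1 / ?s n) \<longlonglongrightarrow> 0" using lim_1_over_n LIMSEQ_Suc by blast
  have lim1: "(\<lambda>n. - \<i> * complex_of_real (b \<bullet> p) * complex_of_real (1 / ?s n)) \<longlonglongrightarrow> - \<i> * complex_of_real (b \<bullet> p) * complex_of_real 0"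
    by (intro tendsto_intros lim0)
  have lim2: "(\<lambda>n. \<integral>z. levy_integrand (?s n *\<^sub>R p) z / complex_of_real ((?s n)\<^sup>2) \<partial>\<nu>') \<longlonglongrightarrow> (\<integral>z. 0 \<partial>\<nu>')"
  proof (rule integral_dominated_convergence)
    show "integrable \<nu>' (\<lambda>z. (2 + (norm p)\<^sup>2) * min 1 ((norm z)\<^sup>2))"
      by (intro integrable_mult_right integrable_min)
    show "AE z in \<nu>'. (\<lambda>n. levy_integrand (?s n *\<^sub>R p) z / complex_of_real ((?s n)\<^sup>2)) \<longlonglongrightarrow> 0"
    proof (rule AE_I2, rule tendsto_norm_zero_cancel)
      fix z
      have "(\<lambda>n. 2 * (1 / ?s n * (1 / ?s n)) + \<bar>p \<bullet> z\<bar> * (1 / ?s n)) \<longlonglongrightarrow> 2 * (0 * 0) + \<bar>p \<bullet> z\<bar> * 0"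
        by (intro tendsto_intros lim0)
      moreover have "2 * (0 * 0) + \<bar>p \<bullet> z\<bar> * 0 = (0::real)" by simp
      ultimately have u: "(\<lambda>n. 2 * (1 / ?s n * (1 / ?s n)) + \<bar>p \<bullet> z\<bar> * (1 / ?s n)) \<longlonglongrightarrow> 0" by metis
      show "(\<lambda>n. cmod (levy_integrand (?s n *\<^sub>R p) z / complex_of_real ((?s n)\<^sup>2))) \<longlonglongrightarrow> 0"
      proof (rule tendsto_sandwich[OF _ _ tendsto_const u])
        show "\<forall>\<^sub>F n in sequentially. cmod (levy_integrand (?s n *\<^sub>R p) z / complex_of_real ((?s n)\<^sup>2))
          \<le> 2 * (1 / ?s n * (1 / ?s n)) + \<bar>p \<bullet> z\<bar> * (1 / ?s n)"
        proof (intro always_eventually allI)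
          fix n
          show "cmod (levy_integrand (?s n *\<^sub>R p) z / complex_of_real ((?s n)\<^sup>2))
            \<le> 2 * (1 / ?s n * (1 / ?s n)) + \<bar>p \<bullet> z\<bar> * (1 / ?s n)"
            by (rule scaled_levy_integrand) simp
        qed
      qed (intro always_eventually allI norm_ge_zero)
    qed
    fix n
    show "AE z in \<nu>'. cmod (levy_integrand (?s n *\<^sub>R p) z / complex_of_real ((?s n)\<^sup>2)) \<le> (2 + (norm p)\<^sup>2) * min 1 ((norm z)\<^sup>2)"
    proof (rule AE_I2)
      fix z
      show "cmod (levy_integrand (?s n *\<^sub>R p) z / complex_of_real ((?s n)\<^sup>2)) \<le> (2 + (norm p)\<^sup>2) * min 1 ((norm z)\<^sup>2)"
        by (rule scaled_levy_integrand) simp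
    qed
  qed (auto intro!: measurable_\<nu>'I borel_measurable_divide measurable_levy_integrand)
  have "levy_symbol b Q \<nu> (?s n *\<^sub>R p) / complex_of_real ((?s n)\<^sup>2)
    = - \<i> * complex_of_real (b \<bullet> p) * complex_of_real (1 / ?s n) + complex_of_real (1/2 * (p \<bullet> (Q *v p)))
      + (\<integral>z. levy_integrand (?s n *\<^sub>R p) z / complex_of_real ((?s n)\<^sup>2) \<partial>\<nu>')" for n
  proof -
    have gen: "(- \<i> * (s * u) + s\<^sup>2 * q + I) / s\<^sup>2 = - \<i> * u * (1 / s) + q + I / s\<^sup>2" if "s \<noteq> 0" for s u q I :: complex
      using that by (simp add: field_simps power2_eq_square)
    have "levy_symbol b Q \<nu> (s *\<^sub>R p) / complex_of_real (s\<^sup>2)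
      = - \<i> * complex_of_real (b \<bullet> p) * complex_of_real (1 / s) + complex_of_real (1/2 * (p \<bullet> (Q *v p)))
        + (\<integral>z. levy_integrand (s *\<^sub>R p) z / complex_of_real (s\<^sup>2) \<partial>\<nu>')" if s: "s \<noteq> 0" for s :: real
    proof -
      have 1: "b \<bullet> (s *\<^sub>R p) = s * (b \<bullet> p)" by simp
      have 2: "1/2 * ((s *\<^sub>R p) \<bullet> (Q *v (s *\<^sub>R p))) = s\<^sup>2 * (1/2 * (p \<bullet> (Q *v p)))"
        by (simp add: matrix_vector_mult_scaleR power2_eq_square)
      show ?thesis
        unfolding levy_symbol_eq 1 2 of_real_mult of_real_power of_real_divide of_real_1 integral_divide_zero
        using s by (intro gen) simp
    qed
    from this[of "?s n"] show ?thesis by (simp only: of_nat_eq_0_iff nat.distinct simp_thms)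
  qed
  moreover have "(\<lambda>n. - \<i> * complex_of_real (b \<bullet> p) * complex_of_real (1 / ?s n) + complex_of_real (1/2 * (p \<bullet> (Q *v p)))
      + (\<integral>z. levy_integrand (?s n *\<^sub>R p) z / complex_of_real ((?s n)\<^sup>2) \<partial>\<nu>'))
    \<longlonglongrightarrow> - \<i> * complex_of_real (b \<bullet> p) * complex_of_real 0 + complex_of_real (1/2 * (p \<bullet> (Q *v p))) + (\<integral>z. 0 \<partial>\<nu>')"
    by (intro tendsto_add lim1 lim2 tendsto_const)
  ultimately show ?thesis by (simp del: of_nat_Suc of_real_of_nat_eq)
qed

text \<open>The Gaussian factor is the limit of the laws of \<open>n Z\<close> at time \<open>t / n\<^sup>2\<close>.\<close>
lemma bdd_gaussian:
  assumes t: "0 \<le> t"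
  shows "bdd (\<lambda>p. exp (- (complex_of_real t * complex_of_real (1/2 * (p \<bullet> (Q *v p)))))) 1"
proof (rule bdd_limit)
  fix n
  have "bdd (\<lambda>p. exp (- (complex_of_real (t / (real (Suc n))\<^sup>2) * levy_symbol b Q \<nu> p))) 1"
    using t by (intro bdd_levy) simp
  from bdd_comp[OF this, of "\<lambda>p. real (Suc n) *\<^sub>R p" "\<lambda>p. real (Suc n) *\<^sub>R p"]
  have "bdd (\<lambda>p. exp (- (complex_of_real (t / (real (Suc n))\<^sup>2) * levy_symbol b Q \<nu> (real (Suc n) *\<^sub>R p)))) 1"
    by simp
  then show "bdd (\<lambda>p. exp (- (complex_of_real t * (levy_symbol b Q \<nu> (real (Suc n) *\<^sub>R p) / complex_of_real ((real (Suc n))\<^sup>2))))) 1"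
    by simp
next
  fix p show "(\<lambda>n. exp (- (complex_of_real t * (levy_symbol b Q \<nu> (real (Suc n) *\<^sub>R p) / complex_of_real ((real (Suc n))\<^sup>2)))))
    \<longlonglongrightarrow> exp (- (complex_of_real t * complex_of_real (1/2 * (p \<bullet> (Q *v p)))))"
    by (intro tendsto_intros symbol_scaling_limit)
qed simp

definition \<nu>_cut :: "real \<Rightarrow> (real^'d) measure" where
  "\<nu>_cut d = density \<nu>' (indicator {z. d \<le> norm z})"

lemma finite_\<nu>_cut:
  assumes "0 < d"
  shows "finite_measure (\<nu>_cut d)"
proof (rule finite_measureI)
  have *: "indicator {z. d \<le> norm z} z \<le> ennreal (1 / min 1 (d\<^sup>2)) * ennreal (min 1 ((norm z)\<^sup>2))" for z :: "real^'d"
  proof (cases "d \<le> norm z")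
    case True
    then have "min 1 (d\<^sup>2) \<le> min 1 ((norm z)\<^sup>2)" using assms by (intro min.mono power_mono) auto
    moreover have "0 < min 1 (d\<^sup>2)" using assms by simp
    ultimately have "1 \<le> 1 / min 1 (d\<^sup>2) * min 1 ((norm z)\<^sup>2)" by (simp add: field_simps)
    then have "ennreal 1 \<le> ennreal (1 / min 1 (d\<^sup>2)) * ennreal (min 1 ((norm z)\<^sup>2))"
      using assms by (subst ennreal_mult[symmetric]) (auto intro!: ennreal_leI)
    with True show ?thesis by simp
  qed simp
  have "emeasure (\<nu>_cut d) (space (\<nu>_cut d)) = (\<integral>\<^sup>+z. indicator {z. d \<le> norm z} z \<partial>\<nu>')"
    unfolding \<nu>_cut_def by (subst emeasure_density) (auto intro: measurable_\<nu>'I)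
  also have "\<dots> \<le> (\<integral>\<^sup>+z. ennreal (1 / min 1 (d\<^sup>2)) * ennreal (min 1 ((norm z)\<^sup>2)) \<partial>\<nu>')"
    by (intro nn_integral_mono) (use * in auto)
  also have "\<dots> = ennreal (1 / min 1 (d\<^sup>2)) * (\<integral>\<^sup>+z. ennreal (min 1 ((norm z)\<^sup>2)) \<partial>\<nu>')"
    using borel_measurable_integrable[OF integrable_min] by (subst nn_integral_cmult) auto
  also have "\<dots> < \<infinity>"
    using integrable_min by (auto simp: nn_integral_eq_integral ennreal_mult_less_top)
  finally show "emeasure (\<nu>_cut d) (space (\<nu>_cut d)) \<noteq> \<infinity>" by simp
qed

text \<open>\<nu> minus \<open>N\<close> is again a Levy measure, so the remaining exponent should
  again belong to a probability law. Once the jumps smaller than \<open>e n < d\<close> are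
  discarded this is explicit: the factor is the product of a translation, the Gaussian factor and a
  compound Poisson factor with jump measure \<open>\<nu>_cut (e n) - N\<close>. The discarded jumps
  are restored in the limit.\<close>

lemma bdd_levy_minus:
  fixes N :: "(real^'d) measure"
  assumes sets: "sets N = sets borel" and d: "0 < d" and t: "0 \<le> t"
    and le: "\<And>A. A \<in> sets borel \<Longrightarrow> emeasure N A \<le> emeasure (\<nu>_cut d) A"
  shows "bdd (\<lambda>p. exp (- (complex_of_real t * (levy_symbol b Q \<nu> p - (\<integral>z. 1 - iexp (p \<bullet> z) \<partial>N))))) 1"
proof (rule bdd_limit_eventually)
  define e where "e n = 1 / real (Suc n)" for n
  have e: "e \<longlonglongrightarrow> 0" "\<And>n. 0 < e n" unfolding e_def using lim_1_over_n LIMSEQ_Suc by (blast, simp)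
  define c where "c n = indicat_real {z::real^'d. e n \<le> norm z}" for n
  have [measurable]: "c n \<in> borel_measurable borel" for n unfolding c_def by measurable
  define \<Phi> where "\<Phi> n p = - \<i> * complex_of_real (b \<bullet> p) + complex_of_real (1/2 * (p \<bullet> (Q *v p)))
      + (\<integral>z. c n z *\<^sub>R levy_integrand p z \<partial>\<nu>') - (\<integral>z. 1 - iexp (p \<bullet> z) \<partial>N)" for n p
  have fin_d: "finite_measure (\<nu>_cut d)" by (rule finite_\<nu>_cut[OF d])
  have "finite_measure N" by (rule bdd_measure_diff(2)[OF fin_d sets _ le]) (auto simp: \<nu>_cut_def)
  have spN: "space N = UNIV" using sets_eq_imp_space_eq[OF sets] by simp
  have [measurable]: "ball (0::real^'d) 1 \<in> sets borel" by simp
  have measN: "f \<in> borel_measurable borel \<Longrightarrow> f \<in> borel_measurable N" for f :: "real^'d \<Rightarrow> complex"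
    using measurable_cong_sets[OF sets refl] by auto
  show "\<forall>\<^sub>F n in sequentially. bdd (\<lambda>p. exp (- (complex_of_real t * \<Phi> n p))) 1"
    using order_tendstoD(2)[OF e(1) d]
  proof eventually_elim
    case (elim n)
    let ?N' = "\<nu>_cut (e n)"
    have fin: "finite_measure ?N'" by (rule finite_\<nu>_cut[OF e(2)])
    interpret N: finite_measure N by fact
    interpret N': finite_measure ?N' by fact
    have sp: "space ?N' = UNIV" by (simp add: \<nu>_cut_def)
    have setsN': "sets ?N' = sets borel" by (simp add: \<nu>_cut_def)
    have measN': "f \<in> borel_measurable borel \<Longrightarrow> f \<in> borel_measurable ?N'" for f :: "real^'d \<Rightarrow> 'q::topological_space"
      using measurable_cong_sets[OF setsN' refl] by auto
    have le': "emeasure N A \<le> emeasure ?N' A" if A: "A \<in> sets borel" for A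
    proof -
      have "emeasure (\<nu>_cut d) A \<le> emeasure ?N' A"
        unfolding \<nu>_cut_def using A elim
        by (subst (1 2) emeasure_density)
          (auto intro!: measurable_\<nu>'I nn_integral_mono split: split_indicator)
      with le[OF A] show ?thesis by simp
    qed
    define D where "D p = (\<integral>z. iexp (p \<bullet> z) \<partial>?N') - (\<integral>z. iexp (p \<bullet> z) \<partial>N)" for p
    define k where "k = measure ?N' UNIV - measure N UNIV"
    note diff = bdd_measure_diff[OF fin sets setsN' le']
    have D: "bdd D k" "0 \<le> k" using diff(1,3) unfolding D_def[abs_def] k_def by auto
    \<comment> \<open>The compensating drift of the truncated measure. It is finite, so the
      compensator can be moved into the translation.\<close>
    define a where "a = (\<integral>z. indicat_real (ball 0 1) z *\<^sub>R z \<partial>?N')"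
    have int_a: "integrable ?N' (\<lambda>z. indicat_real (ball 0 1) z *\<^sub>R z)"
      by (rule N'.integrable_const_bound[of _ 1]) (auto intro!: measN' split: split_indicator)
    have int_1: "integrable ?N' (\<lambda>z. iexp (p \<bullet> z))" "integrable N (\<lambda>z. iexp (p \<bullet> z))" for p
      by (auto intro!: N'.integrable_const_bound[of _ 1] N.integrable_const_bound[of _ 1] measN' measN)
    have \<Phi>_eq: "\<Phi> n p = - \<i> * complex_of_real (p \<bullet> (b - a)) + complex_of_real (1/2 * (p \<bullet> (Q *v p))) - (D p - complex_of_real k)" for p
    proof -
      have "(\<integral>z. c n z *\<^sub>R levy_integrand p z \<partial>\<nu>') = (\<integral>z. levy_integrand p z \<partial>?N')"
      proof -
        have "?N' = density \<nu>' (\<lambda>z. ennreal (c n z))" unfolding \<nu>_cut_def c_def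
          by (intro arg_cong[of _ _ "density \<nu>'"] ext) (auto split: split_indicator)
        then show ?thesis
          by (subst \<open>?N' = _\<close>, subst integral_density) (auto intro!: measurable_\<nu>'I AE_I2 measurable_levy_integrand simp: c_def)
      qed
      also have "\<dots> = (\<integral>z. (1 - iexp (p \<bullet> z)) + \<i> * complex_of_real (p \<bullet> (indicat_real (ball 0 1) z *\<^sub>R z)) \<partial>?N')"
        unfolding levy_integrand_def by (simp add: mult_ac)
      also have "\<dots> = (\<integral>z. 1 - iexp (p \<bullet> z) \<partial>?N') + \<i> * complex_of_real (p \<bullet> a)"
      proof -
        have i: "integrable ?N' (\<lambda>z. p \<bullet> (indicat_real (ball 0 1) z *\<^sub>R z))"
          using int_a by (rule integrable_inner_right)
        have e: "(\<integral>z. p \<bullet> (indicat_real (ball 0 1) z *\<^sub>R z) \<partial>?N') = p \<bullet> a"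
          unfolding a_def by (rule integral_inner_right) (rule int_a)
        have i': "integrable ?N' (\<lambda>z. \<i> * complex_of_real (p \<bullet> (indicat_real (ball 0 1) z *\<^sub>R z)))"
          by (intro integrable_mult_right integrable_of_real i)
        have d: "integrable ?N' (\<lambda>z. 1 - iexp (p \<bullet> z))"
          by (intro Bochner_Integration.integrable_diff int_1 N'.integrable_const)
        show ?thesis
          unfolding Bochner_Integration.integral_add[OF d i'] integral_mult_right_zero integral_complex_of_real e ..
      qed
      also have "(\<integral>z. 1 - iexp (p \<bullet> z) \<partial>?N') = complex_of_real (measure ?N' UNIV) - (\<integral>z. iexp (p \<bullet> z) \<partial>?N')"
        using int_1 by (simp add: sp scaleR_conv_of_real)
      finally have 1: "(\<integral>z. c n z *\<^sub>R levy_integrand p z \<partial>\<nu>') = complex_of_real (measure ?N' UNIV) - (\<integral>z. iexp (p \<bullet> z) \<partial>?N') + \<i> * complex_of_real (p \<bullet> a)" .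
      have 2: "(\<integral>z. 1 - iexp (p \<bullet> z) \<partial>N) = complex_of_real (measure N UNIV) - (\<integral>z. iexp (p \<bullet> z) \<partial>N)"
        using int_1 by (simp add: spN scaleR_conv_of_real)
      show ?thesis unfolding \<Phi>_def 1 2 D_def k_def
        by (simp add: inner_diff_right inner_commute algebra_simps)
    qed
    have "exp (- (complex_of_real t * \<Phi> n p)) = iexp (p \<bullet> (t *\<^sub>R (b - a)))
        * exp (- (complex_of_real t * complex_of_real (1/2 * (p \<bullet> (Q *v p))))) * exp (complex_of_real t * (D p - complex_of_real k))" for p
      unfolding \<Phi>_eq exp_add[symmetric] by (simp add: algebra_simps inner_diff_right)
    moreover have "bdd (\<lambda>p. iexp (p \<bullet> (t *\<^sub>R (b - a)))
        * exp (- (complex_of_real t * complex_of_real (1/2 * (p \<bullet> (Q *v p))))) * exp (complex_of_real t * (D p - complex_of_real k))) (1 * 1 * 1)"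
      by (intro bdd_mult bdd_shift bdd_gaussian bdd_exp_diff D t)
    ultimately show ?case by simp
  qed
  fix p
  have "(\<lambda>n. \<integral>z. c n z *\<^sub>R levy_integrand p z \<partial>\<nu>') \<longlonglongrightarrow> (\<integral>z. levy_integrand p z \<partial>\<nu>')"
  proof (rule integral_dominated_convergence)
    show "integrable \<nu>' (\<lambda>z. cmod (levy_integrand p z))" by (intro integrable_norm integrable_levy_integrand)
    show "AE z in \<nu>'. (\<lambda>n. c n z *\<^sub>R levy_integrand p z) \<longlonglongrightarrow> levy_integrand p z"
    proof (rule AE_I2)
      fix z :: "real^'d"
      show "(\<lambda>n. c n z *\<^sub>R levy_integrand p z) \<longlonglongrightarrow> levy_integrand p z"
      proof (cases "z = 0")
        case True
        then show ?thesis by (simp add: levy_integrand_def)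
      next
        case False
        then have "\<forall>\<^sub>F n in sequentially. c n z *\<^sub>R levy_integrand p z = levy_integrand p z"
          using order_tendstoD(2)[OF e(1), of "norm z"] by (auto simp: c_def elim!: eventually_mono)
        then show ?thesis by (rule tendsto_eventually)
      qed
    qed
    show "levy_integrand p \<in> borel_measurable \<nu>'" by (intro measurable_\<nu>'I measurable_levy_integrand)
    show "(\<lambda>z. c n z *\<^sub>R levy_integrand p z) \<in> borel_measurable \<nu>'" for n
      by (intro measurable_\<nu>'I) measurable
  qed (auto simp: c_def split: split_indicator)
  then show "(\<lambda>n. exp (- (complex_of_real t * \<Phi> n p)))
      \<longlonglongrightarrow> exp (- (complex_of_real t * (levy_symbol b Q \<nu> p - (\<integral>z. 1 - iexp (p \<bullet> z) \<partial>N))))"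
    unfolding \<Phi>_def levy_symbol_eq
    by (intro tendsto_exp tendsto_minus tendsto_mult tendsto_add tendsto_diff tendsto_const)
qed

end

section \<open>The matrix exponential\<close>

lemma mat_pow_scaleR: "mat_pow (s *\<^sub>R A) k = s ^ k *\<^sub>R mat_pow A k"
proof (induction k)
  case (Suc k)
  have "mat_pow (s *\<^sub>R A) (Suc k) = (s *\<^sub>R A) ** (s ^ k *\<^sub>R mat_pow A k)" by (simp add: Suc)
  also have "\<dots> = (s ^ k *\<^sub>R (s *\<^sub>R A)) ** mat_pow A k" by (rule matrix_scalar_ac)
  also have "s ^ k *\<^sub>R (s *\<^sub>R A) = s ^ Suc k *\<^sub>R A" by simp
  also have "(s ^ Suc k *\<^sub>R A) ** mat_pow A k = s ^ Suc k *\<^sub>R (A ** mat_pow A k)"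
    by (rule scalar_matrix_assoc[symmetric])
  finally show ?case by simp
qed simp

lemma mat_pow_Suc_vec: "mat_pow A (Suc k) *v x = A *v (mat_pow A k *v x)"
  by (simp add: matrix_vector_mul_assoc)

lemma mat_pow_commute: "mat_pow A k *v (A *v x) = A *v (mat_pow A k *v x)"
  by (induction k) (simp_all add: matrix_vector_mul_assoc[symmetric])

lemma mat_pow_add_vec: "mat_pow A (j + k) *v x = mat_pow A j *v (mat_pow A k *v x)"
  by (induction j) (simp_all add: matrix_vector_mul_assoc[symmetric])

lemma norm_mat_pow_vec: "norm (mat_pow A k *v x) \<le> onorm ((*v) A) ^ k * norm (x :: real^'n)"
proof (induction k)
  case (Suc k)
  have "norm (A *v (mat_pow A k *v x)) \<le> onorm ((*v) A) * norm (mat_pow A k *v x)"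
    by (rule onorm) simp
  also have "\<dots> \<le> onorm ((*v) A) * (onorm ((*v) A) ^ k * norm x)"
    by (intro mult_left_mono Suc onorm_pos_le) simp
  finally show ?case by (simp add: mat_pow_Suc_vec mult_ac del: mat_pow.simps)
qed simp

text \<open>Passes from the operator norm to the Euclidean norm of the entries, in which the series
  of \<open>mat_exp\<close> has to converge.\<close>

lemma norm_mat_pow: "norm (mat_pow A k) \<le> real (CARD('n) * CARD('n)) * onorm ((*v) A) ^ k" for A :: "real^'n^'n"
proof -
  have c: "\<bar>mat_pow A k $ i $ j\<bar> \<le> onorm ((*v) A) ^ k" for i j
  proof -
    have "mat_pow A k $ i $ j = (mat_pow A k *v axis j 1) $ i"
      by (simp add: matrix_vector_mult_basis column_def)
    then have "\<bar>mat_pow A k $ i $ j\<bar> \<le> norm (mat_pow A k *v axis j 1)"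
      by (metis component_le_norm_cart)
    also have "\<dots> \<le> onorm ((*v) A) ^ k" using norm_mat_pow_vec[of A k "axis j 1"] by simp
    finally show ?thesis .
  qed
  have "norm (mat_pow A k) \<le> (\<Sum>i\<in>UNIV. norm (mat_pow A k $ i))"
    by (simp add: norm_vec_def L2_set_le_sum)
  also have "\<dots> \<le> (\<Sum>i\<in>UNIV. \<Sum>j\<in>UNIV. \<bar>mat_pow A k $ i $ j\<bar>)"
    by (intro sum_mono norm_le_l1_cart)
  also have "\<dots> \<le> (\<Sum>i\<in>(UNIV::'n set). \<Sum>j\<in>(UNIV::'n set). onorm ((*v) A) ^ k)"
    by (intro sum_mono c)
  finally show ?thesis by simp
qed

definition mexp :: "real^'n^'n \<Rightarrow> real \<Rightarrow> real^'n \<Rightarrow> real^'n" where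
  "mexp A s x = mat_exp (s *\<^sub>R A) *v x"

lemma linear_mexp: "linear (mexp A s)"
  unfolding mexp_def[abs_def] by simp

lemma mexp_sums:
  fixes A :: "real^'n^'n"
  shows "(\<lambda>k. (s ^ k / fact k) *\<^sub>R (mat_pow A k *v x)) sums mexp A s x"
proof -
  have "summable (\<lambda>k. (1 / fact k) *\<^sub>R mat_pow (s *\<^sub>R A) k)"
  proof (rule summable_comparison_test')
    let ?K = "onorm ((*v) (s *\<^sub>R A))"
    have "summable (\<lambda>k. real (CARD('n) * CARD('n)) * (inverse (fact k) * ?K ^ k))"
      by (intro summable_mult summable_exp)
    then show "summable (\<lambda>k. real (CARD('n) * CARD('n)) * ?K ^ k / fact k)"
      by (simp add: field_simps)
    fix k
    show "norm ((1 / fact k) *\<^sub>R mat_pow (s *\<^sub>R A) k) \<le> real (CARD('n) * CARD('n)) * ?K ^ k / fact k"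
      using norm_mat_pow[of "s *\<^sub>R A" k] by (simp add: divide_right_mono)
  qed
  then have "(\<lambda>k. (1 / fact k) *\<^sub>R mat_pow (s *\<^sub>R A) k) sums mat_exp (s *\<^sub>R A)"
    unfolding mat_exp_def by (rule summable_sums)
  moreover have "bounded_linear (\<lambda>M :: real^'n^'n. M *v x)"
    by (intro linear_conv_bounded_linear[THEN iffD1] linearI)
      (simp_all add: matrix_vector_mult_add_rdistrib scaleR_matrix_vector_assoc)
  ultimately have "(\<lambda>k. ((1 / fact k) *\<^sub>R mat_pow (s *\<^sub>R A) k) *v x) sums mexp A s x"
    unfolding mexp_def using bounded_linear.sums by blast
  then show ?thesis
    by (simp add: mat_pow_scaleR scaleR_matrix_vector_assoc[symmetric])
qed

lemma mexp_0 [simp]: "mexp A 0 x = x"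
proof -
  have "(\<lambda>k. (0 ^ k / fact k) *\<^sub>R (mat_pow A k *v x)) sums (\<Sum>k\<in>{0}. (0 ^ k / fact k) *\<^sub>R (mat_pow A k *v x))"
    by (rule sums_finite) auto
  then show ?thesis using mexp_sums[of 0 A x] sums_unique2 by force
qed

lemma mexp_commute: "mexp A s (A *v x) = A *v mexp A s x"
proof -
  have "(\<lambda>k. A *v ((s ^ k / fact k) *\<^sub>R (mat_pow A k *v x))) sums (A *v mexp A s x)"
    by (rule bounded_linear.sums[OF matrix_vector_mul_bounded_linear mexp_sums])
  then have "(\<lambda>k. (s ^ k / fact k) *\<^sub>R (mat_pow A k *v (A *v x))) sums (A *v mexp A s x)"
    by (simp add: mat_pow_commute matrix_vector_mult_scaleR)
  with mexp_sums show ?thesis by (rule sums_unique2)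
qed

lemma inner_mexp_deriv: "((\<lambda>s. y \<bullet> mexp A s x) has_field_derivative y \<bullet> (A *v mexp A s x)) (at s)"
proof -
  define c where "c k = (y \<bullet> (mat_pow A k *v x)) / fact k" for k
  have sums: "(\<lambda>k. (y \<bullet> (mat_pow A k *v x)) / fact k * r ^ k) sums (y \<bullet> mexp A r x)" for r x
    using bounded_linear.sums[OF bounded_linear_inner_right mexp_sums, of y r A x]
    by (simp add: field_simps)
  have "((\<lambda>x. \<Sum>n. c n * x^n) has_field_derivative (\<Sum>n. diffs c n * s^n)) (at s)"
    by (rule termdiffs_strong_converges_everywhere) (use sums in \<open>auto simp: c_def sums_iff\<close>)
  moreover have "(\<Sum>n. c n * r^n) = y \<bullet> mexp A r x" for r
    using sums by (simp add: c_def sums_iff)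
  moreover have "diffs c n = (y \<bullet> (mat_pow A n *v (A *v x))) / fact n" for n
    unfolding diffs_def c_def mat_pow_Suc_vec mat_pow_commute by (simp add: fact_Suc del: of_nat_Suc)
  moreover have "(\<Sum>n. (y \<bullet> (mat_pow A n *v (A *v x))) / fact n * s ^ n) = y \<bullet> mexp A s (A *v x)"
    using sums[of "A *v x" s] by (simp add: sums_iff)
  ultimately show ?thesis by (simp add: mexp_commute)
qed

text \<open>The function \<open>r \<mapsto> y \<bullet> mexp A r (mexp A (c - r) x)\<close> has
  derivative 0, because \<open>A\<close> commutes with its exponential; the claim compares its
  values at 0 and \<open>s\<close>.\<close>

lemma mexp_add:
  fixes A :: "real^'n^'n"
  shows "mexp A (s + t) x = mexp A s (mexp A t x)"
proof (rule euclidean_eqI)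
  fix y :: "real^'n"
  define c where "c = s + t"
  \<comment> \<open>Expanding in a basis writes the composition as a sum of products of two scalar
    functions of \<open>r\<close>, so that the product rule on the line is enough.\<close>
  have expand: "y \<bullet> mexp A r w = (\<Sum>e\<in>Basis. (y \<bullet> mexp A r e) * (e \<bullet> w))" for r w
  proof -
    have "mexp A r w = mexp A r (\<Sum>e\<in>Basis. (w \<bullet> e) *\<^sub>R e)" by (simp only: euclidean_representation)
    also have "\<dots> = (\<Sum>e\<in>Basis. (w \<bullet> e) *\<^sub>R mexp A r e)"
      by (simp only: linear_sum[OF linear_mexp] linear_scale[OF linear_mexp])
    finally show ?thesis by (simp add: inner_sum_right inner_commute mult_ac)
  qed
  define g where "g r = y \<bullet> mexp A r (mexp A (c - r) x)" for r
  have "(g has_field_derivative 0) (at r)" for r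
  proof -
    have c: "((\<lambda>r. c - r) has_field_derivative -1) (at r)" by (auto intro!: derivative_eq_intros)
    have d: "((\<lambda>r. e \<bullet> mexp A (c - r) x) has_field_derivative - (e \<bullet> (A *v mexp A (c - r) x))) (at r)" for e :: "real^'n"
      using DERIV_chain2[where f = "\<lambda>s. e \<bullet> mexp A s x" and g = "\<lambda>r. c - r" and x = r and s = UNIV and Db = "-1",
          OF inner_mexp_deriv c]
      by simp
    have "((\<lambda>r. \<Sum>e\<in>Basis. (y \<bullet> mexp A r e) * (e \<bullet> mexp A (c - r) x)) has_field_derivative
      (\<Sum>e\<in>Basis. (y \<bullet> (A *v mexp A r e)) * (e \<bullet> mexp A (c - r) x) + - (e \<bullet> (A *v mexp A (c - r) x)) * (y \<bullet> mexp A r e))) (at r)"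
      by (intro DERIV_sum DERIV_mult inner_mexp_deriv d)
    moreover have "(\<Sum>e\<in>Basis. (y \<bullet> (A *v mexp A r e)) * (e \<bullet> mexp A (c - r) x) + - (e \<bullet> (A *v mexp A (c - r) x)) * (y \<bullet> mexp A r e)) = 0"
    proof -
      have 1: "(\<Sum>e\<in>Basis. (y \<bullet> (A *v mexp A r e)) * (e \<bullet> w)) = y \<bullet> (A *v mexp A r w)" for w
      proof -
        have "y \<bullet> (A *v mexp A r w) = (transpose A *v y) \<bullet> mexp A r w"
          by (simp add: dot_lmul_matrix[symmetric] transpose_matrix_vector)
        also have "\<dots> = (\<Sum>e\<in>Basis. ((transpose A *v y) \<bullet> mexp A r e) * (e \<bullet> w))"
        proof -
          have "mexp A r w = mexp A r (\<Sum>e\<in>Basis. (w \<bullet> e) *\<^sub>R e)" by (simp only: euclidean_representation)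
          also have "\<dots> = (\<Sum>e\<in>Basis. (w \<bullet> e) *\<^sub>R mexp A r e)"
            by (simp only: linear_sum[OF linear_mexp] linear_scale[OF linear_mexp])
          finally show ?thesis by (simp add: inner_sum_right inner_commute mult_ac)
        qed
        also have "\<dots> = (\<Sum>e\<in>Basis. (y \<bullet> (A *v mexp A r e)) * (e \<bullet> w))"
          by (simp add: dot_lmul_matrix[symmetric] transpose_matrix_vector)
        finally show ?thesis by simp
      qed
      have 2: "(\<Sum>e\<in>Basis. (e \<bullet> (A *v w)) * (y \<bullet> mexp A r e)) = y \<bullet> mexp A r (A *v w)" for w
        using expand[of r "A *v w"] by (simp add: mult.commute)
      show ?thesis using 1[of "mexp A (c - r) x"] 2[of "mexp A (c - r) x"]
        by (simp add: sum.distrib sum_negf mexp_commute sum_subtractf)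
    qed
    ultimately show ?thesis unfolding g_def[abs_def] by (simp flip: expand)
  qed
  then have "g 0 = g s" by (rule DERIV_isconst_all[OF allI])
  then show "mexp A (s + t) x \<bullet> y = mexp A s (mexp A t x) \<bullet> y"
    by (simp add: g_def c_def inner_commute)
qed

lemma mexp_tail:
  fixes A :: "real^'n^'n"
  obtains C where "0 \<le> C" "\<And>s x m. \<bar>s\<bar> \<le> 1 \<Longrightarrow>
    norm (mexp A s x - (\<Sum>k<m. (s ^ k / fact k) *\<^sub>R (mat_pow A k *v x))) \<le> C * \<bar>s\<bar> ^ m * norm x"
proof
  define K where "K = onorm ((*v) A)"
  have K: "0 \<le> K" unfolding K_def by (rule onorm_pos_le) simp
  show "0 \<le> exp K" by simp
  fix s x m assume s: "\<bar>s\<bar> \<le> (1::real)"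
  define f where "f k = (s ^ k / fact k) *\<^sub>R (mat_pow A k *v x)" for k
  have f_le: "norm (f (k + m)) \<le> \<bar>s\<bar> ^ m * norm x * (K ^ (k + m) / fact (k + m))" for k
  proof -
    have "norm (f (k + m)) \<le> \<bar>s\<bar> ^ (k + m) / fact (k + m) * (K ^ (k + m) * norm x)"
      using norm_mat_pow_vec[of A "k + m" x] by (simp add: f_def K_def power_abs divide_right_mono mult_left_mono)
    also have "\<dots> \<le> \<bar>s\<bar> ^ m / fact (k + m) * (K ^ (k + m) * norm x)"
      using K s by (intro mult_right_mono divide_right_mono power_decreasing) auto
    finally show ?thesis by (simp add: field_simps)
  qed
  have sumK: "(\<lambda>k. K ^ k / fact k) sums exp K" using exp_converges[of K] by (simp add: field_simps)
  have sK: "summable (\<lambda>k. K ^ (k + m) / fact (k + m))"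
    using sumK summable_iff_shift[of "\<lambda>k. K ^ k / fact k" m] by (auto simp: sums_iff)
  have sf: "summable (\<lambda>k. norm (f (k + m)))"
    by (rule summable_comparison_test'[OF summable_mult[OF sK, of "\<bar>s\<bar> ^ m * norm x"]]) (use f_le in auto)
  have "mexp A s x - (\<Sum>k<m. f k) = (\<Sum>k. f (k + m))"
    using sums_split_initial_segment[OF mexp_sums[of s A x], of m] by (simp add: sums_iff f_def)
  then have "norm (mexp A s x - (\<Sum>k<m. f k)) \<le> (\<Sum>k. norm (f (k + m)))"
    using summable_norm[OF sf] by simp
  also have "\<dots> \<le> (\<Sum>k. \<bar>s\<bar> ^ m * norm x * (K ^ (k + m) / fact (k + m)))"
    by (intro suminf_le f_le sf summable_mult sK)
  also have "\<dots> = \<bar>s\<bar> ^ m * norm x * (\<Sum>k. K ^ (k + m) / fact (k + m))"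
    by (rule suminf_mult[OF sK])
  also have "\<dots> \<le> \<bar>s\<bar> ^ m * norm x * exp K"
  proof (intro mult_left_mono)
    have "(\<Sum>k. K ^ k / fact k) = (\<Sum>k. K ^ (k + m) / fact (k + m)) + (\<Sum>k<m. K ^ k / fact k)"
      using sumK by (intro suminf_split_initial_segment) (auto simp: sums_iff)
    moreover have "0 \<le> (\<Sum>k<m. K ^ k / fact k)" using K by (intro sum_nonneg) auto
    ultimately show "(\<Sum>k. K ^ (k + m) / fact (k + m)) \<le> exp K" using sumK by (simp add: sums_iff)
  qed auto
  finally show "norm (mexp A s x - (\<Sum>k<m. (s ^ k / fact k) *\<^sub>R (mat_pow A k *v x))) \<le> exp K * \<bar>s\<bar> ^ m * norm x"
    by (simp add: f_def mult_ac)
qed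

section \<open>The Kalman decomposition\<close>

lemma subspace_V_space: "subspace (V_space A B h)"
proof (rule subspaceI)
  show "0 \<in> V_space A B h" unfolding V_space_def by (auto intro!: exI[of _ "\<lambda>_. 0"])
  fix x y assume "x \<in> V_space A B h" "y \<in> V_space A B h"
  then obtain u w where "x = (\<Sum>k<h. (mat_pow A k ** B) *v u k)" "y = (\<Sum>k<h. (mat_pow A k ** B) *v w k)"
    unfolding V_space_def by blast
  then have "x + y = (\<Sum>k<h. (mat_pow A k ** B) *v (u k + w k))"
    by (simp add: matrix_vector_right_distrib sum.distrib)
  then show "x + y \<in> V_space A B h" unfolding V_space_def by (auto intro!: exI[of _ "\<lambda>k. u k + w k"])
next
  fix c x assume "x \<in> V_space A B h"
  then obtain u where "x = (\<Sum>k<h. (mat_pow A k ** B) *v u k)" unfolding V_space_def by blast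
  then have "c *\<^sub>R x = (\<Sum>k<h. (mat_pow A k ** B) *v (c *\<^sub>R u k))"
    by (simp add: matrix_vector_mult_scaleR scaleR_sum_right)
  then show "c *\<^sub>R x \<in> V_space A B h" unfolding V_space_def by (auto intro!: exI[of _ "\<lambda>k. c *\<^sub>R u k"])
qed

lemma mat_pow_in_V_space:
  assumes "k < h"
  shows "mat_pow A k *v (B *v u) \<in> V_space A B h"
proof -
  have "mat_pow A k *v (B *v u) = (\<Sum>j<h. (mat_pow A j ** B) *v (if j = k then u else 0))"
    using assms by (simp add: matrix_vector_mul_assoc if_distrib[of "\<lambda>u. _ *v u"] cong: if_cong)
  then show ?thesis unfolding V_space_def by (auto intro!: exI[of _ "\<lambda>j. if j = k then u else 0"])
qed

lemma V_space_mono: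
  assumes "h \<le> h'"
  shows "V_space A B h \<subseteq> V_space A B h'"
proof
  fix x assume "x \<in> V_space A B h"
  then obtain u where "x = (\<Sum>k<h. mat_pow A k *v (B *v u k))" unfolding V_space_def by (auto simp: matrix_vector_mul_assoc)
  then show "x \<in> V_space A B h'"
    using assms by (auto intro!: subspace_sum[OF subspace_V_space] mat_pow_in_V_space)
qed

lemma mat_pow_V_space:
  assumes "x \<in> V_space A B h"
  shows "mat_pow A k *v x \<in> V_space A B (h + k)"
proof -
  obtain u where "x = (\<Sum>j<h. mat_pow A j *v (B *v u j))"
    using assms unfolding V_space_def by (auto simp: matrix_vector_mul_assoc)
  then have "mat_pow A k *v x = (\<Sum>j<h. mat_pow A (k + j) *v (B *v u j))"
    by (simp add: linear_sum[OF matrix_vector_mul_linear] mat_pow_add_vec)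
  then show ?thesis
    by (auto intro!: subspace_sum[OF subspace_V_space] mat_pow_in_V_space)
qed

lemma span_kalman: "span (\<Union>k<r. columns (mat_pow A k ** B)) = V_space A B r"
proof (rule antisym)
  show "span (\<Union>k<r. columns (mat_pow A k ** B)) \<subseteq> V_space A B r"
  proof (rule span_minimal[OF _ subspace_V_space], safe)
    fix x k assume "k < r" "x \<in> columns (mat_pow A k ** B)"
    then obtain j where "x = column j (mat_pow A k ** B)" by (auto simp: columns_def)
    then have "x = (mat_pow A k ** B) *v axis j 1" by (simp only: matrix_vector_mult_basis)
    then have "x = mat_pow A k *v (B *v axis j 1)" by (simp only: matrix_vector_mul_assoc)
    then show "x \<in> V_space A B r" using \<open>k < r\<close> by (simp add: mat_pow_in_V_space)
  qed
  show "V_space A B r \<subseteq> span (\<Union>k<r. columns (mat_pow A k ** B))"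
  proof
    fix x assume "x \<in> V_space A B r"
    then obtain u where x: "x = (\<Sum>k<r. (mat_pow A k ** B) *v u k)" unfolding V_space_def by blast
    have "(mat_pow A k ** B) *v u k \<in> span (\<Union>k<r. columns (mat_pow A k ** B))" if "k < r" for k
      using matrix_vector_mult_in_columnspace[of "mat_pow A k ** B" "u k"] that
      by (meson UN_upper lessThan_iff span_mono subsetD)
    then show "x \<in> span (\<Union>k<r. columns (mat_pow A k ** B))" unfolding x by (intro span_sum) auto
  qed
qed

locale kalman =
  fixes A :: "real^'n^'n" and B :: "real^'d^'n" and S :: "nat \<Rightarrow> (real^'n) set"
  assumes K: "kalman_rank A B CARD('n) = CARD('n)"
    and bases: "\<And>h. h \<in> {1..kalman_index A B} \<Longrightarrow> orthonormal_basis_of (S h) (E_space A B h)"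
begin

abbreviation "nn \<equiv> kalman_index A B"
abbreviation "E \<equiv> E_space A B"
abbreviation "V \<equiv> V_space A B"

lemma V_nn: "V nn = UNIV"
proof -
  have "kalman_rank A B nn = CARD('n)" unfolding kalman_index_def by (rule LeastI[of _ "CARD('n)"]) (rule K)
  then have "dim (\<Union>k<nn. columns (mat_pow A k ** B)) = DIM(real^'n)" by (simp add: kalman_rank_def)
  then have "span (\<Union>k<nn. columns (mat_pow A k ** B)) = UNIV" using dim_eq_full by blast
  then show ?thesis by (simp only: span_kalman)
qed

lemma nn_pos: "1 \<le> nn"
proof (rule ccontr)
  assume "\<not> 1 \<le> nn"
  then have "nn = 0" by simp
  then have "V nn = {0}" by (simp add: V_space_def)
  with V_nn have "(axis undefined 1 :: real^'n) = 0" by blast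
  then show False by simp
qed

lemma S_basis:
  assumes "h \<in> {1..nn}"
  shows "pairwise orthogonal (S h)" "\<And>u. u \<in> S h \<Longrightarrow> norm u = 1" "span (S h) = E h" "finite (S h)"
proof -
  show 1: "pairwise orthogonal (S h)" and 2: "\<And>u. u \<in> S h \<Longrightarrow> norm u = 1" and "span (S h) = E h"
    using bases[OF assms] by (auto simp: orthonormal_basis_of_def)
  have "0 \<notin> S h" using 2 by force
  with 1 have "independent (S h)" by (rule pairwise_orthogonal_independent)
  then show "finite (S h)" by (rule independent_imp_finite)
qed

lemma E_subset_V: "E h \<subseteq> V h"
  by (auto simp: E_space_def)

section \<open>Projections and dilations adapted to the Kalman decomposition\<close>

definition pr :: "nat \<Rightarrow> real^'n \<Rightarrow> real^'n" where
  "pr h x = (\<Sum>e\<in>S h. (x \<bullet> e) *\<^sub>R e)"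

lemma linear_pr: "linear (pr h)"
  by (rule linearI) (simp_all add: pr_def inner_add_left scaleR_add_left sum.distrib scaleR_sum_right)

lemmas pr_add = linear_add[OF linear_pr] and pr_diff = linear_diff[OF linear_pr]
  and pr_scaleR = linear_scale[OF linear_pr] and pr_0 [simp] = linear_0[OF linear_pr] and pr_sum = linear_sum[OF linear_pr]

lemma pr_adjoint: "pr h x \<bullet> y = x \<bullet> pr h y"
  by (simp add: pr_def inner_sum_left inner_sum_right inner_commute mult.commute)

lemma pr_in_E: "h \<in> {1..nn} \<Longrightarrow> pr h x \<in> E h"
  unfolding pr_def by (subst S_basis(3)[symmetric]) (auto intro: span_sum span_scale span_base)

lemma pr_E: "h \<in> {1..nn} \<Longrightarrow> x \<in> E h \<Longrightarrow> pr h x = x"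
  unfolding pr_def by (rule orthonormal_basis_expand) (simp_all add: S_basis)

lemma pr_V_zero:
  assumes "h \<in> {1..nn}" "j < h" "x \<in> V j"
  shows "pr h x = 0"
proof -
  have "x \<bullet> e = 0" if "e \<in> S h" for e
  proof (cases "h = 1")
    case True
    then show ?thesis using assms by (simp add: V_space_def)
  next
    case False
    have "e \<in> E h" using that S_basis(3)[OF assms(1)] span_base by blast
    then have "e \<in> orthogonal_comp (V (h - 1))" using False by (simp add: E_space_def)
    moreover have "j \<le> h - 1" using assms by simp
    then have "x \<in> V (h - 1)" using V_space_mono assms(3) by blast
    ultimately show ?thesis by (auto simp: orthogonal_comp_def orthogonal_def)
  qed
  then show ?thesis by (simp add: pr_def)
qed

text \<open>For one order of the indices this is \<open>pr_V_zero\<close>; the other order follows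
  because the projections are self-adjoint.\<close>

lemma pr_E_other:
  assumes "h \<in> {1..nn}" "j \<in> {1..nn}" "h \<noteq> j" "x \<in> E j"
  shows "pr h x = 0"
proof (cases "j < h")
  case True
  then show ?thesis using pr_V_zero assms E_subset_V by blast
next
  case False
  then have "h < j" using assms by simp
  have "pr h x \<bullet> pr h x = x \<bullet> pr h (pr h x)" by (rule pr_adjoint)
  also have "\<dots> = x \<bullet> pr h x" using assms by (simp add: pr_E pr_in_E)
  also have "\<dots> = x \<bullet> pr j (pr h x)" using pr_E[OF assms(2,4)] pr_adjoint by metis
  also have "pr j (pr h x) = 0"
    using pr_V_zero[OF assms(2) \<open>h < j\<close>] pr_in_E[OF assms(1)] E_subset_V by blast
  finally show ?thesis by simp
qed

text \<open>\<open>V (Suc h)\<close> is the orthogonal sum of \<open>V h\<close> and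
  \<open>E (Suc h)\<close>; the induction adds one summand at a time.\<close>

lemma sum_pr_aux: "h \<le> nn \<Longrightarrow> x \<in> V h \<Longrightarrow> (\<Sum>i=1..h. pr i x) = x"
proof (induction h arbitrary: x)
  case 0
  then show ?case by (simp add: V_space_def)
next
  case (Suc h)
  show ?case
  proof (cases "h = 0")
    case True
    then have "x \<in> E 1" using Suc by (simp add: E_space_def)
    then show ?thesis using True pr_E[of 1] nn_pos by simp
  next
    case False
    obtain y z where yz: "y \<in> span (V h)" "\<And>w. w \<in> span (V h) \<Longrightarrow> orthogonal z w" "x = y + z"
      by (rule orthogonal_subspace_decomp_exists[of "V h" x]) blast
    have sp: "span (V h) = V h" by (rule span_eq_iff[THEN iffD2, OF subspace_V_space])
    have "y \<in> V (Suc h)" using yz(1) V_space_mono[of h "Suc h"] sp by auto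
    then have "z \<in> V (Suc h)" using Suc.prems yz(3) subspace_diff[OF subspace_V_space, of x A B "Suc h" y] by simp
    then have zE: "z \<in> E (Suc h)"
      using yz(2) False by (auto simp: E_space_def orthogonal_comp_def sp orthogonal_commute)
    have "pr (Suc h) y = 0" using yz(1) Suc.prems sp by (intro pr_V_zero[of _ h]) auto
    moreover have "pr (Suc h) z = z" using zE Suc.prems by (intro pr_E) auto
    moreover have "(\<Sum>i=1..h. pr i y) = y" using Suc yz(1) sp by auto
    moreover have "pr i z = 0" if "i \<in> {1..h}" for i
      using that Suc.prems zE by (intro pr_E_other[of i "Suc h"]) auto
    ultimately show ?thesis by (simp add: yz(3) pr_add sum.distrib)
  qed
qed

lemma sum_pr: "(\<Sum>h=1..nn. pr h x) = x"
  by (rule sum_pr_aux) (simp_all add: V_nn)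

lemma norm_pr_le:
  assumes "h \<in> {1..nn}"
  shows "norm (pr h x) \<le> norm x"
proof -
  have "norm (pr h x) * norm (pr h x) = x \<bullet> pr h x"
    using pr_adjoint[of h x "pr h x"] pr_E[OF assms pr_in_E[OF assms]] by (simp add: power2_norm_eq_inner flip: power2_eq_square)
  also have "\<dots> \<le> norm x * norm (pr h x)" by (rule norm_cauchy_schwarz)
  finally show ?thesis by (cases "pr h x = 0") auto
qed

lemma norm_le_sum_pr: "norm x \<le> (\<Sum>h=1..nn. norm (pr h x))"
  using norm_sum[of "\<lambda>h. pr h x" "{1..nn}"] by (simp only: sum_pr)

definition dil :: "(nat \<Rightarrow> real) \<Rightarrow> real^'n \<Rightarrow> real^'n" where
  "dil a x = (\<Sum>h=1..nn. a h *\<^sub>R pr h x)"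

lemma linear_dil: "linear (dil a)"
  by (rule linearI) (simp_all add: dil_def pr_add pr_scaleR scaleR_add_right sum.distrib scaleR_sum_right mult.commute)

lemma dil_adjoint: "dil a x \<bullet> y = x \<bullet> dil a y"
  by (simp add: dil_def inner_sum_left inner_sum_right pr_adjoint)

lemma pr_dil: "h \<in> {1..nn} \<Longrightarrow> pr h (dil a x) = a h *\<^sub>R pr h x"
proof -
  assume h: "h \<in> {1..nn}"
  have "pr h (dil a x) = (\<Sum>j=1..nn. a j *\<^sub>R pr h (pr j x))" by (simp add: dil_def pr_sum pr_scaleR)
  also have "\<dots> = (\<Sum>j=1..nn. if j = h then a h *\<^sub>R pr h x else 0)"
    using h by (intro sum.cong) (auto simp: pr_E pr_in_E pr_E_other[OF h _ _ pr_in_E])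
  also have "\<dots> = a h *\<^sub>R pr h x" using h by simp
  finally show ?thesis .
qed

lemma dil_dil: "dil a (dil b x) = dil (\<lambda>h. a h * b h) x"
  unfolding dil_def[of a "dil b x"] dil_def[of "\<lambda>h. a h * b h"] by (intro sum.cong) (auto simp: pr_dil)

lemma dil_id: "(\<And>h. h \<in> {1..nn} \<Longrightarrow> a h = 1) \<Longrightarrow> dil a x = x"
  unfolding dil_def by (subst (2) sum_pr[symmetric]) (rule sum.cong, auto)

lemma dil_E:
  assumes "h \<in> {1..nn}" "x \<in> E h"
  shows "dil a x = a h *\<^sub>R x"
proof -
  have "dil a x = (\<Sum>j=1..nn. if j = h then a h *\<^sub>R x else 0)"
    unfolding dil_def using assms by (intro sum.cong) (auto simp: pr_E pr_E_other[OF _ assms(1) _ assms(2)])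
  then show ?thesis using assms by simp
qed

end

section \<open>Uniform nondegeneracy of the jump directions\<close>

lemma riemann_sum_tendsto:
  fixes f :: "real \<Rightarrow> real"
  assumes f: "continuous_on {0..1} f"
  shows "(\<lambda>m. (\<Sum>i<m. f (real i / real m)) / real m) \<longlonglongrightarrow> integral {0..1} f"
proof (rule LIMSEQ_I)
  fix e :: real assume e: "0 < e"
  have "uniformly_continuous_on {0..1} f" by (rule compact_uniformly_continuous[OF f]) simp
  then obtain d where d: "0 < d" "\<And>x y. x \<in> {0..1} \<Longrightarrow> y \<in> {0..1} \<Longrightarrow> dist x y < d \<Longrightarrow> dist (f x) (f y) < e / 2"
    unfolding uniformly_continuous_on_def using e by (metis half_gt_zero)
  define F where "F x = integral {0..x} f" for x
  obtain m0 :: nat where m0: "1 / d < m0" using reals_Archimedean2 by blast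
  have "norm ((\<Sum>i<m. f (real i / real m)) / real m - integral {0..1} f) < e" if m: "m0 \<le> m" for m :: nat
  proof -
    have mpos: "0 < real m" using m m0 d(1) by (smt (verit) divide_pos_pos of_nat_le_iff)
    have md: "1 / real m < d" using m m0 d(1) mpos by (smt (verit) divide_less_eq mult.commute of_nat_le_iff)
    have step: "\<bar>f (real i / real m) / real m - (F (real (Suc i) / m) - F (real i / real m))\<bar> \<le> e / 2 / m" if "i < m" for i
    proof -
      let ?a = "real i / m" and ?b = "real (Suc i) / m"
      have ab: "?a \<le> ?b" "0 \<le> ?a" "?b \<le> 1" using that mpos by (auto simp: field_simps)
      have "\<exists>x\<in>{?a..?b}. F ?b - F ?a = (\<lambda>h. h * f x) (?b - ?a)"
      proof (rule mvt_very_simple[OF ab(1)])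
        fix x assume x: "?a \<le> x" "x \<le> ?b"
        have "(F has_real_derivative f x) (at x within {0..1})"
          unfolding F_def
          by (rule integral_has_real_derivative[OF f])
            (simp only: atLeastAtMost_iff, intro conjI order_trans[OF ab(2) x(1)] order_trans[OF x(2) ab(3)])
        then have "(F has_real_derivative f x) (at x within {?a..?b})"
          by (rule DERIV_subset) (use ab in auto)
        then show "(F has_derivative (\<lambda>h. h * f x)) (at x within {?a..?b})"
          unfolding has_field_derivative_def by (simp add: mult.commute[of _ "f x"])
      qed
      then obtain x where x: "x \<in> {?a..?b}" "F ?b - F ?a = (?b - ?a) * f x" by auto
      have ba: "?b - ?a = 1 / m" using mpos by (simp add: field_simps)
      have "dist ?a x < d" using x(1) ba md by (auto simp: dist_real_def)
      moreover have "?a \<in> {0..1}" "x \<in> {0..1}" using x(1) ab unfolding atLeastAtMost_iff by linarith+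
      ultimately have "dist (f ?a) (f x) < e / 2" by (intro d)
      moreover have "f ?a / m - (F ?b - F ?a) = (f ?a - f x) / m" unfolding x(2) ba by (simp add: diff_divide_distrib)
      moreover have "\<bar>(f ?a - f x) / m\<bar> \<le> e / 2 / m"
        using divide_right_mono[of "\<bar>f ?a - f x\<bar>" "e / 2" "real m"] calculation(1) mpos
        by (simp only: dist_real_def abs_divide abs_of_nat)
      ultimately show ?thesis by simp
    qed
    have tele: "(\<Sum>i<m. F (real (Suc i) / m) - F (real i / real m)) = F 1 - F 0"
      using mpos by (subst sum_lessThan_telescope[of "\<lambda>i. F (real i / m)"]) auto
    have "(\<Sum>i<m. f (real i / real m)) / real m - integral {0..1} f = (\<Sum>i<m. f (real i / real m) / real m - (F (real (Suc i) / m) - F (real i / real m)))"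
      unfolding sum_subtractf[of "\<lambda>i. f (real i / real m) / real m"] tele by (simp add: F_def sum_divide_distrib)
    also have "\<bar>\<dots>\<bar> \<le> (\<Sum>i<m. e / 2 / m)"
      by (rule order_trans[OF sum_abs]) (intro sum_mono step, auto)
    also have "\<dots> = e / 2" using mpos by simp
    finally show ?thesis using e by simp
  qed
  then show "\<exists>no. \<forall>n\<ge>no. norm ((\<Sum>i<n. f (real i / real n)) / real n - integral {0..1} f) < e" by blast
qed

text \<open>\<open>mat_pow A k\<close> maps \<open>V 1\<close> into \<open>V (k + 1)\<close>, which
  \<open>pr h\<close> annihilates when \<open>k < h - 1\<close>. So \<open>k = h - 1\<close> is the
  first term of the exponential series that is visible in \<open>E h\<close>, and the remainder
  carries one more power of \<open>s\<close>.\<close>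

lemma (in kalman) pr_mexp_tail:
  obtains C where "0 \<le> C" "\<And>s h w. \<bar>s\<bar> \<le> 1 \<Longrightarrow> h \<in> {1..nn} \<Longrightarrow> w \<in> V 1 \<Longrightarrow>
    norm (pr h (mexp A s w) - (s ^ (h - 1) / fact (h - 1)) *\<^sub>R pr h (mat_pow A (h - 1) *v w)) \<le> C * \<bar>s\<bar> ^ h * norm w"
proof -
  obtain C where C: "0 \<le> C" "\<And>s x m. \<bar>s\<bar> \<le> 1 \<Longrightarrow>
    norm (mexp A s x - (\<Sum>k<m. (s ^ k / fact k) *\<^sub>R (mat_pow A k *v x))) \<le> C * \<bar>s\<bar> ^ m * norm x"
    by (rule mexp_tail[of A]) blast
  have "norm (pr h (mexp A s w) - (s ^ (h - 1) / fact (h - 1)) *\<^sub>R pr h (mat_pow A (h - 1) *v w)) \<le> C * \<bar>s\<bar> ^ h * norm w"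
    if s: "\<bar>s\<bar> \<le> 1" and h: "h \<in> {1..nn}" and w: "w \<in> V 1" for s h w
  proof -
    obtain j where j: "h = Suc j" using h by (cases h) auto
    have z: "pr h (mat_pow A k *v w) = 0" if "k < j" for k
      using mat_pow_V_space[OF w, of k] that h j by (intro pr_V_zero[of h "1 + k"]) auto
    have "pr h (\<Sum>k<h. (s ^ k / fact k) *\<^sub>R (mat_pow A k *v w)) = (\<Sum>k<h. (s ^ k / fact k) *\<^sub>R pr h (mat_pow A k *v w))"
      by (simp add: pr_sum pr_scaleR)
    also have "\<dots> = (s ^ j / fact j) *\<^sub>R pr h (mat_pow A j *v w)"
      unfolding j by (simp add: z[unfolded j])
    finally have "pr h (mexp A s w) - (s ^ (h - 1) / fact (h - 1)) *\<^sub>R pr h (mat_pow A (h - 1) *v w)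
      = pr h (mexp A s w - (\<Sum>k<h. (s ^ k / fact k) *\<^sub>R (mat_pow A k *v w)))"
      by (simp add: pr_diff j)
    then show ?thesis using norm_pr_le[OF h] C(2)[OF s, of w h] order_trans by fastforce
  qed
  then show thesis using that C(1) by blast
qed

context kalman
begin

text \<open>The effect of a jump \<open>u\<close> of the noise at time \<open>t * s\<close>, in
  coordinates in which \<open>E h\<close> is divided by its natural size \<open>t ^ (h - 1)\<close>.
  The common factor e^(tA) has been taken out, whence the minus sign.\<close>

definition F :: "real \<Rightarrow> real \<Rightarrow> real^'d \<Rightarrow> real^'n" where
  "F t s u = dil (\<lambda>h. 1 / t ^ (h - 1)) (mexp A (- (t * s)) (B *v u))"

text \<open>The limit of \<open>F t s\<close> as \<open>t\<close> tends to 0: on each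
  \<open>E h\<close> only the leading term of the exponential series remains.\<close>

definition F0 :: "real \<Rightarrow> real^'d \<Rightarrow> real^'n" where
  "F0 s u = (\<Sum>h=1..nn. ((- s) ^ (h - 1) / fact (h - 1)) *\<^sub>R pr h (mat_pow A (h - 1) *v (B *v u)))"

definition F0T :: "real \<Rightarrow> real^'n \<Rightarrow> real^'d" where
  "F0T s p = (\<Sum>h=1..nn. ((- s) ^ (h - 1) / fact (h - 1)) *\<^sub>R (transpose B *v (transpose (mat_pow A (h - 1)) *v pr h p)))"

lemma inner_transpose: "(transpose M *v x) \<bullet> y = x \<bullet> (M *v y)" for M :: "real^'a^'b"
  by (simp add: dot_lmul_matrix[symmetric] transpose_matrix_vector)

lemma inner_F0: "p \<bullet> F0 s u = F0T s p \<bullet> u"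
  by (simp only: F0_def F0T_def inner_sum_left inner_sum_right inner_scaleR_left inner_scaleR_right inner_transpose pr_adjoint)

lemma B_in_V: "B *v u \<in> V 1"
  using mat_pow_in_V_space[of 0 1 A B u] by simp

lemma F_approx:
  obtains C where "0 \<le> C" "\<And>t s u. 0 < t \<Longrightarrow> t \<le> 1 \<Longrightarrow> 0 \<le> s \<Longrightarrow> s \<le> 1 \<Longrightarrow> norm (F t s u - F0 s u) \<le> C * t * norm u"
proof -
  obtain C where C: "0 \<le> C" "\<And>s h w. \<bar>s\<bar> \<le> 1 \<Longrightarrow> h \<in> {1..nn} \<Longrightarrow> w \<in> V 1 \<Longrightarrow>
    norm (pr h (mexp A s w) - (s ^ (h - 1) / fact (h - 1)) *\<^sub>R pr h (mat_pow A (h - 1) *v w)) \<le> C * \<bar>s\<bar> ^ h * norm w"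
    by (rule pr_mexp_tail) blast
  define D where "D = real nn * (C * onorm ((*v) B))"
  have onB: "0 \<le> onorm ((*v) B)" by (rule onorm_pos_le) simp
  have "norm (F t s u - F0 s u) \<le> D * t * norm u" if t: "0 < t" "t \<le> 1" and s: "0 \<le> s" "s \<le> 1" for t s u
  proof -
    let ?w = "B *v u"
    have ts: "\<bar>- (t * s)\<bar> \<le> 1" using t s by (simp add: abs_mult mult_le_one)
    have summand: "norm ((1 / t ^ (h - 1)) *\<^sub>R pr h (mexp A (- (t * s)) ?w) - ((- s) ^ (h - 1) / fact (h - 1)) *\<^sub>R pr h (mat_pow A (h - 1) *v ?w))
      \<le> C * onorm ((*v) B) * t * norm u" if h: "h \<in> {1..nn}" for h
    proof -
      obtain j where j: "h = Suc j" using h by (cases h) auto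
      have "(- s) ^ j / fact j = 1 / t ^ j * ((- (t * s)) ^ j / fact j)"
        using t by (simp add: power_mult_distrib power_minus[of s] power_minus[of "t * s"])
      then have "(1 / t ^ (h - 1)) *\<^sub>R pr h (mexp A (- (t * s)) ?w) - ((- s) ^ (h - 1) / fact (h - 1)) *\<^sub>R pr h (mat_pow A (h - 1) *v ?w)
        = (1 / t ^ j) *\<^sub>R (pr h (mexp A (- (t * s)) ?w) - ((- (t * s)) ^ (h - 1) / fact (h - 1)) *\<^sub>R pr h (mat_pow A (h - 1) *v ?w))"
        by (simp add: j scaleR_diff_right)
      then have "norm ((1 / t ^ (h - 1)) *\<^sub>R pr h (mexp A (- (t * s)) ?w) - ((- s) ^ (h - 1) / fact (h - 1)) *\<^sub>R pr h (mat_pow A (h - 1) *v ?w))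
        \<le> 1 / t ^ j * (C * \<bar>- (t * s)\<bar> ^ h * norm ?w)"
        using C(2)[OF ts h B_in_V, of u] t by (simp add: divide_right_mono)
      also have "\<dots> \<le> 1 / t ^ j * (C * t ^ h * norm ?w)"
        using t s C(1) by (intro mult_left_mono mult_right_mono power_mono) (auto simp: abs_mult mult_left_le)
      also have "\<dots> = C * t * norm ?w" using t by (simp add: j field_simps)
      also have "\<dots> \<le> C * t * (onorm ((*v) B) * norm u)"
        using C(1) t by (intro mult_left_mono onorm) auto
      finally show ?thesis by (simp add: mult_ac)
    qed
    have "F t s u - F0 s u = (\<Sum>h=1..nn. (1 / t ^ (h - 1)) *\<^sub>R pr h (mexp A (- (t * s)) ?w)
        - ((- s) ^ (h - 1) / fact (h - 1)) *\<^sub>R pr h (mat_pow A (h - 1) *v ?w))"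
      unfolding F_def F0_def dil_def by (rule sum_subtractf[symmetric])
    also have "norm \<dots> \<le> (\<Sum>h=1..nn. C * onorm ((*v) B) * t * norm u)"
      by (rule order_trans[OF norm_sum]) (intro sum_mono summand)
    also have "\<dots> = D * t * norm u" by (simp add: D_def)
    finally show ?thesis .
  qed
  moreover have "0 \<le> D" unfolding D_def using C(1) onB by simp
  ultimately show thesis using that by blast
qed

lemma F0_bound:
  obtains C where "0 \<le> C" "\<And>s u. 0 \<le> s \<Longrightarrow> s \<le> 1 \<Longrightarrow> norm (F0 s u) \<le> C * norm u"
proof -
  define C where "C = (\<Sum>h=1..nn. onorm ((*v) A) ^ (h - 1) * onorm ((*v) B))"
  have on: "0 \<le> onorm ((*v) A)" "0 \<le> onorm ((*v) B)" by (auto intro!: onorm_pos_le)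
  have "norm (F0 s u) \<le> C * norm u" if s: "0 \<le> s" "s \<le> 1" for s u
  proof -
    have "norm (((- s) ^ (h - 1) / fact (h - 1)) *\<^sub>R pr h (mat_pow A (h - 1) *v (B *v u)))
      \<le> onorm ((*v) A) ^ (h - 1) * onorm ((*v) B) * norm u" if h: "h \<in> {1..nn}" for h
    proof -
      have "norm (pr h (mat_pow A (h - 1) *v (B *v u))) \<le> norm (mat_pow A (h - 1) *v (B *v u))"
        by (rule norm_pr_le[OF h])
      also have "\<dots> \<le> onorm ((*v) A) ^ (h - 1) * norm (B *v u)" by (rule norm_mat_pow_vec)
      also have "\<dots> \<le> onorm ((*v) A) ^ (h - 1) * (onorm ((*v) B) * norm u)"
        using on by (intro mult_left_mono onorm) auto
      finally have 1: "norm (pr h (mat_pow A (h - 1) *v (B *v u))) \<le> onorm ((*v) A) ^ (h - 1) * (onorm ((*v) B) * norm u)" .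
      have "s ^ (h - 1) \<le> 1" using s by (simp add: power_le_one)
      then have "\<bar>(- s) ^ (h - 1) / fact (h - 1)\<bar> \<le> 1"
        using s order_trans[OF _ fact_ge_1[of "h - 1", where 'a=real]] by (simp add: abs_divide power_abs divide_le_eq)
      then have "\<bar>(- s) ^ (h - 1) / fact (h - 1)\<bar> * norm (pr h (mat_pow A (h - 1) *v (B *v u))) \<le> 1 * (onorm ((*v) A) ^ (h - 1) * (onorm ((*v) B) * norm u))"
        using 1 by (intro mult_mono) auto
      then show ?thesis by (simp add: mult_ac)
    qed
    then have "norm (F0 s u) \<le> (\<Sum>h=1..nn. onorm ((*v) A) ^ (h - 1) * onorm ((*v) B) * norm u)"
      unfolding F0_def by (intro order_trans[OF norm_sum] sum_mono) auto
    then show ?thesis by (simp add: C_def sum_distrib_right)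
  qed
  moreover have "0 \<le> C" unfolding C_def using on by (intro sum_nonneg) auto
  ultimately show thesis using that by blast
qed

lemma linear_F0T: "linear (F0T s)"
proof (rule linearI)
  show "F0T s (x + y) = F0T s x + F0T s y" for x y
    unfolding F0T_def by (simp add: pr_add matrix_vector_right_distrib scaleR_add_right sum.distrib)
  show "F0T s (r *\<^sub>R x) = r *\<^sub>R F0T s x" for r x
    unfolding F0T_def by (simp add: pr_scaleR matrix_vector_mult_scaleR scaleR_sum_right mult.commute)
qed

lemma continuous_F0T: "continuous_on X (\<lambda>s. F0T s p)"
  unfolding F0T_def by (intro continuous_intros) auto

text \<open>\<open>F0T s p\<close> is a polynomial in \<open>s\<close>, so if it vanishes on an
  interval all its coefficients do. The coefficient of degree \<open>h - 1\<close> makes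
  \<open>pr h p\<close> orthogonal to the image of \<open>mat_pow A (h - 1) ** B\<close>, and as an
  element of \<open>E h\<close> it is orthogonal to \<open>V (h - 1)\<close> anyway; hence it is
  orthogonal to \<open>V h\<close>, which contains it.\<close>

lemma F0T_eq_0:
  assumes z: "\<And>s. s \<in> {0..1} \<Longrightarrow> F0T s p = 0"
  shows "p = 0"
proof -
  define w where "w h = transpose B *v (transpose (mat_pow A (h - 1)) *v pr h p)" for h
  have w0: "w h = 0" if h: "h \<in> {1..nn}" for h
  proof (rule vector_eq_ldot[THEN iffD1, rule_format])
    fix y
    define c where "c k = (- 1) ^ k / fact k * (y \<bullet> w (Suc k))" for k
    have "(\<Sum>k\<le>nn - 1. c k * s ^ k) = 0" if s: "s \<in> {0..1}" for s
    proof -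
      have "0 = y \<bullet> F0T s p" using z[OF s] by simp
      also have "\<dots> = (\<Sum>h=1..nn. (- s) ^ (h - 1) / fact (h - 1) * (y \<bullet> w h))"
        by (simp add: F0T_def inner_sum_right w_def)
      also have "\<dots> = (\<Sum>k\<le>nn - 1. (- s) ^ k / fact k * (y \<bullet> w (Suc k)))"
        by (rule sum.reindex_bij_witness[of _ Suc "\<lambda>h. h - 1"]) (use nn_pos in auto)
      also have "\<dots> = (\<Sum>k\<le>nn - 1. c k * s ^ k)"
        unfolding c_def by (intro sum.cong refl) (subst power_minus, simp)
      finally show ?thesis by simp
    qed
    then have "{0..1} \<subseteq> {s. (\<Sum>k\<le>nn - 1. c k * s ^ k) = 0}" by blast
    moreover have "infinite {0..1::real}" by simp
    ultimately have "infinite {s. (\<Sum>k\<le>nn - 1. c k * s ^ k) = 0}" using finite_subset by blast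
    then have "\<forall>k\<le>nn - 1. c k = 0" using polyfun_finite_roots[of c "nn - 1"] by blast
    then have "c (h - 1) = 0" using h by auto
    then show "y \<bullet> w h = y \<bullet> 0" using h by (simp add: c_def)
  qed
  have "pr h p = 0" if h: "h \<in> {1..nn}" for h
  proof -
    have "pr h p \<in> V h" using pr_in_E[OF h] E_subset_V by blast
    then obtain u where u: "pr h p = (\<Sum>k<h. mat_pow A k *v (B *v u k))"
      unfolding V_space_def by (auto simp: matrix_vector_mul_assoc)
    have "pr h p \<bullet> (mat_pow A k *v (B *v u k)) = 0" if "k < h" for k
    proof (cases "k = h - 1")
      case True
      have "0 = w h \<bullet> u k" using w0[OF h] by simp
      then show ?thesis unfolding w_def True inner_transpose by simp
    next
      case False
      then have "mat_pow A k *v (B *v u k) \<in> V (h - 1)" using that by (intro mat_pow_in_V_space) auto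
      then have "pr h (mat_pow A k *v (B *v u k)) = 0" using h by (intro pr_V_zero[of h "h - 1"]) auto
      then show ?thesis by (simp add: pr_adjoint)
    qed
    then have "pr h p \<bullet> pr h p = 0" by (subst (2) u) (simp add: inner_sum_right)
    then show ?thesis by simp
  qed
  then show ?thesis using sum_pr[of p] by simp
qed

text \<open>The controllability Gramian of the limit system is positive definite by
  \<open>F0T_eq_0\<close>, and compactness of the sphere gives a positive lower bound. Its Riemann
  sums keep half of this bound once the grid is fine enough.\<close>

lemma gramian_lower_bound:
  obtains c :: real and m0 :: nat where "0 < c"
    "\<And>m p. m0 \<le> m \<Longrightarrow> c * (norm p)\<^sup>2 \<le> (\<Sum>i<m. (norm (F0T (real i / m) p))\<^sup>2) / m"
proof -
  let ?B = "Basis :: (real^'n) set"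
  define I where "I e e' = integral {0..1} (\<lambda>s. F0T s e \<bullet> F0T s e')" for e e'
  define R where "R m e e' = (\<Sum>i<m. F0T (real i / m) e \<bullet> F0T (real i / m) e') / m" for m e e'
  have cont: "continuous_on {0..1} (\<lambda>s. F0T s e \<bullet> F0T s e')" for e e'
    by (intro continuous_intros continuous_F0T)
  have RI: "(\<lambda>m. R m e e') \<longlonglongrightarrow> I e e'" for e e'
    unfolding R_def I_def using riemann_sum_tendsto[of "\<lambda>s. F0T s e \<bullet> F0T s e'", OF cont] .
  have expand: "(norm (F0T s p))\<^sup>2 = (\<Sum>e\<in>?B. \<Sum>e'\<in>?B. (p \<bullet> e) * (p \<bullet> e') * (F0T s e \<bullet> F0T s e'))" for s p
  proof -
    have "F0T s p = F0T s (\<Sum>e\<in>?B. (p \<bullet> e) *\<^sub>R e)" by (simp only: euclidean_representation)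
    also have "\<dots> = (\<Sum>e\<in>?B. (p \<bullet> e) *\<^sub>R F0T s e)"
      by (simp only: linear_sum[OF linear_F0T] linear_scale[OF linear_F0T])
    finally have e: "F0T s p = (\<Sum>e\<in>?B. (p \<bullet> e) *\<^sub>R F0T s e)" .
    show ?thesis unfolding power2_norm_eq_inner e inner_sum_left inner_sum_right
      by (subst sum.swap) (simp add: mult_ac)
  qed
  define G where "G p = (\<Sum>e\<in>?B. \<Sum>e'\<in>?B. (p \<bullet> e) * (p \<bullet> e') * I e e')" for p
  have G: "G p = integral {0..1} (\<lambda>s. (norm (F0T s p))\<^sup>2)" for p
    unfolding expand G_def I_def
    by (subst integral_sum integral_mult_right | (intro finite_Basis integrable_sum integrable_on_cmult_left integrable_continuous_interval cont continuous_intros) | rule sum.cong refl)+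
  have Gpos: "0 < G p" if "p \<noteq> 0" for p
  proof -
    have c: "continuous_on {0..1} (\<lambda>s. (norm (F0T s p))\<^sup>2)" by (intro continuous_intros continuous_F0T)
    have "0 \<le> G p" unfolding G by (intro integral_nonneg integrable_continuous_interval c) auto
    moreover have "G p \<noteq> 0"
    proof
      assume "G p = 0"
      then have "\<forall>s\<in>{0..1}. (norm (F0T s p))\<^sup>2 = 0"
        unfolding G by (subst (asm) integral_eq_0_iff[OF c]) auto
      then show False using F0T_eq_0[of p] that by auto
    qed
    ultimately show ?thesis by simp
  qed
  have "continuous_on (sphere 0 1) G" unfolding G_def by (intro continuous_intros)
  moreover have "sphere (0::real^'n) 1 \<noteq> {}" by simp
  ultimately obtain p0 where p0: "p0 \<in> sphere 0 1" "\<And>p. p \<in> sphere 0 1 \<Longrightarrow> G p0 \<le> G p"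
    using continuous_attains_inf[OF compact_sphere] by blast
  define c where "c = G p0"
  have c: "0 < c" unfolding c_def using p0(1) by (intro Gpos) auto
  have Gc: "c * (norm p)\<^sup>2 \<le> G p" for p
  proof (cases "p = 0")
    case False
    have "c \<le> G (p /\<^sub>R norm p)" unfolding c_def using False by (intro p0) auto
    also have "\<dots> = G p / (norm p)\<^sup>2"
      unfolding G_def by (simp add: sum_divide_distrib power2_eq_square field_simps)
    finally show ?thesis using False by (simp add: field_simps)
  qed (simp add: G_def)
  \<comment> \<open>A quadratic form is determined by finitely many entries, so convergence of the
    entries is uniform over \<open>p\<close> in the unit sphere.\<close>
  have "(\<lambda>m. \<Sum>e\<in>?B. \<Sum>e'\<in>?B. \<bar>R m e e' - I e e'\<bar>) \<longlonglongrightarrow> (\<Sum>e\<in>?B. \<Sum>e'\<in>?B. \<bar>I e e' - I e e'\<bar>)"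
    by (intro tendsto_intros RI)
  then have "\<forall>\<^sub>F m in sequentially. (\<Sum>e\<in>?B. \<Sum>e'\<in>?B. \<bar>R m e e' - I e e'\<bar>) < c / 2"
    using c by (intro order_tendstoD(2)) auto
  then obtain m0 where m0: "\<And>m. m0 \<le> m \<Longrightarrow> (\<Sum>e\<in>?B. \<Sum>e'\<in>?B. \<bar>R m e e' - I e e'\<bar>) < c / 2"
    by (auto simp: eventually_sequentially)
  have "c / 2 * (norm p)\<^sup>2 \<le> (\<Sum>i<m. (norm (F0T (real i / m) p))\<^sup>2) / m" if "m0 \<le> m" for m p
  proof -
    have Rm: "(\<Sum>i<m. (norm (F0T (real i / m) p))\<^sup>2) / m = (\<Sum>e\<in>?B. \<Sum>e'\<in>?B. (p \<bullet> e) * (p \<bullet> e') * R m e e')"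
      unfolding expand R_def
      by (subst sum.swap, simp add: sum_divide_distrib sum_distrib_left, intro sum.cong refl)
        (subst sum.swap, simp add: sum_divide_distrib sum_distrib_left)
    have "\<bar>G p - (\<Sum>i<m. (norm (F0T (real i / m) p))\<^sup>2) / m\<bar> = \<bar>\<Sum>e\<in>?B. \<Sum>e'\<in>?B. (p \<bullet> e) * (p \<bullet> e') * (I e e' - R m e e')\<bar>"
      unfolding Rm G_def by (simp add: sum_subtractf[symmetric] right_diff_distrib)
    also have "\<dots> \<le> (\<Sum>e\<in>?B. \<Sum>e'\<in>?B. \<bar>(p \<bullet> e) * (p \<bullet> e') * (I e e' - R m e e')\<bar>)"
      by (intro order_trans[OF sum_abs] sum_mono sum_abs)
    also have "\<dots> \<le> (\<Sum>e\<in>?B. \<Sum>e'\<in>?B. (norm p)\<^sup>2 * \<bar>R m e e' - I e e'\<bar>)"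
    proof (intro sum_mono)
      fix e e' assume "e \<in> ?B" "e' \<in> ?B"
      then have "\<bar>p \<bullet> e\<bar> * \<bar>p \<bullet> e'\<bar> \<le> norm p * norm p" by (intro mult_mono Basis_le_norm) auto
      then show "\<bar>(p \<bullet> e) * (p \<bullet> e') * (I e e' - R m e e')\<bar> \<le> (norm p)\<^sup>2 * \<bar>R m e e' - I e e'\<bar>"
        by (simp add: abs_mult power2_eq_square mult_right_mono abs_minus_commute)
    qed
    also have "\<dots> = (norm p)\<^sup>2 * (\<Sum>e\<in>?B. \<Sum>e'\<in>?B. \<bar>R m e e' - I e e'\<bar>)" by (simp add: sum_distrib_left)
    also have "\<dots> \<le> (norm p)\<^sup>2 * (c / 2)" using m0[OF that] by (intro mult_left_mono) auto
    finally have "G p - (\<Sum>i<m. (norm (F0T (real i / m) p))\<^sup>2) / m \<le> (norm p)\<^sup>2 * (c / 2)" by linarith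
    then show ?thesis using Gc[of p] by (simp add: mult.commute)
  qed
  then show thesis using c by (intro that[of "c / 2" m0]) auto
qed

end

text \<open>The nondegeneracy is given for the exponent \<alpha> < 2, while the argument needs
  second moments. Directions nearly orthogonal to \<open>p\<close>, with
  \<open>\<bar>p \<bullet> s\<bar> \<le> d\<close>, contribute little to the moment of order
  \<alpha>; on the others the power \<alpha> is at most a constant times the square.\<close>

lemma spherical_second_moment:
  fixes \<mu> :: "(real^'d) measure"
  assumes mu: "nondegenerate_spherical \<alpha> \<mu>" and alpha: "0 < \<alpha>" "\<alpha> < 2"
  obtains c where "0 < c" "\<And>p. c * (norm p)\<^sup>2 \<le> (\<integral>s. (p \<bullet> s)\<^sup>2 \<partial>\<mu>)"
proof -
  obtain \<eta> where \<eta>: "1 \<le> \<eta>" "\<And>p. norm p powr \<alpha> / \<eta> \<le> (\<integral>s. \<bar>p \<bullet> s\<bar> powr \<alpha> \<partial>\<mu>)"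
    and fin: "finite_measure \<mu>" and sets: "sets \<mu> = sets (restrict_space borel (sphere 0 1))"
    using mu unfolding nondegenerate_spherical_def by blast
  interpret finite_measure \<mu> by fact
  have sp: "space \<mu> = sphere 0 1" using sets_eq_imp_space_eq[OF sets] by (simp add: space_restrict_space)
  have meas: "f \<in> borel_measurable borel \<Longrightarrow> f \<in> borel_measurable \<mu>" for f :: "real^'d \<Rightarrow> real"
    unfolding measurable_cong_sets[OF sets refl] by (rule measurable_restrict_space1)
  define m where "m = measure \<mu> (space \<mu>)"
  \<comment> \<open>Chosen so that \<open>d powr \<alpha>\<close> times the total mass is at most
    half of the lower bound \<open>1 / \<eta>\<close>; the summand 1 covers mass 0.\<close>
  define d where "d = (1 / (2 * \<eta> * (m + 1))) powr (1 / \<alpha>)"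
  have m0: "0 \<le> m" by (simp add: m_def)
  have dpos: "0 < d" using \<eta> m0 by (simp add: d_def)
  have d\<alpha>: "d powr \<alpha> * m \<le> 1 / (2 * \<eta>)"
  proof -
    have "d powr \<alpha> = 1 / (2 * \<eta> * (m + 1))" using \<eta> m0 alpha by (simp add: d_def powr_powr)
    then have "d powr \<alpha> * m = 1 / (2 * \<eta>) * (m / (m + 1))" by simp
    also have "\<dots> \<le> 1 / (2 * \<eta>) * 1" using \<eta> m0 by (intro mult_left_mono) auto
    finally show ?thesis by simp
  qed
  have pw: "x powr \<alpha> \<le> d powr \<alpha> + d powr (\<alpha> - 2) * x\<^sup>2" if x: "0 \<le> x" for x
  proof (cases "x \<le> d")
    case True
    then have "x powr \<alpha> \<le> d powr \<alpha>" using x alpha by (intro powr_mono2) auto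
    then show ?thesis by (simp add: add_increasing2)
  next
    case False
    then have "x powr \<alpha> = x powr (\<alpha> - 2) * x\<^sup>2" using dpos by (simp add: powr_diff)
    also have "\<dots> \<le> d powr (\<alpha> - 2) * x\<^sup>2"
      using False dpos alpha by (intro mult_right_mono powr_mono2') auto
    finally show ?thesis by (simp add: add_increasing)
  qed
  define c where "c = d powr (2 - \<alpha>) / (2 * \<eta>)"
  have cpos: "0 < c" using dpos \<eta> by (simp add: c_def)
  have int: "integrable \<mu> (\<lambda>s. (p \<bullet> s)\<^sup>2)" for p
  proof (rule integrable_const_bound[of _ "(norm p)\<^sup>2"])
    show "AE s in \<mu>. norm ((p \<bullet> s)\<^sup>2) \<le> (norm p)\<^sup>2"
    proof (rule AE_I2)
      fix s assume "s \<in> space \<mu>"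
      then show "norm ((p \<bullet> s)\<^sup>2) \<le> (norm p)\<^sup>2"
        using power_mono[OF Cauchy_Schwarz_ineq2[of p s], of 2] by (simp add: sp)
    qed
  qed (intro meas, measurable)
  have unit: "c \<le> (\<integral>s. (p \<bullet> s)\<^sup>2 \<partial>\<mu>)" if p: "norm p = 1" for p
  proof -
    have "1 / \<eta> \<le> (\<integral>s. \<bar>p \<bullet> s\<bar> powr \<alpha> \<partial>\<mu>)" using \<eta>(2)[of p] p by simp
    also have "\<dots> \<le> (\<integral>s. d powr \<alpha> + d powr (\<alpha> - 2) * (p \<bullet> s)\<^sup>2 \<partial>\<mu>)"
    proof (rule integral_mono)
      show i: "integrable \<mu> (\<lambda>s. d powr \<alpha> + d powr (\<alpha> - 2) * (p \<bullet> s)\<^sup>2)" using int by simp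
      show le: "\<bar>p \<bullet> s\<bar> powr \<alpha> \<le> d powr \<alpha> + d powr (\<alpha> - 2) * (p \<bullet> s)\<^sup>2" for s using pw[of "\<bar>p \<bullet> s\<bar>"] by simp
      show "integrable \<mu> (\<lambda>s. \<bar>p \<bullet> s\<bar> powr \<alpha>)"
        by (rule Bochner_Integration.integrable_bound[OF i]) (intro meas, measurable, use le in \<open>auto intro!: AE_I2 order_trans[OF le]\<close>)
    qed
    also have "\<dots> = d powr \<alpha> * m + d powr (\<alpha> - 2) * (\<integral>s. (p \<bullet> s)\<^sup>2 \<partial>\<mu>)"
      using int by (simp add: m_def)
    finally have "1 / (2 * \<eta>) \<le> d powr (\<alpha> - 2) * (\<integral>s. (p \<bullet> s)\<^sup>2 \<partial>\<mu>)" using d\<alpha> \<eta> by (simp add: field_simps)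
    then have "d powr (2 - \<alpha>) * (1 / (2 * \<eta>)) \<le> d powr (2 - \<alpha>) * (d powr (\<alpha> - 2) * (\<integral>s. (p \<bullet> s)\<^sup>2 \<partial>\<mu>))"
      by (rule mult_left_mono) simp
    also have "\<dots> = (\<integral>s. (p \<bullet> s)\<^sup>2 \<partial>\<mu>)" using dpos by (simp add: mult.assoc[symmetric] powr_add[symmetric])
    finally show ?thesis by (simp add: c_def)
  qed
  have "c * (norm p)\<^sup>2 \<le> (\<integral>s. (p \<bullet> s)\<^sup>2 \<partial>\<mu>)" for p
  proof (cases "p = 0")
    case False
    have "c \<le> (\<integral>s. ((p /\<^sub>R norm p) \<bullet> s)\<^sup>2 \<partial>\<mu>)" using False by (intro unit) simp
    also have "\<dots> = (\<integral>s. (p \<bullet> s)\<^sup>2 \<partial>\<mu>) / (norm p)\<^sup>2"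
      by (simp add: power_divide divide_inverse[symmetric] inverse_eq_divide power_mult_distrib flip: integral_divide_zero)
    finally show ?thesis using False by (simp add: field_simps)
  qed simp
  then show thesis using cpos that by blast
qed

section \<open>The truncated stable part of the Levy measure\<close>

lemma avg_iexp_scale:
  assumes "a < b" "0 < e"
  shows "avg_iexp (e * a) (e * b) y = avg_iexp a b (e * y)"
proof (cases "y = 0")
  case True
  interpret u1: prob_space "uniform_measure lborel {a..b}" by (rule prob_space_uniform_Icc[OF assms(1)])
  interpret u2: prob_space "uniform_measure lborel {e*a..e*b}" by (rule prob_space_uniform_Icc) (use assms in simp)
  show ?thesis using True u1.prob_space u2.prob_space by (simp add: avg_iexp_def)
next
  case False
  have ab: "e * a < e * b" using assms by simp
  have "\<i> * complex_of_real y * avg_iexp (e * a) (e * b) y = (iexp (y * (e * b)) - iexp (y * (e * a))) / complex_of_real (e * b - e * a)"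
    by (rule avg_iexp_FTC[OF ab])
  moreover have "\<i> * complex_of_real (e * y) * avg_iexp a b (e * y) = (iexp (e * y * b) - iexp (e * y * a)) / complex_of_real (b - a)"
    by (rule avg_iexp_FTC[OF assms(1)])
  moreover have "e * b - e * a = e * (b - a)" by (simp add: algebra_simps)
  moreover have "y * (e * b) = e * y * b" "y * (e * a) = e * y * a" by simp_all
  ultimately have "\<i> * complex_of_real y * avg_iexp (e * a) (e * b) y * complex_of_real e = \<i> * complex_of_real (e * y) * avg_iexp a b (e * y)"
    using assms(2) by (simp only: of_real_mult) simp
  then show ?thesis using False assms(2) by simp
qed

text \<open>Half-open intervals make the dyadic shells of jump sizes disjoint; the missing endpoint
  is a null set.\<close>

lemma integral_interval_iexp:
  assumes "a < b"
  shows "(\<integral>r. indicat_real {a<..b} r *\<^sub>R (1 - iexp (y * r)) \<partial>lborel) = complex_of_real (b - a) * (1 - avg_iexp a b y)"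
proof -
  have u: "uniform_measure lborel {a..b} = density lborel (\<lambda>r. ennreal (indicat_real {a..b} r / (b - a)))"
    unfolding uniform_measure_def using assms divide_ennreal[of 1 "b - a"]
    by (intro density_cong) (auto simp: indicator_def)
  interpret prob_space "uniform_measure lborel {a..b}" by (rule prob_space_uniform_Icc[OF assms])
  have int: "integrable (uniform_measure lborel {a..b}) (\<lambda>r. iexp (y * r))"
    by (rule integrable_const_bound[of _ 1]) auto
  have "1 - avg_iexp a b y = (\<integral>r. 1 - iexp (y * r) \<partial>uniform_measure lborel {a..b})"
    unfolding avg_iexp_def using int prob_space by (subst Bochner_Integration.integral_diff) auto
  also have "\<dots> = (\<integral>r. (indicat_real {a..b} r / (b - a)) *\<^sub>R (1 - iexp (y * r)) \<partial>lborel)"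
    unfolding u using assms by (subst integral_density) auto
  also have "\<dots> = (\<integral>r. (1 / (b - a)) *\<^sub>R (indicat_real {a<..b} r *\<^sub>R (1 - iexp (y * r))) \<partial>lborel)"
  proof (rule integral_cong_AE)
    have "AE r in lborel. r \<noteq> a" by (rule AE_lborel_singleton)
    then show "AE r in lborel. (indicat_real {a..b} r / (b - a)) *\<^sub>R (1 - iexp (y * r)) = (1 / (b - a)) *\<^sub>R (indicat_real {a<..b} r *\<^sub>R (1 - iexp (y * r)))"
      by eventually_elim (auto split: split_indicator)
  qed auto
  also have "\<dots> = (1 / (b - a)) *\<^sub>R (\<integral>r. indicat_real {a<..b} r *\<^sub>R (1 - iexp (y * r)) \<partial>lborel)"
    by (rule integral_scaleR_right)
  finally show ?thesis using assms by (simp add: scaleR_conv_of_real field_simps)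
qed

section \<open>Random jump directions and jump times\<close>

locale spherical =
  fixes \<mu> :: "(real^'d) measure" and \<alpha> :: real
  assumes alpha: "0 < \<alpha>" "\<alpha> < 2" and mu: "nondegenerate_spherical \<alpha> \<mu>"
begin

lemma sets_\<mu>: "sets \<mu> = sets (restrict_space borel (sphere 0 1))"
  using mu by (simp add: nondegenerate_spherical_def)

lemma space_\<mu>: "space \<mu> = sphere 0 1"
  using sets_eq_imp_space_eq[OF sets_\<mu>] by (simp add: space_restrict_space)

lemma finite_\<mu>: "finite_measure \<mu>"
  using mu by (simp add: nondegenerate_spherical_def)

lemma measurable_\<mu>I: "f \<in> measurable borel N \<Longrightarrow> f \<in> measurable \<mu> N"
  unfolding measurable_cong_sets[OF sets_\<mu> refl] by (rule measurable_restrict_space1)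

lemma measurable_id_\<mu> [measurable]: "(\<lambda>x. x) \<in> measurable \<mu> borel"
  by (rule measurable_\<mu>I) simp

definition mass :: real where "mass = measure \<mu> (space \<mu>)"

lemma mass_pos: "0 < mass"
proof (rule ccontr)
  assume "\<not> 0 < mass"
  then have m: "measure \<mu> (space \<mu>) = 0" by (simp add: mass_def not_less measure_le_0_iff)
  obtain c where c: "0 < c" "\<And>p. c * (norm p)\<^sup>2 \<le> (\<integral>s. (p \<bullet> s)\<^sup>2 \<partial>\<mu>)"
    by (rule spherical_second_moment[OF mu alpha]) blast
  have "emeasure \<mu> (space \<mu>) = 0" using m finite_measure.emeasure_eq_measure[OF finite_\<mu>] by simp
  then have "AE s in \<mu>. False" by (intro AE_I[of _ _ "space \<mu>"]) auto
  then have "(\<integral>s. ((axis undefined 1 :: real^'d) \<bullet> s)\<^sup>2 \<partial>\<mu>) = 0"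
    by (intro integral_eq_zero_AE) auto
  with c(1) c(2)[of "axis undefined 1"] show False by simp
qed

definition \<mu>n :: "(real^'d) measure" where "\<mu>n = density \<mu> (\<lambda>_. ennreal (1 / mass))"

lemma prob_space_\<mu>n: "prob_space \<mu>n"
proof (rule prob_spaceI)
  have "emeasure \<mu>n (space \<mu>n) = ennreal (1 / mass) * emeasure \<mu> (space \<mu>)"
    unfolding \<mu>n_def by (simp add: emeasure_density nn_integral_cmult)
  also have "\<dots> = ennreal (1 / mass) * ennreal mass"
    by (simp add: mass_def finite_measure.emeasure_eq_measure[OF finite_\<mu>])
  also have "\<dots> = 1" using mass_pos by (simp add: ennreal_mult[symmetric])
  finally show "emeasure \<mu>n (space \<mu>n) = 1" .
qed

lemma space_\<mu>n: "space \<mu>n = sphere 0 1" and sets_\<mu>n [measurable_cong]: "sets \<mu>n = sets \<mu>"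
  by (simp_all add: \<mu>n_def space_\<mu>)

lemma integral_\<mu>n:
  fixes f :: "real^'d \<Rightarrow> 'b::{banach, second_countable_topology}"
  assumes "f \<in> borel_measurable \<mu>"
  shows "integral\<^sup>L \<mu>n f = (1 / mass) *\<^sub>R integral\<^sup>L \<mu> f"
  unfolding \<mu>n_def using assms mass_pos by (subst integral_density) auto

text \<open>A uniformly chosen grid index, standing for the time of the jump, together with an
  independent direction. The sum of the exponents over the grid thereby becomes a single
  expectation.\<close>

definition dirsp :: "nat \<Rightarrow> (nat \<times> (real^'d)) measure" where
  "dirsp m = measure_pmf (pmf_of_set {..<m}) \<Otimes>\<^sub>M \<mu>n"

lemma prob_space_dirsp: "prob_space (dirsp m)"
proof -
  interpret \<mu>n: prob_space \<mu>n by (rule prob_space_\<mu>n)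
  interpret pair_prob_space "measure_pmf (pmf_of_set {..<m})" \<mu>n ..
  show ?thesis unfolding dirsp_def by unfold_locales
qed

lemma measurable_dirspI:
  assumes "\<And>i. (\<lambda>\<theta>. f (i, \<theta>)) \<in> measurable \<mu> N"
  shows "f \<in> measurable (dirsp m) N"
proof -
  have "f \<in> measurable (count_space UNIV \<Otimes>\<^sub>M \<mu>n) N"
    using assms by (intro measurable_pair_measure_countable1) (auto simp: measurable_cong_sets[OF sets_\<mu>n refl])
  moreover have "sets (dirsp m) = sets (count_space UNIV \<Otimes>\<^sub>M \<mu>n)"
    unfolding dirsp_def by (intro sets_pair_measure_cong) auto
  ultimately show ?thesis using measurable_cong_sets by blast
qed

lemma integral_dirsp:
  fixes f :: "nat \<times> (real^'d) \<Rightarrow> 'b::{banach, second_countable_topology}"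
  assumes m: "0 < m" and f: "f \<in> borel_measurable (dirsp m)" "\<And>x. norm (f x) \<le> C"
  shows "integral\<^sup>L (dirsp m) f = (1 / (m * mass)) *\<^sub>R (\<Sum>i<m. \<integral>\<theta>. f (i, \<theta>) \<partial>\<mu>)"
proof -
  interpret \<mu>n: prob_space \<mu>n by (rule prob_space_\<mu>n)
  interpret pair_prob_space "measure_pmf (pmf_of_set {..<m})" \<mu>n ..
  interpret D: prob_space "dirsp m" by (rule prob_space_dirsp)
  have "integrable (dirsp m) f" by (rule D.integrable_const_bound[of _ C]) (use f in auto)
  then have int: "integrable (measure_pmf (pmf_of_set {..<m}) \<Otimes>\<^sub>M \<mu>n) f" by (simp add: dirsp_def)
  have meas: "(\<lambda>\<theta>. f (i, \<theta>)) \<in> borel_measurable \<mu>" for i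
  proof -
    have "(\<lambda>\<theta>. f (i, \<theta>)) \<in> borel_measurable \<mu>n"
      using f(1) unfolding dirsp_def by (rule measurable_Pair2) simp
    then show ?thesis by (simp add: measurable_cong_sets[OF sets_\<mu>n refl])
  qed
  have "integral\<^sup>L (dirsp m) f = (\<integral>i. (\<integral>\<theta>. f (i, \<theta>) \<partial>\<mu>n) \<partial>measure_pmf (pmf_of_set {..<m}))"
    unfolding dirsp_def by (rule integral_fst'[OF int, symmetric])
  also have "\<dots> = (\<Sum>i<m. (1 / m) *\<^sub>R (\<integral>\<theta>. f (i, \<theta>) \<partial>\<mu>n))"
    using m by (subst integral_measure_pmf[of "{..<m}"]) (auto simp: set_pmf_of_set lessThan_empty_iff split: split_indicator)
  also have "\<dots> = (1 / (m * mass)) *\<^sub>R (\<Sum>i<m. \<integral>\<theta>. f (i, \<theta>) \<partial>\<mu>)"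
    using meas by (simp add: integral_\<mu>n scaleR_sum_right)
  finally show ?thesis .
qed

end

locale kalman_spherical = kalman A B S + spherical \<mu> \<alpha>
  for A :: "real^'n^'n" and B :: "real^'d^'n" and S :: "nat \<Rightarrow> (real^'n) set"
    and \<mu> :: "(real^'d) measure" and \<alpha> :: real
begin

text \<open>The default value 0 off the sphere and outside the grid is there because
  \<open>jump_directions\<close> asks for a bound at every point, not just almost
  everywhere.\<close>

definition dirv :: "real \<Rightarrow> nat \<Rightarrow> nat \<times> (real^'d) \<Rightarrow> real^'n" where
  "dirv t m = (\<lambda>(i, \<theta>). if i < m \<and> norm \<theta> = 1 then F t (real i / m) \<theta> else 0)"

lemma linear_F: "linear (F t s)"
proof -
  have "linear (dil (\<lambda>h. 1 / t ^ (h - 1)) \<circ> mexp A (- (t * s)) \<circ> (*v) B)"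
    by (intro linear_compose linear_dil linear_mexp matrix_vector_mul_linear)
  then show ?thesis by (simp add: F_def[abs_def] comp_def)
qed

lemma measurable_F [measurable]: "F t s \<in> borel_measurable borel"
  by (intro borel_measurable_continuous_onI linear_continuous_on) (simp add: linear_linear linear_conv_bounded_linear[symmetric] linear_F)

text \<open>For small \<open>t\<close> the directions \<open>F\<close> differ from their limits
  \<open>F0\<close> by \<open>C * t\<close>. The limit form is bounded below by combining the
  spherical moment, for fixed time, with the Gramian, for the average over time; the constants do
  not depend on \<open>t\<close> and \<open>m\<close>.\<close>

lemma jump_directions_uniform:
  obtains R c t1 :: real and m0 :: nat where "0 < t1" "t1 \<le> 1" "0 < m0"
    "\<And>t m. 0 < t \<Longrightarrow> t \<le> t1 \<Longrightarrow> m0 \<le> m \<Longrightarrow> jump_directions (dirsp m) (dirv t m) R c"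
proof -
  obtain C where C: "0 \<le> C" "\<And>t s u. 0 < t \<Longrightarrow> t \<le> 1 \<Longrightarrow> 0 \<le> s \<Longrightarrow> s \<le> 1 \<Longrightarrow> norm (F t s u - F0 s u) \<le> C * t * norm u"
    by (rule F_approx) blast
  obtain C' where C': "0 \<le> C'" "\<And>s u. 0 \<le> s \<Longrightarrow> s \<le> 1 \<Longrightarrow> norm (F0 s u) \<le> C' * norm u"
    by (rule F0_bound) blast
  obtain c0 :: real and m0 :: nat where c0: "0 < c0"
    "\<And>m p. m0 \<le> m \<Longrightarrow> c0 * (norm p)\<^sup>2 \<le> (\<Sum>i<m. (norm (F0T (real i / m) p))\<^sup>2) / m"
    by (rule gramian_lower_bound) blast
  obtain c1 where c1: "0 < c1" "\<And>p. c1 * (norm p)\<^sup>2 \<le> (\<integral>s. (p \<bullet> s)\<^sup>2 \<partial>\<mu>)"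
    by (rule spherical_second_moment[OF mu alpha]) blast
  \<comment> \<open>Half of the limit form is at least \<open>2 * c * (norm p)\<^sup>2\<close>; the
    choice of \<open>t1\<close> lets the error \<open>(C * t)\<^sup>2\<close> use up one
    \<open>c\<close> and leaves the other.\<close>
  define c where "c = c1 * c0 / (4 * mass)"
  have c: "0 < c" using c0 c1 mass_pos by (simp add: c_def)
  define t1 where "t1 = min 1 (sqrt c / (C + 1))"
  have t1: "0 < t1" "t1 \<le> 1" using c C(1) by (auto simp: t1_def)
  have Ct1: "(C * t)\<^sup>2 \<le> c" if "0 < t" "t \<le> t1" for t
  proof -
    have "C * t \<le> (C + 1) * (sqrt c / (C + 1))"
      using that C(1) c by (intro mult_mono) (auto simp: t1_def)
    then have "C * t \<le> sqrt c" using C(1) by simp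
    then have "(C * t)\<^sup>2 \<le> (sqrt c)\<^sup>2" using C(1) that by (intro power_mono) auto
    then show ?thesis using c by simp
  qed
  have "jump_directions (dirsp m) (dirv t m) (C' + C) c" if t: "0 < t" "t \<le> t1" and m: "max 1 m0 \<le> m" for t m
  proof -
    interpret D: prob_space "dirsp m" by (rule prob_space_dirsp)
    interpret \<mu>: finite_measure \<mu> by (rule finite_\<mu>)
    have mpos: "0 < m" using m by simp
    have ge0: "0 \<le> real i / m" for i by simp
    have le1: "real i / m \<le> 1" if "i < m" for i using that by simp
    have close: "norm (F t (real i / m) u - F0 (real i / m) u) \<le> C * t * norm u" if "i < m" for i u
      using C(2)[of t "real i / m" u] t t1 that le1[OF that] by auto
    have v_le: "norm (dirv t m x) \<le> C' + C" for x
    proof (cases x)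
      case (Pair i \<theta>)
      show ?thesis
      proof (cases "i < m \<and> norm \<theta> = 1")
        case True
        have "norm (F t (real i / m) \<theta>) \<le> norm (F0 (real i / m) \<theta>) + norm (F t (real i / m) \<theta> - F0 (real i / m) \<theta>)"
          using norm_triangle_ineq[of "F0 (real i / m) \<theta>" "F t (real i / m) \<theta> - F0 (real i / m) \<theta>"] by simp
        also have "\<dots> \<le> C' * norm \<theta> + C * t * norm \<theta>"
          using True by (intro add_mono close C'(2) ge0 le1) auto
        also have "\<dots> \<le> C' + C" using True t t1 C(1) by (simp add: mult_left_le)
        finally show ?thesis using True Pair by (simp add: dirv_def)
      next
        case False
        then show ?thesis using Pair C(1) C'(1) by (auto simp: dirv_def)
      qed
    qed
    have meas: "dirv t m \<in> borel_measurable (dirsp m)"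
    proof (rule measurable_dirspI)
      fix i
      have "(\<lambda>\<theta>. if i < m \<and> norm \<theta> = 1 then F t (real i / m) \<theta> else 0) \<in> borel_measurable borel"
        by measurable
      then show "(\<lambda>\<theta>. dirv t m (i, \<theta>)) \<in> borel_measurable \<mu>"
        by (intro measurable_\<mu>I) (simp add: dirv_def)
    qed
    show ?thesis
    proof (unfold_locales)
      show "dirv t m \<in> borel_measurable (dirsp m)" by fact
      show "norm (dirv t m x) \<le> C' + C" for x by fact
      show "0 < c" by fact
      fix p :: "real^'n"
      have pv_le: "\<bar>p \<bullet> dirv t m x\<bar> \<le> norm p * (C' + C)" for x
        by (rule order_trans[OF Cauchy_Schwarz_ineq2]) (intro mult_left_mono v_le norm_ge_zero)
      have one: "c1 * (norm (F0T (real i / m) p))\<^sup>2 / 2 - (C * t)\<^sup>2 * (norm p)\<^sup>2 * mass \<le> (\<integral>\<theta>. (p \<bullet> dirv t m (i, \<theta>))\<^sup>2 \<partial>\<mu>)"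
        if i: "i < m" for i
      proof -
        let ?q = "F0T (real i / m) p"
        have int1: "integrable \<mu> (\<lambda>\<theta>. (?q \<bullet> \<theta>)\<^sup>2)"
        proof (rule \<mu>.integrable_const_bound[of _ "(norm ?q)\<^sup>2"])
          show "AE \<theta> in \<mu>. norm ((?q \<bullet> \<theta>)\<^sup>2) \<le> (norm ?q)\<^sup>2"
          proof (rule AE_I2)
            fix \<theta> assume "\<theta> \<in> space \<mu>"
            then show "norm ((?q \<bullet> \<theta>)\<^sup>2) \<le> (norm ?q)\<^sup>2"
              using power_mono[OF Cauchy_Schwarz_ineq2[of ?q \<theta>], of 2] by (simp add: space_\<mu>)
          qed
          show "(\<lambda>\<theta>. (?q \<bullet> \<theta>)\<^sup>2) \<in> borel_measurable \<mu>" by (intro measurable_\<mu>I) measurable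
        qed
        have int2: "integrable \<mu> (\<lambda>\<theta>. (p \<bullet> dirv t m (i, \<theta>))\<^sup>2)"
        proof (rule \<mu>.integrable_const_bound[of _ "(norm p * (C' + C))\<^sup>2"])
          show "AE \<theta> in \<mu>. norm ((p \<bullet> dirv t m (i, \<theta>))\<^sup>2) \<le> (norm p * (C' + C))\<^sup>2"
            using power_mono[OF pv_le abs_ge_zero, of _ 2] by auto
          have "(\<lambda>\<theta>. dirv t m (i, \<theta>)) \<in> borel_measurable \<mu>"
            by (intro measurable_\<mu>I, simp only: dirv_def prod.case) measurable
          then show "(\<lambda>\<theta>. (p \<bullet> dirv t m (i, \<theta>))\<^sup>2) \<in> borel_measurable \<mu>" by measurable
        qed
        have pw: "(?q \<bullet> \<theta>)\<^sup>2 / 2 - (C * t)\<^sup>2 * (norm p)\<^sup>2 \<le> (p \<bullet> dirv t m (i, \<theta>))\<^sup>2" if "\<theta> \<in> space \<mu>" for \<theta>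
        proof -
          have n1: "norm \<theta> = 1" using that by (simp add: space_\<mu>)
          define x where "x = ?q \<bullet> \<theta>"
          define y where "y = p \<bullet> dirv t m (i, \<theta>)"
          have "y - x = p \<bullet> (F t (real i / m) \<theta> - F0 (real i / m) \<theta>)"
            using i n1 by (simp add: x_def y_def dirv_def inner_diff_right inner_F0)
          then have "\<bar>y - x\<bar> \<le> norm p * (C * t * norm \<theta>)"
            using order_trans[OF Cauchy_Schwarz_ineq2 mult_left_mono[OF close[OF i] norm_ge_zero]] by simp
          then have "(y - x)\<^sup>2 \<le> (norm p * (C * t))\<^sup>2"
            using power_mono[of "\<bar>y - x\<bar>" _ 2] n1 by fastforce
          then have a: "(y - x)\<^sup>2 \<le> (C * t)\<^sup>2 * (norm p)\<^sup>2" by (simp add: power_mult_distrib mult_ac)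
          \<comment> \<open>Half of this square is the difference of the two sides of the next
            inequality.\<close>
          have "0 \<le> (2 * y - x)\<^sup>2" by simp
          then have "x\<^sup>2 / 2 - (y - x)\<^sup>2 \<le> y\<^sup>2" by (simp add: power2_eq_square algebra_simps)
          with a show ?thesis by (simp add: x_def y_def)
        qed
        have "c1 * (norm ?q)\<^sup>2 / 2 - (C * t)\<^sup>2 * (norm p)\<^sup>2 * mass \<le> (\<integral>\<theta>. (?q \<bullet> \<theta>)\<^sup>2 \<partial>\<mu>) / 2 - (C * t)\<^sup>2 * (norm p)\<^sup>2 * mass"
          using c1(2)[of ?q] by simp
        also have "\<dots> = (\<integral>\<theta>. (?q \<bullet> \<theta>)\<^sup>2 / 2 - (C * t)\<^sup>2 * (norm p)\<^sup>2 \<partial>\<mu>)"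
          using int1 by (simp add: mass_def)
        also have "\<dots> \<le> (\<integral>\<theta>. (p \<bullet> dirv t m (i, \<theta>))\<^sup>2 \<partial>\<mu>)"
          using int1 int2 by (intro integral_mono pw) auto
        finally show ?thesis .
      qed
      have "c * (norm p)\<^sup>2 \<le> 2 * c * (norm p)\<^sup>2 - (C * t)\<^sup>2 * (norm p)\<^sup>2"
        using mult_right_mono[OF Ct1[OF t], of "(norm p)\<^sup>2"] by simp
      also have "2 * c * (norm p)\<^sup>2 = c1 / (2 * mass) * (c0 * (norm p)\<^sup>2)" by (simp add: c_def)
      also have "\<dots> \<le> c1 / (2 * mass) * ((\<Sum>i<m. (norm (F0T (real i / m) p))\<^sup>2) / m)"
        using c1 mass_pos m by (intro mult_left_mono c0) auto
      also have "\<dots> - (C * t)\<^sup>2 * (norm p)\<^sup>2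
        = 1 / (m * mass) * (\<Sum>i<m. c1 * (norm (F0T (real i / m) p))\<^sup>2 / 2 - (C * t)\<^sup>2 * (norm p)\<^sup>2 * mass)"
        using mpos mass_pos
        by (simp add: sum_subtractf sum_distrib_left[symmetric] sum_divide_distrib[symmetric] right_diff_distrib)
      also have "\<dots> \<le> 1 / (m * mass) * (\<Sum>i<m. \<integral>\<theta>. (p \<bullet> dirv t m (i, \<theta>))\<^sup>2 \<partial>\<mu>)"
        using mass_pos by (intro mult_left_mono sum_mono one) auto
      also have "\<dots> = (\<integral>x. (p \<bullet> dirv t m x)\<^sup>2 \<partial>dirsp m)"
        using power_mono[OF pv_le abs_ge_zero, of _ 2] meas
        by (subst integral_dirsp[OF mpos, of _ "(norm p * (C' + C))\<^sup>2"]) auto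
      finally show "c * (norm p)\<^sup>2 \<le> (\<integral>x. (p \<bullet> dirv t m x)\<^sup>2 \<partial>dirsp m)" by simp
    qed
  qed
  then show thesis using t1 by (intro that[of t1 "max 1 m0" "C' + C" c]) auto
qed

end

section \<open>Smoothing by the truncated stable part\<close>

locale ou = kalman_spherical A B S \<mu> \<alpha> + levy_semigroup M b Q \<nu> Z
  for A :: "real^'n^'n" and B :: "real^'d^'n" and S :: "nat \<Rightarrow> (real^'n) set"
    and \<mu> :: "(real^'d) measure" and \<alpha> :: real
    and M :: "'w measure" and b :: "real^'d" and Q :: "real^'d^'d" and \<nu> :: "(real^'d) measure"
    and Z :: "real \<Rightarrow> 'w \<Rightarrow> real^'d" +
  fixes r0 :: real and Y :: "real \<Rightarrow> 'w \<Rightarrow> real^'n"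
  assumes r0: "0 < r0"
    and ND: "stable_lower_bound \<nu> r0 \<alpha> \<mu>"
    and levy: "levy_process M Z"
    and convolution: "\<And>t. 0 \<le> t \<Longrightarrow> is_stoch_integral M Z (\<lambda>s. mat_exp ((t - s) *\<^sub>R A) ** B) t (Y t)"
begin

text \<open>The density \<open>r powr (- 1 - \<alpha>)\<close> lowered on each dyadic interval to
  its minimum there, the value at the right end. A constant density makes the size of a jump uniform
  on the interval, which is the form \<open>avg_iexp\<close> requires.\<close>

definition level_weight :: "real \<Rightarrow> nat \<Rightarrow> nat \<Rightarrow> real \<Rightarrow> real" where
  "level_weight e k0 j r = (\<Sum>i<j. (e / 2 ^ (k0 + i)) powr (- 1 - \<alpha>) * indicat_real {e / 2 ^ (k0 + i + 1) <.. e / 2 ^ (k0 + i)} r)"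

lemma measurable_level_weight [measurable]: "level_weight e k0 j \<in> borel_measurable borel"
  unfolding level_weight_def[abs_def] by measurable

lemma level_weight_nonneg: "0 \<le> level_weight e k0 j r"
  unfolding level_weight_def by (intro sum_nonneg) auto

lemma level_weight_le:
  assumes "0 < e"
  shows "level_weight e k0 j r \<le> (if e / 2 ^ (k0 + j) < r \<and> r \<le> e / 2 ^ k0 then 1 / r powr (1 + \<alpha>) else 0)"
proof (induction j)
  case (Suc j)
  let ?b = "e / 2 ^ (k0 + j)" and ?a = "e / 2 ^ (k0 + Suc j)"
  have ab: "?a < ?b" "0 < ?a" using assms by (auto simp: field_simps)
  have b_le: "?b \<le> e / 2 ^ k0"
    using assms by (intro divide_left_mono) (auto intro: power_increasing)
  have w: "level_weight e k0 (Suc j) r = level_weight e k0 j r + ?b powr (- 1 - \<alpha>) * indicat_real {?a <.. ?b} r"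
    by (simp add: level_weight_def)
  show ?case
  proof (cases "?a < r \<and> r \<le> ?b")
    case True
    have 1: "level_weight e k0 j r \<le> 0" using Suc True by (auto split: if_splits)
    have "r powr (1 + \<alpha>) \<le> ?b powr (1 + \<alpha>)" using True ab alpha by (intro powr_mono2) auto
    then have "1 / ?b powr (1 + \<alpha>) \<le> 1 / r powr (1 + \<alpha>)"
      using True ab order_less_trans[OF ab(2), of r] assms by (intro divide_left_mono mult_pos_pos) auto
    moreover have "?b powr (- 1 - \<alpha>) = 1 / ?b powr (1 + \<alpha>)"
      using powr_minus_divide[of ?b "1 + \<alpha>"] by simp
    moreover have "?a < r \<and> r \<le> e / 2 ^ k0" using True b_le by linarith
    ultimately show ?thesis using 1 True unfolding w by simp
  next
    case False
    then have "level_weight e k0 (Suc j) r = level_weight e k0 j r" unfolding w by auto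
    then show ?thesis using Suc False ab by (auto split: if_splits)
  qed
qed (simp add: level_weight_def)

lemma integrable_indicator_Ioc: "integrable lborel (indicat_real {a'<..b'::real})"
proof (cases "a' \<le> b'")
  case True
  then show ?thesis by (intro integrable_real_indicator) (auto simp: emeasure_lborel_Ioc)
qed simp

definition trunc :: "real \<Rightarrow> nat \<Rightarrow> nat \<Rightarrow> (real^'d) measure" where
  "trunc e k0 j = distr (density lborel (\<lambda>r. ennreal (level_weight e k0 j r)) \<Otimes>\<^sub>M \<mu>) borel (\<lambda>(r, \<theta>). r *\<^sub>R \<theta>)"

lemma measurable_polar: "(\<lambda>(r, \<theta>). r *\<^sub>R \<theta>) \<in> borel_measurable (density lborel (\<lambda>r. ennreal (level_weight e k0 j r)) \<Otimes>\<^sub>M \<mu>)"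
proof -
  have 1: "fst \<in> borel_measurable (density lborel (\<lambda>r. ennreal (level_weight e k0 j r)) \<Otimes>\<^sub>M \<mu>)"
    by (rule measurable_compose[OF measurable_fst]) simp
  have 2: "snd \<in> borel_measurable (density lborel (\<lambda>r. ennreal (level_weight e k0 j r)) \<Otimes>\<^sub>M \<mu>)"
    using measurable_compose[OF measurable_snd measurable_id_\<mu>] by simp
  show ?thesis unfolding case_prod_unfold by (intro borel_measurable_scaleR 1 2)
qed

lemma trunc_le:
  assumes e: "0 < e" "e / 2 ^ k0 < r0" and A: "C \<in> sets borel"
  shows "emeasure (trunc e k0 j) C \<le> emeasure (\<nu>_cut (e / 2 ^ (k0 + j))) C"
proof -
  let ?W = "density lborel (\<lambda>r. ennreal (level_weight e k0 j r))" and ?d = "e / 2 ^ (k0 + j)"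
  interpret \<mu>: finite_measure \<mu> by (rule finite_\<mu>)
  \<comment> \<open>The lower bound on \<nu> speaks about sets away from the origin. The part of
    \<open>C\<close> with \<open>norm z \<ge> ?d\<close> is all that the truncated measure
    charges.\<close>
  define C' where "C' = C \<inter> {z. ?d \<le> norm z} \<inter> (- {0})"
  have d0: "0 < ?d" using e by simp
  have sets\<nu>: "sets \<nu> = sets (restrict_space borel (- {0}))" using levy_measure by (simp add: levy_measure_def)
  have C'b: "C' \<in> sets borel" unfolding C'_def using A by measurable
  have C'\<nu>: "C' \<in> sets \<nu>" unfolding sets\<nu> using C'b by (subst sets_restrict_space_iff) (auto simp: C'_def)
  have "emeasure (trunc e k0 j) C = emeasure (?W \<Otimes>\<^sub>M \<mu>) ((\<lambda>(r, \<theta>). r *\<^sub>R \<theta>) -` C \<inter> space (?W \<Otimes>\<^sub>M \<mu>))"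
    unfolding trunc_def by (rule emeasure_distr[OF measurable_polar A])
  also have "\<dots> = (\<integral>\<^sup>+r. \<integral>\<^sup>+\<theta>. indicator ((\<lambda>(r, \<theta>). r *\<^sub>R \<theta>) -` C \<inter> space (?W \<Otimes>\<^sub>M \<mu>)) (r, \<theta>) \<partial>\<mu> \<partial>?W)"
    by (rule \<mu>.emeasure_pair_measure) (rule measurable_sets[OF measurable_polar A])
  also have "\<dots> = (\<integral>\<^sup>+r. \<integral>\<^sup>+\<theta>. indicator C (r *\<^sub>R \<theta>) \<partial>\<mu> \<partial>?W)"
    by (intro nn_integral_cong) (auto simp: space_pair_measure split: split_indicator)
  also have "\<dots> = (\<integral>\<^sup>+r. ennreal (level_weight e k0 j r) * (\<integral>\<^sup>+\<theta>. indicator C (r *\<^sub>R \<theta>) \<partial>\<mu>) \<partial>lborel)"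
  proof (rule nn_integral_density)
    have "(\<lambda>(r, \<theta>). indicator C (r *\<^sub>R \<theta>) :: ennreal) \<in> borel_measurable (lborel \<Otimes>\<^sub>M \<mu>)"
    proof -
      have 1: "fst \<in> borel_measurable (lborel \<Otimes>\<^sub>M \<mu>)"
        by (rule measurable_compose[OF measurable_fst]) simp
      have 2: "snd \<in> borel_measurable (lborel \<Otimes>\<^sub>M \<mu>)"
        using measurable_compose[OF measurable_snd measurable_id_\<mu>] by simp
      have "(\<lambda>x. fst x *\<^sub>R snd x) \<in> borel_measurable (lborel \<Otimes>\<^sub>M \<mu>)" by (intro borel_measurable_scaleR 1 2)
      from measurable_compose[OF this borel_measurable_indicator[OF A]]
      show ?thesis by (simp add: case_prod_unfold)
    qed
    then show "(\<lambda>r. \<integral>\<^sup>+\<theta>. indicator C (r *\<^sub>R \<theta>) \<partial>\<mu>) \<in> borel_measurable lborel"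
      by (rule \<mu>.borel_measurable_nn_integral)
  qed simp
  also have "\<dots> \<le> (\<integral>\<^sup>+r\<in>{0<..<r0}. (\<integral>\<^sup>+\<theta>. indicator C' (r *\<^sub>R \<theta>) \<partial>\<mu>) * ennreal (1 / r powr (1 + \<alpha>)) \<partial>lborel)"
  proof (rule nn_integral_mono)
    fix r :: real
    note w = level_weight_le[OF e(1), of k0 j r]
    show "ennreal (level_weight e k0 j r) * (\<integral>\<^sup>+\<theta>. indicator C (r *\<^sub>R \<theta>) \<partial>\<mu>)
      \<le> (\<integral>\<^sup>+\<theta>. indicator C' (r *\<^sub>R \<theta>) \<partial>\<mu>) * ennreal (1 / r powr (1 + \<alpha>)) * indicator {0<..<r0} r"
    proof (cases "?d < r \<and> r \<le> e / 2 ^ k0")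
      case True
      have r: "0 < r" "r < r0" using True d0 e by linarith+
      have "indicator C (r *\<^sub>R \<theta>) = (indicator C' (r *\<^sub>R \<theta>) :: ennreal)" if "\<theta> \<in> space \<mu>" for \<theta>
        using that True r by (auto simp: C'_def space_\<mu> split: split_indicator)
      then have "(\<integral>\<^sup>+\<theta>. indicator C (r *\<^sub>R \<theta>) \<partial>\<mu>) = (\<integral>\<^sup>+\<theta>. indicator C' (r *\<^sub>R \<theta>) \<partial>\<mu>)"
        by (rule nn_integral_cong)
      moreover have "ennreal (level_weight e k0 j r) \<le> ennreal (1 / r powr (1 + \<alpha>))"
        using w True by (intro ennreal_leI) simp
      ultimately have "ennreal (level_weight e k0 j r) * (\<integral>\<^sup>+\<theta>. indicator C (r *\<^sub>R \<theta>) \<partial>\<mu>)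
        \<le> ennreal (1 / r powr (1 + \<alpha>)) * (\<integral>\<^sup>+\<theta>. indicator C' (r *\<^sub>R \<theta>) \<partial>\<mu>)"
        by (simp only:) (rule mult_right_mono, auto)
      then show ?thesis using r by (simp add: mult.commute)
    next
      case False
      then have "level_weight e k0 j r = 0" using w level_weight_nonneg[of e k0 j r] by auto
      then show ?thesis by simp
    qed
  qed
  also have "\<dots> \<le> emeasure \<nu> C'" using ND C'\<nu> unfolding stable_lower_bound_def by blast
  also have "\<dots> = emeasure \<nu>' C'"
  proof -
    have "space \<nu> = - {0}" using sets_eq_imp_space_eq[OF sets\<nu>] by (simp add: space_restrict_space)
    then have "(\<lambda>z. z) -` C' \<inter> space \<nu> = C'" by (auto simp: C'_def)
    then show ?thesis unfolding \<nu>'_def by (subst emeasure_distr) (auto simp: C'b)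
  qed
  also have "\<dots> \<le> emeasure (\<nu>_cut ?d) C"
    unfolding \<nu>_cut_def using A C'b
    by (subst emeasure_density)
      (auto simp: nn_integral_indicator[symmetric] C'_def simp del: nn_integral_indicator
        intro!: measurable_\<nu>'I nn_integral_mono split: split_indicator)
  finally show ?thesis .
qed

lemma finite_level: "finite_measure (density lborel (\<lambda>r. ennreal (level_weight e k0 j r)))"
proof (rule finite_measureI)
  have int: "integrable lborel (level_weight e k0 j)"
    unfolding level_weight_def[abs_def] 
    by (intro Bochner_Integration.integrable_sum integrable_mult_right integrable_indicator_Ioc)
  have "emeasure (density lborel (\<lambda>r. ennreal (level_weight e k0 j r))) UNIV = (\<integral>\<^sup>+r. ennreal (level_weight e k0 j r) \<partial>lborel)"
    by (simp add: emeasure_density)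
  also have "\<dots> = ennreal (integral\<^sup>L lborel (level_weight e k0 j))"
    by (rule nn_integral_eq_integral[OF int]) (simp add: level_weight_nonneg)
  finally show "emeasure (density lborel (\<lambda>r. ennreal (level_weight e k0 j r))) (space (density lborel (\<lambda>r. ennreal (level_weight e k0 j r)))) \<noteq> \<infinity>"
    by simp
qed

lemma integral_trunc:
  assumes e: "0 < e"
  shows "(\<integral>z. 1 - iexp (q \<bullet> z) \<partial>trunc e k0 j)
    = (\<Sum>i<j. complex_of_real ((e / 2 ^ (k0 + i)) powr (- 1 - \<alpha>) * (e / 2 ^ (k0 + i) - e / 2 ^ (k0 + i + 1)))
        * (\<integral>\<theta>. 1 - avg_iexp (e / 2 ^ (k0 + i + 1)) (e / 2 ^ (k0 + i)) (q \<bullet> \<theta>) \<partial>\<mu>))"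
proof -
  let ?W = "density lborel (\<lambda>r. ennreal (level_weight e k0 j r))"
  let ?f = "\<lambda>r \<theta>. 1 - iexp (q \<bullet> (r *\<^sub>R \<theta>))"
  interpret \<mu>: finite_measure \<mu> by (rule finite_\<mu>)
  interpret W: finite_measure ?W by (rule finite_level)
  interpret pair_sigma_finite ?W \<mu> ..
  interpret WM: finite_measure "?W \<Otimes>\<^sub>M \<mu>" by (rule finite_measure_pair_measure) (rule W.finite_measure_axioms \<mu>.finite_measure_axioms)+
  have le2: "cmod (1 - iexp y) \<le> 2" for y by (rule order_trans[OF norm_triangle_ineq4]) simp
  have ab: "e / 2 ^ (k0 + i + 1) < e / 2 ^ (k0 + i)" for i using e by (simp add: field_simps)
  have meas: "(\<lambda>(r, \<theta>). ?f r \<theta>) \<in> borel_measurable (?W \<Otimes>\<^sub>M \<mu>)"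
  proof -
    have "(\<lambda>z. 1 - iexp (q \<bullet> z)) \<in> borel_measurable borel" by measurable
    from measurable_compose[OF measurable_polar this] show ?thesis by (simp add: case_prod_unfold)
  qed
  have int: "integrable (?W \<Otimes>\<^sub>M \<mu>) (\<lambda>(r, \<theta>). ?f r \<theta>)"
  proof (rule WM.integrable_const_bound[of _ 2])
    show "AE x in ?W \<Otimes>\<^sub>M \<mu>. cmod (case x of (r, \<theta>) \<Rightarrow> ?f r \<theta>) \<le> 2"
      by (intro AE_I2) (simp only: case_prod_unfold le2)
  qed (rule meas)
  have inner: "(\<integral>r. ?f r \<theta> \<partial>?W) = (\<Sum>i<j. complex_of_real ((e / 2 ^ (k0 + i)) powr (- 1 - \<alpha>) * (e / 2 ^ (k0 + i) - e / 2 ^ (k0 + i + 1)))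
        * (1 - avg_iexp (e / 2 ^ (k0 + i + 1)) (e / 2 ^ (k0 + i)) (q \<bullet> \<theta>)))" for \<theta>
  proof -
    have i: "integrable lborel (\<lambda>r. indicat_real {a<..b} r *\<^sub>R (1 - iexp (y * r)))" if "a < b" for a b y :: real
    proof (rule Bochner_Integration.integrable_bound)
      show "integrable lborel (\<lambda>r. 2 * indicat_real {a<..b} r)"
        by (intro integrable_mult_right integrable_indicator_Ioc)
    qed (auto split: split_indicator simp: le2[of "y * _", simplified])
    have "(\<integral>r. ?f r \<theta> \<partial>?W) = (\<integral>r. level_weight e k0 j r *\<^sub>R ?f r \<theta> \<partial>lborel)"
      by (rule integral_density) (auto simp: level_weight_nonneg)
    also have "\<dots> = (\<integral>r. (\<Sum>i<j. (e / 2 ^ (k0 + i)) powr (- 1 - \<alpha>) *\<^sub>R (indicat_real {e / 2 ^ (k0 + i + 1) <.. e / 2 ^ (k0 + i)} r *\<^sub>R (1 - iexp ((q \<bullet> \<theta>) * r)))) \<partial>lborel)"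
      unfolding level_weight_def
      by (simp only: scaleR_sum_left scaleR_scaleR inner_scaleR_right mult.commute[of "q \<bullet> \<theta>"])
    also have "\<dots> = (\<Sum>i<j. (e / 2 ^ (k0 + i)) powr (- 1 - \<alpha>) *\<^sub>R (\<integral>r. indicat_real {e / 2 ^ (k0 + i + 1) <.. e / 2 ^ (k0 + i)} r *\<^sub>R (1 - iexp ((q \<bullet> \<theta>) * r)) \<partial>lborel))"
      by (subst Bochner_Integration.integral_sum)
        (intro integrable_scaleR_right i ab, simp only: integral_scaleR_right)
    also have "\<dots> = (\<Sum>i<j. complex_of_real ((e / 2 ^ (k0 + i)) powr (- 1 - \<alpha>) * (e / 2 ^ (k0 + i) - e / 2 ^ (k0 + i + 1)))
        * (1 - avg_iexp (e / 2 ^ (k0 + i + 1)) (e / 2 ^ (k0 + i)) (q \<bullet> \<theta>)))"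
      unfolding integral_interval_iexp[OF ab] by (simp only: scaleR_conv_of_real of_real_mult mult.assoc)
    finally show ?thesis .
  qed
  have int\<mu>: "integrable \<mu> (\<lambda>\<theta>. 1 - avg_iexp (e / 2 ^ (k0 + i + 1)) (e / 2 ^ (k0 + i)) (q \<bullet> \<theta>))" for i
  proof (rule \<mu>.integrable_const_bound[of _ 2])
    show "AE \<theta> in \<mu>. cmod (1 - avg_iexp (e / 2 ^ (k0 + i + 1)) (e / 2 ^ (k0 + i)) (q \<bullet> \<theta>)) \<le> 2"
      using norm_avg_iexp_le[OF ab] by (intro AE_I2 order_trans[OF norm_triangle_ineq4]) (simp add: add_mono[of 1 1 _ 1, simplified])
    note [measurable] = measurable_avg_iexp[OF ab]
    show "(\<lambda>\<theta>. 1 - avg_iexp (e / 2 ^ (k0 + i + 1)) (e / 2 ^ (k0 + i)) (q \<bullet> \<theta>)) \<in> borel_measurable \<mu>"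
      by (intro measurable_\<mu>I) measurable
  qed
  have "(\<integral>z. 1 - iexp (q \<bullet> z) \<partial>trunc e k0 j) = (\<integral>x. (case x of (r, \<theta>) \<Rightarrow> ?f r \<theta>) \<partial>(?W \<Otimes>\<^sub>M \<mu>))"
    unfolding trunc_def by (subst integral_distr[OF measurable_polar]) (auto simp: case_prod_unfold)
  also have "\<dots> = (\<integral>\<theta>. (\<integral>r. ?f r \<theta> \<partial>?W) \<partial>\<mu>)"
    using integral_snd[OF int] by simp
  also have "\<dots> = (\<Sum>i<j. complex_of_real ((e / 2 ^ (k0 + i)) powr (- 1 - \<alpha>) * (e / 2 ^ (k0 + i) - e / 2 ^ (k0 + i + 1)))
        * (\<integral>\<theta>. 1 - avg_iexp (e / 2 ^ (k0 + i + 1)) (e / 2 ^ (k0 + i)) (q \<bullet> \<theta>) \<partial>\<mu>))"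
    unfolding inner
    by (subst Bochner_Integration.integral_sum) (intro integrable_mult_right int\<mu>, simp only: integral_mult_right_zero)
  finally show ?thesis .
qed

definition pull :: "real \<Rightarrow> real^'n \<Rightarrow> real^'d" where
  "pull s p = transpose B *v (transpose (mat_exp (- s *\<^sub>R A)) *v p)"

lemma inner_pull: "pull s p \<bullet> u = p \<bullet> mexp A (- s) (B *v u)"
  unfolding pull_def inner_transpose mexp_def by simp

text \<open>Characteristic function at \<open>p\<close> of the Riemann sum of e^(-sA) B against the
  noise on a uniform grid with \<open>m\<close> cells. The factor e^(tA) of the stochastic
  convolution is split off and reappears as \<open>pT\<close>.\<close>

definition grid_char :: "real \<Rightarrow> nat \<Rightarrow> real^'n \<Rightarrow> complex" where
  "grid_char t m p = (\<Prod>i<m. exp (- (complex_of_real (t / real m) * levy_symbol b Q \<nu> (pull (t * (real i / real m)) p))))"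

text \<open>The size of jump that occurs about once in time \<open>t\<close> under an
  \<alpha>-stable noise.\<close>

definition eps :: "real \<Rightarrow> real" where "eps t = t powr (1 / \<alpha>)"

text \<open>Inverse of the natural scaling: in time \<open>t\<close>, jumps of size
  \<open>eps t\<close> displace the component in \<open>E h\<close> by about
  \<open>eps t * t ^ (h - 1)\<close>.\<close>

definition dlinv :: "real \<Rightarrow> real^'n \<Rightarrow> real^'n" where
  "dlinv t = dil (\<lambda>h. 1 / (eps t * t ^ (h - 1)))"

lemma bdd_pull:
  assumes "bdd m C"
  shows "bdd (\<lambda>p. m (pull s p)) C"
proof (rule bdd_comp[OF assms, of "pull s" "\<lambda>u. mexp A (- s) (B *v u)"])
  show "linear (\<lambda>u. mexp A (- s) (B *v u))"
    using linear_compose[OF matrix_vector_mul_linear[of B] linear_mexp[of A "- s"]] by (simp add: comp_def)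
qed (rule inner_pull)

lemma pull_dlinv: "pull (t * s) (dlinv t p) \<bullet> u = (p \<bullet> F t s u) / eps t"
proof -
  have "dlinv t x = (1 / eps t) *\<^sub>R dil (\<lambda>h. 1 / t ^ (h - 1)) x" for x
    by (simp add: dlinv_def dil_def scaleR_sum_right)
  moreover have "dlinv t p \<bullet> x = p \<bullet> dlinv t x" for x unfolding dlinv_def by (rule dil_adjoint)
  ultimately show ?thesis by (simp add: inner_pull F_def)
qed

text \<open>The truncated stable measure is split off at every grid point; what remains is
  contractive by \<open>bdd_levy_minus\<close>. In the scaled coordinates jumps of size
  \<open>eps t / 2 ^ k\<close> become jumps of size \<open>1 / 2 ^ k\<close>, and the sums over grid
  points and directions combine into \<open>jump_char\<close>.\<close>

lemma grid_factorization:
  assumes t: "0 < t" and m: "0 < m" and e: "eps t / 2 ^ k0 < r0"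
    and J: "jump_directions (dirsp m) (dirv t m) R c"
  defines "l \<equiv> \<lambda>k. mass * (2 ^ k) powr \<alpha> / 6"
  obtains m0 where "bdd m0 1"
    "\<And>p. grid_char t m (dlinv t p) = m0 p * jump_directions.dyadic_char (dirsp m) (dirv t m) l k0 j p ^ 3"
proof
  interpret J: jump_directions "dirsp m" "dirv t m" R c by fact
  interpret \<mu>: finite_measure \<mu> by (rule finite_\<mu>)
  have epos: "0 < eps t" using t by (simp add: eps_def)
  let ?N = "trunc (eps t) k0 j"
  let ?I = "\<lambda>q. \<integral>z. 1 - iexp (q \<bullet> z) \<partial>?N"
  define m1 where "m1 q = exp (- (complex_of_real (t / m) * (levy_symbol b Q \<nu> q - ?I q)))" for q
  have m1: "bdd m1 1" unfolding m1_def
  proof (rule bdd_levy_minus)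
    show "sets ?N = sets borel" by (simp add: trunc_def)
    show "0 < eps t / 2 ^ (k0 + j)" using epos by simp
    show "0 \<le> t / m" using t by simp
  qed (rule trunc_le[OF epos e])
  show "bdd (\<lambda>p. \<Prod>i<m. m1 (pull (t * (real i / real m)) (dlinv t p))) 1"
  proof (intro bdd_prod)
    fix i assume "i \<in> {..<m}"
    show "bdd (\<lambda>p. m1 (pull (t * (real i / real m)) (dlinv t p))) 1"
      by (rule bdd_comp[OF bdd_pull[OF m1], of "dlinv t" "dlinv t"]) (simp_all add: dlinv_def dil_adjoint linear_dil)
  qed
  fix p
  have ab: "1 / 2 ^ (k + 1) < (1 / 2 ^ k :: real)" for k :: nat by (simp add: field_simps)
  let ?avg = "\<lambda>k. avg_iexp (1 / 2 ^ (k + 1)) (1 / 2 ^ k)"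
  have int: "integrable \<mu> (\<lambda>\<theta>. ?avg k (p \<bullet> dirv t m (i, \<theta>)))" for i k
  proof (rule \<mu>.integrable_const_bound[of _ 1])
    have "(\<lambda>\<theta>. dirv t m (i, \<theta>)) \<in> borel_measurable \<mu>"
      by (intro measurable_\<mu>I, simp only: dirv_def prod.case) measurable
    moreover note measurable_avg_iexp[OF ab, measurable]
    ultimately show "(\<lambda>\<theta>. ?avg k (p \<bullet> dirv t m (i, \<theta>))) \<in> borel_measurable \<mu>" by measurable
  qed (intro AE_I2 norm_avg_iexp_le[OF ab])
  have avg: "(\<Sum>i<m. \<integral>\<theta>. 1 - ?avg k (p \<bullet> dirv t m (i, \<theta>)) \<partial>\<mu>) = complex_of_real (m * mass) * (1 - J.jump_char (1 / 2 ^ (k + 1)) (1 / 2 ^ k) p)" for k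
  proof -
    have "J.jump_char (1 / 2 ^ (k + 1)) (1 / 2 ^ k) p = (1 / (m * mass)) *\<^sub>R (\<Sum>i<m. \<integral>\<theta>. ?avg k (p \<bullet> dirv t m (i, \<theta>)) \<partial>\<mu>)"
      unfolding J.jump_char_def
    proof (rule integral_dirsp[OF m, of _ 1])
      note measurable_avg_iexp[OF ab, measurable]
      show "(\<lambda>\<omega>. ?avg k (p \<bullet> dirv t m \<omega>)) \<in> borel_measurable (dirsp m)" by measurable
    qed (rule norm_avg_iexp_le[OF ab])
    then have "(\<Sum>i<m. \<integral>\<theta>. ?avg k (p \<bullet> dirv t m (i, \<theta>)) \<partial>\<mu>) = complex_of_real (m * mass) * J.jump_char (1 / 2 ^ (k + 1)) (1 / 2 ^ k) p"
      using m mass_pos by (simp add: scaleR_conv_of_real)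
    moreover have "(\<integral>\<theta>. 1 - ?avg k (p \<bullet> dirv t m (i, \<theta>)) \<partial>\<mu>) = complex_of_real mass - (\<integral>\<theta>. ?avg k (p \<bullet> dirv t m (i, \<theta>)) \<partial>\<mu>)" for i
      using int by (subst Bochner_Integration.integral_diff) (auto simp: mass_def scaleR_conv_of_real)
    ultimately show ?thesis by (simp only: sum_subtractf) (simp add: right_diff_distrib)
  qed
  have I_eq: "?I (pull (t * (real i / real m)) (dlinv t p)) = (\<Sum>k<j. complex_of_real ((eps t / 2 ^ (k0 + k)) powr (- 1 - \<alpha>) * (eps t / 2 ^ (k0 + k) - eps t / 2 ^ (k0 + k + 1)))
        * (\<integral>\<theta>. 1 - ?avg (k0 + k) (p \<bullet> dirv t m (i, \<theta>)) \<partial>\<mu>))" if i: "i < m" for i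
    unfolding integral_trunc[OF epos]
  proof (intro sum.cong refl arg_cong2[of _ _ _ _ "(*)"] Bochner_Integration.integral_cong)
    fix k \<theta> assume "\<theta> \<in> space \<mu>"
    then have "norm \<theta> = 1" by (simp add: space_\<mu>)
    then have "p \<bullet> dirv t m (i, \<theta>) = eps t * (pull (t * (real i / real m)) (dlinv t p) \<bullet> \<theta>)"
      using i epos unfolding pull_dlinv by (simp add: dirv_def)
    then show "1 - avg_iexp (eps t / 2 ^ (k0 + k + 1)) (eps t / 2 ^ (k0 + k)) (pull (t * (real i / real m)) (dlinv t p) \<bullet> \<theta>)
      = 1 - ?avg (k0 + k) (p \<bullet> dirv t m (i, \<theta>))"
      using avg_iexp_scale[OF ab[of "k0 + k"] epos] by (simp add: mult.commute)
  qed
  \<comment> \<open>Since \<open>eps t powr \<alpha> = t\<close>, the time cancels and the scale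
    \<open>k\<close> has total intensity \<open>mass * (2 ^ k) powr \<alpha> / 2\<close>. The factor
    1/6 in \<open>l\<close> splits it into three equal copies, one for each possible
    derivative.\<close>
  have coef: "t / m * ((eps t / 2 ^ k) powr (- 1 - \<alpha>) * (eps t / 2 ^ k - eps t / 2 ^ (k + 1))) * (m * mass) = 3 * l k" for k
  proof -
    let ?b = "eps t / 2 ^ k"
    have bpos: "0 < ?b" using epos by simp
    have "?b - eps t / 2 ^ (k + 1) = ?b / 2" by (simp add: field_simps)
    moreover have "?b powr (- 1 - \<alpha>) * ?b = ?b powr (- \<alpha>)"
    proof -
      have "?b powr (- 1 - \<alpha>) * ?b powr 1 = ?b powr (- \<alpha>)" unfolding powr_add[symmetric] by simp
      then show ?thesis unfolding powr_one[OF less_imp_le[OF bpos]] .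
    qed
    moreover have "?b powr (- \<alpha>) = (2 ^ k) powr \<alpha> / t"
    proof -
      have "?b powr \<alpha> = t / (2 ^ k) powr \<alpha>"
        using t epos alpha by (simp add: powr_divide eps_def powr_powr)
      then show ?thesis by (simp add: powr_minus_divide)
    qed
    ultimately have "(eps t / 2 ^ k) powr (- 1 - \<alpha>) * (eps t / 2 ^ k - eps t / 2 ^ (k + 1)) = (2 ^ k) powr \<alpha> / t / 2"
      by simp
    then show ?thesis using t m unfolding l_def by simp
  qed
  have key: "(\<Sum>i<m. complex_of_real (t / m) * ?I (pull (t * (real i / real m)) (dlinv t p)))
    = - 3 * (\<Sum>k<j. complex_of_real (l (k0 + k)) * (J.jump_char (1 / 2 ^ (k0 + k + 1)) (1 / 2 ^ (k0 + k)) p - 1))"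
  proof -
    let ?c = "\<lambda>k. (eps t / 2 ^ (k0 + k)) powr (- 1 - \<alpha>) * (eps t / 2 ^ (k0 + k) - eps t / 2 ^ (k0 + k + 1))"
    have "(\<Sum>i<m. complex_of_real (t / m) * ?I (pull (t * (real i / real m)) (dlinv t p)))
      = (\<Sum>i<m. \<Sum>k<j. complex_of_real (t / m * ?c k) * (\<integral>\<theta>. 1 - ?avg (k0 + k) (p \<bullet> dirv t m (i, \<theta>)) \<partial>\<mu>))"
      by (intro sum.cong refl) (simp only: I_eq lessThan_iff sum_distrib_left of_real_mult mult.assoc)
    also have "\<dots> = (\<Sum>k<j. complex_of_real (t / m * ?c k) * (\<Sum>i<m. \<integral>\<theta>. 1 - ?avg (k0 + k) (p \<bullet> dirv t m (i, \<theta>)) \<partial>\<mu>))"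
      by (subst sum.swap) (simp only: sum_distrib_left)
    also have "\<dots> = (\<Sum>k<j. complex_of_real (t / m * ?c k * (m * mass)) * (1 - J.jump_char (1 / 2 ^ (k0 + k + 1)) (1 / 2 ^ (k0 + k)) p))"
      unfolding avg by (simp only: of_real_mult mult.assoc)
    also have "\<dots> = (\<Sum>k<j. complex_of_real (3 * l (k0 + k)) * (1 - J.jump_char (1 / 2 ^ (k0 + k + 1)) (1 / 2 ^ (k0 + k)) p))"
      by (simp only: coef)
    finally show ?thesis by (simp add: sum_distrib_left sum_negf[symmetric] algebra_simps)
  qed
  have "grid_char t m (dlinv t p) = (\<Prod>i<m. m1 (pull (t * (real i / real m)) (dlinv t p))) * exp (- (\<Sum>i<m. complex_of_real (t / m) * ?I (pull (t * (real i / real m)) (dlinv t p))))"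
    unfolding grid_char_def m1_def exp_sum[OF finite_lessThan, symmetric] exp_add[symmetric]
    by (simp add: sum_negf[symmetric] sum.distrib[symmetric] algebra_simps)
  also have "exp (- (\<Sum>i<m. complex_of_real (t / m) * ?I (pull (t * (real i / real m)) (dlinv t p)))) = J.dyadic_char l k0 j p ^ 3"
    unfolding key J.dyadic_char_def exp_sum[OF finite_lessThan, symmetric] exp_of_nat_mult[symmetric] by simp
  finally show "grid_char t m (dlinv t p) = (\<Prod>i<m. m1 (pull (t * (real i / real m)) (dlinv t p))) * J.dyadic_char l k0 j p ^ 3" .
qed

end

section \<open>Finite differences\<close>

definition diff1 :: "'a::ab_group_add \<Rightarrow> ('a \<Rightarrow> 'b::ab_group_add) \<Rightarrow> 'a \<Rightarrow> 'b" where
  "diff1 z f x = f (x + z) - f x"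

text \<open>From here on \<open>diffs\<close> means iterated finite differences and hides the
  operation on coefficients of power series used in \<open>inner_mexp_deriv\<close>.\<close>

primrec diffs :: "'a::ab_group_add list \<Rightarrow> ('a \<Rightarrow> 'b::ab_group_add) \<Rightarrow> 'a \<Rightarrow> 'b" where
  "diffs [] f = f"
| "diffs (z # zs) f = diff1 z (diffs zs f)"

lemma tp_diffs: "diffs zs (tp xs) x = tp (mult (\<lambda>p. \<Prod>z\<leftarrow>zs. (iexp (p \<bullet> z) - 1)) xs) x"
proof (induction zs arbitrary: x)
  case (Cons z zs)
  show ?case
    using tp_mult_shift[of z "mult (\<lambda>p. \<Prod>z\<leftarrow>zs. (iexp (p \<bullet> z) - 1)) xs" x]
    by (simp add: diff1_def Cons mult_mult left_diff_distrib tp_mult_diff)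
qed simp

text \<open>A difference is the average of the derivative over the segment. As this average is a
  contraction, bounds on derivatives pass to differences with the same constant.\<close>

lemma iexp_minus_1: "iexp (p \<bullet> z) - 1 = dirm z p * avg_iexp 0 1 (p \<bullet> z)"
  using avg_iexp_FTC[of 0 1 "p \<bullet> z"] by (simp add: dirm_def)

lemma prod_iexp_minus_1:
  "(\<Prod>z\<leftarrow>zs. (iexp (p \<bullet> z) - 1)) = dirs zs p * (\<Prod>z\<leftarrow>zs. avg_iexp 0 1 (p \<bullet> z))"
  by (induction zs) (simp_all add: iexp_minus_1)

lemma bdd_prod_avg: "bdd (\<lambda>p. \<Prod>z\<leftarrow>zs. avg_iexp 0 1 (p \<bullet> z)) 1"
proof (induction zs)
  case (Cons z zs)
  have "bdd (\<lambda>p. avg_iexp 0 1 (p \<bullet> z) * (\<Prod>z\<leftarrow>zs. avg_iexp 0 1 (p \<bullet> z))) (1 * 1)"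
    by (intro bdd_mult avg_iexp_bdd Cons) simp
  then show ?case by simp
qed (simp add: bdd_one)

lemma diffs_tendsto:
  assumes "\<And>x. ((\<lambda>n. f n x) \<longlongrightarrow> (g x :: 'b::real_normed_vector)) F"
  shows "((\<lambda>n. diffs zs (f n) x) \<longlongrightarrow> diffs zs g x) F"
  by (induction zs arbitrary: x) (auto simp: diff1_def intro!: tendsto_intros assms)

section \<open>Approximation by trigonometric polynomials\<close>

definition trig :: "('a::real_inner \<Rightarrow> real) \<Rightarrow> bool" where
  "trig f \<longleftrightarrow> (\<exists>xs. \<forall>x. complex_of_real (f x) = tp xs x)"

lemma tp_times: "tp xs x * tp ys x = tp (concat (map (\<lambda>(c, p). map (\<lambda>(d, q). (c * d, p + q)) ys) xs)) x"
proof (induction xs)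
  case (Cons a xs)
  have "tp (map (\<lambda>(d, q). (fst a * d, snd a + q)) ys) x = fst a * iexp (snd a \<bullet> x) * tp ys x"
    by (induction ys) (auto simp: algebra_simps inner_add_left exp_add)
  with Cons show ?case by (simp add: case_prod_unfold distrib_right)
qed simp

lemma trig_const: "trig (\<lambda>_. c)"
  unfolding trig_def by (rule exI[of _ "[(complex_of_real c, 0)]"]) simp

lemma trig_add: "trig f \<Longrightarrow> trig g \<Longrightarrow> trig (\<lambda>x. f x + g x)"
  unfolding trig_def by (metis of_real_add tp_append)

lemma trig_mult:
  assumes "trig f" "trig g"
  shows "trig (\<lambda>x. f x * g x)"
proof -
  obtain xs ys where "\<And>x. complex_of_real (f x) = tp xs x" "\<And>x. complex_of_real (g x) = tp ys x"
    using assms unfolding trig_def by blast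
  then have "complex_of_real (f x * g x) = tp xs x * tp ys x" for x by simp
  then show ?thesis unfolding trig_def tp_times by blast
qed

lemma trig_sin: "trig (\<lambda>x. sin (p \<bullet> x + c))"
proof -
  have c: "complex_of_real (sin y) = - \<i> / 2 * iexp y + \<i> / 2 * iexp (- y)" for y
    unfolding sin_of_real[symmetric] sin_exp_eq by (simp add: field_simps)
  have "complex_of_real (sin (p \<bullet> x + c)) = tp [(- \<i> / 2 * iexp c, p), (\<i> / 2 * iexp (- c), - p)] x" for x
  proof -
    have "iexp (p \<bullet> x + c) = iexp c * iexp (p \<bullet> x)" "iexp (- (p \<bullet> x + c)) = iexp (- c) * iexp (- p \<bullet> x)"
      unfolding exp_add[symmetric] by (simp_all add: algebra_simps)
    then show ?thesis unfolding c by (simp only: tp_Cons tp_Nil fst_conv snd_conv mult.assoc add_0_right)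
  qed
  then show ?thesis unfolding trig_def by blast
qed

lemma trig_bounded: "trig f \<Longrightarrow> \<exists>B. \<forall>x. \<bar>f x\<bar> \<le> B"
  unfolding trig_def using norm_tp_le by (metis norm_of_real)

lemma trig_continuous: "trig f \<Longrightarrow> continuous_on X f"
proof -
  assume "trig f"
  then obtain xs where xs: "\<And>x. complex_of_real (f x) = tp xs x" unfolding trig_def by blast
  have "continuous_on X (tp xs)" by (induction xs) (auto intro!: continuous_intros)
  then have "continuous_on X (\<lambda>x. Re (tp xs x))" by (intro continuous_intros)
  moreover have "Re (tp xs x) = f x" for x by (simp flip: xs)
  ultimately show ?thesis by simp
qed

lemma trig_polynomial:
  assumes "real_polynomial_function g" and f: "trig f"
  shows "trig (\<lambda>x. g (f x :: real))"
  using assms(1)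
proof (induction rule: real_polynomial_function.induct)
  case (linear g)
  interpret bounded_linear g by fact
  have "g (f x) = g 1 * f x" for x using scaleR[of "f x" 1] by simp
  then show ?case using trig_mult[OF trig_const[of "g 1"] f] by simp
qed (auto intro: trig_const trig_add trig_mult)

text \<open>The Stone-Weierstrass theorem on a ball gives no control outside of it. Composition with
  a polynomial that approximates the truncation to \<open>[- K, K]\<close> on the whole range of the
  first approximant restores a global bound, and a polynomial in a trigonometric polynomial is again
  one.\<close>

lemma trig_approx_ball:
  fixes \<phi> :: "'a::euclidean_space \<Rightarrow> real"
  assumes cont: "continuous_on UNIV \<phi>" and K: "\<And>x. \<bar>\<phi> x\<bar> \<le> K" and e: "0 < e"
  obtains f where "trig f" "\<And>x. \<bar>f x\<bar> \<le> K + e" "\<And>x. norm x \<le> r \<Longrightarrow> \<bar>f x - \<phi> x\<bar> \<le> e"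
proof -
  interpret function_ring_on "Collect trig" "cball (0::'a) r"
  proof
    fix x y :: 'a assume "x \<noteq> y"
    \<comment> \<open>Normalised to \<open>p \<bullet> (x - y) = 1\<close>, so that the sine
      separates the points with the values \<open>sin 1\<close> and 0.\<close>
    define p where "p = (x - y) /\<^sub>R (norm (x - y))\<^sup>2"
    have "p \<bullet> (x - y) = 1"
      using \<open>x \<noteq> y\<close> by (simp add: p_def power2_norm_eq_inner[symmetric])
    then have "sin (p \<bullet> x + - (p \<bullet> y)) = sin 1" "sin (p \<bullet> y + - (p \<bullet> y)) = 0"
      by (simp_all add: inner_diff_right)
    moreover have "0 < sin (1::real)" using pi_gt3 by (intro sin_gt_zero) auto
    ultimately show "\<exists>f\<in>Collect trig. f x \<noteq> f y"
      by (intro bexI[of _ "\<lambda>z. sin (p \<bullet> z + - (p \<bullet> y))"]) (auto simp only: mem_Collect_eq trig_sin)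
  qed (auto intro: trig_continuous trig_add trig_mult trig_const)
  have K0: "0 \<le> K" using K[of 0] by linarith
  have "continuous_on (cball 0 r) \<phi>" using cont continuous_on_subset by blast
  then obtain t where t: "trig t" "\<And>x. norm x \<le> r \<Longrightarrow> \<bar>\<phi> x - t x\<bar> < e / 2"
    using Stone_Weierstrass_basic[of \<phi> "e / 2"] e by auto
  obtain B where B: "\<And>x. \<bar>t x\<bar> \<le> B" using trig_bounded[OF t(1)] by blast
  define clip where "clip s = max (- K) (min K s)" for s :: real
  have clip: "\<bar>clip s\<bar> \<le> K" "\<bar>clip s - clip s'\<bar> \<le> \<bar>s - s'\<bar>" "\<bar>s\<bar> \<le> K \<Longrightarrow> clip s = s" for s s'
    using K0 by (auto simp: clip_def)
  have "continuous_on {-B..B} clip" unfolding clip_def by (intro continuous_intros)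
  then obtain g where g: "real_polynomial_function g" "\<And>s. s \<in> {-B..B} \<Longrightarrow> \<bar>clip s - g s\<bar> < e / 2"
    by (rule Stone_Weierstrass_real_polynomial_function[OF compact_Icc, of "-B" B clip "e / 2"]) (use e in auto)
  have g': "\<bar>clip (t x) - g (t x)\<bar> < e / 2" for x using B[of x] by (intro g) (simp add: abs_le_iff)
  show thesis
  proof (rule that)
    show "trig (\<lambda>x. g (t x))" by (rule trig_polynomial[OF g(1) t(1)])
    show "\<bar>g (t x)\<bar> \<le> K + e" for x using g'[of x] clip(1)[of "t x"] e by linarith
    show "\<bar>g (t x) - \<phi> x\<bar> \<le> e" if "norm x \<le> r" for x
      using g'[of x] clip(2)[of "t x" "\<phi> x"] clip(3)[OF K[of x]] t(2)[OF that] by linarith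
  qed
qed

section \<open>Smoothing by the semigroup\<close>

context ou
begin

lemma eps_pos: "0 < t \<Longrightarrow> 0 < eps t"
  by (simp add: eps_def)

lemma eps_le_1: "0 < t \<Longrightarrow> t \<le> 1 \<Longrightarrow> eps t \<le> 1"
  using alpha by (simp add: eps_def powr_le1)

text \<open>\<open>R\<close> and \<open>c\<close> are uniform in \<open>t\<close> and
  \<open>m\<close>; they determine the number \<open>n\<close> of jumps, \<open>n\<close> determines
  the intensity \<open>l0\<close>, and this in turn the coarsest scale \<open>k0\<close> that is
  used. So the final constant is uniform as well.\<close>

lemma grid_smoothing:
  obtains C t1 :: real and m0 :: nat where "0 \<le> C" "0 < t1" "t1 \<le> 1" "0 < m0"
    "\<And>t m zs xs K x. 0 < t \<Longrightarrow> t \<le> t1 \<Longrightarrow> m0 \<le> m \<Longrightarrow> length zs \<le> 3 \<Longrightarrow> (\<And>y. cmod (tp xs y) \<le> K) \<Longrightarrow>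
      cmod (tp (mult (\<lambda>p. dirs zs p * grid_char t m p) xs) x) \<le> (\<Prod>z\<leftarrow>zs. C * norm (dlinv t z)) * K"
proof -
  obtain R c t1 :: real and m0 :: nat where t1: "0 < t1" "t1 \<le> 1" "0 < m0"
    and J: "\<And>t m. 0 < t \<Longrightarrow> t \<le> t1 \<Longrightarrow> m0 \<le> m \<Longrightarrow> jump_directions (dirsp m) (dirv t m) R c"
    by (rule jump_directions_uniform) blast
  have c: "0 < c" using jump_directions.c_pos[OF J[of t1 m0]] t1 by simp
  have R: "0 \<le> R" using jump_directions.R_nonneg[OF J[of t1 m0]] t1 by simp
  obtain n :: nat where n: "(8 * R\<^sup>2 / c)\<^sup>2 < n" using reals_Archimedean2 by blast
  have n0: "0 < n" using n zero_le_power2[of "8 * R\<^sup>2 / c"] by (cases n) auto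
  have "8 * R\<^sup>2 / c < sqrt n" using n c R by (intro real_less_rsqrt) auto
  then have n1: "R\<^sup>2 / (c * sqrt n) \<le> 1/8" using c n0 by (simp add: field_simps)
  obtain l0 where l0: "0 \<le> l0" "\<And>l. l0 \<le> l \<Longrightarrow> exp (- l) * (\<Sum>j<n. l ^ j / fact j) \<le> (1/8 :: real)"
    using poisson_head_small[of n] by blast
  define l where "l = (\<lambda>k::nat. mass * (2 ^ k) powr \<alpha> / 6)"
  \<comment> \<open>From \<open>k1\<close> on the intensities are at least \<open>l0\<close>; from
    \<open>k2\<close> on the jumps stay below \<open>r0\<close>, because
    \<open>eps t \<le> 1\<close>.\<close>
  obtain k1 :: nat where k1: "(6 * l0 / mass + 1) powr (1 / \<alpha>) < 2 ^ k1" using real_arch_pow[of 2] by auto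
  obtain k2 :: nat where k2: "1 / r0 < 2 ^ k2" using real_arch_pow[of 2] by auto
  define k0 where "k0 = max k1 k2"
  have l_ge: "l0 \<le> l k" if k: "k0 \<le> k" for k
  proof -
    have "(2::real) ^ k1 \<le> 2 ^ k" using k by (intro power_increasing) (auto simp: k0_def)
    then have "(6 * l0 / mass + 1) powr (1 / \<alpha>) \<le> 2 ^ k" using k1 by linarith
    then have "((6 * l0 / mass + 1) powr (1 / \<alpha>)) powr \<alpha> \<le> (2 ^ k) powr \<alpha>"
      using alpha by (intro powr_mono2) auto
    then have "6 * l0 / mass + 1 \<le> (2 ^ k) powr \<alpha>" using alpha l0 mass_pos by (simp add: powr_powr)
    then have "mass * (6 * l0 / mass) \<le> mass * (2 ^ k) powr \<alpha>" using mass_pos by (intro mult_left_mono) auto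
    then show ?thesis using mass_pos by (simp add: l_def)
  qed
  have small: "eps t / 2 ^ k0 < r0" if "0 < t" "t \<le> t1" for t
  proof -
    have "eps t \<le> 1" using that t1 by (intro eps_le_1) auto
    moreover have "(2::real) ^ k2 \<le> 2 ^ k0" by (intro power_increasing) (auto simp: k0_def)
    then have "1 / r0 < 2 ^ k0" using k2 by linarith
    then have "1 < r0 * 2 ^ k0" using r0 by (simp add: field_simps)
    ultimately show ?thesis by (simp add: field_simps)
  qed
  define C where "C = 8 * R / c * 2 ^ k0"
  have C0: "0 \<le> C" using R c by (simp add: C_def)
  have scaled: "cmod (tp (mult (\<lambda>p. dirs zs p * grid_char t m (dlinv t p)) xs) x) \<le> (\<Prod>z\<leftarrow>zs. C * norm z) * K"
    if t: "0 < t" "t \<le> t1" and m: "m0 \<le> m" and zs: "length zs \<le> 3" and K: "\<And>y. cmod (tp xs y) \<le> K" for t m zs xs K x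
  proof -
    interpret J: jump_directions "dirsp m" "dirv t m" R c by (rule J[OF t m])
    have mpos: "0 < m" using m t1 by simp
    have "\<exists>m1. bdd m1 1 \<and> (\<forall>p. grid_char t m (dlinv t p) = m1 p * J.dyadic_char l k0 j p ^ 3)" for j
      unfolding l_def by (rule grid_factorization[OF t(1) mpos small[OF t] J.jump_directions_axioms, of j]) blast
    then obtain m1 where m1: "\<And>j. bdd (m1 j) 1" "\<And>j p. grid_char t m (dlinv t p) = m1 j p * J.dyadic_char l k0 j p ^ 3"
      by metis
    show ?thesis
    proof (rule smoothing_all_orders[where Q = "J.dyadic_char l k0" and ?m0.0 = m1 and e = "\<lambda>j. 1 / 4 ^ j" and m = 3])
      show "bdd (J.dyadic_char l k0 j) 1" for j
        by (rule J.dyadic_char_bdd) (use l_ge l0 order_trans in blast)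
      show "(\<lambda>j. 1 / 4 ^ j) \<longlonglongrightarrow> (0::real)"
        using LIMSEQ_realpow_zero[of "1/4::real"] by (simp add: power_one_over)
      fix xs :: "(complex \<times> (real^'n)) list" and K L z j x
      assume K: "\<And>x. cmod (tp xs x) \<le> K" and L: "grad_bdd xs L" "0 \<le> L"
      have K0: "0 \<le> K" using K norm_ge_zero order_trans by blast
      have "cmod (tp (mult (\<lambda>p. dirm z p * J.dyadic_char l k0 j p) xs) x)
        \<le> (8 * R / c * 2 ^ k0 * (1 - 1 / 2 ^ j) * K + L / 4 ^ j) * norm z"
        using l_ge l0 by (intro J.dyadic_gradient[OF n0 n1 _ _ K L]) (blast intro: order_trans)+
      also have "\<dots> \<le> (C * K + 1 / 4 ^ j * L) * norm z"
      proof (intro mult_right_mono add_mono)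
        have "C * (1 - 1 / 2 ^ j) \<le> C * 1" using C0 by (intro mult_left_mono) auto
        then show "8 * R / c * 2 ^ k0 * (1 - 1 / 2 ^ j) \<le> C"
          unfolding C_def[symmetric] by simp
      qed (use K0 in auto)
      finally show "cmod (tp (mult (\<lambda>p. dirm z p * J.dyadic_char l k0 j p) xs) x) \<le> (C * K + 1 / 4 ^ j * L) * norm z" .
    qed (use C0 m1 zs K in auto)
  qed
  have "cmod (tp (mult (\<lambda>p. dirs zs p * grid_char t m p) xs) x) \<le> (\<Prod>z\<leftarrow>zs. C * norm (dlinv t z)) * K"
    if t: "0 < t" "t \<le> t1" and m: "m0 \<le> m" and zs: "length zs \<le> 3" and K: "\<And>y. cmod (tp xs y) \<le> K" for t m zs xs K x
  proof -
    \<comment> \<open>Undoes the change of coordinates: applied to the frequencies it replaces each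
      direction \<open>z\<close> by \<open>dlinv t z\<close>.\<close>
    define dl where "dl = dil (\<lambda>h. eps t * t ^ (h - 1))"
    have inv: "dlinv t (dl y) = y" "dl (dlinv t y) = y" for y
      using t eps_pos[OF t(1)] unfolding dl_def dlinv_def dil_dil by (auto intro!: dil_id)
    have adj: "dl p \<bullet> y = p \<bullet> dl y" for p y unfolding dl_def by (rule dil_adjoint)
    define ys where "ys = map (\<lambda>(c, p). (c, dl p)) xs"
    define zs' where "zs' = map (dlinv t) zs"
    have dirs': "dirs zs' (dl p) = dirs zs p" for p
      unfolding zs'_def by (induction zs) (simp_all add: dirm_def adj inv)
    have "cmod (tp (mult (\<lambda>p. dirs zs' p * grid_char t m (dlinv t p)) ys) (dlinv t x)) \<le> (\<Prod>z\<leftarrow>zs'. C * norm z) * K"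
      using zs K unfolding ys_def by (intro scaled[OF t m]) (simp_all add: zs'_def tp_map_snd[of dl dl, OF adj])
    moreover have "tp (mult (\<lambda>p. dirs zs' p * grid_char t m (dlinv t p)) ys) (dlinv t x) = tp (mult (\<lambda>p. dirs zs p * grid_char t m p) xs) x"
      unfolding ys_def mult_map_snd tp_map_snd[of dl dl, OF adj] by (simp add: inv dirs')
    moreover have "(\<Prod>z\<leftarrow>zs'. C * norm z) = (\<Prod>z\<leftarrow>zs. C * norm (dlinv t z))" by (simp add: zs'_def comp_def)
    ultimately show ?thesis by simp
  qed
  then show thesis using that[OF C0 t1] by blast
qed

section \<open>The characteristic function of the stochastic convolution\<close>

definition pT :: "real \<Rightarrow> real^'n \<Rightarrow> real^'n" where
  "pT t \<xi> = transpose (mat_exp (t *\<^sub>R A)) *v \<xi>"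

lemma inner_pT: "pT t \<xi> \<bullet> x = \<xi> \<bullet> mexp A t x"
  by (simp only: pT_def inner_transpose mexp_def)

lemma meas_Y: "0 \<le> t \<Longrightarrow> Y t \<in> borel_measurable M"
  using convolution by (simp add: is_stoch_integral_def)

definition char_Y :: "real \<Rightarrow> real^'n \<Rightarrow> complex" where
  "char_Y t \<xi> = (\<integral>\<omega>. iexp (\<xi> \<bullet> Y t \<omega>) \<partial>M)"

lemma norm_iexp_diff_le: "cmod (iexp a - iexp c) \<le> \<bar>a - c\<bar>" "cmod (iexp a - iexp c) \<le> 2"
proof -
  have "iexp a - iexp c = iexp c * (iexp (a - c) - 1)" by (simp add: algebra_simps exp_diff)
  then have "cmod (iexp a - iexp c) = cmod (iexp (a - c) - 1)" by (simp add: norm_mult)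
  also have "\<dots> \<le> \<bar>a - c\<bar>" using iexp_approx1[of "a - c" 0] by simp
  finally show "cmod (iexp a - iexp c) \<le> \<bar>a - c\<bar>" .
  show "cmod (iexp a - iexp c) \<le> 2" by (rule order_trans[OF norm_triangle_ineq4]) simp
qed

lemma increments:
  fixes t :: real and m :: nat and q :: "nat \<Rightarrow> real^'d"
  assumes t: "0 < t" and m: "0 < m"
  defines "\<tau> \<equiv> \<lambda>i::nat. t * (real i / real m)"
  shows "(\<integral>\<omega>. iexp (\<Sum>i<m. q i \<bullet> (Z (\<tau> (Suc i)) \<omega> - Z (\<tau> i) \<omega>)) \<partial>M)
    = (\<Prod>i<m. exp (- (complex_of_real (t / m) * levy_symbol b Q \<nu> (q i))))"
proof -
  have \<tau>: "0 \<le> \<tau> i" "\<tau> i < \<tau> (Suc i)" "\<tau> (Suc i) = \<tau> i + t / m" for i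
    using t m by (auto simp: \<tau>_def field_simps)
  have "indep_vars (\<lambda>_. borel) (\<lambda>i \<omega>. Z (\<tau> (Suc i)) \<omega> - Z (\<tau> i) \<omega>) {..<m}"
  proof -
    have "\<forall>(m::nat) (\<tau>::nat \<Rightarrow> real). 0 \<le> \<tau> 0 \<and> (\<forall>i<m. \<tau> i < \<tau> (Suc i)) \<longrightarrow>
        indep_vars (\<lambda>_. borel) (\<lambda>i \<omega>. Z (\<tau> (Suc i)) \<omega> - Z (\<tau> i) \<omega>) {..<m}"
      using levy unfolding levy_process_def by (elim conjE)
    from this[rule_format, of \<tau> m] show ?thesis using \<tau>(1,2) by blast
  qed
  then have ind: "indep_vars (\<lambda>_. borel) (\<lambda>i \<omega>. iexp (q i \<bullet> (Z (\<tau> (Suc i)) \<omega> - Z (\<tau> i) \<omega>))) {..<m}"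
    by (rule indep_vars_compose2[where Y = "\<lambda>i z. iexp (q i \<bullet> z)" and N = "\<lambda>_. borel"]) measurable
  have meas: "(\<lambda>\<omega>. Z (\<tau> (Suc i)) \<omega> - Z (\<tau> i) \<omega>) \<in> borel_measurable M" for i
    by (intro borel_measurable_diff meas_Z \<tau>)
  have one: "(\<integral>\<omega>. iexp (q i \<bullet> (Z (\<tau> (Suc i)) \<omega> - Z (\<tau> i) \<omega>)) \<partial>M) = exp (- (complex_of_real (t / m) * levy_symbol b Q \<nu> (q i)))" for i
  proof -
    have tm: "0 \<le> t / m" using t by simp
    have dist: "distr M borel (\<lambda>\<omega>. Z (\<tau> i + t / m) \<omega> - Z (\<tau> i) \<omega>) = distr M borel (Z (t / m))"
    proof -
      have "\<forall>s\<ge>0. \<forall>t\<ge>0. distr M borel (\<lambda>\<omega>. Z (s + t) \<omega> - Z s \<omega>) = distr M borel (Z t)"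
        using levy unfolding levy_process_def by (elim conjE)
      then show ?thesis using \<tau>(1) tm by blast
    qed
    have "(\<integral>\<omega>. iexp (q i \<bullet> (Z (\<tau> (Suc i)) \<omega> - Z (\<tau> i) \<omega>)) \<partial>M) = (\<integral>z. iexp (q i \<bullet> z) \<partial>distr M borel (\<lambda>\<omega>. Z (\<tau> (Suc i)) \<omega> - Z (\<tau> i) \<omega>))"
      by (rule integral_distr[OF meas, symmetric]) measurable
    also have "\<dots> = (\<integral>z. iexp (q i \<bullet> z) \<partial>distr M borel (Z (t / m)))" unfolding \<tau>(3) dist ..
    also have "\<dots> = (\<integral>\<omega>. iexp (q i \<bullet> Z (t / m) \<omega>) \<partial>M)"
      by (rule integral_distr[OF meas_Z[OF tm]]) measurable
    finally show ?thesis unfolding symbol[OF tm] .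
  qed
  have "(\<integral>\<omega>. iexp (\<Sum>i<m. q i \<bullet> (Z (\<tau> (Suc i)) \<omega> - Z (\<tau> i) \<omega>)) \<partial>M)
    = (\<integral>\<omega>. (\<Prod>i<m. iexp (q i \<bullet> (Z (\<tau> (Suc i)) \<omega> - Z (\<tau> i) \<omega>))) \<partial>M)"
    by (simp add: exp_sum[symmetric] sum_distrib_left)
  also have "\<dots> = (\<Prod>i<m. (\<integral>\<omega>. iexp (q i \<bullet> (Z (\<tau> (Suc i)) \<omega> - Z (\<tau> i) \<omega>)) \<partial>M))"
  proof (rule indep_vars_lebesgue_integral[OF _ ind])
    fix i
    have "(\<lambda>\<omega>. iexp (q i \<bullet> (Z (\<tau> (Suc i)) \<omega> - Z (\<tau> i) \<omega>))) \<in> borel_measurable M"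
      using measurable_compose[OF meas[of i], of "\<lambda>z. iexp (q i \<bullet> z)" borel] by simp
    then show "integrable M (\<lambda>\<omega>. iexp (q i \<bullet> (Z (\<tau> (Suc i)) \<omega> - Z (\<tau> i) \<omega>)))"
      by (intro integrable_const_bound[of _ 1]) auto
  qed simp
  finally show ?thesis unfolding one .
qed

text \<open>The Riemann sums converge in probability to \<open>Y t\<close>, and characteristic
  functions are continuous under this convergence.\<close>

lemma grid_char_tendsto:
  assumes t: "0 < t"
  shows "(\<lambda>m. grid_char t m (pT t \<xi>)) \<longlonglongrightarrow> char_Y t \<xi>"
proof (rule LIMSEQ_I)
  fix r :: real assume r: "0 < r"
  \<comment> \<open>The event of closeness contributes \<open>norm \<xi> * e\<close> and its
    complement, of probability below \<open>e\<close>, at most \<open>2 * e\<close>; together this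
    is \<open>r / 2\<close>.\<close>
  define e where "e = r / (2 * (norm \<xi> + 2))"
  have npos: "0 < norm \<xi> + 2" by (simp add: add_nonneg_pos)
  have e: "0 < e" using r npos by (simp add: e_def)
  let ?F = "\<lambda>s. mat_exp ((t - s) *\<^sub>R A) ** B"
  obtain d where d: "0 < d" "\<And>(m::nat) (\<tau>::nat \<Rightarrow> real).
        \<tau> 0 = 0 \<Longrightarrow> \<tau> m = t \<Longrightarrow> (\<And>i. i < m \<Longrightarrow> \<tau> i < \<tau> (Suc i) \<and> \<tau> (Suc i) - \<tau> i < d) \<Longrightarrow>
        measure M {\<omega>\<in>space M. norm ((\<Sum>i<m. ?F (\<tau> i) *v (Z (\<tau> (Suc i)) \<omega> - Z (\<tau> i) \<omega>)) - Y t \<omega>) > e} < e"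
  proof -
    have "\<forall>\<epsilon>>0. \<exists>\<delta>>0. \<forall>(m::nat) (\<tau>::nat \<Rightarrow> real).
        \<tau> 0 = 0 \<and> \<tau> m = t \<and> (\<forall>i<m. \<tau> i < \<tau> (Suc i) \<and> \<tau> (Suc i) - \<tau> i < \<delta>) \<longrightarrow>
        measure M {\<omega>\<in>space M. norm ((\<Sum>i<m. ?F (\<tau> i) *v (Z (\<tau> (Suc i)) \<omega> - Z (\<tau> i) \<omega>)) - Y t \<omega>) > \<epsilon>} < \<epsilon>"
      using convolution[OF less_imp_le[OF t]] unfolding is_stoch_integral_def by (elim conjE)
    from this[rule_format, OF e] show ?thesis using that by blast
  qed
  obtain m0 :: nat where m0: "t / d < m0" using reals_Archimedean2 by blast
  have "norm (grid_char t m (pT t \<xi>) - char_Y t \<xi>) < r" if m: "m0 \<le> m" for m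
  proof -
    have m1: "t / d < m" using m m0 by linarith
    have mpos: "0 < m" using m1 t d(1) by (cases m) (auto simp: field_simps)
    define \<tau> where "\<tau> i = t * (real i / real m)" for i :: nat
    define X where "X \<omega> = (\<Sum>i<m. ?F (\<tau> i) *v (Z (\<tau> (Suc i)) \<omega> - Z (\<tau> i) \<omega>))" for \<omega>
    have step: "\<tau> (Suc i) - \<tau> i = t / m" for i using mpos by (simp add: \<tau>_def field_simps)
    have "t / m < d" using m1 mpos d(1) by (simp add: field_simps)
    moreover have "0 < t / m" using t mpos by simp
    ultimately have small: "measure M {\<omega>\<in>space M. norm (X \<omega> - Y t \<omega>) > e} < e"
      unfolding X_def using mpos by (intro d(2)) (auto simp: \<tau>_def step[unfolded \<tau>_def] field_simps)
    have mX [measurable]: "X \<in> borel_measurable M"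
    proof -
      have "(\<lambda>\<omega>. ?F (\<tau> i) *v (Z (\<tau> (Suc i)) \<omega> - Z (\<tau> i) \<omega>)) \<in> borel_measurable M" for i
      proof (rule measurable_compose[of _ M borel "\<lambda>u. ?F (\<tau> i) *v u"])
        show "(\<lambda>\<omega>. Z (\<tau> (Suc i)) \<omega> - Z (\<tau> i) \<omega>) \<in> borel_measurable M"
          using t by (intro borel_measurable_diff meas_Z) (auto simp: \<tau>_def)
        show "(\<lambda>u. ?F (\<tau> i) *v u) \<in> borel_measurable borel"
          by (intro borel_measurable_continuous_onI linear_continuous_on) simp
      qed
      then show ?thesis unfolding X_def by (intro borel_measurable_sum)
    qed
    have mY [measurable]: "Y t \<in> borel_measurable M" using meas_Y t by simp
    have eq: "grid_char t m (pT t \<xi>) = (\<integral>\<omega>. iexp (\<xi> \<bullet> X \<omega>) \<partial>M)"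
    proof -
      \<comment> \<open>By the group property e^((t-s)A) is e^(tA) composed with e^(-sA); the first
        factor moves to the frequency.\<close>
      have q: "\<xi> \<bullet> (?F s *v u) = pull s (pT t \<xi>) \<bullet> u" for s u
      proof -
        have "\<xi> \<bullet> (?F s *v u) = \<xi> \<bullet> mexp A (t + - s) (B *v u)"
          by (simp add: mexp_def matrix_vector_mul_assoc)
        also have "\<dots> = \<xi> \<bullet> mexp A t (mexp A (- s) (B *v u))" by (simp only: mexp_add)
        finally show ?thesis by (simp add: inner_pull inner_pT)
      qed
      have "(\<integral>\<omega>. iexp (\<xi> \<bullet> X \<omega>) \<partial>M) = (\<integral>\<omega>. iexp (\<Sum>i<m. pull (\<tau> i) (pT t \<xi>) \<bullet> (Z (\<tau> (Suc i)) \<omega> - Z (\<tau> i) \<omega>)) \<partial>M)"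
        by (simp only: X_def inner_sum_right q)
      also have "\<dots> = grid_char t m (pT t \<xi>)"
        unfolding \<tau>_def increments[OF t mpos] grid_char_def ..
      finally show ?thesis by simp
    qed
    have int: "integrable M (\<lambda>\<omega>. iexp (\<xi> \<bullet> X \<omega>))" "integrable M (\<lambda>\<omega>. iexp (\<xi> \<bullet> Y t \<omega>))"
      by (auto intro!: integrable_const_bound[of _ 1])
    let ?E = "{\<omega>\<in>space M. norm (X \<omega> - Y t \<omega>) > e}"
    have E: "?E \<in> sets M" by measurable
    have pw: "cmod (iexp (\<xi> \<bullet> X \<omega>) - iexp (\<xi> \<bullet> Y t \<omega>)) \<le> norm \<xi> * e + 2 * indicator ?E \<omega>" if "\<omega> \<in> space M" for \<omega>
    proof (cases "\<omega> \<in> ?E")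
      case True
      have "0 \<le> norm \<xi> * e" using e by simp
      then show ?thesis using True norm_iexp_diff_le(2)[of "\<xi> \<bullet> X \<omega>" "\<xi> \<bullet> Y t \<omega>"]
        by (simp add: add_increasing)
    next
      case False
      then have "norm (X \<omega> - Y t \<omega>) \<le> e" using that by simp
      then have "\<bar>\<xi> \<bullet> X \<omega> - \<xi> \<bullet> Y t \<omega>\<bar> \<le> norm \<xi> * e"
        unfolding inner_diff_right[symmetric] by (intro order_trans[OF Cauchy_Schwarz_ineq2] mult_left_mono) auto
      then show ?thesis using False order_trans[OF norm_iexp_diff_le(1)] by (simp add: indicator_simps)
    qed
    have "cmod (grid_char t m (pT t \<xi>) - char_Y t \<xi>) = cmod (\<integral>\<omega>. iexp (\<xi> \<bullet> X \<omega>) - iexp (\<xi> \<bullet> Y t \<omega>) \<partial>M)"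
      unfolding eq char_Y_def Bochner_Integration.integral_diff[OF int] ..
    also have "\<dots> \<le> (\<integral>\<omega>. cmod (iexp (\<xi> \<bullet> X \<omega>) - iexp (\<xi> \<bullet> Y t \<omega>)) \<partial>M)" by (rule integral_norm_bound)
    also have "\<dots> \<le> (\<integral>\<omega>. norm \<xi> * e + 2 * indicator ?E \<omega> \<partial>M)"
    proof (rule integral_mono[OF _ _ pw])
      show "integrable M (\<lambda>\<omega>. cmod (iexp (\<xi> \<bullet> X \<omega>) - iexp (\<xi> \<bullet> Y t \<omega>)))"
        by (intro integrable_norm Bochner_Integration.integrable_diff int)
      show "integrable M (\<lambda>\<omega>. norm \<xi> * e + 2 * indicat_real ?E \<omega>)"
        using E by (intro Bochner_Integration.integrable_add integrable_const integrable_mult_right integrable_real_indicator)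
          (auto simp: emeasure_eq_measure)
    qed
    also have "\<dots> = norm \<xi> * e + 2 * measure M ?E"
      using E by (subst Bochner_Integration.integral_add) (auto simp: prob_space emeasure_eq_measure intro!: integrable_mult_right integrable_real_indicator)
    also have "\<dots> < norm \<xi> * e + 2 * e" using small by simp
    also have "\<dots> = (norm \<xi> + 2) * e" by (simp add: algebra_simps)
    also have "\<dots> = r / 2" using npos unfolding e_def by (simp add: field_simps)
    finally show ?thesis using r by simp
  qed
  then show "\<exists>no. \<forall>n\<ge>no. norm (grid_char t n (pT t \<xi>) - char_Y t \<xi>) < r" by blast
qed

text \<open>The semigroup, polymorphic in the range so that it acts on complex trigonometric
  polynomials as well as on real functions.\<close>

definition PP :: "real \<Rightarrow> (real^'n \<Rightarrow> 'b::{banach, second_countable_topology}) \<Rightarrow> real^'n \<Rightarrow> 'b" where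
  "PP t f x = (\<integral>\<omega>. f (mexp A t x + Y t \<omega>) \<partial>M)"

lemma PP_tp:
  assumes t: "0 < t"
  shows "PP t (tp xs) x = tp (map (\<lambda>(c, \<xi>). (char_Y t \<xi> * c, pT t \<xi>)) xs) x"
proof -
  have mY [measurable]: "Y t \<in> borel_measurable M" using meas_Y t by simp
  have i: "integrable M (\<lambda>\<omega>. iexp (\<xi> \<bullet> (y + Y t \<omega>)))" for \<xi> y
    by (rule integrable_const_bound[of _ 1]) auto
  have "integrable M (\<lambda>\<omega>. tp xs (mexp A t x + Y t \<omega>)) \<and>
    (\<integral>\<omega>. tp xs (mexp A t x + Y t \<omega>) \<partial>M) = tp (map (\<lambda>(c, \<xi>). (char_Y t \<xi> * c, pT t \<xi>)) xs) x"
  proof (induction xs)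
    case (Cons a xs)
    have e: "(\<integral>\<omega>. iexp (snd a \<bullet> (mexp A t x + Y t \<omega>)) \<partial>M) = iexp (pT t (snd a) \<bullet> x) * char_Y t (snd a)"
      unfolding char_Y_def inner_add_right of_real_add distrib_left exp_add inner_pT by simp
    have i': "integrable M (\<lambda>\<omega>. fst a * iexp (snd a \<bullet> (mexp A t x + Y t \<omega>)))"
      by (rule integrable_mult_right) (rule i)
    have "(\<integral>\<omega>. fst a * iexp (snd a \<bullet> (mexp A t x + Y t \<omega>)) + tp xs (mexp A t x + Y t \<omega>) \<partial>M)
      = fst a * (\<integral>\<omega>. iexp (snd a \<bullet> (mexp A t x + Y t \<omega>)) \<partial>M) + (\<integral>\<omega>. tp xs (mexp A t x + Y t \<omega>) \<partial>M)"
      unfolding Bochner_Integration.integral_add[OF i' conjunct1[OF Cons]] integral_mult_right_zero ..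
    then show ?case
      using Bochner_Integration.integrable_add[OF i' conjunct1[OF Cons]] Cons
      unfolding tp_Cons e by (simp add: case_prod_unfold mult_ac)
  qed simp
  then show ?thesis by (simp add: PP_def)
qed

text \<open>The first \<open>m\<close> cells of the grid on the long interval form the grid on its
  initial piece of length \<open>t\<close>; every other cell contributes a contraction.\<close>

lemma grid_char_split:
  assumes m: "0 < m" and L: "0 < L" and t: "0 \<le> t"
  obtains m1 where "bdd m1 1" "\<And>p. grid_char (real L * t) (m * L) p = m1 p * grid_char t m p"
proof
  let ?g = "\<lambda>i p. exp (- (complex_of_real (t / real m) * levy_symbol b Q \<nu> (pull (t * (real i / real m)) p)))"
  show "bdd (\<lambda>p. \<Prod>i\<in>{m..<m * L}. ?g i p) 1"
    using t by (intro bdd_prod bdd_pull bdd_levy) simp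
  fix p
  have "{..<N} = {m..<N} \<union> {..<m}" if "m \<le> N" for N using that by auto
  from this[of "m * L"] have mL: "{..<m * L} = {m..<m * L} \<union> {..<m}" using L by simp
  have "grid_char (real L * t) (m * L) p = (\<Prod>i<m * L. ?g i p)"
    using L m unfolding grid_char_def by (intro prod.cong refl) (simp add: field_simps)
  also have "\<dots> = (\<Prod>i\<in>{m..<m * L}. ?g i p) * (\<Prod>i<m. ?g i p)"
    unfolding mL by (rule prod.union_disjoint) auto
  finally show "grid_char (real L * t) (m * L) p = (\<Prod>i\<in>{m..<m * L}. ?g i p) * grid_char t m p"
    by (simp only: grid_char_def)
qed

text \<open>Nondegeneracy is available up to time \<open>t1\<close>. A larger \<open>t\<close> is
  divided by the least integer \<open>L\<close> with \<open>t / L \<le> t1\<close>, and only the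
  noise up to time \<open>t / L\<close>, which is at least \<open>t1 / 2\<close>, is used for
  smoothing.\<close>

lemma smoothing_tp:
  obtains C t1 :: real where "0 \<le> C" "0 < t1" "t1 \<le> 1"
    "\<And>t. 0 < t \<Longrightarrow> \<exists>\<tau>. 0 < \<tau> \<and> \<tau> \<le> t1 \<and> (t \<le> t1 \<longrightarrow> \<tau> = t) \<and> (t1 < t \<longrightarrow> t1 / 2 \<le> \<tau>) \<and>
      (\<forall>zs xs K x. length zs \<le> 3 \<longrightarrow> (\<forall>y. cmod (tp xs y) \<le> K) \<longrightarrow>
        cmod (diffs zs (PP t (tp xs)) x) \<le> (\<Prod>z\<leftarrow>zs. C * norm (dlinv \<tau> z)) * K)"
proof -
  obtain C t1 :: real and m0 :: nat where C: "0 \<le> C" "0 < t1" "t1 \<le> 1" "0 < m0"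
    and G: "\<And>t m zs xs K x. 0 < t \<Longrightarrow> t \<le> t1 \<Longrightarrow> m0 \<le> m \<Longrightarrow> length zs \<le> 3 \<Longrightarrow> (\<And>y. cmod (tp xs y) \<le> K) \<Longrightarrow>
      cmod (tp (mult (\<lambda>p. dirs zs p * grid_char t m p) xs) x) \<le> (\<Prod>z\<leftarrow>zs. C * norm (dlinv t z)) * K"
    by (rule grid_smoothing) blast
  have "\<exists>\<tau>. 0 < \<tau> \<and> \<tau> \<le> t1 \<and> (t \<le> t1 \<longrightarrow> \<tau> = t) \<and> (t1 < t \<longrightarrow> t1 / 2 \<le> \<tau>) \<and>
      (\<forall>zs xs K x. length zs \<le> 3 \<longrightarrow> (\<forall>y. cmod (tp xs y) \<le> K) \<longrightarrow>
        cmod (diffs zs (PP t (tp xs)) x) \<le> (\<Prod>z\<leftarrow>zs. C * norm (dlinv \<tau> z)) * K)" if t: "0 < t" for t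
  proof -
    define L where "L = (if t \<le> t1 then 1 else nat \<lceil>t / t1\<rceil>)"
    define \<tau> where "\<tau> = t / L"
    have L: "0 < L" "t \<le> real L * t1" "t1 < t \<Longrightarrow> real L \<le> 2 * t / t1"
    proof -
      show "0 < L" using t C by (auto simp: L_def)
      show "t \<le> real L * t1"
      proof (cases "t \<le> t1")
        case False
        have "t / t1 \<le> real (nat \<lceil>t / t1\<rceil>)" by linarith
        then have "t / t1 \<le> real L" using False by (simp add: L_def)
        then show ?thesis using C by (simp add: pos_divide_le_eq)
      qed (simp add: L_def)
      assume tt: "t1 < t"
      have "1 \<le> t / t1" using tt C by simp
      then have "real (nat \<lceil>t / t1\<rceil>) \<le> t / t1 + t / t1" by linarith
      then show "real L \<le> 2 * t / t1" using tt by (simp add: L_def)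
    qed
    have \<tau>: "0 < \<tau>" "\<tau> \<le> t1" "t \<le> t1 \<Longrightarrow> \<tau> = t" "t1 < t \<Longrightarrow> t1 / 2 \<le> \<tau>" "t = real L * \<tau>"
      using L t C by (auto simp: \<tau>_def field_simps L_def)
    have main: "cmod (diffs zs (PP t (tp xs)) x) \<le> (\<Prod>z\<leftarrow>zs. C * norm (dlinv \<tau> z)) * K"
      if zs: "length zs \<le> 3" and K: "\<And>y. cmod (tp xs y) \<le> K" for zs xs K x
    proof -
      define ws where "ws = map (\<lambda>(c, \<xi>). (c, pT t \<xi>)) xs"
      have ws: "cmod (tp ws y) \<le> K" for y
        unfolding ws_def tp_map_snd[of "pT t" "mexp A t", OF inner_pT] by (rule K)
      let ?d = "\<lambda>p. \<Prod>z\<leftarrow>zs. (iexp (p \<bullet> z) - 1)"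
      have fin: "cmod (tp (mult (\<lambda>p. ?d p * grid_char t (m * L) p) ws) x) \<le> (\<Prod>z\<leftarrow>zs. C * norm (dlinv \<tau> z)) * K"
        if m: "m0 \<le> m" for m
      proof -
        have mpos: "0 < m" using m C by simp
        obtain m1 where m1: "bdd m1 1" "\<And>p. grid_char (real L * \<tau>) (m * L) p = m1 p * grid_char \<tau> m p"
          using grid_char_split[OF mpos L(1) less_imp_le[OF \<tau>(1)]] by blast
        \<comment> \<open>The two factors that remain beside the derivatives: the averages which
          turn derivatives into differences, and the noise after time \<open>\<tau>\<close>.\<close>
        have "bdd (\<lambda>p. (\<Prod>z\<leftarrow>zs. avg_iexp 0 1 (p \<bullet> z)) * m1 p) (1 * 1)" by (intro bdd_mult bdd_prod_avg m1)
        from bddD[OF this G[OF \<tau>(1,2) m zs ws]]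
        moreover have "grid_char t (m * L) p = m1 p * grid_char \<tau> m p" for p using m1(2) \<tau>(5) by simp
        ultimately show ?thesis unfolding mult_mult prod_iexp_minus_1 mult_1 by (simp only: mult_ac)
      qed
      have lim: "(\<lambda>m. grid_char t (m * L) (pT t \<xi>)) \<longlonglongrightarrow> char_Y t \<xi>" for \<xi>
        using LIMSEQ_subseq_LIMSEQ[OF grid_char_tendsto[OF t], of "\<lambda>m. m * L" \<xi>] L(1)
        by (simp add: strict_mono_def comp_def)
      have "(\<lambda>m. tp (mult (\<lambda>p. ?d p * grid_char t (m * L) p) ws) x)
        \<longlonglongrightarrow> tp (mult ?d (map (\<lambda>(c, \<xi>). (char_Y t \<xi> * c, pT t \<xi>)) xs)) x"
        unfolding ws_def
      proof (induction xs)
        case (Cons a xs)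
        have "(\<lambda>m. ?d (pT t (snd a)) * grid_char t (m * L) (pT t (snd a)) * fst a * iexp (pT t (snd a) \<bullet> x)
            + tp (mult (\<lambda>p. ?d p * grid_char t (m * L) p) (map (\<lambda>(c, \<xi>). (c, pT t \<xi>)) xs)) x)
          \<longlonglongrightarrow> ?d (pT t (snd a)) * char_Y t (snd a) * fst a * iexp (pT t (snd a) \<bullet> x)
            + tp (mult ?d (map (\<lambda>(c, \<xi>). (char_Y t \<xi> * c, pT t \<xi>)) xs)) x"
          by (intro tendsto_add tendsto_mult tendsto_const lim Cons)
        then show ?case by (simp add: case_prod_unfold mult.assoc)
      qed simp
      then have "(\<lambda>m. cmod (tp (mult (\<lambda>p. ?d p * grid_char t (m * L) p) ws) x)) \<longlonglongrightarrow> cmod (diffs zs (PP t (tp xs)) x)"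
        unfolding PP_tp[OF t, abs_def] tp_diffs by (rule tendsto_norm)
      then show ?thesis
        using fin by (intro LIMSEQ_le_const2[of _ _ "(\<Prod>z\<leftarrow>zs. C * norm (dlinv \<tau> z)) * K"]) blast+
    qed
    show ?thesis using \<tau> main by blast
  qed
  then show thesis using that C by blast
qed

lemma diffs_of_real: "complex_of_real (diffs zs f x) = diffs zs (\<lambda>x. complex_of_real (f x)) x"
  by (induction zs arbitrary: x) (auto simp: diff1_def)

lemma PP_of_real: "complex_of_real (PP t f x) = PP t (\<lambda>x. complex_of_real (f x)) x" for f :: "real^'n \<Rightarrow> real"
  by (simp add: PP_def)

lemma measurable_PP:
  fixes \<phi> :: "real^'n \<Rightarrow> real"
  assumes "0 \<le> t" "continuous_on UNIV \<phi>"
  shows "(\<lambda>\<omega>. \<phi> (y + Y t \<omega>)) \<in> borel_measurable M"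
proof -
  have "\<phi> \<in> borel_measurable borel" by (rule borel_measurable_continuous_onI[OF assms(2)])
  moreover have "(\<lambda>\<omega>. y + Y t \<omega>) \<in> borel_measurable M" using meas_Y[OF assms(1)] by measurable
  ultimately show ?thesis by (rule measurable_compose[rotated])
qed

lemma PP_tendsto:
  fixes \<phi> :: "real^'n \<Rightarrow> real"
  assumes t: "0 \<le> t" and cont: "\<And>j. continuous_on UNIV (f j)" "continuous_on UNIV \<phi>"
    and K: "\<And>j x. \<bar>f j x\<bar> \<le> K" and lim: "\<And>x. (\<lambda>j. f j x) \<longlonglongrightarrow> \<phi> x"
  shows "(\<lambda>j. PP t (f j) x) \<longlonglongrightarrow> PP t \<phi> x"
  unfolding PP_def
  by (rule integral_dominated_convergence[where w = "\<lambda>_. K"])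
    (auto intro!: measurable_PP t cont lim K)

text \<open>The estimate depends on the function only through its supremum. So uniformly bounded
  pointwise approximation is enough, with approximants controlled on the ball of radius
  \<open>j\<close> and dominated convergence under the expectation.\<close>

theorem smoothing:
  obtains C t1 :: real where "0 \<le> C" "0 < t1" "t1 \<le> 1"
    "\<And>t. 0 < t \<Longrightarrow> \<exists>\<tau>. 0 < \<tau> \<and> \<tau> \<le> t1 \<and> (t \<le> t1 \<longrightarrow> \<tau> = t) \<and> (t1 < t \<longrightarrow> t1 / 2 \<le> \<tau>) \<and>
      (\<forall>zs \<phi> K x. length zs \<le> 3 \<longrightarrow> continuous_on UNIV \<phi> \<longrightarrow> (\<forall>y. \<bar>\<phi> y\<bar> \<le> K) \<longrightarrow>
        \<bar>diffs zs (PP t \<phi> :: real^'n \<Rightarrow> real) x\<bar> \<le> (\<Prod>z\<leftarrow>zs. C * norm (dlinv \<tau> z)) * K)"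
proof -
  obtain C t1 :: real where C: "0 \<le> C" "0 < t1" "t1 \<le> 1"
    and G: "\<And>t. 0 < t \<Longrightarrow> \<exists>\<tau>. 0 < \<tau> \<and> \<tau> \<le> t1 \<and> (t \<le> t1 \<longrightarrow> \<tau> = t) \<and> (t1 < t \<longrightarrow> t1 / 2 \<le> \<tau>) \<and>
      (\<forall>zs xs K x. length zs \<le> 3 \<longrightarrow> (\<forall>y. cmod (tp xs y) \<le> K) \<longrightarrow>
        cmod (diffs zs (PP t (tp xs)) x) \<le> (\<Prod>z\<leftarrow>zs. C * norm (dlinv \<tau> z)) * K)"
    by (rule smoothing_tp) blast
  have "\<exists>\<tau>. 0 < \<tau> \<and> \<tau> \<le> t1 \<and> (t \<le> t1 \<longrightarrow> \<tau> = t) \<and> (t1 < t \<longrightarrow> t1 / 2 \<le> \<tau>) \<and>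
      (\<forall>zs \<phi> K x. length zs \<le> 3 \<longrightarrow> continuous_on UNIV \<phi> \<longrightarrow> (\<forall>y. \<bar>\<phi> y\<bar> \<le> K) \<longrightarrow>
        \<bar>diffs zs (PP t \<phi> :: real^'n \<Rightarrow> real) x\<bar> \<le> (\<Prod>z\<leftarrow>zs. C * norm (dlinv \<tau> z)) * K)" if t: "0 < t" for t
  proof -
    obtain \<tau> where \<tau>: "0 < \<tau>" "\<tau> \<le> t1" "t \<le> t1 \<longrightarrow> \<tau> = t" "t1 < t \<longrightarrow> t1 / 2 \<le> \<tau>"
      and T: "\<And>zs xs K x. length zs \<le> 3 \<Longrightarrow> (\<And>y. cmod (tp xs y) \<le> K) \<Longrightarrow>
        cmod (diffs zs (PP t (tp xs)) x) \<le> (\<Prod>z\<leftarrow>zs. C * norm (dlinv \<tau> z)) * K"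
      using G[OF t] by blast
    have "\<bar>diffs zs (PP t \<phi>) x\<bar> \<le> (\<Prod>z\<leftarrow>zs. C * norm (dlinv \<tau> z)) * K"
      if zs: "length zs \<le> 3" and cont: "continuous_on UNIV \<phi>" and K: "\<And>y. \<bar>\<phi> y\<bar> \<le> K"
      for zs K x and \<phi> :: "real^'n \<Rightarrow> real"
    proof -
      define r where "r j = 1 / real (Suc j)" for j
      have r: "r \<longlonglongrightarrow> 0" "\<And>j. 0 < r j" "\<And>j. r j \<le> 1"
        unfolding r_def using lim_1_over_n LIMSEQ_Suc by (blast, auto)
      have "\<exists>f. trig f \<and> (\<forall>x. \<bar>f x\<bar> \<le> K + r j) \<and> (\<forall>x. norm x \<le> real j \<longrightarrow> \<bar>f x - \<phi> x\<bar> \<le> r j)" for j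
        by (rule trig_approx_ball[OF cont K r(2)]) blast
      then obtain f where f: "\<And>j. trig (f j)" "\<And>j x. \<bar>f j x\<bar> \<le> K + r j"
        "\<And>j x. norm x \<le> real j \<Longrightarrow> \<bar>f j x - \<phi> x\<bar> \<le> r j" by metis
      have lim: "(\<lambda>j. f j y) \<longlonglongrightarrow> \<phi> y" for y
      proof (rule Lim_transform_eventually[THEN LIM_zero_cancel])
        obtain N :: nat where N: "norm y < N" using reals_Archimedean2 by blast
        show "(\<lambda>j. f j y - \<phi> y) \<longlonglongrightarrow> 0"
        proof (rule tendsto_rabs_zero_cancel, rule tendsto_sandwich[OF _ _ tendsto_const r(1)])
          show "\<forall>\<^sub>F j in sequentially. \<bar>f j y - \<phi> y\<bar> \<le> r j"
            using N by (intro eventually_sequentiallyI[of N] f(3)) auto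
        qed auto
      qed auto
      have bound: "\<bar>diffs zs (PP t (f j)) x\<bar> \<le> (\<Prod>z\<leftarrow>zs. C * norm (dlinv \<tau> z)) * (K + r j)" for j
      proof -
        obtain xs where xs: "\<And>x. complex_of_real (f j x) = tp xs x" using f(1)[of j] unfolding trig_def by blast
        have "complex_of_real (diffs zs (PP t (f j)) x) = diffs zs (PP t (tp xs)) x"
          by (simp add: diffs_of_real PP_of_real xs)
        moreover have "cmod (tp xs y) \<le> K + r j" for y using f(2)[of j y] by (simp flip: xs)
        ultimately show ?thesis using T[OF zs, of xs "K + r j" x] by (metis norm_of_real)
      qed
      have "(\<lambda>j. PP t (f j) y) \<longlonglongrightarrow> PP t \<phi> y" for y
        using t f(2) r(3) order_trans[OF f(2) add_left_mono[OF r(3)]]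
        by (intro PP_tendsto[where K = "K + 1"] trig_continuous f(1) cont lim) auto
      then have "(\<lambda>j. \<bar>diffs zs (PP t (f j)) x\<bar>) \<longlonglongrightarrow> \<bar>diffs zs (PP t \<phi>) x\<bar>"
        by (intro tendsto_rabs diffs_tendsto)
      moreover have "(\<lambda>j. (\<Prod>z\<leftarrow>zs. C * norm (dlinv \<tau> z)) * (K + r j)) \<longlonglongrightarrow> (\<Prod>z\<leftarrow>zs. C * norm (dlinv \<tau> z)) * (K + 0)"
        by (intro tendsto_intros r)
      ultimately show ?thesis using bound LIMSEQ_le by fastforce
    qed
    then show ?thesis using \<tau> by blast
  qed
  then show thesis using that C by blast
qed

end

section \<open>Mollification in terms of finite differences\<close>

lemma diff1_commute: "diff1 y (diff1 z f) = diff1 z (diff1 y f)"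
  by (rule ext) (simp add: diff1_def algebra_simps)

lemma diffs_diff1: "diffs zs (diff1 z f) = diff1 z (diffs zs f)"
  by (induction zs) (simp_all add: diff1_commute)

lemma diffs_add: "diffs zs (\<lambda>x. f x + g x) x = diffs zs f x + diffs zs g x"
  by (induction zs arbitrary: x) (simp_all add: diff1_def)

lemma diffs_minus: "diffs zs (\<lambda>x. f x - g x) x = diffs zs f x - diffs zs g x"
  by (induction zs arbitrary: x) (simp_all add: diff1_def)

lemma diffs_sum: "diffs zs (\<lambda>x. \<Sum>i\<in>I. f i x) x = (\<Sum>i\<in>I. diffs zs (f i) x)"
  by (induction zs arbitrary: x) (simp_all add: diff1_def sum_subtractf)

lemma diffs_bound:
  fixes f :: "'a::ab_group_add \<Rightarrow> real"
  assumes "\<And>x. \<bar>f x\<bar> \<le> K"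
  shows "\<bar>diffs zs f x\<bar> \<le> 2 ^ length zs * K"
proof (induction zs arbitrary: x)
  case (Cons z zs)
  have "\<bar>diffs (z # zs) f x\<bar> \<le> \<bar>diffs zs f (x + z)\<bar> + \<bar>diffs zs f x\<bar>" by (simp add: diff1_def)
  also have "\<dots> \<le> 2 ^ length (z # zs) * K" using Cons[of x] Cons[of "x + z"] by simp
  finally show ?case .
qed (simp add: assms)

section \<open>Bounded continuous functions\<close>

definition bcont :: "('a::metric_space \<Rightarrow> real) \<Rightarrow> bool" where
  "bcont f \<longleftrightarrow> continuous_on UNIV f \<and> (\<exists>K. \<forall>x. \<bar>f x\<bar> \<le> K)"

lemma bcontE:
  assumes "bcont f"
  obtains K where "continuous_on UNIV f" "\<And>x. \<bar>f x\<bar> \<le> K" "0 \<le> K"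
proof -
  obtain K where K: "\<And>x. \<bar>f x\<bar> \<le> K" using assms unfolding bcont_def by blast
  have "0 \<le> K" using order_trans[OF abs_ge_zero K] by blast
  then show thesis using K assms that unfolding bcont_def by blast
qed

lemma bcont_diff:
  assumes "bcont f" "bcont g"
  shows "bcont (\<lambda>x. f x - g x)"
proof -
  obtain K1 K2 where "\<And>x. \<bar>f x\<bar> \<le> K1" "\<And>x. \<bar>g x\<bar> \<le> K2" using assms unfolding bcont_def by blast
  then have "\<bar>f x - g x\<bar> \<le> K1 + K2" for x by (intro order_trans[OF abs_triangle_ineq4] add_mono)
  then show ?thesis using assms unfolding bcont_def by (blast intro: continuous_intros)
qed

lemma bcont_add:
  assumes "bcont f" "bcont g"
  shows "bcont (\<lambda>x. f x + g x)"
proof -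
  obtain K1 K2 where "\<And>x. \<bar>f x\<bar> \<le> K1" "\<And>x. \<bar>g x\<bar> \<le> K2" using assms unfolding bcont_def by blast
  then have "\<bar>f x + g x\<bar> \<le> K1 + K2" for x by (intro order_trans[OF abs_triangle_ineq] add_mono)
  then show ?thesis using assms unfolding bcont_def by (blast intro: continuous_intros)
qed

lemma bcont_sum: "(\<And>i. i \<in> I \<Longrightarrow> bcont (f i)) \<Longrightarrow> bcont (\<lambda>x. \<Sum>i\<in>I. f i x)"
proof (induction I rule: infinite_finite_induct)
  case (insert i I)
  then show ?case using bcont_add[of "f i" "\<lambda>x. \<Sum>i\<in>I. f i x"] by simp
qed (simp_all add: bcont_def exI[of _ 0])

lemma bcont_shift:
  fixes f :: "'a::real_normed_vector \<Rightarrow> real"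
  assumes "bcont f"
  shows "bcont (\<lambda>x. f (x + z))"
proof -
  obtain K where K: "continuous_on UNIV f" "\<And>x. \<bar>f x\<bar> \<le> K" using bcontE[OF assms] by metis
  have "continuous_on UNIV (\<lambda>x. f (x + z))"
    by (intro continuous_on_compose2[OF K(1)] continuous_intros) auto
  then show ?thesis using K(2) unfolding bcont_def by blast
qed

lemma bcont_diff1: "bcont f \<Longrightarrow> bcont (diff1 z f)" for f :: "'a::real_normed_vector \<Rightarrow> real"
  using bcont_diff[OF bcont_shift, of f f z] by (simp add: diff1_def[abs_def])

lemma bcont_diffs: "bcont f \<Longrightarrow> bcont (diffs zs f)" for f :: "'a::real_normed_vector \<Rightarrow> real"
  by (induction zs) (simp_all add: bcont_diff1)

section \<open>The mollifier\<close>

definition tent :: "'a::euclidean_space \<Rightarrow> real" where "tent u = max 0 (1 - norm u)"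

definition tent_mass :: "'a::euclidean_space itself \<Rightarrow> real" where
  "tent_mass _ = integral\<^sup>L lborel (tent :: 'a \<Rightarrow> real)"

text \<open>A Lipschitz kernel is enough, because each averaging has to absorb only one difference;
  higher orders come from iterating the averaging.\<close>

definition kern :: "'a::euclidean_space \<Rightarrow> real" where
  "kern u = tent u / tent_mass TYPE('a)"

lemma integrable_supported:
  fixes f :: "'a::euclidean_space \<Rightarrow> real"
  assumes "f \<in> borel_measurable borel" "\<And>u. \<bar>f u\<bar> \<le> c * indicator (cball 0 r) u"
  shows "integrable lborel f"
proof (rule Bochner_Integration.integrable_bound)
  show "integrable lborel (\<lambda>u. c * indicat_real (cball (0::'a) r) u)"
    using emeasure_lborel_cball_finite[of "0::'a"] by (intro integrable_mult_right integrable_real_indicator) auto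
qed (use assms in \<open>auto intro!: AE_I2 order_trans[OF assms(2)]\<close>)

lemma measurable_tent [measurable]: "tent \<in> borel_measurable borel"
  unfolding tent_def[abs_def] by measurable

lemma tent_mass_pos: "0 < tent_mass TYPE('a::euclidean_space)"
proof -
  have i: "integrable lborel (tent :: 'a \<Rightarrow> real)"
    by (rule integrable_supported[of _ 1 1]) (auto simp: tent_def split: split_indicator)
  have "0 < measure lborel (ball (0::'a) (1/2))" by (rule content_ball_pos) simp
  moreover have "(\<integral>u. 1/2 * indicat_real (ball (0::'a) (1/2)) u \<partial>lborel) \<le> tent_mass TYPE('a)"
    unfolding tent_mass_def
  proof (rule integral_mono[OF _ i])
    show "integrable lborel (\<lambda>u. 1/2 * indicat_real (ball (0::'a) (1/2)) u)"
    proof (rule integrable_supported[of _ "1/2" 1])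
      show "(\<lambda>u. 1/2 * indicat_real (ball (0::'a) (1/2)) u) \<in> borel_measurable borel"
        by (intro borel_measurable_times borel_measurable_const borel_measurable_indicator) simp
    qed (auto split: split_indicator)
  qed (auto simp: tent_def split: split_indicator)
  moreover have "(\<integral>u. 1/2 * indicat_real (ball (0::'a) (1/2)) u \<partial>lborel) = 1/2 * measure lborel (ball (0::'a) (1/2))"
    by simp
  ultimately show ?thesis by linarith
qed

lemma measurable_kern [measurable]: "kern \<in> borel_measurable borel"
  unfolding kern_def[abs_def] by measurable

lemma kern_nonneg: "0 \<le> kern u" for u :: "'a::euclidean_space"
  using tent_mass_pos[where 'a='a] by (simp add: kern_def tent_def)

lemma kern_zero: "1 < norm u \<Longrightarrow> kern u = 0"
  by (simp add: kern_def tent_def)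

lemma integrable_kern: "integrable lborel (kern :: 'a::euclidean_space \<Rightarrow> real)"
  by (rule integrable_supported[of _ "1 / tent_mass TYPE('a)" 1])
    (use tent_mass_pos[where 'a='a] in \<open>auto simp: kern_def tent_def abs_mult divide_right_mono split: split_indicator\<close>)

lemma integral_kern: "integral\<^sup>L lborel (kern :: 'a::euclidean_space \<Rightarrow> real) = 1"
  unfolding kern_def[abs_def] using tent_mass_pos[where 'a='a] by (simp add: tent_mass_def)

lemma kern_lipschitz: "\<bar>kern (u - v) - kern u\<bar> \<le> norm v / tent_mass TYPE('a)" for u v :: "'a::euclidean_space"
proof -
  have "\<bar>tent (u - v) - tent u\<bar> \<le> norm v"
    unfolding tent_def using norm_triangle_ineq2[of u v] norm_triangle_sub[of "u - v" u] by (auto simp: max_def)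
  then show ?thesis using tent_mass_pos[where 'a='a]
    by (simp add: kern_def diff_divide_distrib[symmetric] abs_divide divide_right_mono)
qed

lemma lborel_translate:
  fixes f :: "'a::euclidean_space \<Rightarrow> real"
  assumes f: "integrable lborel f"
  shows "integrable lborel (\<lambda>u. f (c + u))" "(\<integral>u. f (c + u) \<partial>lborel) = integral\<^sup>L lborel f"
proof -
  have [measurable]: "f \<in> borel_measurable borel" using borel_measurable_integrable[OF f] by simp
  have "integrable (distr lborel borel ((+) c)) f" using f by (simp add: lborel_distr_plus)
  then show "integrable lborel (\<lambda>u. f (c + u))" by (subst (asm) integrable_distr_eq) auto
  have "integral\<^sup>L (distr lborel borel ((+) c)) f = (\<integral>u. f (c + u) \<partial>lborel)" by (rule integral_distr) auto
  then show "(\<integral>u. f (c + u) \<partial>lborel) = integral\<^sup>L lborel f" by (simp add: lborel_distr_plus)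
qed

section \<open>Averaging along the image of the unit ball\<close>

locale dilation =
  fixes \<delta> :: "'a::euclidean_space \<Rightarrow> 'a"
  assumes linear_\<delta>: "linear \<delta>"
begin

definition Kop :: "('a \<Rightarrow> real) \<Rightarrow> 'a \<Rightarrow> real" where
  "Kop f x = (\<integral>u. kern u * f (x + \<delta> u) \<partial>lborel)"

lemma continuous_shift: "continuous_on UNIV f \<Longrightarrow> continuous_on UNIV (\<lambda>u. f (x + \<delta> u))" for f :: "'a \<Rightarrow> real"
proof -
  assume f: "continuous_on UNIV f"
  have "continuous_on UNIV \<delta>" using linear_\<delta> by (simp add: linear_continuous_on linear_conv_bounded_linear)
  then show ?thesis by (intro continuous_on_compose2[OF f] continuous_intros) auto
qed

lemma integrable_Kop:
  assumes f: "bcont f" and g: "integrable lborel g"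
  shows "integrable lborel (\<lambda>u. g u * f (x + \<delta> u))"
proof -
  obtain K where K: "continuous_on UNIV f" "\<And>x. \<bar>f x\<bar> \<le> K" "0 \<le> K" using bcontE[OF f] by metis
  have "(\<lambda>u. f (x + \<delta> u)) \<in> borel_measurable borel"
    by (rule borel_measurable_continuous_onI[OF continuous_shift[OF K(1)]])
  then have m: "(\<lambda>u. g u * f (x + \<delta> u)) \<in> borel_measurable lborel"
    using borel_measurable_integrable[OF g] by simp
  show ?thesis
    by (rule Bochner_Integration.integrable_bound[OF integrable_mult_right[OF integrable_abs[OF g], of K] m])
      (use K in \<open>auto intro!: AE_I2 mult_right_mono simp: abs_mult mult.commute[of _ "\<bar>f _\<bar>"]\<close>)
qed

lemma Kop_bound:
  assumes f: "bcont f" and le: "\<And>x. \<bar>f x\<bar> \<le> W"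
  shows "\<bar>Kop f x\<bar> \<le> W"
proof -
  have "\<bar>Kop f x\<bar> \<le> (\<integral>u. \<bar>kern u * f (x + \<delta> u)\<bar> \<partial>lborel)" unfolding Kop_def by (rule integral_abs_bound)
  also have "\<dots> \<le> (\<integral>u. kern (u::'a) * W \<partial>lborel)"
    using le by (intro integral_mono integrable_abs integrable_Kop f integrable_kern integrable_mult_left)
      (auto simp: abs_mult kern_nonneg mult_left_mono)
  finally show ?thesis by (simp add: integral_kern)
qed

lemma bcont_Kop:
  assumes f: "bcont f"
  shows "bcont (Kop f)"
proof -
  obtain K where K: "continuous_on UNIV f" "\<And>x. \<bar>f x\<bar> \<le> K" "0 \<le> K" using bcontE[OF f] by metis
  have "continuous_on UNIV (Kop f)"
  proof (rule continuous_on_sequentiallyI)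
    fix X :: "nat \<Rightarrow> 'a" and a assume X: "X \<longlonglongrightarrow> a"
    show "(\<lambda>n. Kop f (X n)) \<longlonglongrightarrow> Kop f a" unfolding Kop_def
    proof (rule integral_dominated_convergence[where w = "\<lambda>u. kern u * K"])
      show "AE u in lborel. (\<lambda>n. kern u * f (X n + \<delta> u)) \<longlonglongrightarrow> kern u * f (a + \<delta> u)"
        using K(1) by (intro AE_I2 tendsto_mult tendsto_const continuous_on_tendsto_compose[OF K(1)] tendsto_add X) auto
      show "AE u in lborel. norm (kern u * f (X n + \<delta> u)) \<le> kern u * K" for n
        using K(2) by (auto simp: abs_mult kern_nonneg mult_left_mono)
      show "integrable lborel (\<lambda>u. kern u * K)" by (intro integrable_mult_left integrable_kern)
    qed (use integrable_Kop[OF f integrable_kern, THEN borel_measurable_integrable] in auto)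
  qed
  then show ?thesis using Kop_bound[OF f K(2)] unfolding bcont_def by blast
qed

lemma Kop_diff:
  assumes "bcont f" "bcont g"
  shows "Kop (\<lambda>x. f x - g x) x = Kop f x - Kop g x"
  unfolding Kop_def right_diff_distrib
  by (rule Bochner_Integration.integral_diff[OF integrable_Kop[OF assms(1) integrable_kern] integrable_Kop[OF assms(2) integrable_kern]])

lemma Kop_diff1:
  assumes f: "bcont f"
  shows "Kop (diff1 z f) = diff1 z (Kop f)"
proof
  fix x
  have fz: "bcont (\<lambda>x. f (x + z))" by (rule bcont_shift[OF f])
  show "Kop (diff1 z f) x = diff1 z (Kop f) x"
    using Kop_diff[OF fz f, of x] unfolding diff1_def[abs_def] by (simp add: Kop_def ac_simps)
qed

lemma Kop_diffs: "bcont f \<Longrightarrow> Kop (diffs zs f) = diffs zs (Kop f)"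
  by (induction zs) (simp_all add: Kop_diff1 bcont_diffs)

lemma Kop_approx:
  assumes f: "bcont f" and le: "\<And>u. norm u \<le> 1 \<Longrightarrow> \<bar>diff1 (\<delta> u) f x\<bar> \<le> W"
  shows "\<bar>f x - Kop f x\<bar> \<le> W"
proof -
  have i: "integrable lborel (\<lambda>u. kern u * f (x + \<delta> u))" by (rule integrable_Kop[OF f integrable_kern])
  have "f x - Kop f x = (\<integral>u. kern u * f x - kern u * f (x + \<delta> u) \<partial>lborel)"
    unfolding Kop_def using i integrable_kern[where 'a='a] by (simp add: integral_kern)
  also have "\<bar>\<dots>\<bar> \<le> (\<integral>u. \<bar>kern u * f x - kern u * f (x + \<delta> u)\<bar> \<partial>lborel)" by (rule integral_abs_bound)
  also have "\<dots> \<le> (\<integral>u. kern (u::'a) * W \<partial>lborel)"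
  proof (rule integral_mono)
    show "integrable lborel (\<lambda>u. \<bar>kern u * f x - kern u * f (x + \<delta> u)\<bar>)"
      by (intro integrable_abs Bochner_Integration.integrable_diff i integrable_mult_left integrable_kern)
    fix u :: 'a
    show "\<bar>kern u * f x - kern u * f (x + \<delta> u)\<bar> \<le> kern u * W"
    proof (cases "norm u \<le> 1")
      case True
      have "\<bar>kern u * f x - kern u * f (x + \<delta> u)\<bar> = kern u * \<bar>diff1 (\<delta> u) f x\<bar>"
        using kern_nonneg[of u] by (simp add: diff1_def right_diff_distrib[symmetric] abs_mult abs_minus_commute)
      then show ?thesis using le[OF True] kern_nonneg[of u] by (simp add: mult_left_mono)
    qed (simp add: kern_zero)
  qed (intro integrable_mult_left integrable_kern)
  finally show ?thesis by (simp add: integral_kern)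
qed

text \<open>Bounds the integral of \<open>\<bar>kern (u - v) - kern u\<bar>\<close> per unit of
  \<open>norm v\<close>: the Lipschitz constant of the kernel times the volume of a ball containing
  both supports when \<open>norm v \<le> R\<close>.\<close>

definition kern_const :: "real \<Rightarrow> real" where
  "kern_const R = measure lborel (cball (0::'a) (1 + R)) / tent_mass TYPE('a)"

lemma kern_const_nonneg: "0 \<le> kern_const R"
  using tent_mass_pos[where 'a='a] by (simp add: kern_const_def)

text \<open>The kernel \<open>kern (u - v) - kern u\<close> has integral 0, so it acts on \<open>diff1 (\<delta> u) f\<close>.\<close>
lemma diff1_Kop_bound:
  assumes f: "bcont f" and v: "norm v \<le> R" and le: "\<And>u. norm u \<le> 1 + R \<Longrightarrow> \<bar>diff1 (\<delta> u) f x\<bar> \<le> W"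
  shows "\<bar>diff1 (\<delta> v) (Kop f) x\<bar> \<le> kern_const R * norm v * W"
proof -
  have R: "0 \<le> R" using v norm_ge_zero order_trans by blast
  have W: "0 \<le> W" using le[of 0] R by fastforce
  define \<kappa> where "\<kappa> u = kern (u - v) - kern u" for u
  have ks: "integrable lborel (\<lambda>u. kern (u - v))" "(\<integral>u. kern (u - v) \<partial>lborel) = 1"
    using lborel_translate[OF integrable_kern, of "- v"] by (simp_all add: integral_kern)
  have i\<kappa>: "integrable lborel \<kappa>" "(\<integral>u. \<kappa> u \<partial>lborel) = 0"
    unfolding \<kappa>_def[abs_def] using ks integrable_kern[where 'a='a] by (simp_all add: integral_kern)
  have \<kappa>_le: "\<bar>\<kappa> u\<bar> \<le> norm v / tent_mass TYPE('a) * indicator (cball 0 (1 + R)) u" for u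
  proof (cases "norm u \<le> 1 + R")
    case True
    then show ?thesis using kern_lipschitz[of u v] by (simp add: \<kappa>_def)
  next
    case False
    then have "1 < norm u" "1 < norm (u - v)" using v R norm_triangle_sub[of u v] by linarith+
    then show ?thesis using False by (simp add: \<kappa>_def kern_zero)
  qed
  have shift: "Kop f (x + \<delta> v) = (\<integral>u. kern (u - v) * f (x + \<delta> u) \<partial>lborel)"
  proof -
    have "(\<integral>u. kern (u - v) * f (x + \<delta> u) \<partial>lborel) = (\<integral>u. kern (v + u - v) * f (x + \<delta> (v + u)) \<partial>lborel)"
      by (rule lborel_translate(2)[symmetric, OF integrable_Kop[OF f ks(1)]])
    then show ?thesis by (simp add: Kop_def linear_add[OF linear_\<delta>] add.assoc)
  qed
  have i1: "integrable lborel (\<lambda>u. \<kappa> u * f (x + \<delta> u))" by (rule integrable_Kop[OF f i\<kappa>(1)])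
  have i2: "integrable lborel (\<lambda>u. \<kappa> u * f x)" using i\<kappa>(1) by simp
  have "diff1 (\<delta> v) (Kop f) x = (\<integral>u. \<kappa> u * f (x + \<delta> u) \<partial>lborel)"
    unfolding diff1_def shift unfolding Kop_def \<kappa>_def left_diff_distrib
    by (rule Bochner_Integration.integral_diff[symmetric, OF integrable_Kop[OF f ks(1)] integrable_Kop[OF f integrable_kern]])
  also have "\<dots> = (\<integral>u. \<kappa> u * f (x + \<delta> u) - \<kappa> u * f x \<partial>lborel)"
    unfolding Bochner_Integration.integral_diff[OF i1 i2] using i\<kappa> by simp
  also have "\<bar>\<dots>\<bar> \<le> (\<integral>u. \<bar>\<kappa> u * f (x + \<delta> u) - \<kappa> u * f x\<bar> \<partial>lborel)" by (rule integral_abs_bound)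
  also have "\<dots> \<le> (\<integral>u. norm v / tent_mass TYPE('a) * W * indicator (cball 0 (1 + R)) (u::'a) \<partial>lborel)"
  proof (rule integral_mono)
    show "integrable lborel (\<lambda>u. \<bar>\<kappa> u * f (x + \<delta> u) - \<kappa> u * f x\<bar>)"
      by (intro integrable_abs Bochner_Integration.integrable_diff i1 i2)
    show "integrable lborel (\<lambda>u. norm v / tent_mass TYPE('a) * W * indicat_real (cball (0::'a) (1 + R)) u)"
      using emeasure_lborel_cball_finite[of "0::'a"] by (intro integrable_mult_right integrable_real_indicator) auto
    fix u :: 'a
    have "\<bar>\<kappa> u * f (x + \<delta> u) - \<kappa> u * f x\<bar> = \<bar>\<kappa> u\<bar> * \<bar>diff1 (\<delta> u) f x\<bar>"
      by (simp add: diff1_def right_diff_distrib[symmetric] abs_mult)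
    also have "\<dots> \<le> norm v / tent_mass TYPE('a) * W * indicator (cball 0 (1 + R)) u"
    proof (cases "norm u \<le> 1 + R")
      case True
      then show ?thesis using mult_mono[OF \<kappa>_le[of u] le[OF True]] W tent_mass_pos[where 'a='a] by simp
    next
      case False
      then show ?thesis using \<kappa>_le[of u] by simp
    qed
    finally show "\<bar>\<kappa> u * f (x + \<delta> u) - \<kappa> u * f x\<bar> \<le> norm v / tent_mass TYPE('a) * W * indicator (cball 0 (1 + R)) u" .
  qed
  also have "\<dots> = kern_const R * norm v * W"
    by (simp add: kern_const_def)
  finally show ?thesis .
qed

lemma bcont_Kop_pow: "bcont f \<Longrightarrow> bcont ((Kop ^^ i) f)"
  by (induction i) (auto intro: bcont_Kop)

lemma Kop_pow_diffs: "bcont f \<Longrightarrow> (Kop ^^ i) (diffs zs f) = diffs zs ((Kop ^^ i) f)"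
  by (induction i) (simp_all add: Kop_diffs bcont_Kop_pow)

lemma Kop_pow_bound: "bcont f \<Longrightarrow> (\<And>x. \<bar>f x\<bar> \<le> W) \<Longrightarrow> \<bar>(Kop ^^ i) f x\<bar> \<le> W"
  by (induction i arbitrary: x) (auto intro: Kop_bound bcont_Kop_pow)

lemma Kop_pow_approx:
  assumes f: "bcont f" and le: "\<And>u x. norm u \<le> 1 \<Longrightarrow> \<bar>diff1 (\<delta> u) f x\<bar> \<le> W"
  shows "\<bar>f x - (Kop ^^ i) f x\<bar> \<le> real i * W"
proof (induction i arbitrary: x)
  case (Suc i)
  have b: "bcont (\<lambda>x. f x - (Kop ^^ i) f x)" by (intro bcont_diff f bcont_Kop_pow)
  have "f x - (Kop ^^ Suc i) f x = (f x - Kop f x) + Kop (\<lambda>x. f x - (Kop ^^ i) f x) x"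
    using Kop_diff[OF f bcont_Kop_pow[OF f]] by simp
  also have "\<bar>\<dots>\<bar> \<le> W + real i * W"
    using Kop_approx[OF f le, of x] Kop_bound[OF b Suc, of x] abs_triangle_ineq order_trans by fastforce
  finally show ?case by (simp add: algebra_simps)
qed simp

text \<open>Averaging commutes with differences, so each difference can be given to a copy of
  \<open>Kop\<close> of its own. That copy replaces the step \<open>v\<close> by arbitrary steps of
  length at most \<open>1 + R\<close> and yields the factor \<open>kern_const R * norm v\<close>;
  the number of differences of \<open>f\<close> stays the same throughout.\<close>

lemma diffs_Kop_pow:
  assumes f: "bcont f" and vs: "\<And>v. v \<in> set vs \<Longrightarrow> norm v \<le> R"
    and le: "\<And>us (x::'a). length us = length vs \<Longrightarrow> (\<And>u. u \<in> set us \<Longrightarrow> norm u \<le> 1 + R) \<Longrightarrow> \<bar>diffs (map \<delta> us) f x\<bar> \<le> W"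
  shows "\<bar>diffs (map \<delta> vs) ((Kop ^^ length vs) f) x\<bar> \<le> (\<Prod>v\<leftarrow>vs. kern_const R * norm v) * W"
  using assms
proof (induction vs arbitrary: f x W)
  case Nil
  from Nil.prems(3)[of "[]"] show ?case by simp
next
  case (Cons v vs)
  define g where "g = diffs (map \<delta> vs) ((Kop ^^ length vs) f)"
  have bg: "bcont g" unfolding g_def by (intro bcont_diffs bcont_Kop_pow Cons.prems)
  have gd: "\<bar>diff1 (\<delta> u) g x\<bar> \<le> (\<Prod>v\<leftarrow>vs. kern_const R * norm v) * W" if u: "norm u \<le> 1 + R" for u x
  proof -
    have "diff1 (\<delta> u) g = diffs (map \<delta> vs) ((Kop ^^ length vs) (diff1 (\<delta> u) f))"
      unfolding g_def using Kop_pow_diffs[OF Cons.prems(1), of "length vs" "[\<delta> u]"] by (simp add: diffs_diff1)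
    moreover have "\<bar>diffs (map \<delta> vs) ((Kop ^^ length vs) (diff1 (\<delta> u) f)) x\<bar> \<le> (\<Prod>v\<leftarrow>vs. kern_const R * norm v) * W"
    proof (rule Cons.IH)
      show "bcont (diff1 (\<delta> u) f)" by (rule bcont_diff1[OF Cons.prems(1)])
      fix us :: "'a list" and x :: 'a assume us: "length us = length vs" "\<And>u. u \<in> set us \<Longrightarrow> norm u \<le> 1 + R"
      have "\<bar>diffs (map \<delta> (u # us)) f x\<bar> \<le> W" using us u by (intro Cons.prems(3)) auto
      then show "\<bar>diffs (map \<delta> us) (diff1 (\<delta> u) f) x\<bar> \<le> W" by (simp add: diffs_diff1)
    qed (use Cons.prems in auto)
    ultimately show ?thesis by simp
  qed
  have "diffs (map \<delta> (v # vs)) ((Kop ^^ length (v # vs)) f) = diff1 (\<delta> v) (Kop g)"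
    unfolding g_def by (simp add: Kop_diffs bcont_Kop_pow[OF Cons.prems(1)])
  moreover have "\<bar>diff1 (\<delta> v) (Kop g) x\<bar> \<le> kern_const R * norm v * ((\<Prod>v\<leftarrow>vs. kern_const R * norm v) * W)"
    using Cons.prems(2) gd by (intro diff1_Kop_bound bg) auto
  ultimately show ?case by (simp add: mult.assoc)
qed

text \<open>With \<open>L = Kop\<^sup>m\<close>, this is \<open>f = (1 - L)\<^sup>m f + (\<Sum>i<m. L (1 - L)\<^sup>i f)\<close>.\<close>
lemma smooth_decomposition:
  assumes f: "bcont f" and R: "0 \<le> R"
    and le: "\<And>us (x::'a). length us = m \<Longrightarrow> (\<And>u. u \<in> set us \<Longrightarrow> norm u \<le> 1 + R) \<Longrightarrow> \<bar>diffs (map \<delta> us) f x\<bar> \<le> W"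
  obtains g h where "bcont g" "bcont h" "\<And>x. f x = g x + h x" "\<And>x. \<bar>g x\<bar> \<le> real m ^ m * W"
    "\<And>vs (x::'a). length vs = m \<Longrightarrow> (\<And>v. v \<in> set vs \<Longrightarrow> norm v \<le> R) \<Longrightarrow>
      \<bar>diffs (map \<delta> vs) h x\<bar> \<le> real m * 2 ^ m * (\<Prod>v\<leftarrow>vs. kern_const R * norm v) * W"
proof -
  define T where "T f = (\<lambda>x. f x - (Kop ^^ m) f x)" for f
  have bT: "bcont (T f)" if "bcont f" for f unfolding T_def by (intro bcont_diff that bcont_Kop_pow)
  have bTi: "bcont ((T ^^ i) f)" if "bcont f" for f i by (induction i) (auto intro: bT that)
  have T_diffs: "T (diffs zs f) = diffs zs (T f)" if "bcont f" for f zs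
    using that by (simp add: T_def Kop_pow_diffs fun_eq_iff diffs_minus)
  have Ti_diffs: "(T ^^ i) (diffs zs f) = diffs zs ((T ^^ i) f)" if "bcont f" for f zs i
    by (induction i) (simp_all add: T_diffs bTi that)
  \<comment> \<open>Each factor of \<open>T ^^ j\<close> consumes one difference and costs a factor
    \<open>m\<close>, since \<open>T\<close> is the identity minus \<open>m\<close> averagings. The
    induction hypothesis is applied to \<open>diff1 (\<delta> u) f\<close>.\<close>
  have small: "\<bar>(T ^^ j) f x\<bar> \<le> real m ^ j * W"
    if "bcont f" "\<And>us (x::'a). length us = j \<Longrightarrow> (\<And>u. u \<in> set us \<Longrightarrow> norm u \<le> 1) \<Longrightarrow> \<bar>diffs (map \<delta> us) f x\<bar> \<le> W" for f j x
    using that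
  proof (induction j arbitrary: f x)
    case 0
    from 0(2)[of "[]"] show ?case by simp
  next
    case (Suc j)
    have d: "\<bar>diff1 (\<delta> u) ((T ^^ j) f) x\<bar> \<le> real m ^ j * W" if u: "norm u \<le> 1" for u x
    proof -
      have "diff1 (\<delta> u) ((T ^^ j) f) = (T ^^ j) (diff1 (\<delta> u) f)" using Ti_diffs[OF Suc.prems(1), of j "[\<delta> u]"] by simp
      moreover have "\<bar>(T ^^ j) (diff1 (\<delta> u) f) x\<bar> \<le> real m ^ j * W"
      proof (rule Suc.IH)
        show "bcont (diff1 (\<delta> u) f)" by (rule bcont_diff1[OF Suc.prems(1)])
        fix us :: "'a list" and x :: 'a assume us: "length us = j" "\<And>u. u \<in> set us \<Longrightarrow> norm u \<le> 1"
        have "\<bar>diffs (map \<delta> (u # us)) f x\<bar> \<le> W" using us u by (intro Suc.prems(2)) auto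
        then show "\<bar>diffs (map \<delta> us) (diff1 (\<delta> u) f) x\<bar> \<le> W" by (simp add: diffs_diff1)
      qed
      ultimately show ?thesis by simp
    qed
    have "\<bar>T ((T ^^ j) f) x\<bar> \<le> real m * (real m ^ j * W)"
      unfolding T_def[of "(T ^^ j) f"] by (rule Kop_pow_approx[OF bTi[OF Suc.prems(1)] d])
    then show ?case by (simp add: mult.assoc)
  qed
  define h where "h x = (\<Sum>i<m. (Kop ^^ m) ((T ^^ i) f) x)" for x
  show thesis
  proof (rule that)
    show "bcont ((T ^^ m) f)" by (rule bTi[OF f])
    show "bcont h" unfolding h_def[abs_def] by (intro bcont_sum bcont_Kop_pow bTi f)
    have "f x = (T ^^ j) f x + (\<Sum>i<j. (Kop ^^ m) ((T ^^ i) f) x)" for j x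
      by (induction j) (simp_all add: T_def)
    then show "f x = (T ^^ m) f x + h x" for x unfolding h_def .
    show "\<bar>(T ^^ m) f x\<bar> \<le> real m ^ m * W" for x
      using le R by (intro small f) force
    fix vs :: "'a list" and x :: 'a assume vs: "length vs = m" "\<And>v. v \<in> set vs \<Longrightarrow> norm v \<le> R"
    let ?P = "\<Prod>v\<leftarrow>vs. kern_const R * norm v"
    have P: "0 \<le> ?P" by (induction vs) (auto simp: kern_const_nonneg)
    have Tle: "\<bar>diffs (map \<delta> us) ((T ^^ i) f) x\<bar> \<le> 2 ^ i * W"
      if us: "length us = m" "\<And>u. u \<in> set us \<Longrightarrow> norm u \<le> 1 + R" for us i x
    proof (induction i arbitrary: x)
      case 0
      show ?case using le[OF us] by simp
    next
      case (Suc i)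
      have b: "bcont (diffs (map \<delta> us) ((T ^^ i) f))" by (intro bcont_diffs bTi f)
      have "diffs (map \<delta> us) ((T ^^ Suc i) f) x = T (diffs (map \<delta> us) ((T ^^ i) f)) x"
        by (simp add: T_diffs bTi f)
      also have "\<bar>\<dots>\<bar> \<le> 2 ^ i * W + 2 ^ i * W"
        unfolding T_def[of "diffs (map \<delta> us) ((T ^^ i) f)"]
        using Suc[of x] Kop_pow_bound[OF b Suc, of m x] by (intro order_trans[OF abs_triangle_ineq4] add_mono)
      finally show ?case by (simp add: mult_ac)
    qed
    have W: "0 \<le> W" using le[of "replicate m 0" x] R by fastforce
    have "\<bar>diffs (map \<delta> vs) h x\<bar> = \<bar>\<Sum>i<m. diffs (map \<delta> vs) ((Kop ^^ m) ((T ^^ i) f)) x\<bar>"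
      unfolding h_def[abs_def] diffs_sum ..
    also have "\<dots> \<le> (\<Sum>i<m. \<bar>diffs (map \<delta> vs) ((Kop ^^ m) ((T ^^ i) f)) x\<bar>)" by (rule sum_abs)
    also have "\<dots> \<le> (\<Sum>i<m. ?P * (2 ^ i * W))"
    proof (rule sum_mono)
      fix i
      show "\<bar>diffs (map \<delta> vs) ((Kop ^^ m) ((T ^^ i) f)) x\<bar> \<le> ?P * (2 ^ i * W)"
        using diffs_Kop_pow[where f = "(T ^^ i) f" and vs = vs and R = R and W = "2 ^ i * W" and x = x, OF bTi[OF f] vs(2)] Tle vs(1)
        by simp
    qed
    also have "\<dots> \<le> (\<Sum>i<m. ?P * (2 ^ m * W))"
      using P W by (intro sum_mono mult_left_mono mult_right_mono power_increasing) auto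
    finally show "\<bar>diffs (map \<delta> vs) h x\<bar> \<le> real m * 2 ^ m * ?P * W" by (simp add: mult_ac)
  qed
qed

end

section \<open>Anisotropic differences under the semigroup\<close>

lemma prod_list_le_power:
  fixes f :: "'a \<Rightarrow> real"
  assumes "\<And>z. z \<in> set zs \<Longrightarrow> 0 \<le> f z \<and> f z \<le> q"
  shows "(\<Prod>z\<leftarrow>zs. f z) \<le> q ^ length zs"
  using assms
proof (induction zs)
  case (Cons z zs)
  have "0 \<le> (\<Prod>z\<leftarrow>zs. f z)" using Cons.prems by (intro prod_list_nonneg) auto
  moreover have "0 \<le> q" using Cons.prems[of z] by auto
  ultimately show ?case using Cons by (auto intro!: mult_mono)
qed simp

context kalman
begin

definition abox :: "(nat \<Rightarrow> real) \<Rightarrow> real \<Rightarrow> (real^'n) set" where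
  "abox d \<rho> = {y. \<forall>h\<in>{1..nn}. norm (pr h y) \<le> \<rho> powr d h}"

text \<open>Differences in arbitrary directions of an anisotropic box rather than along a single
  \<open>E h\<close>: e^(tA) mixes the subspaces, and the class must be usable after that. The
  exponents \<open>d\<close> are free because two systems of weights occur.\<close>

definition ahoelder :: "(nat \<Rightarrow> real) \<Rightarrow> nat \<Rightarrow> real \<Rightarrow> real \<Rightarrow> (real^'n \<Rightarrow> real) \<Rightarrow> bool" where
  "ahoelder d m \<beta> K \<phi> \<longleftrightarrow> bcont \<phi> \<and> (\<forall>x. \<bar>\<phi> x\<bar> \<le> K) \<and>
     (\<forall>\<rho> ys x. 0 < \<rho> \<longrightarrow> \<rho> \<le> 1 \<longrightarrow> length ys = m \<longrightarrow> set ys \<subseteq> abox d \<rho> \<longrightarrow> \<bar>diffs ys \<phi> x\<bar> \<le> K * \<rho> powr \<beta>)"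

text \<open>As all exponents are at least 1, enlarging the box by \<open>c\<close> is covered by
  enlarging the radius by \<open>c\<close>. If the radius then exceeds 1, the supremum bound takes
  over, which is the origin of \<open>2 ^ m\<close>.\<close>

lemma ahoelder_scaled:
  assumes a: "ahoelder d m \<beta> K \<phi>" and \<beta>: "0 \<le> \<beta>" and \<rho>: "0 < \<rho>" and c: "1 \<le> c"
    and d: "\<And>h. h \<in> {1..nn} \<Longrightarrow> 1 \<le> d h"
    and ys: "length ys = m" "\<And>y h. y \<in> set ys \<Longrightarrow> h \<in> {1..nn} \<Longrightarrow> norm (pr h y) \<le> c * \<rho> powr d h"
  shows "\<bar>diffs ys \<phi> x\<bar> \<le> 2 ^ m * K * (c * \<rho>) powr \<beta>"
proof (cases "c * \<rho> \<le> 1")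
  case True
  have "set ys \<subseteq> abox d (c * \<rho>)" unfolding abox_def
  proof safe
    fix y h assume yh: "y \<in> set ys" "h \<in> {1..nn}"
    have "c powr 1 \<le> c powr d h" using c d[OF yh(2)] by (rule powr_mono[rotated])
    then have "c * \<rho> powr d h \<le> (c * \<rho>) powr d h"
      using c \<rho> by (simp add: powr_mult mult_right_mono)
    with ys(2)[OF yh] show "norm (pr h y) \<le> (c * \<rho>) powr d h" by (rule order_trans)
  qed
  then have "\<bar>diffs ys \<phi> x\<bar> \<le> 1 * K * (c * \<rho>) powr \<beta>"
    using a ys(1) True c \<rho> unfolding ahoelder_def by simp
  also have "\<dots> \<le> 2 ^ m * K * (c * \<rho>) powr \<beta>"
  proof -
    have "0 \<le> K" using a abs_ge_zero order_trans unfolding ahoelder_def by blast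
    then show ?thesis by (intro mult_right_mono) auto
  qed
  finally show ?thesis .
next
  case False
  have K: "\<bar>\<phi> x\<bar> \<le> K" for x using a unfolding ahoelder_def by blast
  have "\<bar>diffs ys \<phi> x\<bar> \<le> 2 ^ m * K" using diffs_bound[of \<phi> K ys x] K ys(1) by simp
  also have "\<dots> * 1 \<le> 2 ^ m * K * (c * \<rho>) powr \<beta>"
    using False \<beta> order_trans[OF abs_ge_zero K] by (intro mult_left_mono ge_one_powr_ge_zero) auto
  finally show ?thesis by simp
qed

text \<open>To reach \<open>E h\<close> from \<open>E h0\<close> at least \<open>h - h0\<close>
  applications of \<open>A\<close> are needed, each with a factor \<open>s\<close>. The truncated
  subtraction makes the exponent 0 for \<open>h \<le> h0\<close>, where nothing is gained.\<close>

lemma pr_mexp: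
  obtains C where "1 \<le> C"
    "\<And>s h0 h z. \<bar>s\<bar> \<le> 1 \<Longrightarrow> h0 \<in> {1..nn} \<Longrightarrow> h \<in> {1..nn} \<Longrightarrow> z \<in> E h0 \<Longrightarrow>
      norm (pr h (mexp A s z)) \<le> C * \<bar>s\<bar> ^ (h - h0) * norm z"
proof -
  obtain C where C: "0 \<le> C" "\<And>s x m. \<bar>s\<bar> \<le> 1 \<Longrightarrow>
    norm (mexp A s x - (\<Sum>k<m. (s ^ k / fact k) *\<^sub>R (mat_pow A k *v x))) \<le> C * \<bar>s\<bar> ^ m * norm x"
    by (rule mexp_tail[of A]) blast
  show thesis
  proof (rule that[of "C + 1"])
    fix s h0 h z assume s: "\<bar>s\<bar> \<le> (1::real)" and h: "h0 \<in> {1..nn}" "h \<in> {1..nn}" and z: "z \<in> E h0"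
    have 0: "pr h ((s ^ k / fact k) *\<^sub>R (mat_pow A k *v z)) = 0" if "k < h - h0" for k
    proof -
      have "mat_pow A k *v z \<in> V (h0 + k)" using z E_subset_V by (intro mat_pow_V_space) blast
      then have "pr h (mat_pow A k *v z) = 0" using that by (intro pr_V_zero[OF h(2)]) auto
      then show ?thesis by (simp add: pr_scaleR)
    qed
    have "pr h (mexp A s z) = pr h (mexp A s z - (\<Sum>k<h - h0. (s ^ k / fact k) *\<^sub>R (mat_pow A k *v z)))"
      using 0 by (simp add: pr_diff pr_sum)
    then have "norm (pr h (mexp A s z)) \<le> norm (mexp A s z - (\<Sum>k<h - h0. (s ^ k / fact k) *\<^sub>R (mat_pow A k *v z)))"
      using norm_pr_le[OF h(2)] by metis
    also have "\<dots> \<le> C * \<bar>s\<bar> ^ (h - h0) * norm z" by (rule C(2)[OF s])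
    also have "\<dots> \<le> (C + 1) * \<bar>s\<bar> ^ (h - h0) * norm z" by (intro mult_right_mono) auto
    finally show "norm (pr h (mexp A s z)) \<le> (C + 1) * \<bar>s\<bar> ^ (h - h0) * norm z" .
  qed (use C in simp)
qed

end

context ou
begin

lemma integrable_PP:
  fixes f :: "real^'n \<Rightarrow> real"
  assumes "0 \<le> t" "bcont f"
  shows "integrable M (\<lambda>\<omega>. f (y + Y t \<omega>))"
proof -
  obtain K where K: "continuous_on UNIV f" "\<And>x. \<bar>f x\<bar> \<le> K" using bcontE[OF assms(2)] by metis
  show ?thesis using K by (intro integrable_const_bound[of _ K] measurable_PP assms(1)) auto
qed

lemma PP_bound:
  fixes f :: "real^'n \<Rightarrow> real"
  assumes "0 \<le> t" "bcont f" "\<And>x. \<bar>f x\<bar> \<le> K"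
  shows "\<bar>PP t f x\<bar> \<le> K"
proof -
  have "\<bar>PP t f x\<bar> \<le> (\<integral>\<omega>. \<bar>f (mexp A t x + Y t \<omega>)\<bar> \<partial>M)" unfolding PP_def by (rule integral_abs_bound)
  also have "\<dots> \<le> (\<integral>\<omega>. K \<partial>M)"
    by (rule integral_mono[OF integrable_abs[OF integrable_PP[OF assms(1,2)]]]) (simp_all add: assms(3))
  finally show ?thesis by (simp add: prob_space)
qed

lemma PP_add:
  fixes f g :: "real^'n \<Rightarrow> real"
  assumes "0 \<le> t" "bcont f" "bcont g"
  shows "PP t (\<lambda>x. f x + g x) x = PP t f x + PP t g x"
  unfolding PP_def by (intro Bochner_Integration.integral_add integrable_PP assms)

lemma diffs_PP:
  fixes f :: "real^'n \<Rightarrow> real"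
  assumes t: "0 \<le> t" and f: "bcont f"
  shows "diffs zs (PP t f) x = PP t (diffs (map (mexp A t) zs) f) x"
proof (induction zs arbitrary: x)
  case (Cons z zs)
  let ?g = "diffs (map (mexp A t) zs) f"
  have "diffs (z # zs) (PP t f) x = PP t ?g (x + z) - PP t ?g x" by (simp add: diff1_def Cons)
  also have "\<dots> = (\<integral>\<omega>. ?g (mexp A t (x + z) + Y t \<omega>) - ?g (mexp A t x + Y t \<omega>) \<partial>M)"
    unfolding PP_def by (intro Bochner_Integration.integral_diff[symmetric] integrable_PP t bcont_diffs f)
  also have "\<dots> = PP t (diffs (map (mexp A t) (z # zs)) f) x"
    unfolding PP_def by (simp add: diff1_def linear_add[OF linear_mexp] ac_simps)
  finally show ?case .
qed simp

lemma eps_powr_power: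
  assumes "0 < t"
  shows "t ^ k = eps t powr (\<alpha> * real k)"
  using assms alpha by (simp add: eps_def powr_powr powr_realpow)

lemma norm_dlinv:
  assumes t: "0 < t" and h: "h \<in> {1..nn}" and z: "z \<in> E h"
  shows "norm (dlinv t z) = norm z / eps t powr (1 + \<alpha> * (real h - 1))"
proof -
  have "eps t * t ^ (h - 1) = eps t powr (1 + \<alpha> * (real h - 1))"
    unfolding eps_powr_power[OF t] using h eps_pos[OF t] by (simp add: powr_add of_nat_diff)
  then show ?thesis unfolding dlinv_def dil_E[OF h z] using eps_pos[OF t] by simp
qed

text \<open>The rough part \<open>g\<close> has size of order \<open>e powr \<beta>\<close> and
  takes the smoothing bound. For the smooth part \<open>h\<close> the differences pass under the
  semigroup and use its regularity at scale \<open>e\<close>. Both give the same quantity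
  \<open>q ^ m * W\<close>, where \<open>q\<close> is the ratio of the step length to the natural
  scale of \<open>E h0\<close> at time \<open>t\<close>.\<close>

lemma diffs_PP_small_scale:
  fixes R C1 C2 :: real
  assumes h0: "h0 \<in> {1..nn}" and m: "1 \<le> m" "m \<le> 3" and D: "D = 1 + \<alpha> * (real h0 - 1)"
    and d: "\<And>h. h \<in> {1..nn} \<Longrightarrow> 1 \<le> d h \<and> d h \<le> D + \<alpha> * real (h - h0)"
    and \<beta>: "0 \<le> \<beta>" and \<gamma>: "\<gamma> \<le> real m * D" "0 \<le> \<gamma>"
    and C1: "1 \<le> C1" "\<And>s h z. \<bar>s\<bar> \<le> 1 \<Longrightarrow> h \<in> {1..nn} \<Longrightarrow> z \<in> E h0 \<Longrightarrow>
        norm (pr h (mexp A s z)) \<le> C1 * \<bar>s\<bar> ^ (h - h0) * norm z"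
    and R: "R = real nn * C1"
    and t: "0 < t" "t \<le> 1" and C2: "0 \<le> C2"
    and smooth: "\<And>zs \<phi> K x. length zs \<le> 3 \<Longrightarrow> continuous_on UNIV \<phi> \<Longrightarrow> (\<And>y. \<bar>\<phi> y\<bar> \<le> K) \<Longrightarrow>
        \<bar>diffs zs (PP t \<phi>) x\<bar> \<le> (\<Prod>z\<leftarrow>zs. C2 * norm (dlinv t z)) * K"
    and \<phi>: "ahoelder d m \<beta> K \<phi>" and \<rho>: "0 < \<rho>" "\<rho> \<le> eps t"
    and zs: "length zs = m" "\<And>z. z \<in> set zs \<Longrightarrow> z \<in> E h0 \<and> norm z \<le> \<rho> powr D"
  shows "\<bar>diffs zs (PP t \<phi>) x\<bar> \<le> ((C2 ^ m * real m ^ m + real m * 2 ^ m * (dilation.kern_const TYPE(real^'n) R * R) ^ m)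
    * 2 ^ m * (1 + R) powr \<beta>) * eps t powr (\<beta> - \<gamma>) * K * \<rho> powr \<gamma>"
proof -
  define e where "e = eps t"
  have e: "0 < e" "e \<le> 1" unfolding e_def using t eps_pos eps_le_1 by auto
  have R0: "0 \<le> R" unfolding R using C1 by simp
  have D1: "1 \<le> D" unfolding D using h0 alpha by simp
  have K0: "0 \<le> K" using \<phi> abs_ge_zero order_trans unfolding ahoelder_def by blast
  have b\<phi>: "bcont \<phi>" using \<phi> unfolding ahoelder_def by blast
  define q where "q = (\<rho> / e) powr D"
  have q: "0 \<le> q" "q \<le> 1" unfolding q_def using \<rho> e D1 by (auto simp: e_def powr_le1)
  define \<delta> where "\<delta> = dil (\<lambda>h. e powr d h)"
  define \<delta>' where "\<delta>' = dil (\<lambda>h. 1 / e powr d h)"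
  define W where "W = 2 ^ m * K * ((1 + R) * e) powr \<beta>"
  have W0: "0 \<le> W" unfolding W_def using K0 by simp
  interpret dilation \<delta> unfolding dilation_def \<delta>_def by (rule linear_dil)
  have \<delta>\<delta>': "\<delta> (\<delta>' y) = y" for y unfolding \<delta>_def \<delta>'_def dil_dil using e by (intro dil_id) simp
  have z_le: "norm z / e powr D \<le> q" if "z \<in> set zs" for z
  proof -
    have "norm z / e powr D \<le> \<rho> powr D / e powr D" using zs(2)[OF that] by (intro divide_right_mono) auto
    then show ?thesis unfolding q_def using \<rho> e by (simp add: powr_divide)
  qed
  \<comment> \<open>In the coordinates of \<delta> the displaced increment still has size of order
    \<open>q\<close>: a component moved up to \<open>E h\<close> carries
    \<open>t ^ (h - h0)\<close>, which pays for the larger exponent \<open>d h\<close> thanks to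
    \<open>d h \<le> D + \<alpha> * real (h - h0)\<close>.\<close>
  have v_le: "norm (\<delta>' (mexp A t z)) \<le> R * q" if z: "z \<in> set zs" for z
  proof -
    have "norm (pr h (\<delta>' (mexp A t z))) \<le> C1 * q" if h: "h \<in> {1..nn}" for h
    proof -
      have "norm (pr h (\<delta>' (mexp A t z))) = norm (pr h (mexp A t z)) / e powr d h"
        unfolding \<delta>'_def pr_dil[OF h] using e by simp
      also have "\<dots> \<le> C1 * t ^ (h - h0) * norm z / e powr d h"
        using C1(2)[OF _ h, of t z] t zs(2)[OF z] by (intro divide_right_mono) auto
      also have "t ^ (h - h0) = e powr (\<alpha> * real (h - h0))" unfolding e_def by (rule eps_powr_power[OF t(1)])
      also have "C1 * e powr (\<alpha> * real (h - h0)) * norm z / e powr d h \<le> C1 * e powr (\<alpha> * real (h - h0)) * norm z / e powr (D + \<alpha> * real (h - h0))"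
        using e d[OF h] C1(1) by (intro divide_left_mono powr_mono') auto
      also have "\<dots> = C1 * (norm z / e powr D)" using e by (simp add: powr_add)
      also have "\<dots> \<le> C1 * q" using z_le[OF z] C1 by (intro mult_left_mono) auto
      finally show ?thesis .
    qed
    then have "(\<Sum>h=1..nn. norm (pr h (\<delta>' (mexp A t z)))) \<le> (\<Sum>h=1..nn. C1 * q)" by (intro sum_mono)
    then show ?thesis using norm_le_sum_pr[of "\<delta>' (mexp A t z)"] by (simp add: R)
  qed
  obtain g h where gh: "bcont g" "bcont h" "\<And>x. \<phi> x = g x + h x" "\<And>x. \<bar>g x\<bar> \<le> real m ^ m * W"
    "\<And>vs (x::real^'n). length vs = m \<Longrightarrow> (\<And>v. v \<in> set vs \<Longrightarrow> norm v \<le> R) \<Longrightarrow>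
      \<bar>diffs (map \<delta> vs) h x\<bar> \<le> real m * 2 ^ m * (\<Prod>v\<leftarrow>vs. kern_const R * norm v) * W"
  proof (rule smooth_decomposition[OF b\<phi> R0])
    fix us :: "(real^'n) list" and x :: "real^'n" assume us: "length us = m" "\<And>u. u \<in> set us \<Longrightarrow> norm u \<le> 1 + R"
    show "\<bar>diffs (map \<delta> us) \<phi> x\<bar> \<le> W" unfolding W_def
    proof (rule ahoelder_scaled[OF \<phi> \<beta> e(1)])
      fix y h assume y: "y \<in> set (map \<delta> us)" and h: "h \<in> {1..nn}"
      then obtain u where u: "u \<in> set us" "y = \<delta> u" by auto
      have "norm (pr h u) \<le> 1 + R" using norm_pr_le[OF h] us(2)[OF u(1)] order_trans by blast
      then show "norm (pr h y) \<le> (1 + R) * e powr d h"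
        unfolding u \<delta>_def pr_dil[OF h] by (simp add: mult.commute[of "1 + R"] mult_left_mono)
    qed (use R0 d us in auto)
  qed blast
  have "\<bar>diffs zs (PP t g) x\<bar> \<le> (\<Prod>z\<leftarrow>zs. C2 * norm (dlinv t z)) * (real m ^ m * W)"
    using gh(1,4) zs(1) m(2) unfolding bcont_def by (intro smooth) auto
  also have "\<dots> \<le> (C2 * q) ^ m * (real m ^ m * W)"
  proof (rule mult_right_mono)
    show "(\<Prod>z\<leftarrow>zs. C2 * norm (dlinv t z)) \<le> (C2 * q) ^ m" unfolding zs(1)[symmetric]
    proof (rule prod_list_le_power)
      fix z assume z: "z \<in> set zs"
      have "norm (dlinv t z) \<le> q"
        using norm_dlinv[OF t(1) h0, of z] zs(2)[OF z] z_le[OF z] by (simp add: D e_def)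
      then show "0 \<le> C2 * norm (dlinv t z) \<and> C2 * norm (dlinv t z) \<le> C2 * q" using C2 by (simp add: mult_left_mono)
    qed
  qed (use W0 in simp)
  finally have gb: "\<bar>diffs zs (PP t g) x\<bar> \<le> C2 ^ m * real m ^ m * (q ^ m * W)" by (simp add: power_mult_distrib mult_ac)
  have hb: "\<bar>diffs zs (PP t h) x\<bar> \<le> real m * 2 ^ m * (kern_const R * R) ^ m * (q ^ m * W)"
    unfolding diffs_PP[OF less_imp_le[OF t(1)] gh(2)]
  proof (rule PP_bound)
    fix x
    let ?vs = "map (\<lambda>z. \<delta>' (mexp A t z)) zs"
    have map_eq: "map (mexp A t) zs = map \<delta> ?vs" by (simp add: \<delta>\<delta>')
    have 1: "\<bar>diffs (map \<delta> ?vs) h x\<bar> \<le> real m * 2 ^ m * (\<Prod>v\<leftarrow>?vs. kern_const R * norm v) * W"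
    proof (rule gh(5))
      fix v assume "v \<in> set ?vs"
      then obtain z where z: "z \<in> set zs" "v = \<delta>' (mexp A t z)" by auto
      have "norm v \<le> R * q" using v_le[OF z(1)] z(2) by simp
      also have "R * q \<le> R" using q R0 by (simp add: mult_left_le)
      finally show "norm v \<le> R" .
    qed (simp add: zs)
    have 2: "(\<Prod>v\<leftarrow>?vs. kern_const R * norm v) \<le> (kern_const R * (R * q)) ^ length ?vs"
    proof (rule prod_list_le_power)
      fix v assume "v \<in> set ?vs"
      then have "norm v \<le> R * q" using v_le by auto
      then show "0 \<le> kern_const R * norm v \<and> kern_const R * norm v \<le> kern_const R * (R * q)"
        by (simp add: kern_const_nonneg mult_left_mono)
    qed
    have "\<bar>diffs (map (mexp A t) zs) h x\<bar> \<le> real m * 2 ^ m * (kern_const R * (R * q)) ^ length ?vs * W"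
      unfolding map_eq by (intro order_trans[OF 1] mult_left_mono mult_right_mono 2 W0) simp
    then show "\<bar>diffs (map (mexp A t) zs) h x\<bar> \<le> real m * 2 ^ m * (kern_const R * R) ^ m * (q ^ m * W)"
      by (simp add: zs(1) power_mult_distrib mult_ac)
  qed (use t gh(2) bcont_diffs in auto)
  have "diffs zs (PP t \<phi>) x = diffs zs (PP t g) x + diffs zs (PP t h) x"
  proof -
    have "\<phi> = (\<lambda>x. g x + h x)" using gh(3) by (rule ext)
    then have "PP t \<phi> = PP t (\<lambda>x. g x + h x)" by simp
    also have "\<dots> = (\<lambda>x. PP t g x + PP t h x)" by (rule ext) (rule PP_add[OF less_imp_le[OF t(1)] gh(1,2)])
    finally have "PP t \<phi> = (\<lambda>x. PP t g x + PP t h x)" .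
    then show ?thesis by (simp add: diffs_add)
  qed
  then have "\<bar>diffs zs (PP t \<phi>) x\<bar> \<le> (C2 ^ m * real m ^ m + real m * 2 ^ m * (kern_const R * R) ^ m) * (q ^ m * W)"
    using gb hb abs_triangle_ineq[of "diffs zs (PP t g) x" "diffs zs (PP t h) x"] by (simp add: algebra_simps)
  also have "\<dots> \<le> (C2 ^ m * real m ^ m + real m * 2 ^ m * (kern_const R * R) ^ m) * ((\<rho> / e) powr \<gamma> * W)"
  proof (intro mult_left_mono mult_right_mono W0)
    \<comment> \<open>Here the number of differences matters: the exponent \<open>m * D\<close> is
      at least \<open>\<gamma>\<close>, and the base is at most 1.\<close>
    have "q ^ m = (\<rho> / e) powr (real m * D)"
      unfolding q_def using \<rho> e by (simp add: powr_realpow[symmetric] powr_powr mult.commute)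
    also have "\<dots> \<le> (\<rho> / e) powr \<gamma>" using \<gamma> \<rho> e by (intro powr_mono') (auto simp: e_def)
    finally show "q ^ m \<le> (\<rho> / e) powr \<gamma>" .
  qed (use C2 R0 kern_const_nonneg in simp)
  also have "(\<rho> / e) powr \<gamma> * W = 2 ^ m * (1 + R) powr \<beta> * e powr (\<beta> - \<gamma>) * K * \<rho> powr \<gamma>"
    unfolding W_def using \<rho> e R0 by (simp add: powr_divide powr_mult powr_diff)
  finally show ?thesis by (simp add: e_def mult_ac)
qed

text \<open>Four regimes, one for each summand of the constant: large steps, where the supremum
  suffices; large times, where smoothing at a time comparable to \<open>t1\<close> suffices; small
  times with \<open>\<rho> \<ge> eps t\<close>, where the regularity of \<phi> suffices; and small
  times with smaller steps, where smoothing and regularity have to be combined.\<close>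

theorem diffs_PP_bound:
  assumes h0: "h0 \<in> {1..nn}" and m: "1 \<le> m" "m \<le> 3" and D: "D = 1 + \<alpha> * (real h0 - 1)"
    and d: "\<And>h. h \<in> {1..nn} \<Longrightarrow> 1 \<le> d h \<and> d h \<le> D + \<alpha> * real (h - h0)"
    and \<beta>: "0 \<le> \<beta>" "\<beta> \<le> \<gamma>" and \<gamma>: "\<gamma> \<le> real m * D"
  obtains C where "0 \<le> C" "\<And>t \<phi> K \<rho> zs x. 0 < t \<Longrightarrow> ahoelder d m \<beta> K \<phi> \<Longrightarrow> 0 < \<rho> \<Longrightarrow> length zs = m \<Longrightarrow>
    (\<And>z. z \<in> set zs \<Longrightarrow> z \<in> E h0 \<and> norm z \<le> \<rho> powr D) \<Longrightarrow>
    \<bar>diffs zs (PP t \<phi>) x\<bar> \<le> C * (1 + t powr ((\<beta> - \<gamma>) / \<alpha>)) * K * \<rho> powr \<gamma>"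
proof -
  obtain C2 t1 where C2: "0 \<le> C2" "0 < t1" "t1 \<le> 1"
    and S: "\<forall>t>0. \<exists>\<tau>. 0 < \<tau> \<and> \<tau> \<le> t1 \<and> (t \<le> t1 \<longrightarrow> \<tau> = t) \<and> (t1 < t \<longrightarrow> t1 / 2 \<le> \<tau>) \<and>
      (\<forall>zs (\<phi> :: real^'n \<Rightarrow> real) K x. length zs \<le> 3 \<longrightarrow> continuous_on UNIV \<phi> \<longrightarrow> (\<forall>y. \<bar>\<phi> y\<bar> \<le> K) \<longrightarrow>
        \<bar>diffs zs (PP t \<phi>) x\<bar> \<le> (\<Prod>z\<leftarrow>zs. C2 * norm (dlinv \<tau> z)) * K)"
    using smoothing by blast
  obtain C1 where C1: "1 \<le> C1"
    "\<And>s h0 h z. \<bar>s\<bar> \<le> 1 \<Longrightarrow> h0 \<in> {1..nn} \<Longrightarrow> h \<in> {1..nn} \<Longrightarrow> z \<in> E h0 \<Longrightarrow>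
      norm (pr h (mexp A s z)) \<le> C1 * \<bar>s\<bar> ^ (h - h0) * norm z" using pr_mexp by metis
  define R where "R = real nn * C1"
  define e0 where "e0 = eps (t1 / 2)"
  have e0: "0 < e0" unfolding e0_def using C2 by (intro eps_pos) simp
  have D1: "1 \<le> D" unfolding D using h0 alpha by simp
  define Ca where "Ca = (C2 / e0 powr D) ^ m"
  define Cb where "Cb = 2 ^ m * C1 powr \<beta>"
  define Cc where "Cc = ((C2 ^ m * real m ^ m + real m * 2 ^ m * (dilation.kern_const TYPE(real^'n) R * R) ^ m)
    * 2 ^ m * (1 + R) powr \<beta>)"
  have "0 \<le> dilation.kern_const TYPE(real^'n) R"
    by (rule dilation.kern_const_nonneg[of "\<lambda>x. x"]) (simp add: dilation_def linear_id[unfolded id_def])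
  then have C0: "0 \<le> Ca" "0 \<le> Cb" "0 \<le> Cc"
    using C1 C2 e0 by (simp_all add: Ca_def Cb_def Cc_def R_def)
  show thesis
  proof (rule that[of "2 ^ m + Ca + Cb + Cc"])
    show "0 \<le> 2 ^ m + Ca + Cb + Cc" using C0 by simp
    fix t K \<rho> :: real and \<phi> zs x
    assume t: "0 < t" and \<phi>: "ahoelder d m \<beta> K \<phi>" and \<rho>: "0 < \<rho>"
      and zs: "length zs = m" "\<And>z. z \<in> set zs \<Longrightarrow> z \<in> E h0 \<and> norm z \<le> \<rho> powr D"
    have b: "bcont \<phi>" and \<phi>K: "\<And>x. \<bar>\<phi> x\<bar> \<le> K" using \<phi> unfolding ahoelder_def by blast+
    have K0: "0 \<le> K" using \<phi>K abs_ge_zero order_trans by blast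
    let ?e = "t powr ((\<beta> - \<gamma>) / \<alpha>)"
    have reduce: "\<bar>diffs zs (PP t \<phi>) x\<bar> \<le> (2 ^ m + Ca + Cb + Cc) * (1 + ?e) * K * \<rho> powr \<gamma>"
      if "\<bar>diffs zs (PP t \<phi>) x\<bar> \<le> c * q * K * \<rho> powr \<gamma>" "0 \<le> c" "c \<le> 2 ^ m + Ca + Cb + Cc" "q = 1 \<or> q = ?e" for c q
    proof -
      have "0 \<le> q" "q \<le> 1 + ?e" using that(4) by auto
      then have "c * q * K * \<rho> powr \<gamma> \<le> (2 ^ m + Ca + Cb + Cc) * (1 + ?e) * K * \<rho> powr \<gamma>"
        using that K0 C0 by (intro mult_right_mono mult_mono) auto
      with that(1) show ?thesis by (rule order_trans)
    qed
    have eps_e: "eps t powr (\<beta> - \<gamma>) = ?e" using alpha by (simp add: eps_def powr_powr)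
    show "\<bar>diffs zs (PP t \<phi>) x\<bar> \<le> (2 ^ m + Ca + Cb + Cc) * (1 + ?e) * K * \<rho> powr \<gamma>"
    proof (cases "1 \<le> \<rho>")
      case True
      have "\<bar>diffs zs (PP t \<phi>) x\<bar> \<le> 2 ^ m * K"
        using diffs_bound[of "PP t \<phi>" K zs x] PP_bound[OF _ b \<phi>K] t zs(1) by simp
      also have "\<dots> \<le> 2 ^ m * 1 * K * \<rho> powr \<gamma>"
        using True \<beta> K0 mult_left_mono[OF ge_one_powr_ge_zero[OF True, of \<gamma>], of "2 ^ m * K"] by simp
      finally show ?thesis by (rule reduce) (use C0 in auto)
    next
      case False
      obtain \<tau> where \<tau>: "0 < \<tau>" "\<tau> \<le> t1" "t \<le> t1 \<longrightarrow> \<tau> = t" "t1 < t \<longrightarrow> t1 / 2 \<le> \<tau>"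
        and sm: "\<And>zs (\<phi> :: real^'n \<Rightarrow> real) K x. length zs \<le> 3 \<Longrightarrow> continuous_on UNIV \<phi> \<Longrightarrow> (\<And>y. \<bar>\<phi> y\<bar> \<le> K) \<Longrightarrow>
        \<bar>diffs zs (PP t \<phi>) x\<bar> \<le> (\<Prod>z\<leftarrow>zs. C2 * norm (dlinv \<tau> z)) * K"
        using S t by blast
      show ?thesis
      proof (cases "t \<le> t1")
        case large: False
        \<comment> \<open>No growth in \<open>t\<close> occurs: the smoothing time stays at least
          \<open>t1 / 2\<close>, so \<open>eps \<tau>\<close> is bounded below by
          \<open>e0\<close>.\<close>
        then have \<tau>t: "t1 / 2 \<le> \<tau>" using \<tau>(4) by simp
        have "e0 \<le> eps \<tau>" unfolding e0_def eps_def using \<tau>t C2 alpha by (intro powr_mono2) auto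
        then have eD: "e0 powr D \<le> eps \<tau> powr D" using e0 D1 by (intro powr_mono2) auto
        have "\<bar>diffs zs (PP t \<phi>) x\<bar> \<le> (\<Prod>z\<leftarrow>zs. C2 * norm (dlinv \<tau> z)) * K"
          using m(2) zs(1) b \<phi>K by (intro sm) (auto simp: bcont_def)
        also have "\<dots> \<le> (C2 / e0 powr D * \<rho> powr D) ^ length zs * K"
        proof (intro mult_right_mono K0 prod_list_le_power)
          fix z assume z: "z \<in> set zs"
          have "norm (dlinv \<tau> z) = norm z / eps \<tau> powr D" using norm_dlinv[OF \<tau>(1) h0, of z] zs(2)[OF z] by (simp add: D)
          also have "\<dots> \<le> \<rho> powr D / e0 powr D" using zs(2)[OF z] eD e0 by (intro frac_le) auto
          finally have "C2 * norm (dlinv \<tau> z) \<le> C2 * (\<rho> powr D / e0 powr D)" by (intro mult_left_mono C2)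
          then show "0 \<le> C2 * norm (dlinv \<tau> z) \<and> C2 * norm (dlinv \<tau> z) \<le> C2 / e0 powr D * \<rho> powr D"
            using C2 by (simp add: field_simps)
        qed
        also have "\<dots> = Ca * 1 * K * \<rho> powr (real m * D)"
          unfolding zs(1) Ca_def power_mult_distrib using \<rho> by (simp add: powr_power mult_ac)
        also have "\<dots> \<le> Ca * 1 * K * \<rho> powr \<gamma>"
          using C0 K0 \<rho> False \<gamma> by (intro mult_left_mono powr_mono') auto
        finally show ?thesis by (rule reduce) (use C0 in auto)
      next
        case True
        then have \<tau>t: "\<tau> = t" using \<tau>(3) by simp
        have t1: "t \<le> 1" using True C2 by simp
        show ?thesis
        proof (cases "eps t \<le> \<rho>")
          case True
          \<comment> \<open>Since \<open>t\<close> is at most \<open>\<rho> powr \<alpha>\<close>,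
            e^(tA) keeps the increments in a box of radius comparable to \<rho>. The lost power of
            \<rho> is bounded by the same power of \<open>eps t\<close>, because \<beta> - \<gamma>
            is not positive.\<close>
          have "\<bar>diffs zs (PP t \<phi>) x\<bar> \<le> 2 ^ m * K * (C1 * \<rho>) powr \<beta>"
            unfolding diffs_PP[OF less_imp_le[OF t] b]
          proof (rule PP_bound)
            fix x
            show "\<bar>diffs (map (mexp A t) zs) \<phi> x\<bar> \<le> 2 ^ m * K * (C1 * \<rho>) powr \<beta>"
            proof (rule ahoelder_scaled[OF \<phi> \<beta>(1) \<rho> C1(1)])
              fix y h assume y: "y \<in> set (map (mexp A t) zs)" and h: "h \<in> {1..nn}"
              then obtain z where z: "z \<in> set zs" "y = mexp A t z" by auto
              have "norm (pr h y) \<le> C1 * t ^ (h - h0) * norm z"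
                using C1(2)[OF _ h0 h, of t z] zs(2)[OF z(1)] t t1 z(2) by simp
              also have "\<dots> \<le> C1 * \<rho> powr (\<alpha> * real (h - h0)) * \<rho> powr D"
                unfolding eps_powr_power[OF t] using C1(1) zs(2)[OF z(1)] True eps_pos[OF t] alpha
                by (intro mult_mono powr_mono2) auto
              also have "\<dots> = C1 * \<rho> powr (D + \<alpha> * real (h - h0))" using \<rho> by (simp add: powr_add)
              also have "\<dots> \<le> C1 * \<rho> powr d h" using C1(1) \<rho> False d[OF h] by (intro mult_left_mono powr_mono') auto
              finally show "norm (pr h y) \<le> C1 * \<rho> powr d h" .
            qed (use d zs(1) in auto)
          qed (use t b bcont_diffs in auto)
          also have "\<dots> = Cb * \<rho> powr (\<beta> - \<gamma>) * K * \<rho> powr \<gamma>"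
            using \<rho> C1(1) by (simp add: Cb_def powr_mult powr_diff)
          also have "\<dots> \<le> Cb * ?e * K * \<rho> powr \<gamma>"
            unfolding eps_e[symmetric] using True eps_pos[OF t] \<beta>(2) C0 K0
            by (intro mult_right_mono mult_left_mono powr_mono2') auto
          finally show ?thesis by (rule reduce) (use C0 in auto)
        next
          case small: False
          have "\<bar>diffs zs (PP t \<phi>) x\<bar> \<le> Cc * eps t powr (\<beta> - \<gamma>) * K * \<rho> powr \<gamma>"
            unfolding Cc_def
          proof (rule diffs_PP_small_scale[OF h0 m D d \<beta>(1) \<gamma> _ C1(1) _ R_def t t1 C2(1) _ \<phi> \<rho> _ zs])
            show "0 \<le> \<gamma>" using \<beta> by simp
            show "\<rho> \<le> eps t" using small by simp
          qed (use C1(2)[OF _ h0] sm \<tau>t in auto)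
          then show ?thesis unfolding eps_e by (rule reduce) (use C0 in auto)
        qed
      qed
    qed
  qed
qed

end

section \<open>Hoelder--Zygmund classes and finite differences\<close>

lemma geometric_cauchy:
  fixes U :: "nat \<Rightarrow> real"
  assumes U: "\<And>j. \<bar>U (Suc j) - U j\<bar> \<le> M * r ^ j" and r: "0 \<le> r" "r < 1"
  obtains l where "U \<longlonglongrightarrow> l" "\<bar>l - U 0\<bar> \<le> M / (1 - r)"
proof -
  have s: "(\<lambda>j. M * r ^ j) sums (M * (1 / (1 - r)))" using r by (intro sums_mult geometric_sums) simp
  have sn: "summable (\<lambda>j. norm (U (Suc j) - U j))"
    by (rule summable_comparison_test'[OF sums_summable[OF s]]) (use U in auto)
  then have sU: "summable (\<lambda>j. U (Suc j) - U j)" by (rule summable_norm_cancel)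
  define l where "l = (\<Sum>j. U (Suc j) - U j)"
  have "(\<lambda>n. U n - U 0) \<longlonglongrightarrow> l"
    using summable_LIMSEQ[OF sU] by (simp add: l_def sum_lessThan_telescope)
  then have lim: "U \<longlonglongrightarrow> l + U 0" using tendsto_add[OF _ tendsto_const, of "\<lambda>n. U n - U 0" l _ "U 0"] by simp
  have "\<bar>l\<bar> \<le> (\<Sum>j. \<bar>U (Suc j) - U j\<bar>)" unfolding l_def using sn by (intro summable_rabs) simp
  also have "\<dots> \<le> (\<Sum>j. M * r ^ j)" using sn by (intro suminf_le U sums_summable[OF s]) simp
  finally have "\<bar>l\<bar> \<le> (\<Sum>j. M * r ^ j)" .
  then have "\<bar>(l + U 0) - U 0\<bar> \<le> M / (1 - r)" using s by (simp add: sums_iff)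
  with lim show thesis by (rule that)
qed

text \<open>Subtracting the linear function \<open>h * D 1\<close> leaves an additive function that
  vanishes on the integers. It is therefore 1-periodic and bounded on the whole line, and a bounded
  additive function is 0.\<close>

lemma additive_bounded_linear:
  fixes D :: "real \<Rightarrow> real"
  assumes add: "\<And>a b. D (a + b) = D a + D b" and bd: "\<And>h. \<bar>h\<bar> \<le> 1 \<Longrightarrow> \<bar>D h\<bar> \<le> M"
  shows "D h = h * D 1"
proof -
  define g where "g h = D h - h * D 1" for h
  have ga: "g (a + b) = g a + g b" for a b by (simp add: g_def add algebra_simps)
  have g0: "g 0 = 0" using ga[of 0 0] by simp
  have gn: "g (real n * h) = real n * g h" for n h by (induction n) (simp_all add: g0 ga distrib_right)
  have "g 1 = 0" by (simp add: g_def)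
  then have gnat: "g (real n) = 0" for n using gn[of n 1] by simp
  have gint: "g (of_int k) = 0" for k
  proof (cases "0 \<le> k")
    case True
    then show ?thesis using gnat[of "nat k"] by simp
  next
    case False
    then have "g (of_int k + real (nat (- k))) = 0" by (simp add: g0)
    then show ?thesis using gnat by (simp add: ga)
  qed
  have gb: "\<bar>g h\<bar> \<le> 2 * M" for h
  proof -
    have "g h = g (of_int \<lfloor>h\<rfloor> + frac h)" by (simp add: frac_def)
    also have "\<dots> = g (frac h)" unfolding ga gint by simp
    finally have "\<bar>g h\<bar> \<le> \<bar>D (frac h)\<bar> + \<bar>frac h * D 1\<bar>" by (simp add: g_def)
    moreover have fr: "\<bar>frac h\<bar> \<le> 1" using frac_ge_0[of h] frac_lt_1[of h] by linarith
    then have "\<bar>D (frac h)\<bar> \<le> M" by (rule bd)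
    moreover have "\<bar>frac h * D 1\<bar> \<le> 1 * M"
      unfolding abs_mult using fr bd[of 1] by (intro mult_mono) auto
    ultimately show ?thesis by simp
  qed
  have "g h = 0"
  proof (rule ccontr)
    assume "g h \<noteq> 0"
    then obtain n where "2 * M / \<bar>g h\<bar> < real n" using reals_Archimedean2 by blast
    then have "2 * M < \<bar>g (real n * h)\<bar>" using \<open>g h \<noteq> 0\<close> by (simp add: gn abs_mult divide_less_eq)
    with gb show False by (simp add: not_less[symmetric])
  qed
  then show ?thesis by (simp add: g_def)
qed

lemma dyadic_powr:
  fixes h \<gamma> :: real
  assumes "0 \<le> h"
  shows "2 ^ j * (h / 2 ^ j) powr \<gamma> = h powr \<gamma> * (2 powr (1 - \<gamma>)) ^ j"
proof -
  have "(2::real) ^ j = 2 powr real j" by (simp add: powr_realpow)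
  moreover have "(2 powr (1 - \<gamma>)) ^ j = 2 powr (real j * (1 - \<gamma>))" by (simp add: powr_power mult.commute)
  ultimately show ?thesis using assms
    by (simp add: powr_divide powr_powr powr_diff right_diff_distrib mult.commute)
qed

text \<open>Halving the step changes the dyadic difference quotient by a second difference, so the
  quotients converge geometrically with ratio \<open>2 powr (1 - \<gamma>)\<close>. The limit is
  additive in the step, again by the bound on second differences, and bounded for small steps; hence
  it is linear, and its slope is the derivative.\<close>

lemma second_difference_derivative:
  fixes f :: "real \<Rightarrow> real"
  assumes \<gamma>: "1 < \<gamma>" and F: "\<And>x. \<bar>f x\<bar> \<le> F"
    and d2: "\<And>\<rho> a b. 0 < \<rho> \<Longrightarrow> \<bar>a\<bar> \<le> \<rho> \<Longrightarrow> \<bar>b\<bar> \<le> \<rho> \<Longrightarrow> \<bar>f (a + b) - f a - f b + f 0\<bar> \<le> K * \<rho> powr \<gamma>"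
  obtains D where "(f has_real_derivative D) (at 0)"
    "\<And>h. \<bar>f h - f 0 - h * D\<bar> \<le> K / (1 - 2 powr (1 - \<gamma>)) * \<bar>h\<bar> powr \<gamma>"
proof -
  define r where "r = (2::real) powr (1 - \<gamma>)"
  have r: "0 \<le> r" "r < 1" unfolding r_def using \<gamma> powr_less_mono[of "1 - \<gamma>" 0 "2::real"] by auto
  have K: "0 \<le> K" using d2[of 1 0 0] by simp
  define U where "U h j = 2 ^ j * (f (h / 2 ^ j) - f 0)" for h j
  have U: "\<bar>U h (Suc j) - U h j\<bar> \<le> (K * \<bar>h\<bar> powr \<gamma>) * r ^ j" for h j
  proof (cases "h = 0")
    case False
    let ?c = "h / 2 ^ Suc j"
    have "h / 2 ^ j = ?c + ?c" by simp
    then have "U h (Suc j) - U h j = - (2 ^ j) * (f (?c + ?c) - f ?c - f ?c + f 0)"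
      unfolding U_def by (simp add: algebra_simps)
    also have "\<bar>\<dots>\<bar> \<le> 2 ^ j * (K * (\<bar>h\<bar> / 2 ^ j) powr \<gamma>)"
      unfolding abs_mult using False by (intro mult_mono d2) (auto simp: field_simps)
    also have "\<dots> = K * (2 ^ j * (\<bar>h\<bar> / 2 ^ j) powr \<gamma>)" by simp
    also have "\<dots> = (K * \<bar>h\<bar> powr \<gamma>) * r ^ j" unfolding dyadic_powr[OF abs_ge_zero] r_def by simp
    finally show ?thesis .
  qed (simp add: U_def)
  have "\<exists>l. U h \<longlonglongrightarrow> l \<and> \<bar>l - U h 0\<bar> \<le> K * \<bar>h\<bar> powr \<gamma> / (1 - r)" for h
    by (rule geometric_cauchy[OF U[of h] r]) (auto simp: mult.assoc)
  then obtain D where D: "\<And>h. U h \<longlonglongrightarrow> D h" "\<And>h. \<bar>D h - U h 0\<bar> \<le> K * \<bar>h\<bar> powr \<gamma> / (1 - r)" by metis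
  have add: "D (a + b) = D a + D b" for a b
  proof -
    define \<rho> where "\<rho> = max 1 (max \<bar>a\<bar> \<bar>b\<bar>)"
    have "(\<lambda>j. U (a + b) j - U a j - U b j) \<longlonglongrightarrow> 0"
    proof (rule Lim_null_comparison)
      show "\<forall>\<^sub>F j in sequentially. norm (U (a + b) j - U a j - U b j) \<le> (K * \<rho> powr \<gamma>) * r ^ j"
      proof (rule always_eventually, rule allI)
        fix j
        have "U (a + b) j - U a j - U b j = 2 ^ j * (f (a / 2 ^ j + b / 2 ^ j) - f (a / 2 ^ j) - f (b / 2 ^ j) + f 0)"
          unfolding U_def by (simp add: algebra_simps add_divide_distrib)
        also have "\<bar>\<dots>\<bar> \<le> 2 ^ j * (K * (\<rho> / 2 ^ j) powr \<gamma>)"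
          unfolding abs_mult by (intro mult_mono d2) (auto simp: \<rho>_def divide_right_mono)
        also have "\<dots> = K * (2 ^ j * (\<rho> / 2 ^ j) powr \<gamma>)" by simp
        also have "\<dots> = (K * \<rho> powr \<gamma>) * r ^ j" unfolding r_def by (subst dyadic_powr) (auto simp: \<rho>_def)
        finally show "norm (U (a + b) j - U a j - U b j) \<le> (K * \<rho> powr \<gamma>) * r ^ j" by simp
      qed
      show "(\<lambda>j. (K * \<rho> powr \<gamma>) * r ^ j) \<longlonglongrightarrow> 0" using r by (intro tendsto_mult_right_zero LIMSEQ_realpow_zero)
    qed
    moreover have "(\<lambda>j. U (a + b) j - U a j - U b j) \<longlonglongrightarrow> D (a + b) - D a - D b" by (intro tendsto_diff D)
    ultimately have "D (a + b) - D a - D b = 0" using LIMSEQ_unique by blast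
    then show ?thesis by simp
  qed
  have bd: "\<bar>D h\<bar> \<le> 2 * F + K / (1 - r)" if "\<bar>h\<bar> \<le> 1" for h
  proof -
    have "K * \<bar>h\<bar> powr \<gamma> / (1 - r) \<le> K * 1 / (1 - r)"
      using K r \<gamma> that by (intro divide_right_mono mult_left_mono powr_le1) auto
    then show ?thesis using D(2)[of h] F[of h] F[of 0] by (simp add: U_def)
  qed
  have lin: "D h = h * D 1" for h by (rule additive_bounded_linear[OF add bd])
  have est: "\<bar>f h - f 0 - h * D 1\<bar> \<le> K / (1 - r) * \<bar>h\<bar> powr \<gamma>" for h
    using D(2)[of h] unfolding lin[of h] by (simp add: U_def abs_minus_commute)
  show thesis
  proof (rule that)
    show "\<bar>f h - f 0 - h * D 1\<bar> \<le> K / (1 - 2 powr (1 - \<gamma>)) * \<bar>h\<bar> powr \<gamma>" for h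
      using est unfolding r_def .
    have "((\<lambda>h. (f (0 + h) - f 0) / h - D 1) \<longlongrightarrow> 0) (at 0)"
    proof (rule Lim_null_comparison)
      show "\<forall>\<^sub>F h in at 0. norm ((f (0 + h) - f 0) / h - D 1) \<le> K / (1 - r) * \<bar>h\<bar> powr (\<gamma> - 1)"
      proof (rule eventually_at_filter[THEN iffD2], rule always_eventually, safe)
        fix h :: real assume h: "h \<noteq> 0"
        have "norm ((f (0 + h) - f 0) / h - D 1) = \<bar>f h - f 0 - h * D 1\<bar> / \<bar>h\<bar>"
          using h by (simp add: field_simps flip: abs_divide)
        also have "\<dots> \<le> K / (1 - r) * \<bar>h\<bar> powr \<gamma> / \<bar>h\<bar>" using est by (intro divide_right_mono) auto
        finally show "norm ((f (0 + h) - f 0) / h - D 1) \<le> K / (1 - r) * \<bar>h\<bar> powr (\<gamma> - 1)"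
          using h by (simp add: powr_diff)
      qed
      have "((\<lambda>h::real. \<bar>h\<bar> powr (\<gamma> - 1)) \<longlongrightarrow> \<bar>0\<bar> powr (\<gamma> - 1)) (at 0)"
        using \<gamma> by (intro tendsto_powr' tendsto_rabs tendsto_const) auto
      then show "((\<lambda>h::real. K / (1 - r) * \<bar>h\<bar> powr (\<gamma> - 1)) \<longlongrightarrow> 0) (at 0)"
        by (intro tendsto_mult_right_zero) simp
    qed
    then show "(f has_real_derivative D 1) (at 0)"
      unfolding DERIV_def by (simp add: LIM_zero_iff)
  qed
qed

lemma segment_midpoint: "y + (1/2) *\<^sub>R (x - y) = (1/2) *\<^sub>R (x + y)" for x y :: "'a::real_vector"
proof -
  have "(1/2) *\<^sub>R (x + y) = (1/2) *\<^sub>R ((x - y) + (y + y))" by simp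
  also have "\<dots> = (1/2) *\<^sub>R (x - y) + y" by (simp only: scaleR_add_right[of "1/2" "x - y" "y + y"] scaleR_half_double)
  finally show ?thesis by simp
qed

lemma diffs_append: "diffs (as @ bs) f = diffs as (diffs bs f)"
  by (induction as) simp_all

lemma diffs_cmult: "diffs zs (\<lambda>x. c * f x) x = c * diffs zs f x" for c :: real
  by (induction zs arbitrary: x) (simp_all add: diff1_def right_diff_distrib)

lemma bcont_cmult:
  assumes "bcont f"
  shows "bcont (\<lambda>x. c * f x)"
proof -
  obtain K where K: "continuous_on UNIV f" "\<And>x. \<bar>f x\<bar> \<le> K" using bcontE[OF assms] by metis
  have "\<bar>c * f x\<bar> \<le> \<bar>c\<bar> * K" for x unfolding abs_mult by (intro mult_left_mono K) simp
  then show ?thesis unfolding bcont_def using continuous_on_mult_left[OF K(1), of c] by blast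
qed

lemma diffs_shift: "diffs zs (\<lambda>x. f (x + a)) x = diffs zs f (x + a)"
  by (induction zs arbitrary: x) (simp_all add: diff1_def ac_simps)

lemma has_derivative_diffs:
  assumes "\<And>x. ((\<lambda>s. f (x + s *\<^sub>R e)) has_real_derivative f' x) (at 0)"
  shows "((\<lambda>s. diffs zs f (x + s *\<^sub>R e)) has_real_derivative diffs zs f' x) (at 0)"
proof (induction zs arbitrary: x)
  case (Cons z zs)
  have "((\<lambda>s. diffs zs f (x + z + s *\<^sub>R e) - diffs zs f (x + s *\<^sub>R e)) has_real_derivative diffs zs f' (x + z) - diffs zs f' x) (at 0)"
    by (intro DERIV_diff Cons)
  then show ?case by (simp add: diff1_def ac_simps)
qed (simp add: assms)

section \<open>The classes along a subspace, one derivative at a time\<close>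

locale onb_subspace =
  fixes E S :: "'a::euclidean_space set"
  assumes orth: "pairwise orthogonal S" and unit: "\<And>e. e \<in> S \<Longrightarrow> norm e = 1"
    and span_S: "span S = E" and finite_S: "finite S"
begin

lemma sub_E: "subspace E"
  unfolding span_S[symmetric] by (rule subspace_span)

lemma S_in_E: "e \<in> S \<Longrightarrow> e \<in> E"
  unfolding span_S[symmetric] by (rule span_base)

lemma expand: "z \<in> E \<Longrightarrow> z = (\<Sum>e\<in>S. (z \<bullet> e) *\<^sub>R e)"
  using orthonormal_basis_expand[of S z] orth unit span_S finite_S by simp

text \<open>Derivatives are known only along the basis, so the increment is taken one basis vector
  at a time; each leg has length at most \<rho>.\<close>

lemma mean_value_E:
  assumes der: "\<And>e x. e \<in> S \<Longrightarrow> ((\<lambda>s. g (x + s *\<^sub>R e)) has_real_derivative g' e x) (at 0)"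
    and W: "\<And>e x. e \<in> S \<Longrightarrow> \<bar>g' e x\<bar> \<le> W" and W0: "0 \<le> W"
    and z: "z \<in> E" "norm z \<le> \<rho>"
  shows "\<bar>diff1 z g x\<bar> \<le> real (card S) * \<rho> * W"
proof -
  have step: "\<bar>g (x + c *\<^sub>R e) - g x\<bar> \<le> \<bar>c\<bar> * W" if e: "e \<in> S" for e c x
  proof -
    have "((\<lambda>s. g (x + s *\<^sub>R e)) has_real_derivative g' e (x + s *\<^sub>R e)) (at s)" for s
      using der[OF e, of "x + s *\<^sub>R e"] DERIV_shift[of "\<lambda>s. g (x + s *\<^sub>R e)" "g' e (x + s *\<^sub>R e)" 0 s]
      by (simp add: scaleR_add_left ac_simps)
    then have "norm (g (x + c *\<^sub>R e) - g (x + 0 *\<^sub>R e)) \<le> W * norm (c - 0)"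
      using W[OF e] by (intro field_differentiable_bound[OF convex_UNIV, of _ "\<lambda>s. g' e (x + s *\<^sub>R e)"]) auto
    then show ?thesis by (simp add: mult.commute)
  qed
  have "\<bar>g (x + (\<Sum>e\<in>T. (z \<bullet> e) *\<^sub>R e)) - g x\<bar> \<le> (\<Sum>e\<in>T. \<rho> * W)" if "finite T" "T \<subseteq> S" for T
    using that
  proof (induction T)
    case (insert e T)
    let ?y = "x + (\<Sum>e\<in>T. (z \<bullet> e) *\<^sub>R e)"
    have "\<bar>z \<bullet> e\<bar> \<le> \<rho>" using Cauchy_Schwarz_ineq2[of z e] unit[of e] insert.prems z by simp
    then have "\<bar>g (?y + (z \<bullet> e) *\<^sub>R e) - g ?y\<bar> \<le> \<rho> * W"
      using step[of e ?y "z \<bullet> e"] insert.prems W0 by (auto elim!: order_trans intro!: mult_right_mono)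
    then have "\<bar>g (?y + (z \<bullet> e) *\<^sub>R e) - g x\<bar> \<le> \<rho> * W + (\<Sum>e\<in>T. \<rho> * W)" using insert by simp
    moreover have "x + (\<Sum>e\<in>insert e T. (z \<bullet> e) *\<^sub>R e) = ?y + (z \<bullet> e) *\<^sub>R e" using insert.hyps by (simp add: ac_simps)
    moreover have "(\<Sum>e\<in>insert e T. \<rho> * W) = \<rho> * W + (\<Sum>e\<in>T. \<rho> * W)" using insert.hyps by (intro sum.insert)
    ultimately show ?case by (simp only:)
  qed simp
  from this[OF finite_S order_refl] show ?thesis using expand[OF z(1)] by (simp add: diff1_def mult.assoc)
qed

text \<open>The space of order \<open>k + \<theta>\<close> along \<open>E\<close>, uniformly over
  all translates, with one constant for all derivatives and the seminorm. The recursion over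
  existing derivatives replaces lists of partial derivatives and fits inductions on the
  order.\<close>

primrec hzf :: "nat \<Rightarrow> real \<Rightarrow> real \<Rightarrow> ('a \<Rightarrow> real) \<Rightarrow> bool" where
  "hzf 0 \<theta> K f \<longleftrightarrow> (\<forall>x. \<bar>f x\<bar> \<le> K) \<and> (\<forall>x0. continuous_on E (\<lambda>z. f (x0 + z))) \<and>
     (\<forall>x. \<forall>z\<in>E. if \<theta> \<noteq> 1 then \<bar>f (x + z) - f x\<bar> \<le> K * norm z powr \<theta>
       else \<bar>f (x + z) + f x - 2 * f (x + (1/2) *\<^sub>R z)\<bar> \<le> K * norm z)"
| "hzf (Suc k) \<theta> K f \<longleftrightarrow> (\<forall>x. \<bar>f x\<bar> \<le> K) \<and> (\<forall>x0. continuous_on E (\<lambda>z. f (x0 + z))) \<and>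
     (\<forall>e\<in>S. \<exists>f'. (\<forall>x. ((\<lambda>s. f (x + s *\<^sub>R e)) has_real_derivative f' x) (at 0)) \<and> hzf k \<theta> K f')"

lemma hzf_bound: "hzf k \<theta> K f \<Longrightarrow> \<bar>f x\<bar> \<le> K"
  by (cases k) auto

lemma hzf_continuous: "hzf k \<theta> K f \<Longrightarrow> continuous_on E (\<lambda>z. f (x0 + z))"
  by (cases k) auto

lemma hzf_mono: "hzf k \<theta> K f \<Longrightarrow> K \<le> K' \<Longrightarrow> hzf k \<theta> K' f"
proof (induction k arbitrary: f)
  case 0
  have "K * norm z powr \<theta> \<le> K' * norm z powr \<theta>" "K * norm z \<le> K' * norm z" for z :: 'a
    using 0 by (auto intro: mult_right_mono)
  then show ?case using 0 unfolding hzf.simps by (meson order_trans)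
next
  case (Suc k)
  then show ?case by (simp, meson order_trans)
qed

lemma partials_translate: "partials vs (\<lambda>z. \<phi> (x0 + z)) x = partials vs \<phi> (x0 + x)"
  by (induction vs arbitrary: x) (simp_all add: add.assoc)

lemma hz_space_hzf:
  assumes H: "\<And>x0. (\<lambda>z. \<phi> (x0 + z)) \<in> hz_space E S s" "\<And>x0. hz_norm E S s (\<lambda>z. \<phi> (x0 + z)) \<le> ennreal K"
    and K: "0 \<le> K"
  shows "hzf (int_order s) (frac_order s) K \<phi>"
proof -
  define k where "k = int_order s"
  define \<theta> where "\<theta> = frac_order s"
  have 0: "0 \<in> E" by (rule subspace_0[OF sub_E])
  have C: "Ck_on E S k (\<lambda>z. \<phi> (x0 + z))" for x0 using H(1) by (simp add: hz_space_def k_def)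
  have bnd: "\<bar>partials vs \<phi> x\<bar> \<le> K" if "i \<le> k" "vs \<in> multi_indices S i" for i vs x
  proof -
    let ?f = "\<lambda>z. \<phi> (x + z)"
    have "ennreal \<bar>partials vs \<phi> x\<bar> = ennreal \<bar>partials vs ?f 0\<bar>" by (simp add: partials_translate)
    also have "\<dots> \<le> sup_norm_on E (partials vs ?f)" unfolding sup_norm_on_def by (rule SUP_upper[OF 0])
    also have "\<dots> \<le> (SUP vs\<in>multi_indices S i. sup_norm_on E (partials vs ?f))" by (rule SUP_upper[OF that(2)])
    also have "\<dots> \<le> (\<Sum>i\<le>int_order s. SUP vs\<in>multi_indices S i. sup_norm_on E (partials vs ?f))"
      using that(1) by (intro member_le_sum) (auto simp: k_def)
    also have "\<dots> \<le> hz_norm E S s ?f" unfolding hz_norm_def by simp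
    also have "\<dots> \<le> ennreal K" by (rule H(2))
    finally show ?thesis using K by simp
  qed
  have sem: "if \<theta> \<noteq> 1 then \<bar>partials vs \<phi> (x + z) - partials vs \<phi> x\<bar> \<le> K * norm z powr \<theta>
       else \<bar>partials vs \<phi> (x + z) + partials vs \<phi> x - 2 * partials vs \<phi> (x + (1/2) *\<^sub>R z)\<bar> \<le> K * norm z"
    if vs: "vs \<in> multi_indices S k" and z: "z \<in> E" for vs x z
  proof (cases "z = 0")
    case False
    let ?f = "\<lambda>z. \<phi> (x + z)"
    let ?D = "partials vs ?f"
    have "(if \<theta> \<noteq> 1 then ennreal (\<bar>?D z - ?D 0\<bar> / norm (z - 0) powr \<theta>)
        else ennreal (\<bar>?D z + ?D 0 - 2 * ?D ((1/2) *\<^sub>R (z + 0))\<bar> / norm (z - 0))) \<le> hz_seminorm E S s ?f"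
      unfolding hz_seminorm_def Let_def \<theta>_def using z 0 False vs
      by (intro SUP_upper2[of vs] SUP_upper2[of "(z, 0)"]) (auto simp: k_def)
    also have "\<dots> \<le> hz_norm E S s ?f" unfolding hz_norm_def by simp
    also have "\<dots> \<le> ennreal K" by (rule H(2))
    finally show ?thesis using K False by (auto simp: partials_translate pos_divide_le_eq split: if_splits)
  qed (use K in simp)
  have main: "hzf j \<theta> K (partials vs \<phi>)" if "j \<le> k" "vs \<in> multi_indices S (k - j)" for j vs
    using that
  proof (induction j arbitrary: vs)
    have cont: "continuous_on E (\<lambda>z. partials vs \<phi> (x0 + z))" if "i \<le> k" "vs \<in> multi_indices S i" for i vs x0
      using C[of x0] that unfolding Ck_on_def by (auto simp: partials_translate[abs_def])
    {
      case 0
      then show ?case using bnd[OF order_refl] cont[OF order_refl] sem by simp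
    next
      case (Suc j)
      have "\<exists>f'. (\<forall>x. ((\<lambda>s. partials vs \<phi> (x + s *\<^sub>R e)) has_real_derivative f' x) (at 0)) \<and> hzf j \<theta> K f'"
        if e: "e \<in> S" for e
      proof (intro exI[of _ "partials (e # vs) \<phi>"] conjI allI)
        have "e # vs \<in> multi_indices S (k - j)" using e Suc.prems by (auto simp: multi_indices_def)
        then show "hzf j \<theta> K (partials (e # vs) \<phi>)" using Suc.prems(1) by (intro Suc.IH) auto
        fix x
        have i: "k - Suc j < k" using Suc.prems by simp
        have "(\<lambda>s. partials vs (\<lambda>z. \<phi> (x + z)) (0 + s *\<^sub>R e)) differentiable (at 0)"
          using C[of x] i Suc.prems(2) e 0 unfolding Ck_on_def by blast
        then have "(\<lambda>s. partials vs \<phi> (x + s *\<^sub>R e)) differentiable (at 0)" by (simp add: partials_translate)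
        then show "((\<lambda>s. partials vs \<phi> (x + s *\<^sub>R e)) has_real_derivative partials (e # vs) \<phi> x) (at 0)"
          by (simp add: DERIV_deriv_iff_real_differentiable)
      qed
      then show ?case using bnd[of "k - Suc j" vs] cont[of "k - Suc j" vs] Suc.prems by simp
    }
  qed
  show ?thesis using main[of k "[]"] by (simp add: multi_indices_def k_def \<theta>_def)
qed

text \<open>The \<open>k + 1\<close> supremum norms and the seminorm are each at most
  \<open>K\<close>, which gives the factor \<open>k + 2\<close>.\<close>

lemma hzf_hz_space:
  assumes H: "hzf (int_order s) (frac_order s) K \<phi>"
  shows "(\<lambda>z. \<phi> (x0 + z)) \<in> hz_space E S s" "hz_norm E S s (\<lambda>z. \<phi> (x0 + z)) \<le> ennreal ((real (int_order s) + 2) * K)"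
proof -
  define k where "k = int_order s"
  define \<theta> where "\<theta> = frac_order s"
  have K: "0 \<le> K" using hzf_bound[OF H, of 0] by simp
  have main: "hzf (k - i) \<theta> K (partials vs \<phi>)" if "i \<le> k" "vs \<in> multi_indices S i" for i vs
    using that
  proof (induction i arbitrary: vs)
    case 0
    then show ?case using H by (simp add: multi_indices_def k_def \<theta>_def)
  next
    case (Suc i)
    then obtain v ws where vs: "vs = v # ws" "v \<in> S" "ws \<in> multi_indices S i"
      by (cases vs) (auto simp: multi_indices_def)
    have "k - i = Suc (k - Suc i)" using Suc.prems by simp
    then have "hzf (Suc (k - Suc i)) \<theta> K (partials ws \<phi>)" using Suc.IH[OF _ vs(3)] Suc.prems by simp
    then obtain f' where f': "\<And>x. ((\<lambda>s. partials ws \<phi> (x + s *\<^sub>R v)) has_real_derivative f' x) (at 0)"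
      "hzf (k - Suc i) \<theta> K f'" using vs(2) unfolding hzf.simps by blast
    have "partials vs \<phi> = f'" unfolding vs(1) using DERIV_imp_deriv[OF f'(1)] by auto
    then show ?case using f'(2) by simp
  qed
  have diff: "(\<lambda>s. partials vs \<phi> (x + s *\<^sub>R v)) differentiable (at 0)"
    if "i < k" "vs \<in> multi_indices S i" "v \<in> S" for i vs v x
  proof -
    have "k - i = Suc (k - Suc i)" using that by simp
    then have "hzf (Suc (k - Suc i)) \<theta> K (partials vs \<phi>)" using main[of i vs] that by simp
    then show ?thesis using that(3) real_differentiable_def by fastforce
  qed
  show n: "hz_norm E S s (\<lambda>z. \<phi> (x0 + z)) \<le> ennreal ((real (int_order s) + 2) * K)"
  proof -
    have "(\<Sum>i\<le>k. SUP vs\<in>multi_indices S i. sup_norm_on E (partials vs (\<lambda>z. \<phi> (x0 + z)))) \<le> (\<Sum>i\<le>k. ennreal K)"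
      unfolding sup_norm_on_def
      by (intro sum_mono SUP_least ennreal_leI) (auto simp: partials_translate intro!: hzf_bound[OF main])
    also have "(\<Sum>i\<le>k. ennreal K) = ennreal ((real k + 1) * K)"
      using sum_ennreal[of "{..k}" "\<lambda>_. K"] K by (simp add: add.commute)
    finally have 1: "(\<Sum>i\<le>k. SUP vs\<in>multi_indices S i. sup_norm_on E (partials vs (\<lambda>z. \<phi> (x0 + z)))) \<le> ennreal ((real k + 1) * K)" .
    have 2: "hz_seminorm E S s (\<lambda>z. \<phi> (x0 + z)) \<le> ennreal K"
      unfolding hz_seminorm_def Let_def
    proof (intro SUP_least, clarify)
      fix vs and x y :: 'a assume vs: "vs \<in> multi_indices S (int_order s)" and xy: "x \<in> E" "y \<in> E" "x \<noteq> y"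
      have z: "x - y \<in> E" by (rule subspace_diff[OF sub_E xy(1,2)])
      note mid = segment_midpoint[of y x]
      have "hzf 0 \<theta> K (partials vs \<phi>)" using main[of k vs] vs by (simp add: k_def)
      then have "if \<theta> \<noteq> 1 then \<bar>partials vs \<phi> (x0 + y + (x - y)) - partials vs \<phi> (x0 + y)\<bar> \<le> K * norm (x - y) powr \<theta>
         else \<bar>partials vs \<phi> (x0 + y + (x - y)) + partials vs \<phi> (x0 + y) - 2 * partials vs \<phi> (x0 + y + (1/2) *\<^sub>R (x - y))\<bar> \<le> K * norm (x - y)"
        using z unfolding hzf.simps by blast
      then show "(if frac_order s \<noteq> 1
          then ennreal (\<bar>partials vs (\<lambda>z. \<phi> (x0 + z)) x - partials vs (\<lambda>z. \<phi> (x0 + z)) y\<bar> / norm (x - y) powr frac_order s)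
          else ennreal (\<bar>partials vs (\<lambda>z. \<phi> (x0 + z)) x + partials vs (\<lambda>z. \<phi> (x0 + z)) y - 2 * partials vs (\<lambda>z. \<phi> (x0 + z)) ((1 / 2) *\<^sub>R (x + y))\<bar> / norm (x - y)))
        \<le> ennreal K"
        unfolding partials_translate add.assoc mid \<theta>_def using xy(3) K
        by (auto simp: pos_divide_le_eq intro!: ennreal_leI split: if_splits)
    qed
    have "hz_norm E S s (\<lambda>z. \<phi> (x0 + z)) \<le> ennreal ((real k + 1) * K) + ennreal K"
      unfolding hz_norm_def k_def[symmetric] by (rule add_mono[OF 1 2])
    also have "\<dots> = ennreal ((real k + 2) * K)" using K by (simp add: algebra_simps flip: ennreal_plus)
    finally show ?thesis by (simp add: k_def)
  qed
  have "Ck_on E S k (\<lambda>z. \<phi> (x0 + z))"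
    unfolding Ck_on_def partials_translate[abs_def] using diff hzf_continuous[OF main]
    by (auto simp: add.assoc[symmetric])
  moreover have "hz_norm E S s (\<lambda>z. \<phi> (x0 + z)) < \<infinity>" using n ennreal_less_top le_less_trans by fastforce
  ultimately show "(\<lambda>z. \<phi> (x0 + z)) \<in> hz_space E S s" by (simp add: hz_space_def k_def)
qed


text \<open>Each derivative is converted into one difference by the mean value theorem; the
  remaining order \<theta> takes one difference more, or two in the Zygmund case \<theta> =
  1.\<close>

lemma hzf_diffs:
  assumes "hzf k \<theta> K f" and \<rho>: "0 \<le> \<rho>" and "length zs = (if \<theta> = 1 then k + 2 else k + 1)"
    and zs: "set zs \<subseteq> E \<inter> cball 0 \<rho>" and \<theta>: "0 < \<theta>"
  shows "\<bar>diffs zs f x\<bar> \<le> 4 * (real (card S) * \<rho>) ^ k * K * \<rho> powr \<theta>"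
  using assms
proof (induction k arbitrary: f zs x)
  case 0
  have K: "0 \<le> K" using hzf_bound[OF 0(1), of 0] by simp
  show ?case
  proof (cases "\<theta> = 1")
    case False
    then obtain z where z: "zs = [z]" using 0(3) by (auto simp: length_Suc_conv)
    have zE: "z \<in> E" "norm z \<le> \<rho>" using 0(4) by (auto simp: z)
    have "\<bar>f (x + z) - f x\<bar> \<le> K * norm z powr \<theta>" using 0(1) zE False by auto
    also have "\<dots> \<le> 4 * K * \<rho> powr \<theta>"
      using K zE \<theta> by (intro mult_mono powr_mono2) auto
    finally show ?thesis by (simp add: z diff1_def)
  next
    case True
    then obtain a b where ab: "zs = [a, b]" using 0(3) by (auto simp: length_Suc_conv numeral_2_eq_2)
    have E: "a \<in> E" "b \<in> E" "norm a \<le> \<rho>" "norm b \<le> \<rho>" using 0(4) by (auto simp: ab)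
    have Z: "\<bar>f (x + z) + f x - 2 * f (x + (1/2) *\<^sub>R z)\<bar> \<le> K * norm z" if "z \<in> E" for x z
      using 0(1) that True by simp
    \<comment> \<open>The parallelogram with vertices \<open>x\<close>, \<open>x + a\<close>,
      \<open>x + b\<close>, \<open>x + a + b\<close> has a single midpoint, so the mixed second
      difference is the difference of the symmetric ones along its two diagonals.\<close>
    note half = segment_midpoint[of b a]
    have "\<bar>f (x + (a + b)) + f x - 2 * f (x + (1/2) *\<^sub>R (a + b))\<bar> \<le> K * norm (a + b)"
      by (intro Z subspace_add[OF sub_E] E)
    moreover have "\<bar>f (x + b + (a - b)) + f (x + b) - 2 * f (x + b + (1/2) *\<^sub>R (a - b))\<bar> \<le> K * norm (a - b)"
      by (intro Z subspace_diff[OF sub_E] E)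
    then have "\<bar>f (x + a) + f (x + b) - 2 * f (x + (1/2) *\<^sub>R (a + b))\<bar> \<le> K * norm (a - b)"
      by (simp add: add.assoc half)
    moreover have "K * norm (a + b) \<le> K * (2 * \<rho>)" "K * norm (a - b) \<le> K * (2 * \<rho>)"
      using K E norm_triangle_ineq[of a b] norm_triangle_ineq4[of a b] by (auto intro!: mult_left_mono)
    ultimately have "\<bar>f (x + (a + b)) - f (x + a) - f (x + b) + f x\<bar> \<le> 4 * K * \<rho>" by linarith
    then show ?thesis using True \<rho> by (simp add: ab diff1_def ac_simps algebra_simps)
  qed
next
  case (Suc k)
  have K: "0 \<le> K" using hzf_bound[OF Suc.prems(1), of 0] by simp
  obtain z ws where zs: "zs = z # ws" using Suc.prems(3) by (cases zs) (auto split: if_splits)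
  obtain f' where f': "\<And>e x. e \<in> S \<Longrightarrow> ((\<lambda>s. f (x + s *\<^sub>R e)) has_real_derivative f' e x) (at 0)"
    "\<And>e. e \<in> S \<Longrightarrow> hzf k \<theta> K (f' e)" using Suc.prems(1) unfolding hzf.simps by metis
  have "\<bar>diff1 z (diffs ws f) x\<bar> \<le> real (card S) * \<rho> * (4 * (real (card S) * \<rho>) ^ k * K * \<rho> powr \<theta>)"
  proof (rule mean_value_E)
    show "((\<lambda>s. diffs ws f (x + s *\<^sub>R e)) has_real_derivative diffs ws (f' e) x) (at 0)" if "e \<in> S" for e x
      by (rule has_derivative_diffs) (rule f'(1)[OF that])
    show "\<bar>diffs ws (f' e) x\<bar> \<le> 4 * (real (card S) * \<rho>) ^ k * K * \<rho> powr \<theta>" if "e \<in> S" for e x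
      using Suc.prems zs by (intro Suc.IH f'(2)[OF that]) (auto split: if_splits)
  qed (use K \<rho> Suc.prems zs in auto)
  then show ?case by (simp add: zs mult_ac)
qed

text \<open>The step is doubled until its length exceeds 1/2, where the supremum bound suffices. In
  \<open>diff1 (2 *\<^sub>R z) f x = 2 * diff1 z f x + diffs [z, z] f x\<close> the exponent
  \<open>s < 1\<close> gives the factor \<open>q < 1\<close>, and the constant \<open>C\<close> is
  chosen such that \<open>C * q + 2 \<le> C\<close>.\<close>

lemma zygmund_hoelder:
  assumes F: "\<And>x. \<bar>f x\<bar> \<le> K" and Z: "\<And>x z. z \<in> E \<Longrightarrow> \<bar>diffs [z, z] f x\<bar> \<le> 4 * K * norm z"
    and s: "0 < s" "s < 1" and z: "z \<in> E" "norm z \<le> 1"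
  shows "\<bar>diff1 z f x\<bar> \<le> (4 + 2 / (1 - 2 powr (s - 1))) * K * norm z powr s"
proof -
  define q where "q = (2::real) powr (s - 1)"
  define C where "C = 4 + 2 / (1 - q)"
  have q: "0 < q" "q < 1" unfolding q_def using s powr_less_mono[of "s - 1" 0 "2::real"] by auto
  have K: "0 \<le> K" using F order_trans[OF abs_ge_zero] by blast
  have "2 / (1 - q) \<le> C" by (simp add: C_def)
  then have "2 \<le> C * (1 - q)" using q by (simp add: pos_divide_le_eq)
  then have Cq: "C * q + 2 \<le> C" by (simp add: algebra_simps)
  have C4: "4 \<le> C" unfolding C_def using q by simp
  have "\<bar>diff1 z f x\<bar> \<le> C * K * norm z powr s" if "z \<in> E" "norm z \<le> 1" "1 / 2 ^ n < norm z" for n z x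
    using that
  proof (induction n arbitrary: z x)
    case (Suc n)
    show ?case
    proof (cases "1/2 < norm z")
      case True
      have "(1/2) \<le> (1/2::real) powr s" using s powr_mono'[of s 1 "1/2::real"] by simp
      also have "\<dots> \<le> norm z powr s" using True s by (intro powr_mono2) auto
      finally have "4 * K * (1/2) \<le> C * K * norm z powr s" using C4 K by (intro mult_mono) auto
      moreover have "\<bar>diff1 z f x\<bar> \<le> 2 * K" using F[of x] F[of "x + z"] by (simp add: diff1_def)
      ultimately show ?thesis by simp
    next
      case False
      have z2: "2 *\<^sub>R z \<in> E" by (rule subspace_scale[OF sub_E Suc.prems(1)])
      have "\<bar>diff1 (2 *\<^sub>R z) f x\<bar> \<le> C * K * norm (2 *\<^sub>R z) powr s"
        using False Suc.prems by (intro Suc.IH z2) (auto simp: field_simps)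
      moreover have "norm (2 *\<^sub>R z) powr s = 2 * q * norm z powr s"
        by (simp add: powr_mult q_def powr_diff)
      moreover have "diff1 (2 *\<^sub>R z) f x = 2 * diff1 z f x + diffs [z, z] f x"
        by (simp add: diff1_def scaleR_2 ac_simps)
      moreover have "\<bar>diffs [z, z] f x\<bar> \<le> 4 * K * norm z" by (rule Z[OF Suc.prems(1)])
      moreover have "norm z \<le> norm z powr s" using s Suc.prems(2) powr_mono'[of s 1 "norm z"] by simp
      then have "4 * K * norm z \<le> 4 * K * norm z powr s" using K by (intro mult_left_mono) auto
      moreover from calculation(1) have "\<bar>diff1 (2 *\<^sub>R z) f x\<bar> \<le> C * K * (2 * q * norm z powr s)"
        unfolding calculation(2) .
      ultimately have "2 * \<bar>diff1 z f x\<bar> \<le> C * K * (2 * q * norm z powr s) + 4 * K * norm z powr s" by argo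
      also have "\<dots> = 2 * ((C * q + 2) * (K * norm z powr s))" by (simp add: algebra_simps)
      also have "\<dots> \<le> 2 * (C * (K * norm z powr s))" using Cq K by (intro mult_left_mono mult_right_mono) auto
      finally show ?thesis by (simp add: mult.assoc)
    qed
  qed simp
  moreover obtain n where "1 / 2 ^ n < norm z" if "z \<noteq> 0"
    using real_arch_pow_inv[of "norm z" "1/2"] by (auto simp: power_one_over)
  ultimately have "z \<noteq> 0 \<Longrightarrow> \<bar>diff1 z f x\<bar> \<le> C * K * norm z powr s" using z by blast
  then show ?thesis by (cases "z = 0") (auto simp: C_def q_def diff1_def)
qed

text \<open>If a derivative exists the mean value theorem applies; otherwise the class is a Hoelder
  class or the Zygmund class. The latter does not consist of Lipschitz functions, hence the strict
  bound \<open>s < 1\<close>.\<close>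

lemma hzf_hoelder:
  assumes H: "hzf k \<theta> K f" and \<theta>: "0 < \<theta>" "\<theta> \<le> 1" and s: "0 < s" "s < 1" "s \<le> real k + \<theta>"
    and z: "z \<in> E" "norm z \<le> 1"
  shows "\<bar>diff1 z f x\<bar> \<le> (real (card S) + 4 + 2 / (1 - 2 powr (s - 1))) * K * norm z powr s"
proof -
  have K: "0 \<le> K" using hzf_bound[OF H, of 0] by simp
  have q: "0 \<le> 2 / (1 - (2::real) powr (s - 1))" using s powr_mono[of "s - 1" 0 "2::real"] by simp
  have reduce: ?thesis if "\<bar>diff1 z f x\<bar> \<le> c * K * norm z powr s" "c \<le> real (card S) + 4 + 2 / (1 - 2 powr (s - 1))" for c
    by (rule order_trans[OF that(1)]) (intro mult_right_mono that K powr_ge_zero)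
  show ?thesis
  proof (cases k)
    case (Suc j)
    obtain f' where f': "\<And>e x. e \<in> S \<Longrightarrow> ((\<lambda>s. f (x + s *\<^sub>R e)) has_real_derivative f' e x) (at 0)"
      "\<And>e. e \<in> S \<Longrightarrow> hzf j \<theta> K (f' e)" using H unfolding Suc hzf.simps by metis
    have "\<bar>diff1 z f x\<bar> \<le> real (card S) * norm z * K"
      using f' K z(1) by (intro mean_value_E[of f f']) (auto intro: hzf_bound)
    also have "\<dots> = real (card S) * K * norm z powr 1" by simp
    also have "\<dots> \<le> real (card S) * K * norm z powr s" using K z s by (intro mult_left_mono powr_mono') auto
    finally show ?thesis by (rule reduce) (use q in simp)
  next
    case 0
    show ?thesis
    proof (cases "\<theta> = 1")
      case False
      have "\<bar>diff1 z f x\<bar> \<le> K * norm z powr \<theta>" using H z False unfolding 0 by (simp add: diff1_def)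
      also have "\<dots> \<le> K * norm z powr s" using K z s 0 by (intro mult_left_mono powr_mono') auto
      finally show ?thesis by (intro reduce[of 1]) (use q in auto)
    next
      case True
      have "\<bar>diffs [z, z] f x\<bar> \<le> 4 * K * norm z" if "z \<in> E" for x z
        using hzf_diffs[OF H, of "norm z" "[z, z]" x] that True 0 by simp
      then have "\<bar>diff1 z f x\<bar> \<le> (4 + 2 / (1 - 2 powr (s - 1))) * K * norm z powr s"
        using hzf_bound[OF H] s z by (intro zygmund_hoelder) auto
      then show ?thesis by (rule reduce) simp
    qed
  qed
qed

section \<open>From bounds on differences back to derivatives\<close>

definition dbd :: "nat \<Rightarrow> real \<Rightarrow> real \<Rightarrow> ('a \<Rightarrow> real) \<Rightarrow> bool" where
  "dbd m \<gamma> K f \<longleftrightarrow> bcont f \<and> (\<forall>x. \<bar>f x\<bar> \<le> K) \<and>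
     (\<forall>\<rho> zs x. 0 < \<rho> \<longrightarrow> length zs = m \<longrightarrow> set zs \<subseteq> E \<inter> cball 0 \<rho> \<longrightarrow> \<bar>diffs zs f x\<bar> \<le> K * \<rho> powr \<gamma>)"

lemma dbdD:
  "dbd m \<gamma> K f \<Longrightarrow> 0 < \<rho> \<Longrightarrow> length zs = m \<Longrightarrow> set zs \<subseteq> E \<inter> cball 0 \<rho> \<Longrightarrow> \<bar>diffs zs f x\<bar> \<le> K * \<rho> powr \<gamma>"
  by (simp add: dbd_def)

text \<open>The step of the approximation \<open>A h\<close> is chosen equal to the scale \<rho> of
  the differences. Then the differences of \<open>A \<rho>\<close> and of the error are both of
  order \<open>\<rho> powr \<gamma>\<close>, and division by \<rho> gives the order \<gamma> - 1;
  the error passes through \<open>p\<close> differences, hence \<open>2 ^ p * c\<close>. Continuity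
  of \<open>f'\<close> comes from uniform convergence of \<open>A h x / h\<close> along a sequence
  of steps.\<close>

lemma dbd_derivative:
  assumes \<gamma>: "1 < \<gamma>" and c: "0 \<le> c" "0 \<le> c'" and K: "0 \<le> K"
    and A: "\<And>h. 0 < h \<Longrightarrow> bcont (A h)" "\<And>h x. 0 < h \<Longrightarrow> \<bar>A h x - h * f' x\<bar> \<le> c * K * h powr \<gamma>"
      "\<And>x. \<bar>A 1 x\<bar> \<le> c' * K"
      "\<And>h zs x. 0 < h \<Longrightarrow> length zs = p \<Longrightarrow> set zs \<subseteq> E \<inter> cball 0 h \<Longrightarrow> \<bar>diffs zs (A h) x\<bar> \<le> c' * K * h powr \<gamma>"
  shows "dbd p (\<gamma> - 1) ((c' + 2 ^ p * c) * K) f'"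
proof -
  have app: "\<bar>A h x / h - f' x\<bar> \<le> c * K * h powr (\<gamma> - 1)" if h: "0 < h" for h x
  proof -
    have "A h x / h - f' x = (A h x - h * f' x) / h" using h by (simp add: diff_divide_distrib)
    then have "\<bar>A h x / h - f' x\<bar> = \<bar>A h x - h * f' x\<bar> / h" using h by simp
    also have "\<dots> \<le> c * K * h powr \<gamma> / h" using A(2)[OF h] h by (intro divide_right_mono) auto
    finally show ?thesis using h by (simp add: powr_diff)
  qed
  have "uniform_limit UNIV (\<lambda>n x. A (1 / real (Suc n)) x / (1 / real (Suc n))) f' sequentially"
    unfolding uniform_limit_iff
  proof (intro allI impI)
    fix e :: real assume "0 < e"
    have "(\<lambda>n. (1 / real (Suc n)) powr (\<gamma> - 1)) \<longlonglongrightarrow> 0 powr (\<gamma> - 1)"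
      using \<gamma> by (intro tendsto_powr' LIMSEQ_Suc[OF lim_1_over_n] tendsto_const) auto
    then have "(\<lambda>n. c * K * (1 / real (Suc n)) powr (\<gamma> - 1)) \<longlonglongrightarrow> 0" by (intro tendsto_mult_right_zero) simp
    then have "\<forall>\<^sub>F n in sequentially. c * K * (1 / real (Suc n)) powr (\<gamma> - 1) < e"
      using \<open>0 < e\<close> by (rule order_tendstoD(2))
    then show "\<forall>\<^sub>F n in sequentially. \<forall>x\<in>UNIV. dist (A (1 / real (Suc n)) x / (1 / real (Suc n))) (f' x) < e"
    proof (rule eventually_mono, intro ballI)
      fix n x assume lt: "c * K * (1 / real (Suc n)) powr (\<gamma> - 1) < e"
      from app[of "1 / real (Suc n)" x] show "dist (A (1 / real (Suc n)) x / (1 / real (Suc n))) (f' x) < e"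
        unfolding dist_real_def by (intro le_less_trans[OF _ lt]) simp
    qed
  qed
  moreover have "continuous_on UNIV (\<lambda>x. A (1 / real (Suc n)) x / (1 / real (Suc n)))" for n
    using A(1)[of "1 / real (Suc n)"] unfolding bcont_def by (intro continuous_intros) auto
  ultimately have cont: "continuous_on UNIV f'"
    by (intro uniform_limit_theorem[where F = sequentially]) auto
  have cK: "0 \<le> c * K" "0 \<le> c' * K" using c K by auto
  have bd: "\<bar>f' x\<bar> \<le> (c' + 2 ^ p * c) * K" for x
  proof -
    have "\<bar>f' x\<bar> \<le> c' * K + c * K" using A(2)[of 1 x] A(3)[of x] by simp
    also have "c * K \<le> 2 ^ p * (c * K)" using cK mult_right_mono[of 1 "2 ^ p" "c * K"] by simp
    finally show ?thesis by (simp add: distrib_right mult.assoc)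
  qed
  show ?thesis unfolding dbd_def
  proof (intro conjI allI impI bd)
    show "bcont f'" unfolding bcont_def using cont bd by blast
    fix \<rho> zs x assume \<rho>: "0 < (\<rho>::real)" and zs: "length zs = p" "set zs \<subseteq> E \<inter> cball 0 \<rho>"
    have "diffs zs f' x = (diffs zs (A \<rho>) x - diffs zs (\<lambda>x. A \<rho> x - \<rho> * f' x) x) / \<rho>"
      using \<rho> by (simp add: diffs_minus diffs_cmult)
    also have "\<bar>\<dots>\<bar> \<le> (c' * K * \<rho> powr \<gamma> + 2 ^ p * (c * K * \<rho> powr \<gamma>)) / \<rho>"
      using A(4)[OF \<rho> zs, of x] diffs_bound[of "\<lambda>x. A \<rho> x - \<rho> * f' x", OF A(2)[OF \<rho>], of zs x] \<rho> zs(1)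
      unfolding abs_divide by (intro frac_le) auto
    also have "\<dots> = (c' + 2 ^ p * c) * K * \<rho> powr (\<gamma> - 1)" using \<rho> by (simp add: powr_diff field_simps)
    finally show "\<bar>diffs zs f' x\<bar> \<le> (c' + 2 ^ p * c) * K * \<rho> powr (\<gamma> - 1)" .
  qed
qed

lemma dbd2_derivative:
  assumes f: "dbd 2 \<gamma> K f" and \<gamma>: "1 < \<gamma>" and e: "e \<in> S"
  obtains f' where "\<And>x. ((\<lambda>s. f (x + s *\<^sub>R e)) has_real_derivative f' x) (at 0)"
    "\<And>x h. \<bar>diff1 (h *\<^sub>R e) f x - h * f' x\<bar> \<le> K / (1 - 2 powr (1 - \<gamma>)) * \<bar>h\<bar> powr \<gamma>"
proof -
  have F: "\<And>x. \<bar>f x\<bar> \<le> K" using f by (simp add: dbd_def)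
  have "\<exists>D. ((\<lambda>s. f (x + s *\<^sub>R e)) has_real_derivative D) (at 0) \<and>
    (\<forall>h. \<bar>diff1 (h *\<^sub>R e) f x - h * D\<bar> \<le> K / (1 - 2 powr (1 - \<gamma>)) * \<bar>h\<bar> powr \<gamma>)" for x
  proof (rule second_difference_derivative[OF \<gamma>, of "\<lambda>s. f (x + s *\<^sub>R e)" K K])
    fix \<rho> a b :: real assume ab: "0 < \<rho>" "\<bar>a\<bar> \<le> \<rho>" "\<bar>b\<bar> \<le> \<rho>"
    have "\<bar>diffs [a *\<^sub>R e, b *\<^sub>R e] f x\<bar> \<le> K * \<rho> powr \<gamma>"
      using f ab unit[OF e] subspace_scale[OF sub_E S_in_E[OF e]] by (simp add: dbd_def del: diffs.simps)
    then show "\<bar>f (x + (a + b) *\<^sub>R e) - f (x + a *\<^sub>R e) - f (x + b *\<^sub>R e) + f (x + 0 *\<^sub>R e)\<bar> \<le> K * \<rho> powr \<gamma>"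
      by (simp add: diff1_def scaleR_add_left ac_simps algebra_simps)
  next
    fix D assume "((\<lambda>s. f (x + s *\<^sub>R e)) has_real_derivative D) (at 0)"
      "\<And>h. \<bar>f (x + h *\<^sub>R e) - f (x + 0 *\<^sub>R e) - h * D\<bar> \<le> K / (1 - 2 powr (1 - \<gamma>)) * \<bar>h\<bar> powr \<gamma>"
    then show ?thesis by (auto simp: diff1_def)
  qed (use F in auto)
  then show thesis using that by metis
qed

text \<open>Sum of the geometric series of ratio \<open>2 powr (1 - \<gamma>)\<close> for \<gamma> >
  1, the loss in summing over dyadic steps.\<close>

definition dconst :: "real \<Rightarrow> real" where "dconst \<gamma> = 1 / (1 - 2 powr (1 - \<gamma>))"

lemma dconst_nonneg: "1 \<le> \<gamma> \<Longrightarrow> 0 \<le> dconst \<gamma>"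
  using powr_mono[of "1 - \<gamma>" 0 "2::real"] by (simp add: dconst_def)

lemma dbd2_dbd1:
  assumes f: "dbd 2 \<gamma> K f" and \<gamma>: "1 < \<gamma>" and e: "e \<in> S"
  obtains f' where "\<And>x. ((\<lambda>s. f (x + s *\<^sub>R e)) has_real_derivative f' x) (at 0)" "dbd 1 (\<gamma> - 1) ((2 + 2 * dconst \<gamma>) * K) f'"
proof -
  obtain f' where f': "\<And>x. ((\<lambda>s. f (x + s *\<^sub>R e)) has_real_derivative f' x) (at 0)"
    "\<And>x h. \<bar>diff1 (h *\<^sub>R e) f x - h * f' x\<bar> \<le> K / (1 - 2 powr (1 - \<gamma>)) * \<bar>h\<bar> powr \<gamma>"
    using dbd2_derivative[OF f \<gamma> e] by metis
  have b: "bcont f" and F: "\<And>x. \<bar>f x\<bar> \<le> K" using f by (simp_all add: dbd_def)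
  have K: "0 \<le> K" using F order_trans[OF abs_ge_zero] by blast
  have "dbd 1 (\<gamma> - 1) ((2 + 2 ^ 1 * dconst \<gamma>) * K) f'"
  proof (rule dbd_derivative[where A = "\<lambda>h. diff1 (h *\<^sub>R e) f"])
    show "bcont (diff1 (h *\<^sub>R e) f)" for h by (rule bcont_diff1[OF b])
    show "\<bar>diff1 (h *\<^sub>R e) f x - h * f' x\<bar> \<le> dconst \<gamma> * K * h powr \<gamma>" if "0 < h" for h x
      using f'(2)[of h x] that by (simp add: dconst_def)
    show "\<bar>diff1 (1 *\<^sub>R e) f x\<bar> \<le> 2 * K" for x using F[of x] F[of "x + e"] by (simp add: diff1_def)
    fix h :: real and zs x assume h: "0 < h" and zs: "length zs = 1" "set zs \<subseteq> E \<inter> cball 0 h"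
    have "\<bar>diffs (zs @ [h *\<^sub>R e]) f x\<bar> \<le> K * h powr \<gamma>"
      using f h zs unit[OF e] subspace_scale[OF sub_E S_in_E[OF e]] unfolding dbd_def by simp
    moreover have "1 * (K * h powr \<gamma>) \<le> 2 * (K * h powr \<gamma>)" using K by (intro mult_right_mono) auto
    ultimately show "\<bar>diffs zs (diff1 (h *\<^sub>R e) f) x\<bar> \<le> 2 * K * h powr \<gamma>" by (simp add: diffs_append)
  qed (use \<gamma> K dconst_nonneg in auto)
  then show thesis using that[OF f'(1)] by simp
qed

text \<open>The combination \<open>L h = 2 * \<Delta> h - \<Delta> (2 * h) / 2\<close> approximates \<open>h * \<partial>\<close> to second order, and
  \<open>L h - 2 * L (h / 2) = - (T - 1)\<^sup>3 (T + 3) / 2\<close> for the translation \<open>T\<close> by \<open>h / 2\<close>.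
  The bound by \<open>K'\<close> is only used to know that the derivative exists.\<close>
lemma dbd3_dbd2:
  assumes f: "dbd 3 \<gamma> K f" "dbd 2 2 K' f" and \<gamma>: "1 < \<gamma>" and e: "e \<in> S"
  obtains f' where "\<And>x. ((\<lambda>s. f (x + s *\<^sub>R e)) has_real_derivative f' x) (at 0)" "dbd 2 (\<gamma> - 1) ((5 + 8 * dconst \<gamma>) * K) f'"
proof -
  obtain f' where f': "\<And>x. ((\<lambda>s. f (x + s *\<^sub>R e)) has_real_derivative f' x) (at 0)"
    "\<And>x h. \<bar>diff1 (h *\<^sub>R e) f x - h * f' x\<bar> \<le> K' / (1 - 2 powr (1 - 2)) * \<bar>h\<bar> powr 2"
    using dbd2_derivative[OF f(2) _ e] by (metis one_less_numeral_iff semiring_norm(76))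
  have f'2: "\<bar>diff1 (h *\<^sub>R e) f x - h * f' x\<bar> \<le> 2 * K' * h ^ 2" for x h
    using f'(2)[of h x] by (simp add: powr_diff powr_numeral)
  have b: "bcont f" and F: "\<And>x. \<bar>f x\<bar> \<le> K" using f by (simp_all add: dbd_def)
  have K: "0 \<le> K" using F order_trans[OF abs_ge_zero] by blast
  have hE: "h *\<^sub>R e \<in> E" for h by (rule subspace_scale[OF sub_E S_in_E[OF e]])
  have d3: "\<bar>diffs zs f x\<bar> \<le> K * \<rho> powr \<gamma>" if "0 < \<rho>" "length zs = 3" "set zs \<subseteq> E \<inter> cball 0 \<rho>" for \<rho> zs x
    using f(1) that by (simp add: dbd_def)
  define L where "L h x = 2 * diff1 (h *\<^sub>R e) f x - 1/2 * diff1 ((2 * h) *\<^sub>R e) f x" for h x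
  define r where "r = (2::real) powr (1 - \<gamma>)"
  have r: "0 \<le> r" "r < 1" unfolding r_def using \<gamma> powr_less_mono[of "1 - \<gamma>" 0 "2::real"] by auto
  have L_approx: "\<bar>L h x - h * f' x\<bar> \<le> 8 * K' * h ^ 2" for h x
  proof -
    have "L h x - h * f' x = 2 * (diff1 (h *\<^sub>R e) f x - h * f' x) - 1/2 * (diff1 ((2 * h) *\<^sub>R e) f x - (2 * h) * f' x)"
      by (simp add: L_def algebra_simps)
    moreover have "2 * K' * (2 * h)\<^sup>2 = 8 * K' * h\<^sup>2" by (simp add: power_mult_distrib)
    ultimately show ?thesis using f'2[of h x] f'2[of "2 * h" x] by argo
  qed
  have L_step: "\<bar>2 * L (h / 2) x - L h x\<bar> \<le> 2 * K * h powr \<gamma>" if h: "0 < h" for h x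
  proof -
    let ?z = "(h / 2) *\<^sub>R e"
    have "h *\<^sub>R e = ?z + ?z" "(2 * h) *\<^sub>R e = ?z + ?z + ?z + ?z" "(2 * (h / 2)) *\<^sub>R e = ?z + ?z" by (simp_all flip: scaleR_add_left)
    then have "2 * L (h / 2) x - L h x = 3/2 * diffs [?z, ?z, ?z] f x + 1/2 * diffs [?z, ?z, ?z] f (x + ?z)"
      by (simp add: L_def diff1_def add.assoc) argo
    moreover have "\<bar>diffs [?z, ?z, ?z] f x\<bar> \<le> K * h powr \<gamma>" for x
      using h hE unit[OF e] by (intro d3) auto
    then have "\<bar>diffs [?z, ?z, ?z] f x\<bar> \<le> K * h powr \<gamma>" "\<bar>diffs [?z, ?z, ?z] f (x + ?z)\<bar> \<le> K * h powr \<gamma>" by blast+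
    ultimately show ?thesis by linarith
  qed
  have A2: "\<bar>L h x - h * f' x\<bar> \<le> 2 * dconst \<gamma> * K * h powr \<gamma>" if h: "0 < h" for h x
  proof -
    define U where "U j = 2 ^ j * L (h / 2 ^ j) x" for j
    have U: "\<bar>U (Suc j) - U j\<bar> \<le> (2 * K * h powr \<gamma>) * r ^ j" for j
    proof -
      have "U (Suc j) - U j = 2 ^ j * (2 * L (h / 2 ^ j / 2) x - L (h / 2 ^ j) x)"
        by (simp add: U_def algebra_simps)
      also have "\<bar>\<dots>\<bar> \<le> 2 ^ j * (2 * K * (h / 2 ^ j) powr \<gamma>)"
        unfolding abs_mult using h by (intro mult_mono L_step) auto
      also have "\<dots> = 2 * K * (2 ^ j * (h / 2 ^ j) powr \<gamma>)" by simp
      also have "\<dots> = (2 * K * h powr \<gamma>) * r ^ j" unfolding r_def using h by (subst dyadic_powr) auto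
      finally show ?thesis .
    qed
    obtain l where l: "U \<longlonglongrightarrow> l" "\<bar>l - U 0\<bar> \<le> 2 * K * h powr \<gamma> / (1 - r)"
      by (rule geometric_cauchy[OF U r]) auto
    \<comment> \<open>The bound with \<open>K'\<close> identifies the limit of \<open>U\<close> as
      \<open>h * f' x\<close>; the rate of convergence, and with it the constant, comes from the
      third differences.\<close>
    have "(\<lambda>j. U j - h * f' x) \<longlonglongrightarrow> 0"
    proof (rule Lim_null_comparison)
      show "\<forall>\<^sub>F j in sequentially. norm (U j - h * f' x) \<le> 8 * K' * h ^ 2 * (1/2) ^ j"
      proof (rule always_eventually, rule allI)
        fix j
        have "U j - h * f' x = 2 ^ j * (L (h / 2 ^ j) x - h / 2 ^ j * f' x)" by (simp add: U_def field_simps)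
        also have "\<bar>\<dots>\<bar> \<le> 2 ^ j * (8 * K' * (h / 2 ^ j) ^ 2)"
          unfolding abs_mult by (intro mult_mono L_approx) auto
        also have "\<dots> = 8 * K' * h ^ 2 * (1/2) ^ j" by (simp add: power2_eq_square field_simps)
        finally show "norm (U j - h * f' x) \<le> 8 * K' * h ^ 2 * (1/2) ^ j" by simp
      qed
      show "(\<lambda>j. 8 * K' * h ^ 2 * (1/2) ^ j) \<longlonglongrightarrow> 0" by (intro tendsto_mult_right_zero LIMSEQ_realpow_zero) auto
    qed
    then have "U \<longlonglongrightarrow> h * f' x" by (rule LIM_zero_cancel)
    then have "l = h * f' x" using l(1) LIMSEQ_unique by blast
    then show ?thesis using l(2) by (simp add: U_def dconst_def r_def abs_minus_commute)
  qed
  have "dbd 2 (\<gamma> - 1) ((5 + 2 ^ 2 * (2 * dconst \<gamma>)) * K) f'"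
  proof (rule dbd_derivative[where A = L])
    show "bcont (L h)" for h
      unfolding L_def[abs_def] by (intro bcont_diff bcont_cmult bcont_diff1 b)
    show "\<bar>L h x - h * f' x\<bar> \<le> 2 * dconst \<gamma> * K * h powr \<gamma>" if "0 < h" for h x by (rule A2[OF that])
    show "\<bar>L 1 x\<bar> \<le> 5 * K" for x
      using F[of x] F[of "x + e"] F[of "x + 2 *\<^sub>R e"] by (simp add: L_def diff1_def) argo
    fix h :: real and zs x assume h: "0 < h" and zs: "length zs = 2" "set zs \<subseteq> E \<inter> cball 0 h"
    have 3: "\<bar>diffs (zs @ [h *\<^sub>R e]) f x\<bar> \<le> K * h powr \<gamma>" for x
      using h zs hE unit[OF e] by (intro d3) auto
    \<comment> \<open>\<open>L h\<close> is a combination of first differences with step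
      \<open>h\<close>, with coefficients of total size 2, so its second differences are third
      differences of \<open>f\<close>.\<close>
    have "(2 * h) *\<^sub>R e = h *\<^sub>R e + h *\<^sub>R e" by (simp flip: scaleR_add_left)
    then have "L h = (\<lambda>x. 3/2 * diff1 (h *\<^sub>R e) f x - 1/2 * diff1 (h *\<^sub>R e) f (x + h *\<^sub>R e))"
      by (intro ext) (simp add: L_def diff1_def add.assoc, argo)
    then have "diffs zs (L h) x = 3/2 * diffs (zs @ [h *\<^sub>R e]) f x - 1/2 * diffs (zs @ [h *\<^sub>R e]) f (x + h *\<^sub>R e)"
      by (simp only: diffs_minus diffs_cmult diffs_append diffs_shift diffs.simps)
    then have "\<bar>diffs zs (L h) x\<bar> \<le> 2 * (K * h powr \<gamma>)" using 3[of x] 3[of "x + h *\<^sub>R e"] by linarith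
    also have "\<dots> \<le> 5 * (K * h powr \<gamma>)" using K by (intro mult_right_mono) auto
    finally show "\<bar>diffs zs (L h) x\<bar> \<le> 5 * K * h powr \<gamma>" by simp
  qed (use \<gamma> K dconst_nonneg in auto)
  then show thesis using that[OF f'(1)] by simp
qed

lemma dbd_continuous:
  assumes "dbd m \<gamma> K f"
  shows "continuous_on E (\<lambda>z. f (x0 + z))"
proof (rule continuous_on_compose2[of UNIV f])
  show "continuous_on UNIV f" using assms by (simp add: dbd_def bcont_def)
qed (auto intro: continuous_intros)

lemma dbd1_hzf:
  assumes f: "dbd 1 \<gamma> K f" and \<gamma>: "0 < \<gamma>" "\<gamma> < 1"
  shows "hzf 0 \<gamma> K f"
proof -
  have "\<bar>f (x + z) - f x\<bar> \<le> K * norm z powr \<gamma>" if "z \<in> E" for x z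
  proof (cases "z = 0")
    case False
    then have "\<bar>diffs [z] f x\<bar> \<le> K * norm z powr \<gamma>" using that by (intro dbdD[OF f]) auto
    then show ?thesis by (simp add: diff1_def)
  qed simp
  then show ?thesis using f \<gamma> dbd_continuous[OF f] by (simp add: dbd_def)
qed

lemma dbd2_hzf_zygmund:
  assumes f: "dbd 2 1 K f"
  shows "hzf 0 1 K f"
proof -
  have K: "0 \<le> K" using f order_trans[OF abs_ge_zero] unfolding dbd_def by blast
  have "\<bar>f (x + z) + f x - 2 * f (x + (1/2) *\<^sub>R z)\<bar> \<le> K * norm z" if "z \<in> E" for x z
  proof (cases "z = 0")
    case False
    let ?z = "(1/2) *\<^sub>R z"
    have "?z \<in> E" using that by (rule subspace_scale[OF sub_E])
    then have "\<bar>diffs [?z, ?z] f x\<bar> \<le> K * (norm z / 2) powr 1" using False by (intro dbdD[OF f]) auto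
    moreover have "K * (norm z / 2) powr 1 \<le> K * norm z" using K by (simp add: mult_left_mono)
    moreover have w: "diffs [w, w] f x = f (x + (w + w)) + f x - 2 * f (x + w)" for w
      by (simp add: diff1_def add.assoc)
    have "z = ?z + ?z" by (simp flip: scaleR_add_left)
    then have "diffs [?z, ?z] f x = f (x + z) + f x - 2 * f (x + ?z)" using w[of ?z] by simp
    ultimately show ?thesis by linarith
  qed simp
  then show ?thesis using f dbd_continuous[OF f] by (simp add: dbd_def)
qed

lemma dbd2_hzf:
  assumes f: "dbd 2 \<gamma> K f" and \<gamma>: "1 < \<gamma>" "\<gamma> < 2"
  shows "hzf 1 (\<gamma> - 1) ((2 + 2 * dconst \<gamma>) * K) f"
proof -
  have K: "0 \<le> K" using f order_trans[OF abs_ge_zero] unfolding dbd_def by blast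
  have "1 * K \<le> (2 + 2 * dconst \<gamma>) * K" using K dconst_nonneg[of \<gamma>] \<gamma> by (intro mult_right_mono) auto
  then have "\<bar>f x\<bar> \<le> (2 + 2 * dconst \<gamma>) * K" for x using f unfolding dbd_def by (auto intro: order_trans)
  moreover have "\<exists>f'. (\<forall>x. ((\<lambda>s. f (x + s *\<^sub>R e)) has_real_derivative f' x) (at 0)) \<and> hzf 0 (\<gamma> - 1) ((2 + 2 * dconst \<gamma>) * K) f'"
    if e: "e \<in> S" for e
  proof -
    obtain f' where "\<And>x. ((\<lambda>s. f (x + s *\<^sub>R e)) has_real_derivative f' x) (at 0)" "dbd 1 (\<gamma> - 1) ((2 + 2 * dconst \<gamma>) * K) f'"
      using dbd2_dbd1[OF f \<gamma>(1) e] by blast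
    moreover from this(2) have "hzf 0 (\<gamma> - 1) ((2 + 2 * dconst \<gamma>) * K) f'" by (rule dbd1_hzf) (use \<gamma> in auto)
    ultimately show ?thesis by blast
  qed
  ultimately show ?thesis using dbd_continuous[OF f] unfolding One_nat_def hzf.simps(2) by blast
qed

text \<open>For \<open>\<gamma> = 2\<close> the constant \<open>dconst (\<gamma> - 1)\<close> is \<open>1 / 0 = 0\<close>.\<close>
lemma dbd3_hzf:
  assumes f: "dbd 3 \<gamma> K f" "dbd 2 2 K' f" and \<gamma>: "2 \<le> \<gamma>" "\<gamma> < 3"
  shows "hzf (int_order \<gamma>) (frac_order \<gamma>) ((2 + 2 * dconst (\<gamma> - 1)) * ((5 + 8 * dconst \<gamma>) * K)) f"
proof -
  let ?M = "(5 + 8 * dconst \<gamma>) * K" and ?c = "2 + 2 * dconst (\<gamma> - 1)"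
  have K: "0 \<le> K" using f order_trans[OF abs_ge_zero] unfolding dbd_def by blast
  have dc: "0 \<le> dconst \<gamma>" "0 \<le> dconst (\<gamma> - 1)" using \<gamma> by (auto intro: dconst_nonneg)
  have "1 * K \<le> ?M" using K dc by (intro mult_right_mono) auto
  moreover have M: "1 * ?M \<le> ?c * ?M" using K dc by (intro mult_right_mono) auto
  ultimately have "K \<le> ?c * ?M" by simp
  then have bd: "\<bar>f x\<bar> \<le> ?c * ?M" for x using f unfolding dbd_def by (blast intro: order_trans)
  have der: "\<exists>f'. (\<forall>x. ((\<lambda>s. f (x + s *\<^sub>R e)) has_real_derivative f' x) (at 0)) \<and> dbd 2 (\<gamma> - 1) ?M f'"
    if e: "e \<in> S" for e
    using dbd3_dbd2[OF f _ e] \<gamma> by (metis less_le_trans one_less_numeral_iff semiring_norm(76))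
  show ?thesis
  proof (cases "\<gamma> = 2")
    case True
    then have i: "int_order \<gamma> = Suc 0" "frac_order \<gamma> = 1" by (simp_all add: int_order_def frac_order_def)
    have "hzf 0 1 (?c * ?M) f'" if "dbd 2 (\<gamma> - 1) ?M f'" for f'
    proof -
      have "hzf 0 1 ?M f'" by (rule dbd2_hzf_zygmund) (use that True in simp)
      then show ?thesis by (rule hzf_mono) (use M in simp)
    qed
    then show ?thesis unfolding i hzf.simps(2) using bd der dbd_continuous[OF f(1)] by blast
  next
    case False
    then have "\<lceil>\<gamma>\<rceil> = 3" using \<gamma> by (intro ceiling_unique) auto
    then have i: "int_order \<gamma> = Suc 1" "frac_order \<gamma> = \<gamma> - 1 - 1" by (simp_all add: int_order_def frac_order_def)
    have "hzf 1 (\<gamma> - 1 - 1) (?c * ?M) f'" if "dbd 2 (\<gamma> - 1) ?M f'" for f'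
      using dbd2_hzf[OF that] \<gamma> False by simp
    then show ?thesis unfolding i hzf.simps(2) using bd der dbd_continuous[OF f(1)] by blast
  qed
qed

end

section \<open>The anisotropic spaces\<close>

lemma int_frac_order:
  assumes "0 < s"
  shows "real (int_order s) + frac_order s = s" "0 < frac_order s" "frac_order s \<le> 1"
proof -
  have "1 \<le> \<lceil>s\<rceil>" using assms by (simp add: one_le_ceiling)
  then have "real (int_order s) = of_int \<lceil>s\<rceil> - 1" by (simp add: int_order_def)
  then show "real (int_order s) + frac_order s = s" "0 < frac_order s" "frac_order s \<le> 1"
    using ceiling_correct[of s] by (auto simp: frac_order_def)
qed

lemma int_order_0: "0 < s \<Longrightarrow> s \<le> 1 \<Longrightarrow> int_order s = 0"
  using int_frac_order(1,2)[of s] by (cases "int_order s") auto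

lemma int_order_1: "1 < s \<Longrightarrow> s \<le> 2 \<Longrightarrow> int_order s = 1"
  using int_frac_order[of s] by (cases "int_order s"; cases "int_order s - 1") auto

lemma diffs_longer:
  assumes "\<And>zs (x::'a::real_normed_vector). length zs = p \<Longrightarrow> set zs \<subseteq> U \<Longrightarrow> \<bar>diffs zs f x\<bar> \<le> W"
    and "length zs = p + j" "set zs \<subseteq> U"
  shows "\<bar>diffs zs f x\<bar> \<le> 2 ^ j * (W :: real)"
  using assms(2,3)
proof (induction j arbitrary: zs x)
  case (Suc j)
  then obtain z ws where zs: "zs = z # ws" by (cases zs) auto
  have "\<bar>diffs zs f x\<bar> \<le> \<bar>diffs ws f (x + z)\<bar> + \<bar>diffs ws f x\<bar>" by (simp add: zs diff1_def)
  also have "\<dots> \<le> 2 ^ j * W + 2 ^ j * W" using Suc.prems zs by (intro add_mono Suc.IH) auto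
  finally show ?case by (simp add: mult_ac)
qed (use assms(1) in simp)

text \<open>Every increment is replaced by its image under \<open>p\<close>. Each replacement leaves
  a term with a difference along \<open>y - p y\<close>, for which the first-order bound
  \<open>W'\<close> is available; the other differences only double it.\<close>

lemma diffs_split:
  fixes f :: "'a::real_normed_vector \<Rightarrow> real"
  assumes "\<And>x y. y \<in> set ys \<Longrightarrow> \<bar>diff1 (y - p y) f x\<bar> \<le> W'" and "\<And>x. \<bar>diffs (map p ys) f x\<bar> \<le> W"
    and W': "0 \<le> W'"
  shows "\<bar>diffs ys f x\<bar> \<le> W + real (length ys) * 2 ^ length ys * W'"
  using assms
proof (induction ys arbitrary: f W W' x)
  case (Cons y ys)
  \<comment> \<open>The hypothesis is used for \<open>diff1 (p y) f\<close>, for which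
    \<open>W'\<close> doubles.\<close>
  have "\<bar>diffs ys (diff1 (p y) f) x\<bar> \<le> W + real (length ys) * 2 ^ length ys * (2 * W')" for x
  proof (rule Cons.IH)
    fix x z assume z: "z \<in> set ys"
    have "diff1 (z - p z) (diff1 (p y) f) x = diff1 (z - p z) f (x + p y) - diff1 (z - p z) f x"
      by (simp add: diff1_def ac_simps)
    then show "\<bar>diff1 (z - p z) (diff1 (p y) f) x\<bar> \<le> 2 * W'"
      using Cons.prems(1)[of z x] Cons.prems(1)[of z "x + p y"] z by simp
  qed (use Cons.prems in \<open>simp_all add: diffs_diff1\<close>)
  then have 1: "\<bar>diffs ys (diff1 (p y) f) (x + (y - p y))\<bar> \<le> W + real (length ys) * 2 ^ length ys * (2 * W')" by blast
  have 2: "\<bar>diffs ys (diff1 (y - p y) f) x\<bar> \<le> 2 ^ length ys * W'"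
    by (rule diffs_bound) (use Cons.prems(1) in simp)
  have "diff1 y f = (\<lambda>x. diff1 (p y) f (x + (y - p y)) + diff1 (y - p y) f x)" by (auto simp: diff1_def)
  then have "diffs (y # ys) f x = diffs ys (diff1 (p y) f) (x + (y - p y)) + diffs ys (diff1 (y - p y) f) x"
    by (simp only: diffs.simps diffs_diff1[symmetric] diffs_add diffs_shift)
  then have "\<bar>diffs (y # ys) f x\<bar> \<le> (W + real (length ys) * 2 ^ length ys * (2 * W')) + 2 ^ length ys * W'"
    using 1 2 by linarith
  also have "\<dots> \<le> W + real (length (y # ys)) * 2 ^ length (y # ys) * W'"
    using Cons.prems(3) by (simp add: algebra_simps)
  finally show ?case .
qed simp

context ou
begin

definition lev :: "nat \<Rightarrow> real" where "lev h = 1 + \<alpha> * (real h - 1)"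

text \<open>
  Along \<open>E h\<close> with \<open>h \<ge> 2\<close> the target order is below 1, so first differences suffice there, even if the
  homogeneity of \<open>E 1\<close> is raised to \<open>1 + \<alpha>\<close>; the orders along all \<open>E h\<close> are then below 1.
\<close>
definition lev' :: "nat \<Rightarrow> real" where "lev' h = (if h = 1 then 1 + \<alpha> else lev h)"

lemma lev_ge: "h \<in> {1..nn} \<Longrightarrow> 1 \<le> lev h" "h \<in> {1..nn} \<Longrightarrow> 1 + \<alpha> \<le> lev' h"
proof -
  assume h: "h \<in> {1..nn}"
  then show "1 \<le> lev h" using alpha by (simp add: lev_def)
  have "\<alpha> * 1 \<le> \<alpha> * (real h - 1)" if "h \<noteq> 1" using alpha h that by (intro mult_left_mono) auto
  then show "1 + \<alpha> \<le> lev' h" by (auto simp: lev'_def lev_def)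
qed

lemma onb_E: "h \<in> {1..nn} \<Longrightarrow> onb_subspace (E h) (S h)"
  by unfold_locales (use S_basis in auto)

lemma aniso_order_lev: "aniso_order \<alpha> \<gamma> h = \<gamma> / lev h"
  by (simp add: aniso_order_def lev_def)

section \<open>From the anisotropic norms to differences\<close>

definition aniso_le :: "real \<Rightarrow> real \<Rightarrow> (real^'n \<Rightarrow> real) \<Rightarrow> bool" where
  "aniso_le \<beta> K \<phi> \<longleftrightarrow> 0 \<le> K \<and> (\<forall>h\<in>{1..nn}. \<forall>x0. (\<lambda>z. \<phi> (x0 + z)) \<in> hz_space (E h) (S h) (aniso_order \<alpha> \<beta> h) \<and>
     hz_norm (E h) (S h) (aniso_order \<alpha> \<beta> h) (\<lambda>z. \<phi> (x0 + z)) \<le> ennreal K)"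

lemma aniso_le_hzf:
  assumes "aniso_le \<beta> K \<phi>" "h \<in> {1..nn}"
  shows "onb_subspace.hzf (E h) (S h) (int_order (\<beta> / lev h)) (frac_order (\<beta> / lev h)) K \<phi>"
  using assms onb_subspace.hz_space_hzf[OF onb_E[OF assms(2)]] unfolding aniso_le_def aniso_order_lev by blast

lemma ahoelder_const:
  assumes "bcont \<phi>" "\<And>x. \<bar>\<phi> x\<bar> \<le> K"
  shows "ahoelder d m 0 (2 ^ m * K) \<phi>"
proof -
  have K: "0 \<le> K" using assms(2) order_trans[OF abs_ge_zero] by blast
  then have "1 * K \<le> 2 ^ m * K" by (intro mult_right_mono) auto
  then have "\<bar>\<phi> x\<bar> \<le> 2 ^ m * K" for x using assms(2)[of x] by simp
  moreover have "\<bar>diffs ys \<phi> x\<bar> \<le> 2 ^ m * K" if "length ys = m" for ys x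
    using diffs_bound[of \<phi> K ys x, OF assms(2)] that by simp
  ultimately show ?thesis unfolding ahoelder_def using assms(1) by simp
qed

text \<open>An increment is split into its components. In \<open>E h\<close> with
  \<open>h \<ge> 2\<close> the order is below 1 and a first difference is enough. In
  \<open>E 1\<close> the order \<beta> may exceed 1: either \<open>m\<close> differences are taken,
  with weights \<open>lev\<close>, or the exponent is lowered to
  \<open>\<beta> / (1 + \<alpha>) < 1\<close> and one difference is taken, with weights
  \<open>lev'\<close>.\<close>

lemma aniso_ahoelder:
  assumes \<beta>: "0 < \<beta>" "\<beta> < 1 + \<alpha>" "\<beta> < real m"
  obtains C where "1 \<le> C" "\<And>\<phi> K. aniso_le \<beta> K \<phi> \<Longrightarrow> ahoelder lev m \<beta> (C * K) \<phi> \<and> ahoelder lev' 1 \<beta> (C * K) \<phi>"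
proof -
  have one: "1 \<in> {1..nn}" using nn_pos by simp
  define N where "N = real (card (S 1))"
  define C1 where "C1 = N + 4 + 2 / (1 - 2 powr (\<beta> / (1 + \<alpha>) - 1))"
  have s: "0 < \<beta> / (1 + \<alpha>)" "\<beta> / (1 + \<alpha>) < 1" "\<beta> / (1 + \<alpha>) \<le> \<beta>" using \<beta> alpha by (auto simp: field_simps)
  have "0 \<le> 2 / (1 - (2::real) powr (\<beta> / (1 + \<alpha>) - 1))" using s powr_mono[of "\<beta> / (1 + \<alpha>) - 1" 0 "2::real"] by simp
  then have C1: "1 \<le> C1" unfolding C1_def N_def by linarith
  define k \<theta> where "k = int_order \<beta>" and "\<theta> = frac_order \<beta>"
  have k\<theta>: "real k + \<theta> = \<beta>" "0 < \<theta>" "\<theta> \<le> 1" unfolding k_def \<theta>_def using int_frac_order[OF \<beta>(1)] by auto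
  define C where "C = 1 + real nn * C1 + 4 * N ^ k * 2 ^ m + real m * 2 ^ m * (real nn * C1)"
  have C: "1 \<le> C" "real nn * C1 \<le> C" "4 * N ^ k * 2 ^ m + real m * 2 ^ m * (real nn * C1) \<le> C"
    using C1 by (auto simp: C_def N_def)
  have lev1: "lev 1 = 1" by (simp add: lev_def)
  show thesis
  proof (rule that[OF C(1)])
    fix \<phi> K assume \<phi>: "aniso_le \<beta> K \<phi>"
    have K: "0 \<le> K" using \<phi> by (simp add: aniso_le_def)
    have bd: "\<bar>\<phi> x\<bar> \<le> K" for x by (rule onb_subspace.hzf_bound[OF onb_E[OF one] aniso_le_hzf[OF \<phi> one]])
    have along: "\<bar>diff1 z \<phi> x\<bar> \<le> C1 * K * norm z powr (\<beta> / lev' h)"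
      if h: "h \<in> {1..nn}" and z: "z \<in> E h" "norm z \<le> 1" for h z x
    proof (cases "h = 1")
      case True
      have "\<bar>diff1 z \<phi> x\<bar> \<le> (real (card (S 1)) + 4 + 2 / (1 - 2 powr (\<beta> / (1 + \<alpha>) - 1))) * K * norm z powr (\<beta> / (1 + \<alpha>))"
        using aniso_le_hzf[OF \<phi> one] z True s k\<theta> unfolding lev1
        by (intro onb_subspace.hzf_hoelder[OF onb_E[OF one], of k \<theta>]) (simp_all add: k_def \<theta>_def)
      then show ?thesis using True by (simp add: C1_def N_def lev'_def)
    next
      case False
      have l: "lev' h = lev h" "1 + \<alpha> \<le> lev h" using lev_ge(2)[OF h] False by (simp_all add: lev'_def)
      define s where "s = \<beta> / lev h"
      have s1: "0 < s" "s < 1" unfolding s_def using \<beta> l alpha by (auto simp: field_simps)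
      have i: "int_order s = 0" "frac_order s = s" using int_order_0[of s] s1 by (simp_all add: frac_order_def)
      have "onb_subspace.hzf (E h) (S h) 0 s K \<phi>" using aniso_le_hzf[OF \<phi> h] i by (simp add: s_def)
      then have "\<bar>diff1 z \<phi> x\<bar> \<le> K * norm z powr s"
        using z s1 unfolding onb_subspace.hzf.simps[OF onb_E[OF h]] diff1_def by auto
      also have "\<dots> \<le> C1 * K * norm z powr s" using mult_right_mono[OF C1 K] by (intro mult_right_mono) auto
      finally show ?thesis by (simp add: l(1) s_def)
    qed
    have tele: "\<bar>\<phi> (x + (\<Sum>h\<in>H. pr h y)) - \<phi> x\<bar> \<le> (\<Sum>h\<in>H. C1 * K * norm (pr h y) powr (\<beta> / lev' h))"
      if "finite H" "H \<subseteq> {1..nn}" "\<And>h. h \<in> H \<Longrightarrow> norm (pr h y) \<le> 1" for H y x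
      using that
    proof (induction H)
      case (insert h H)
      let ?u = "x + (\<Sum>h\<in>H. pr h y)"
      have "\<bar>diff1 (pr h y) \<phi> ?u\<bar> \<le> C1 * K * norm (pr h y) powr (\<beta> / lev' h)"
        using insert.prems by (intro along pr_in_E) auto
      moreover have "\<bar>\<phi> ?u - \<phi> x\<bar> \<le> (\<Sum>h\<in>H. C1 * K * norm (pr h y) powr (\<beta> / lev' h))"
        using insert by simp
      ultimately have "\<bar>\<phi> (?u + pr h y) - \<phi> x\<bar> \<le> C1 * K * norm (pr h y) powr (\<beta> / lev' h) + (\<Sum>h\<in>H. C1 * K * norm (pr h y) powr (\<beta> / lev' h))"
        by (simp add: diff1_def)
      then show ?case using insert.hyps by (simp add: ac_simps)
    qed simp
    have box: "\<bar>\<phi> (x + (\<Sum>h\<in>H. pr h y)) - \<phi> x\<bar> \<le> real nn * C1 * K * \<rho> powr \<beta>"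
      if H: "H \<subseteq> {1..nn}" and \<rho>: "0 < \<rho>" "\<rho> \<le> 1" and y: "\<And>h. h \<in> H \<Longrightarrow> norm (pr h y) \<le> \<rho> powr lev' h" for H y x \<rho>
    proof -
      have fH: "finite H" using H finite_subset by blast
      have l0: "0 < lev' h" if "h \<in> H" for h using lev_ge(2)[of h] H alpha that by auto
      have small: "norm (pr h y) \<le> 1" if "h \<in> H" for h
        using y[OF that] powr_le1[of "lev' h" \<rho>] \<rho> l0[OF that] by simp
      have "(\<Sum>h\<in>H. C1 * K * norm (pr h y) powr (\<beta> / lev' h)) \<le> (\<Sum>h\<in>H. C1 * K * \<rho> powr \<beta>)"
      proof (intro sum_mono mult_left_mono)
        fix h assume h: "h \<in> H"
        have "norm (pr h y) powr (\<beta> / lev' h) \<le> (\<rho> powr lev' h) powr (\<beta> / lev' h)"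
          using y[OF h] \<beta> l0[OF h] by (intro powr_mono2) auto
        also have "\<dots> = \<rho> powr \<beta>" using l0[OF h] by (simp add: powr_powr)
        finally show "norm (pr h y) powr (\<beta> / lev' h) \<le> \<rho> powr \<beta>" .
      qed (use C1 K in simp)
      also have "\<dots> = real (card H) * (C1 * K * \<rho> powr \<beta>)" by simp
      also have "\<dots> \<le> real nn * (C1 * K * \<rho> powr \<beta>)"
        using card_mono[OF _ H] C1 K by (intro mult_right_mono) auto
      finally show ?thesis using tele[OF fH H small, of x] by (simp add: mult.assoc)
    qed
    \<comment> \<open>The norm only provides continuity along each \<open>E h\<close> separately.
      Joint continuity follows from the Hoelder bounds along the components, which hold at every
      base point.\<close>
    have bc: "bcont \<phi>"
    proof -
      have "isCont \<phi> x" for x unfolding isCont_iff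
      proof (rule LIM_zero_cancel, rule Lim_null_comparison)
        show "\<forall>\<^sub>F y in at 0. norm (\<phi> (x + y) - \<phi> x) \<le> (\<Sum>h\<in>{1..nn}. C1 * K * norm y powr (\<beta> / lev' h))"
          unfolding eventually_at
        proof (intro exI[of _ 1] conjI ballI impI)
          fix y :: "real^'n" assume y: "y \<noteq> 0 \<and> dist y 0 < 1"
          have "\<bar>\<phi> (x + (\<Sum>h\<in>{1..nn}. pr h y)) - \<phi> x\<bar> \<le> (\<Sum>h\<in>{1..nn}. C1 * K * norm (pr h y) powr (\<beta> / lev' h))"
          proof (rule tele)
            fix h assume "h \<in> {1..nn}"
            then show "norm (pr h y) \<le> 1" using norm_pr_le[of h y] y by simp
          qed auto
          also have "\<dots> \<le> (\<Sum>h\<in>{1..nn}. C1 * K * norm y powr (\<beta> / lev' h))"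
          proof (intro sum_mono mult_left_mono powr_mono2)
            fix h assume h: "h \<in> {1..nn}"
            then show "norm (pr h y) \<le> norm y" by (rule norm_pr_le)
            show "0 \<le> \<beta> / lev' h" using \<beta> lev_ge(2)[OF h] alpha by simp
          qed (use C1 K in auto)
          finally show "norm (\<phi> (x + y) - \<phi> x) \<le> (\<Sum>h\<in>{1..nn}. C1 * K * norm y powr (\<beta> / lev' h))"
            by (simp only: sum_pr real_norm_def)
        qed simp
        have "((\<lambda>y::real^'n. \<Sum>h\<in>{1..nn}. C1 * K * norm y powr (\<beta> / lev' h)) \<longlongrightarrow> (\<Sum>h\<in>{1..nn}. C1 * K * norm (0::real^'n) powr (\<beta> / lev' h))) (at 0)"
        proof (intro tendsto_sum tendsto_mult tendsto_const tendsto_powr' tendsto_norm tendsto_ident_at)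
          fix h assume h: "h \<in> {1..nn}"
          have "0 < \<beta> / lev' h" using \<beta> lev_ge(2)[OF h] alpha by simp
          then show "norm (0::real^'n) \<noteq> 0 \<or> 0 < \<beta> / lev' h \<and> (\<forall>\<^sub>F y in at (0::real^'n). 0 \<le> norm y)" by simp
        qed
        then show "((\<lambda>y::real^'n. \<Sum>h\<in>{1..nn}. C1 * K * norm y powr (\<beta> / lev' h)) \<longlongrightarrow> 0) (at 0)" by simp
      qed
      then have "continuous_on UNIV \<phi>" by (simp add: continuous_at_imp_continuous_on)
      then show ?thesis unfolding bcont_def using bd by blast
    qed
    have KC: "K \<le> C * K" using mult_right_mono[OF C(1) K] by simp
    have bdC: "\<bar>\<phi> x\<bar> \<le> C * K" for x using bd[of x] KC by simp
    show "ahoelder lev m \<beta> (C * K) \<phi> \<and> ahoelder lev' 1 \<beta> (C * K) \<phi>"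
      unfolding ahoelder_def
    proof (intro conjI allI impI bc bdC)
      fix \<rho> :: real and ys and x assume \<rho>: "0 < \<rho>" "\<rho> \<le> 1" and ys: "length ys = 1" "set ys \<subseteq> abox lev' \<rho>"
      obtain y where y: "ys = [y]" using ys(1) by (auto simp: length_Suc_conv)
      have "\<bar>\<phi> (x + (\<Sum>h\<in>{1..nn}. pr h y)) - \<phi> x\<bar> \<le> real nn * C1 * K * \<rho> powr \<beta>"
        using ys(2) \<rho> by (intro box) (auto simp: y abox_def)
      also have "\<dots> \<le> C * K * \<rho> powr \<beta>" using C(2) K by (intro mult_right_mono) auto
      finally show "\<bar>diffs ys \<phi> x\<bar> \<le> C * K * \<rho> powr \<beta>" by (simp only: y diff1_def diffs.simps sum_pr)
    next
      fix \<rho> :: real and ys and x assume \<rho>: "0 < \<rho>" "\<rho> \<le> 1" and ys: "length ys = m" "set ys \<subseteq> abox lev \<rho>"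
      \<comment> \<open>The least number of differences that sees the order
        \<open>k + \<theta>\<close>; as \<beta> is strictly below \<open>m\<close>, it is at most
        \<open>m\<close>, also in the Zygmund case.\<close>
      define p where "p = (if \<theta> = 1 then k + 2 else k + 1)"
      have pm: "p \<le> m" using k\<theta> \<beta>(3) by (auto simp: p_def)
      have base: "\<bar>diffs zs \<phi> x\<bar> \<le> 4 * (N * \<rho>) ^ k * K * \<rho> powr \<theta>"
        if "length zs = p" "set zs \<subseteq> E 1 \<inter> cball 0 \<rho>" for zs x
        using aniso_le_hzf[OF \<phi> one] that k\<theta> \<rho> unfolding lev1 N_def
        by (intro onb_subspace.hzf_diffs[OF onb_E[OF one]]) (simp_all add: k_def \<theta>_def p_def)
      have "\<bar>diffs (map (pr 1) ys) \<phi> x\<bar> \<le> 2 ^ (m - p) * (4 * (N * \<rho>) ^ k * K * \<rho> powr \<theta>)" for x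
      proof (rule diffs_longer[where p = p and U = "E 1 \<inter> cball 0 \<rho>"])
        show "set (map (pr 1) ys) \<subseteq> E 1 \<inter> cball 0 \<rho>"
        proof
          fix z assume "z \<in> set (map (pr 1) ys)"
          then obtain y where y: "y \<in> set ys" "z = pr 1 y" by auto
          then have "norm z \<le> \<rho> powr lev 1" using ys(2) one unfolding abox_def by blast
          then show "z \<in> E 1 \<inter> cball 0 \<rho>" using pr_in_E[OF one] y(2) \<rho> by (simp add: lev1 del: One_nat_def)
        qed
      qed (use base pm ys in auto)
      moreover have "2 ^ (m - p) * (4 * (N * \<rho>) ^ k * K * \<rho> powr \<theta>) \<le> 4 * N ^ k * 2 ^ m * K * \<rho> powr \<beta>"
      proof -
        have "\<rho> ^ k * \<rho> powr \<theta> = \<rho> powr \<beta>" using \<rho> by (simp add: k\<theta>(1)[symmetric] powr_add powr_realpow)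
        then have "2 ^ (m - p) * (4 * (N * \<rho>) ^ k * K * \<rho> powr \<theta>) = 2 ^ (m - p) * (4 * N ^ k * K * \<rho> powr \<beta>)"
          by (simp add: power_mult_distrib)
        also have "\<dots> \<le> 2 ^ m * (4 * N ^ k * K * \<rho> powr \<beta>)"
          using K by (intro mult_right_mono power_increasing) (auto simp: N_def)
        finally show ?thesis by (simp add: mult_ac)
      qed
      ultimately have W: "\<bar>diffs (map (pr 1) ys) \<phi> x\<bar> \<le> 4 * N ^ k * 2 ^ m * K * \<rho> powr \<beta>" for x
        using order_trans by blast
      \<comment> \<open>Only components with \<open>h \<ge> 2\<close> are left here, and on these
        \<open>lev'\<close> agrees with \<open>lev\<close>.\<close>
      have W': "\<bar>diff1 (y - pr 1 y) \<phi> x\<bar> \<le> real nn * C1 * K * \<rho> powr \<beta>" if y: "y \<in> set ys" for x y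
      proof -
        have "{1..nn} = insert 1 {2..nn}" using nn_pos by auto
        then have "(\<Sum>h\<in>{1..nn}. pr h y) = pr 1 y + (\<Sum>h\<in>{2..nn}. pr h y)" by simp
        then have "y - pr 1 y = (\<Sum>h\<in>{2..nn}. pr h y)" unfolding sum_pr by (metis add_diff_cancel_left')
        moreover have "\<bar>\<phi> (x + (\<Sum>h\<in>{2..nn}. pr h y)) - \<phi> x\<bar> \<le> real nn * C1 * K * \<rho> powr \<beta>"
          using ys(2) y \<rho> by (intro box) (auto simp: abox_def lev'_def)
        ultimately show ?thesis by (simp add: diff1_def)
      qed
      have "\<bar>diffs ys \<phi> x\<bar> \<le> 4 * N ^ k * 2 ^ m * K * \<rho> powr \<beta> + real (length ys) * 2 ^ length ys * (real nn * C1 * K * \<rho> powr \<beta>)"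
        using C1 K by (intro diffs_split[where p = "pr 1"] W W') auto
      also have "\<dots> = (4 * N ^ k * 2 ^ m + real m * 2 ^ m * (real nn * C1)) * (K * \<rho> powr \<beta>)"
        by (simp add: ys(1) algebra_simps)
      also have "\<dots> \<le> C * (K * \<rho> powr \<beta>)" using C(3) K by (intro mult_right_mono) auto
      finally show "\<bar>diffs ys \<phi> x\<bar> \<le> C * K * \<rho> powr \<beta>" by (simp add: mult.assoc)
    qed
  qed
qed

section \<open>Regularity of the image under the semigroup\<close>

lemma bcont_PP:
  fixes f :: "real^'n \<Rightarrow> real"
  assumes t: "0 \<le> t" and f: "bcont f"
  shows "bcont (PP t f)"
proof -
  obtain K where K: "continuous_on UNIV f" "\<And>x. \<bar>f x\<bar> \<le> K" using bcontE[OF f] by metis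
  have "continuous_on UNIV (PP t f)"
  proof (rule continuous_on_sequentiallyI)
    fix X :: "nat \<Rightarrow> real^'n" and a assume X: "X \<longlonglongrightarrow> a"
    have l: "(\<lambda>n. mexp A t (X n)) \<longlonglongrightarrow> mexp A t a"
      using linear_mexp[of A t] by (intro bounded_linear.tendsto[OF _ X]) (simp add: linear_conv_bounded_linear)
    show "(\<lambda>n. PP t f (X n)) \<longlonglongrightarrow> PP t f a" unfolding PP_def
    proof (rule integral_dominated_convergence[where w = "\<lambda>_. K"])
      show "AE \<omega> in M. (\<lambda>n. f (mexp A t (X n) + Y t \<omega>)) \<longlonglongrightarrow> f (mexp A t a + Y t \<omega>)"
        by (intro AE_I2 continuous_on_tendsto_compose[OF K(1)] tendsto_add l tendsto_const) auto
    qed (use K measurable_PP[OF t K(1)] in auto)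
  qed
  then show ?thesis unfolding bcont_def using PP_bound[OF t f K(2)] by blast
qed

text \<open>\<open>m\<close> is the least integer exceeding \<gamma>. Along \<open>E 1\<close> all
  \<open>m\<close> differences and the weights \<open>lev\<close> are used; along the other
  subspaces the target order is below 1 and a single difference with the weights \<open>lev'\<close>
  suffices.\<close>

lemma PP_hzf:
  assumes \<beta>: "0 \<le> \<beta>" "\<beta> \<le> \<gamma>" and \<gamma>: "0 < \<gamma>" "\<gamma> < 1 + \<alpha>"
  defines "m \<equiv> (if \<gamma> < 1 then 1 else if \<gamma> < 2 then 2 else 3)"
  obtains C where "0 \<le> C" "\<And>t \<phi> K h. 0 < t \<Longrightarrow> ahoelder lev m \<beta> K \<phi> \<Longrightarrow> ahoelder lev' 1 \<beta> K \<phi> \<Longrightarrow> h \<in> {1..nn} \<Longrightarrow>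
    onb_subspace.hzf (E h) (S h) (int_order (\<gamma> / lev h)) (frac_order (\<gamma> / lev h)) (C * (1 + t powr ((\<beta> - \<gamma>) / \<alpha>)) * K) (PP t \<phi>)"
proof -
  have one: "1 \<in> {1..nn}" using nn_pos by simp
  interpret E1: onb_subspace "E 1" "S 1" by (rule onb_E[OF one])
  have lev1: "lev 1 = 1" by (simp add: lev_def)
  have m: "1 \<le> m" "m \<le> 3" by (simp_all add: m_def)
  have \<gamma>3: "\<gamma> < 3" using \<gamma> alpha by simp
  have \<gamma>m: "\<gamma> \<le> real m * 1" using \<gamma>3 by (simp add: m_def)
  have levd: "1 \<le> lev h \<and> lev h \<le> 1 + \<alpha> * real (h - 1)" if "h \<in> {1..nn}" for h
    using lev_ge(1)[OF that] that by (simp add: lev_def of_nat_diff)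
  \<comment> \<open>The compatibility of the weights with e^(tA) needed for
    \<open>h0 \<ge> 2\<close>. For \<open>h0 = 1\<close> it fails, as
    \<open>lev' 1 = 1 + \<alpha>\<close> exceeds \<open>lev 1\<close>; that is why
    \<open>E 1\<close> uses \<open>lev\<close>.\<close>
  have levd': "1 \<le> lev' h \<and> lev' h \<le> lev h0 + \<alpha> * real (h - h0)" if "h \<in> {1..nn}" "h0 \<in> {2..nn}" for h h0
  proof
    show "1 \<le> lev' h" using lev_ge(2)[OF that(1)] alpha by simp
    have "\<alpha> * 1 \<le> \<alpha> * (real h0 - 1)" using alpha that by (intro mult_left_mono) auto
    then have 1: "1 + \<alpha> \<le> lev h0" by (simp add: lev_def)
    have "real h - 1 \<le> real h0 - 1 + real (h - h0)" by simp
    then have "\<alpha> * (real h - 1) \<le> \<alpha> * (real h0 - 1 + real (h - h0))" using alpha by (intro mult_left_mono) auto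
    then have "lev h \<le> lev h0 + \<alpha> * real (h - h0)" by (simp add: lev_def algebra_simps)
    moreover have "0 \<le> \<alpha> * real (h - h0)" using alpha by simp
    ultimately show "lev' h \<le> lev h0 + \<alpha> * real (h - h0)" using 1 by (auto simp: lev'_def)
  qed
  obtain Ca where Ca: "0 \<le> Ca" "\<And>t \<phi> K \<rho> zs x. 0 < t \<Longrightarrow> ahoelder lev m \<beta> K \<phi> \<Longrightarrow> 0 < \<rho> \<Longrightarrow> length zs = m \<Longrightarrow>
    (\<And>z. z \<in> set zs \<Longrightarrow> z \<in> E 1 \<and> norm z \<le> \<rho> powr 1) \<Longrightarrow>
    \<bar>diffs zs (PP t \<phi>) x\<bar> \<le> Ca * (1 + t powr ((\<beta> - \<gamma>) / \<alpha>)) * K * \<rho> powr \<gamma>"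
    by (rule diffs_PP_bound[OF one m _ levd \<beta> \<gamma>m]) auto
  \<comment> \<open>An auxiliary bound of order 2 from the supremum alone. Its power of
    \<open>t\<close> is worse, but it only enters through \<open>K'\<close> in
    \<open>dbd3_hzf\<close>, whose conclusion does not contain \<open>K'\<close>.\<close>
  obtain Cb where Cb: "0 \<le> Cb" "\<And>t \<phi> K \<rho> zs x. 0 < t \<Longrightarrow> ahoelder lev 2 0 K \<phi> \<Longrightarrow> 0 < \<rho> \<Longrightarrow> length zs = 2 \<Longrightarrow>
    (\<And>z. z \<in> set zs \<Longrightarrow> z \<in> E 1 \<and> norm z \<le> \<rho> powr 1) \<Longrightarrow>
    \<bar>diffs zs (PP t \<phi>) x\<bar> \<le> Cb * (1 + t powr ((0 - 2) / \<alpha>)) * K * \<rho> powr 2"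
    by (rule diffs_PP_bound[where m = 2 and \<beta> = 0 and \<gamma> = 2, OF one _ _ _ levd]) auto
  have "\<exists>C. 0 \<le> C \<and> (\<forall>t \<phi> K \<rho> zs x. 0 < t \<longrightarrow> ahoelder lev' 1 \<beta> K \<phi> \<longrightarrow> 0 < \<rho> \<longrightarrow> length zs = 1 \<longrightarrow>
    (\<forall>z\<in>set zs. z \<in> E h \<and> norm z \<le> \<rho> powr lev h) \<longrightarrow>
    \<bar>diffs zs (PP t \<phi>) x\<bar> \<le> C * (1 + t powr ((\<beta> - \<gamma>) / \<alpha>)) * K * \<rho> powr \<gamma>)" if h: "h \<in> {2..nn}" for h
  proof -
    have h1: "h \<in> {1..nn}" using h by auto
    have le: "\<gamma> \<le> real 1 * lev h" using \<gamma> lev_ge(2)[OF h1] h by (simp add: lev'_def)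
    show ?thesis
      by (rule diffs_PP_bound[where m = 1 and \<beta> = \<beta> and \<gamma> = \<gamma>, OF h1 _ _ lev_def levd'[OF _ h] \<beta> le]) auto
  qed
  then obtain Cc where Cc: "\<And>h. h \<in> {2..nn} \<Longrightarrow> 0 \<le> Cc h" "\<And>h t \<phi> K \<rho> zs x. h \<in> {2..nn} \<Longrightarrow> 0 < t \<Longrightarrow> ahoelder lev' 1 \<beta> K \<phi> \<Longrightarrow> 0 < \<rho> \<Longrightarrow> length zs = 1 \<Longrightarrow>
    (\<forall>z\<in>set zs. z \<in> E h \<and> norm z \<le> \<rho> powr lev h) \<Longrightarrow>
    \<bar>diffs zs (PP t \<phi>) x\<bar> \<le> Cc h * (1 + t powr ((\<beta> - \<gamma>) / \<alpha>)) * K * \<rho> powr \<gamma>" by metis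
  define C1 where "C1 = 1 + Ca"
  \<comment> \<open>Dominates the coefficients of all four ranges of \<gamma> treated below; the
    absolute values spare a discussion of the sign of \<open>dconst\<close> outside its
    range.\<close>
  define D where "D = 1 + \<bar>2 + 2 * E1.dconst \<gamma>\<bar> + \<bar>(2 + 2 * E1.dconst (\<gamma> - 1)) * (5 + 8 * E1.dconst \<gamma>)\<bar>"
  define C where "C = D * C1 + (\<Sum>h\<in>{2..nn}. 1 + Cc h)"
  have D0: "0 \<le> D" "0 \<le> C1" unfolding D_def C1_def using Ca(1) by auto
  have S0: "0 \<le> (\<Sum>h\<in>{2..nn}. 1 + Cc h)" using Cc(1) by (intro sum_nonneg) (auto intro: add_nonneg_nonneg)
  show thesis
  proof (rule that)
    show "0 \<le> C" unfolding C_def using D0 S0 by simp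
    fix t K :: real and \<phi> h
    assume t: "0 < t" and \<phi>: "ahoelder lev m \<beta> K \<phi>" "ahoelder lev' 1 \<beta> K \<phi>" and h: "h \<in> {1..nn}"
    define G where "G = 1 + t powr ((\<beta> - \<gamma>) / \<alpha>)"
    have G: "1 \<le> G" by (simp add: G_def)
    define f where "f = PP t \<phi>"
    have b: "bcont \<phi>" and \<phi>K: "\<And>x. \<bar>\<phi> x\<bar> \<le> K" using \<phi>(1) unfolding ahoelder_def by blast+
    have K: "0 \<le> K" using \<phi>K order_trans[OF abs_ge_zero] by blast
    have bf: "bcont f" and fK: "\<And>x. \<bar>f x\<bar> \<le> K"
      unfolding f_def using t by (auto intro: bcont_PP PP_bound b \<phi>K)
    have GK: "K \<le> G * K" using mult_right_mono[OF G K] by simp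
    show "onb_subspace.hzf (E h) (S h) (int_order (\<gamma> / lev h)) (frac_order (\<gamma> / lev h)) (C * (1 + t powr ((\<beta> - \<gamma>) / \<alpha>)) * K) (PP t \<phi>)"
      unfolding f_def[symmetric] G_def[symmetric]
    proof (cases "h = 1")
      case True
      have coeff: "c * (C1 * (G * K)) \<le> C * G * K" if "c \<le> D" for c
      proof -
        have "c * C1 \<le> C" unfolding C_def using that D0 S0 mult_right_mono[of c D C1] by simp
        then have "c * C1 * (G * K) \<le> C * (G * K)" using G K by (intro mult_right_mono) auto
        then show ?thesis by (simp add: mult.assoc)
      qed
      have GK0: "0 \<le> G * K" using G K by simp
      have d: "E1.dbd m \<gamma> (C1 * (G * K)) f" unfolding E1.dbd_def
      proof (intro conjI allI impI bf)
        have "1 * (G * K) \<le> C1 * (G * K)" unfolding C1_def using Ca(1) GK0 by (intro mult_right_mono) auto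
        then show "\<bar>f x\<bar> \<le> C1 * (G * K)" for x using fK[of x] GK by simp
        fix \<rho> zs x assume \<rho>: "0 < (\<rho>::real)" and zs: "length zs = m" "set zs \<subseteq> E 1 \<inter> cball 0 \<rho>"
        have "\<bar>diffs zs f x\<bar> \<le> Ca * G * K * \<rho> powr \<gamma>"
          unfolding f_def G_def by (rule Ca(2)[OF t \<phi>(1) \<rho> zs(1)]) (use zs(2) \<rho> in auto)
        also have "\<dots> = Ca * (G * K * \<rho> powr \<gamma>)" by simp
        also have "\<dots> \<le> C1 * (G * K * \<rho> powr \<gamma>)" unfolding C1_def using GK0 by (intro mult_right_mono) auto
        finally show "\<bar>diffs zs f x\<bar> \<le> C1 * (G * K) * \<rho> powr \<gamma>" by (simp add: mult.assoc)
      qed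
      consider "\<gamma> < 1" | "\<gamma> = 1" | "1 < \<gamma>" "\<gamma> < 2" | "2 \<le> \<gamma>" by linarith
      then have "E1.hzf (int_order \<gamma>) (frac_order \<gamma>) (C * G * K) f"
      proof cases
        case 1
        then have i: "int_order \<gamma> = 0" "frac_order \<gamma> = \<gamma>" using int_order_0[of \<gamma>] \<gamma> by (auto simp: frac_order_def)
        have "E1.hzf 0 \<gamma> (1 * (C1 * (G * K))) f" using E1.dbd1_hzf[of \<gamma> _ f] d 1 \<gamma> by (simp add: m_def)
        then show ?thesis unfolding i by (rule E1.hzf_mono) (rule coeff, simp add: D_def)
      next
        case 2
        then have i: "int_order \<gamma> = 0" "frac_order \<gamma> = 1" using int_order_0[of \<gamma>] by (auto simp: frac_order_def)
        have "E1.hzf 0 1 (1 * (C1 * (G * K))) f" using E1.dbd2_hzf_zygmund[of _ f] d 2 by (simp add: m_def)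
        then show ?thesis unfolding i by (rule E1.hzf_mono) (rule coeff, simp add: D_def)
      next
        case 3
        then have i: "int_order \<gamma> = 1" "frac_order \<gamma> = \<gamma> - 1" using int_order_1[of \<gamma>] by (auto simp: frac_order_def)
        have "E1.hzf 1 (\<gamma> - 1) ((2 + 2 * E1.dconst \<gamma>) * (C1 * (G * K))) f" using E1.dbd2_hzf[of \<gamma> _ f] d 3 by (simp add: m_def)
        then show ?thesis unfolding i by (rule E1.hzf_mono) (rule coeff, simp add: D_def)
      next
        case 4
        define K' where "K' = K + Cb * (1 + t powr ((0 - 2) / \<alpha>)) * (2 ^ 2 * K)"
        have K'0: "0 \<le> Cb * (1 + t powr ((0 - 2) / \<alpha>)) * (2 ^ 2 * K)" using Cb(1) K by simp
        have "E1.dbd 2 2 K' f" unfolding E1.dbd_def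
        proof (intro conjI allI impI bf)
          show "\<bar>f x\<bar> \<le> K'" for x using fK[of x] K'0 unfolding K'_def by linarith
          fix \<rho> zs x assume \<rho>: "0 < (\<rho>::real)" and zs: "length zs = 2" "set zs \<subseteq> E 1 \<inter> cball 0 \<rho>"
          have "\<bar>diffs zs f x\<bar> \<le> Cb * (1 + t powr ((0 - 2) / \<alpha>)) * (2 ^ 2 * K) * \<rho> powr 2"
            unfolding f_def by (rule Cb(2)[OF t ahoelder_const[OF b \<phi>K] \<rho> zs(1)]) (use zs(2) \<rho> in auto)
          also have "\<dots> \<le> K' * \<rho> powr 2" using K by (intro mult_right_mono) (auto simp: K'_def)
          finally show "\<bar>diffs zs f x\<bar> \<le> K' * \<rho> powr 2" .
        qed
        then have "E1.hzf (int_order \<gamma>) (frac_order \<gamma>) ((2 + 2 * E1.dconst (\<gamma> - 1)) * ((5 + 8 * E1.dconst \<gamma>) * (C1 * (G * K)))) f"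
          using d 4 \<gamma>3 by (intro E1.dbd3_hzf) (simp_all add: m_def)
        then show ?thesis unfolding mult.assoc[symmetric, of "2 + 2 * E1.dconst (\<gamma> - 1)"]
          by (rule E1.hzf_mono) (rule coeff, simp add: D_def)
      qed
      then show "onb_subspace.hzf (E h) (S h) (int_order (\<gamma> / lev h)) (frac_order (\<gamma> / lev h)) (C * G * K) f"
        using True lev1 by simp
    next
      case False
      then have h2: "h \<in> {2..nn}" using h by auto
      interpret Eh: onb_subspace "E h" "S h" by (rule onb_E[OF h])
      define s where "s = \<gamma> / lev h"
      have l: "0 < lev h" "\<gamma> < lev h" using lev_ge[OF h] \<gamma> alpha False by (auto simp: lev'_def)
      have s: "0 < s" "s < 1" unfolding s_def using \<gamma> l by (auto simp: field_simps)
      have i: "int_order s = 0" "frac_order s = s" using int_order_0[of s] s by (auto simp: frac_order_def)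
      have GK0: "0 \<le> G * K" using G K by simp
      have "Eh.dbd 1 s ((1 + Cc h) * (G * K)) f" unfolding Eh.dbd_def
      proof (intro conjI allI impI bf)
        have "1 * (G * K) \<le> (1 + Cc h) * (G * K)" using Cc(1)[OF h2] GK0 by (intro mult_right_mono) auto
        then show "\<bar>f x\<bar> \<le> (1 + Cc h) * (G * K)" for x using fK[of x] GK by simp
        fix \<rho> zs x assume \<rho>: "0 < (\<rho>::real)" and zs: "length zs = 1" "set zs \<subseteq> E h \<inter> cball 0 \<rho>"
        \<comment> \<open>Converts a Euclidean radius in \<open>E h\<close> into the homogeneous
          radius, so that \<gamma> becomes \<open>\<gamma> / lev h\<close>.\<close>
        let ?\<rho> = "\<rho> powr (1 / lev h)"
        have e: "?\<rho> powr lev h = \<rho>" "?\<rho> powr \<gamma> = \<rho> powr s" using \<rho> l by (simp_all add: powr_powr s_def)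
        have "\<bar>diffs zs f x\<bar> \<le> Cc h * G * K * ?\<rho> powr \<gamma>"
          unfolding f_def G_def by (rule Cc(2)[OF h2 t \<phi>(2) _ zs(1)]) (use zs(2) \<rho> e in auto)
        also have "\<dots> = Cc h * (G * K * \<rho> powr s)" unfolding e by simp
        also have "\<dots> \<le> (1 + Cc h) * (G * K * \<rho> powr s)" using GK0 by (intro mult_right_mono) auto
        finally show "\<bar>diffs zs f x\<bar> \<le> (1 + Cc h) * (G * K) * \<rho> powr s" by (simp add: mult.assoc)
      qed
      then have "Eh.hzf 0 s ((1 + Cc h) * (G * K)) f" by (rule Eh.dbd1_hzf[OF _ s])
      moreover have "(1 + Cc h) * (G * K) \<le> C * G * K"
      proof -
        have "1 + Cc h \<le> (\<Sum>h\<in>{2..nn}. 1 + Cc h)"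
          using Cc(1) by (intro member_le_sum[OF h2]) (auto intro: add_nonneg_nonneg)
        then have "1 + Cc h \<le> C" unfolding C_def using D0 by (simp add: add_increasing)
        then show ?thesis using GK0 by (simp add: mult.assoc mult_right_mono)
      qed
      ultimately show "Eh.hzf (int_order (\<gamma> / lev h)) (frac_order (\<gamma> / lev h)) (C * G * K) f"
        unfolding s_def[symmetric] i by (rule Eh.hzf_mono)
    qed
  qed
qed

lemma ou_semigroup_PP: "ou_semigroup M A Y t \<phi> = PP t \<phi>"
  by (simp add: ou_semigroup_def ou_process_def PP_def mexp_def fun_eq_iff)

lemma bcont_Cb: "\<phi> \<in> Cb \<Longrightarrow> bcont \<phi>" for \<phi> :: "real^'n \<Rightarrow> real"
  unfolding Cb_def bcont_def bounded_iff by (auto intro: uniformly_continuous_imp_continuous)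

text \<open>Needed for the target \<gamma> = 0, where the space asks for uniform continuity: the
  linear map e^(tA) is Lipschitz, and the modulus of continuity passes under the
  expectation.\<close>

lemma PP_Cb:
  fixes \<phi> :: "real^'n \<Rightarrow> real"
  assumes t: "0 \<le> t" and \<phi>: "\<phi> \<in> Cb"
  shows "PP t \<phi> \<in> Cb"
proof -
  have b: "bcont \<phi>" by (rule bcont_Cb[OF \<phi>])
  obtain K where K: "\<And>x. \<bar>\<phi> x\<bar> \<le> K" using b unfolding bcont_def by blast
  have "uniformly_continuous_on UNIV (PP t \<phi>)" unfolding uniformly_continuous_on_def
  proof (intro allI impI)
    fix e :: real assume e: "0 < e"
    have "uniformly_continuous_on UNIV \<phi>" using \<phi> by (simp add: Cb_def)
    then obtain d where d: "0 < d" "\<And>x y. dist y x < d \<Longrightarrow> dist (\<phi> y) (\<phi> x) < e / 2"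
      unfolding uniformly_continuous_on_def using e by (metis UNIV_I half_gt_zero)
    obtain B where B: "0 < B" "\<And>x. norm (mexp A t x) \<le> B * norm x"
      using linear_bounded_pos[OF linear_mexp] by blast
    show "\<exists>d>0. \<forall>x\<in>UNIV. \<forall>y\<in>UNIV. dist y x < d \<longrightarrow> dist (PP t \<phi> y) (PP t \<phi> x) < e"
    proof (intro exI[of _ "d / B"] conjI ballI impI)
      show "0 < d / B" using d B by simp
      fix x y :: "real^'n" assume "dist y x < d / B"
      then have "B * norm (y - x) < d" using B(1) by (simp add: dist_norm field_simps)
      then have "norm (mexp A t (y - x)) < d" using B(2)[of "y - x"] by simp
      then have small: "\<bar>diff1 (mexp A t (y - x)) \<phi> u\<bar> \<le> e / 2" for u
        using d(2)[of "u + mexp A t (y - x)" u] by (simp add: dist_norm diff1_def)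
      have "\<bar>diffs [y - x] (PP t \<phi>) x\<bar> \<le> e / 2"
        unfolding diffs_PP[OF t b] by (rule PP_bound[OF t]) (use small b bcont_diff1 in auto)
      then show "dist (PP t \<phi> y) (PP t \<phi> x) < e" using e by (simp add: diff1_def dist_real_def)
    qed
  qed
  moreover have "bounded (range (PP t \<phi>))" unfolding bounded_iff using PP_bound[OF t b K] by auto
  ultimately show ?thesis by (simp add: Cb_def)
qed

section \<open>Source functions of order zero or positive order, and the operator norm\<close>

definition source_le :: "real \<Rightarrow> real \<Rightarrow> (real^'n \<Rightarrow> real) \<Rightarrow> bool" where
  "source_le \<beta> K \<phi> \<longleftrightarrow> (if \<beta> = 0 then \<phi> \<in> Cb \<and> (\<forall>x. \<bar>\<phi> x\<bar> \<le> K) else aniso_le \<beta> K \<phi>)"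

lemma source_le_exists:
  assumes "\<phi> \<in> aniso_space A B \<alpha> S \<beta>"
  obtains K where "0 \<le> K" "source_le \<beta> K \<phi>"
proof (cases "\<beta> = 0")
  case True
  then have "\<phi> \<in> Cb" using assms by (simp add: aniso_space_def)
  with bcontE[OF bcont_Cb] show thesis using that True by (metis source_le_def)
next
  case False
  then have sp: "\<And>h x0. h \<in> {1..nn} \<Longrightarrow> (\<lambda>z. \<phi> (x0 + z)) \<in> hz_space (E h) (S h) (aniso_order \<alpha> \<beta> h)"
    and "\<forall>h\<in>{1..nn}. \<exists>K. \<forall>x0. hz_norm (E h) (S h) (aniso_order \<alpha> \<beta> h) (\<lambda>z. \<phi> (x0 + z)) \<le> ennreal K"
    using assms by (auto simp: aniso_space_def)
  then obtain Kf where Kf: "\<And>h x0. h \<in> {1..nn} \<Longrightarrow> hz_norm (E h) (S h) (aniso_order \<alpha> \<beta> h) (\<lambda>z. \<phi> (x0 + z)) \<le> ennreal (Kf h)"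
    by metis
  define K where "K = (\<Sum>h\<in>{1..nn}. \<bar>Kf h\<bar>)"
  have "Kf h \<le> K" if "h \<in> {1..nn}" for h
    unfolding K_def using member_le_sum[OF that, of "\<lambda>h. \<bar>Kf h\<bar>"] by simp
  then have "aniso_le \<beta> K \<phi>" unfolding aniso_le_def
    using sp Kf by (auto simp: K_def sum_nonneg intro!: order_trans[OF Kf] ennreal_leI)
  then show thesis using that[of K] False by (simp add: source_le_def aniso_le_def)
qed

lemma source_le_norm:
  assumes \<phi>: "\<phi> \<in> aniso_space A B \<alpha> S \<beta>" and le: "aniso_norm A B \<alpha> S \<beta> \<phi> \<le> 1"
  shows "source_le \<beta> 1 \<phi>"
proof (cases "\<beta> = 0")
  case True
  have "ennreal \<bar>\<phi> x\<bar> \<le> 1" for x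
    using le True SUP_upper[of x UNIV "\<lambda>x. ennreal \<bar>\<phi> x\<bar>"] order_trans unfolding aniso_norm_def sup_norm_on_def by fastforce
  then have "\<bar>\<phi> x\<bar> \<le> 1" for x by (metis ennreal_le_1)
  then show ?thesis using \<phi> True by (simp add: source_le_def aniso_space_def)
next
  case False
  have "hz_norm (E h) (S h) (aniso_order \<alpha> \<beta> h) (\<lambda>z. \<phi> (x0 + z)) \<le> ennreal 1" if h: "h \<in> {1..nn}" for h x0
  proof -
    have "hz_norm (E h) (S h) (aniso_order \<alpha> \<beta> h) (\<lambda>z. \<phi> (x0 + z)) \<le> (SUP x0. hz_norm (E h) (S h) (aniso_order \<alpha> \<beta> h) (\<lambda>z. \<phi> (x0 + z)))"
      by (rule SUP_upper) simp
    also have "\<dots> \<le> aniso_norm A B \<alpha> S \<beta> \<phi>" unfolding aniso_norm_def if_not_P[OF False]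
      by (rule member_le_sum[OF h]) simp_all
    finally show ?thesis using le by simp
  qed
  then show ?thesis using \<phi> False by (auto simp: source_le_def aniso_le_def aniso_space_def)
qed

lemma source_le_ahoelder:
  assumes \<beta>: "0 \<le> \<beta>" "\<beta> < 1 + \<alpha>" "\<beta> < real m"
  obtains C where "0 \<le> C" "\<And>\<phi> K. 0 \<le> K \<Longrightarrow> source_le \<beta> K \<phi> \<Longrightarrow> ahoelder lev m \<beta> (C * K) \<phi> \<and> ahoelder lev' 1 \<beta> (C * K) \<phi>"
proof (cases "\<beta> = 0")
  case True
  show thesis
  proof (rule that[of "2 ^ m"])
    fix \<phi> K assume K: "0 \<le> K" and "source_le \<beta> K \<phi>"
    then have b: "bcont \<phi>" "\<And>x. \<bar>\<phi> x\<bar> \<le> K" using True by (auto simp: source_le_def intro: bcont_Cb)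
    have m: "1 \<le> m" using \<beta> by (cases m) auto
    \<comment> \<open>Inflating \<open>K\<close> lets the single difference for \<open>lev'\<close>
      produce the same constant \<open>2 ^ m * K\<close> as the \<open>m\<close> differences for
      \<open>lev\<close>.\<close>
    have "K \<le> 2 ^ (m - 1) * K" using mult_right_mono[OF _ K, of 1 "2 ^ (m - 1)"] by simp
    then have b2: "\<And>x. \<bar>\<phi> x\<bar> \<le> 2 ^ (m - 1) * K" using b(2) order_trans by blast
    have e: "(2::real) ^ 1 * (2 ^ (m - 1) * K) = 2 ^ m * K" using m by (cases m) auto
    show "ahoelder lev m \<beta> (2 ^ m * K) \<phi> \<and> ahoelder lev' 1 \<beta> (2 ^ m * K) \<phi>"
      unfolding True using ahoelder_const[OF b] ahoelder_const[OF b(1) b2, of lev' 1] unfolding e by blast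
  qed simp
next
  case False
  then obtain C where "1 \<le> C" "\<And>\<phi> K. aniso_le \<beta> K \<phi> \<Longrightarrow> ahoelder lev m \<beta> (C * K) \<phi> \<and> ahoelder lev' 1 \<beta> (C * K) \<phi>"
    using aniso_ahoelder[of \<beta> m] \<beta> by (metis less_eq_real_def)
  then show thesis using that[of C] False by (simp add: source_le_def)
qed

lemma PP_aniso:
  assumes \<beta>: "0 \<le> \<beta>" "\<beta> \<le> \<gamma>" and \<gamma>: "0 < \<gamma>" "\<gamma> < 1 + \<alpha>"
  obtains C where "0 \<le> C" "\<And>t \<phi> K. 0 < t \<Longrightarrow> 0 \<le> K \<Longrightarrow> source_le \<beta> K \<phi> \<Longrightarrow> aniso_le \<gamma> (C * (1 + t powr ((\<beta> - \<gamma>) / \<alpha>)) * K) (PP t \<phi>)"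
proof -
  define m :: nat where "m = (if \<gamma> < 1 then 1 else if \<gamma> < 2 then 2 else 3)"
  have "\<beta> < real m" using \<beta> \<gamma> alpha by (auto simp: m_def)
  moreover have "\<beta> < 1 + \<alpha>" using \<beta> \<gamma> by simp
  ultimately obtain C1 where C1: "0 \<le> C1" "\<And>\<phi> K. 0 \<le> K \<Longrightarrow> source_le \<beta> K \<phi> \<Longrightarrow> ahoelder lev m \<beta> (C1 * K) \<phi> \<and> ahoelder lev' 1 \<beta> (C1 * K) \<phi>"
    using source_le_ahoelder[OF \<beta>(1)] by metis
  obtain C2 where C2: "0 \<le> C2" "\<And>t \<phi> K h. 0 < t \<Longrightarrow> ahoelder lev m \<beta> K \<phi> \<Longrightarrow> ahoelder lev' 1 \<beta> K \<phi> \<Longrightarrow> h \<in> {1..nn} \<Longrightarrow>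
    onb_subspace.hzf (E h) (S h) (int_order (\<gamma> / lev h)) (frac_order (\<gamma> / lev h)) (C2 * (1 + t powr ((\<beta> - \<gamma>) / \<alpha>)) * K) (PP t \<phi>)"
    using PP_hzf[OF \<beta> \<gamma>] unfolding m_def[symmetric] by blast
  show thesis
  \<comment> \<open>The orders are below 3, so the integer order \<open>k\<close> satisfies
    \<open>k + 2 \<le> 5\<close>.\<close>
  proof (rule that[of "5 * C2 * C1"])
    show "0 \<le> 5 * C2 * C1" using C1 C2 by simp
    fix t K :: real and \<phi> assume t: "0 < t" and K: "0 \<le> K" and \<phi>: "source_le \<beta> K \<phi>"
    let ?G = "1 + t powr ((\<beta> - \<gamma>) / \<alpha>)"
    let ?K = "C2 * ?G * (C1 * K)"
    have K0: "0 \<le> ?K" using C1 C2 K by (simp add: add_nonneg_nonneg)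
    have hzf: "onb_subspace.hzf (E h) (S h) (int_order (\<gamma> / lev h)) (frac_order (\<gamma> / lev h)) ?K (PP t \<phi>)" if "h \<in> {1..nn}" for h
      using C1(2)[OF K \<phi>] by (intro C2(2) t that) auto
    show "aniso_le \<gamma> (5 * C2 * C1 * ?G * K) (PP t \<phi>)" unfolding aniso_le_def aniso_order_lev
    proof (intro conjI ballI allI)
      show "0 \<le> 5 * C2 * C1 * ?G * K" using C1 C2 K by (simp add: add_nonneg_nonneg)
      fix h x0 assume h: "h \<in> {1..nn}"
      note sp = onb_subspace.hzf_hz_space[OF onb_E[OF h] hzf[OF h], of x0]
      show "(\<lambda>z. PP t \<phi> (x0 + z)) \<in> hz_space (E h) (S h) (\<gamma> / lev h)" by (rule sp(1))
      have l: "1 \<le> lev h" by (rule lev_ge(1)[OF h])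
      have "0 < \<gamma> / lev h" "\<gamma> / lev h \<le> \<gamma>" using \<gamma> l by (auto simp: field_simps)
      then have "real (int_order (\<gamma> / lev h)) < 3" using int_frac_order[of "\<gamma> / lev h"] \<gamma> alpha by linarith
      then have "(real (int_order (\<gamma> / lev h)) + 2) * ?K \<le> 5 * ?K" using K0 by (intro mult_right_mono) auto
      then show "hz_norm (E h) (S h) (\<gamma> / lev h) (\<lambda>z. PP t \<phi> (x0 + z)) \<le> ennreal (5 * C2 * C1 * ?G * K)"
        using order_trans[OF sp(2) ennreal_leI] by (simp add: mult_ac)
    qed
  qed
qed

lemma aniso_le_space:
  assumes "0 < \<gamma>" "aniso_le \<gamma> K f"
  shows "f \<in> aniso_space A B \<alpha> S \<gamma>" "aniso_norm A B \<alpha> S \<gamma> f \<le> ennreal (real nn * K)"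
proof -
  show "f \<in> aniso_space A B \<alpha> S \<gamma>" using assms unfolding aniso_space_def aniso_le_def by auto
  have "hz_norm (E h) (S h) (aniso_order \<alpha> \<gamma> h) (\<lambda>z. f (x0 + z)) \<le> ennreal K" if "h \<in> {1..nn}" for h x0
    using assms(2) that unfolding aniso_le_def by blast
  then have "(\<Sum>h=1..nn. SUP x0. hz_norm (E h) (S h) (aniso_order \<alpha> \<gamma> h) (\<lambda>z. f (x0 + z))) \<le> (\<Sum>h=1..nn. ennreal K)"
    by (intro sum_mono SUP_least)
  then have "aniso_norm A B \<alpha> S \<gamma> f \<le> (\<Sum>h=1..nn. ennreal K)" using assms(1) unfolding aniso_norm_def by simp
  also have "\<dots> = ennreal (real nn * K)" using assms sum_ennreal[of "{1..nn}" "\<lambda>_. K"] by (simp add: aniso_le_def)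
  finally show "aniso_norm A B \<alpha> S \<gamma> f \<le> ennreal (real nn * K)" .
qed

theorem ou_semigroup_operator_norm:
  assumes \<beta>: "0 \<le> \<beta>" and \<gamma>: "0 \<le> \<gamma>" "\<gamma> < 1 + \<alpha>" and le: "\<beta> \<le> \<gamma>"
  shows "\<exists>C>0. \<forall>t>0.
    (\<forall>\<phi>\<in>aniso_space A B \<alpha> S \<beta>. ou_semigroup M A Y t \<phi> \<in> aniso_space A B \<alpha> S \<gamma>) \<and>
    operator_norm (aniso_space A B \<alpha> S \<beta>) (aniso_norm A B \<alpha> S \<beta>) (aniso_norm A B \<alpha> S \<gamma>)
        (ou_semigroup M A Y t)
      \<le> ennreal (C * (1 + t powr ((\<beta> - \<gamma>) / \<alpha>)))"
proof (cases "\<gamma> = 0")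
  case True
  then have z: "\<gamma> = 0" "\<beta> = 0" using \<beta> le by auto
  show ?thesis
  proof (intro exI[of _ 1] conjI allI impI ballI)
    fix t :: real assume t: "0 < t"
    show "ou_semigroup M A Y t \<phi> \<in> aniso_space A B \<alpha> S \<gamma>" if "\<phi> \<in> aniso_space A B \<alpha> S \<beta>" for \<phi>
      using that PP_Cb[of t] t by (simp add: z aniso_space_def ou_semigroup_PP)
    show "operator_norm (aniso_space A B \<alpha> S \<beta>) (aniso_norm A B \<alpha> S \<beta>) (aniso_norm A B \<alpha> S \<gamma>) (ou_semigroup M A Y t)
      \<le> ennreal (1 * (1 + t powr ((\<beta> - \<gamma>) / \<alpha>)))"
      unfolding operator_norm_def
    proof (rule SUP_least, clarify)
      fix \<phi> assume \<phi>: "\<phi> \<in> aniso_space A B \<alpha> S \<beta>" "aniso_norm A B \<alpha> S \<beta> \<phi> \<le> 1"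
      have "source_le \<beta> 1 \<phi>" by (rule source_le_norm[OF \<phi>])
      then have "\<bar>PP t \<phi> x\<bar> \<le> 1" for x using t by (intro PP_bound bcont_Cb) (auto simp: source_le_def z)
      then have "aniso_norm A B \<alpha> S \<gamma> (ou_semigroup M A Y t \<phi>) \<le> ennreal 1"
        unfolding aniso_norm_def ou_semigroup_PP sup_norm_on_def z by (auto intro!: SUP_least simp del: ennreal_1 intro: ennreal_leI)
      also have "\<dots> \<le> ennreal (1 * (1 + t powr ((\<beta> - \<gamma>) / \<alpha>)))" by (intro ennreal_leI) simp
      finally show "aniso_norm A B \<alpha> S \<gamma> (ou_semigroup M A Y t \<phi>) \<le> ennreal (1 * (1 + t powr ((\<beta> - \<gamma>) / \<alpha>)))" .
    qed
  qed simp
next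
  case False
  then have \<gamma>0: "0 < \<gamma>" using \<gamma> by simp
  obtain C where C: "0 \<le> C" "\<And>t \<phi> K. 0 < t \<Longrightarrow> 0 \<le> K \<Longrightarrow> source_le \<beta> K \<phi> \<Longrightarrow> aniso_le \<gamma> (C * (1 + t powr ((\<beta> - \<gamma>) / \<alpha>)) * K) (PP t \<phi>)"
    using PP_aniso[OF \<beta> le \<gamma>0 \<gamma>(2)] by metis
  show ?thesis
  \<comment> \<open>The norm sums over \<open>nn\<close> subspaces; the summand 1 makes the constant
    positive.\<close>
  proof (intro exI[of _ "real nn * C + 1"] conjI allI impI ballI)
    show "0 < real nn * C + 1" using C(1) by (simp add: add_nonneg_pos)
    fix t :: real assume t: "0 < t"
    show "ou_semigroup M A Y t \<phi> \<in> aniso_space A B \<alpha> S \<gamma>" if \<phi>: "\<phi> \<in> aniso_space A B \<alpha> S \<beta>" for \<phi>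
    proof -
      obtain K where "0 \<le> K" "source_le \<beta> K \<phi>" by (rule source_le_exists[OF \<phi>])
      then show ?thesis unfolding ou_semigroup_PP by (intro aniso_le_space(1)[OF \<gamma>0 C(2)[OF t]])
    qed
    show "operator_norm (aniso_space A B \<alpha> S \<beta>) (aniso_norm A B \<alpha> S \<beta>) (aniso_norm A B \<alpha> S \<gamma>) (ou_semigroup M A Y t)
      \<le> ennreal ((real nn * C + 1) * (1 + t powr ((\<beta> - \<gamma>) / \<alpha>)))"
      unfolding operator_norm_def
    proof (rule SUP_least, clarify)
      fix \<phi> assume \<phi>: "\<phi> \<in> aniso_space A B \<alpha> S \<beta>" "aniso_norm A B \<alpha> S \<beta> \<phi> \<le> 1"
      have "aniso_norm A B \<alpha> S \<gamma> (PP t \<phi>) \<le> ennreal (real nn * (C * (1 + t powr ((\<beta> - \<gamma>) / \<alpha>)) * 1))"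
        by (rule aniso_le_space(2)[OF \<gamma>0 C(2)[OF t _ source_le_norm[OF \<phi>]]]) simp
      also have "\<dots> \<le> ennreal ((real nn * C + 1) * (1 + t powr ((\<beta> - \<gamma>) / \<alpha>)))"
        by (intro ennreal_leI) (simp add: algebra_simps)
      finally show "aniso_norm A B \<alpha> S \<gamma> (ou_semigroup M A Y t \<phi>) \<le> ennreal ((real nn * C + 1) * (1 + t powr ((\<beta> - \<gamma>) / \<alpha>)))"
        unfolding ou_semigroup_PP .
    qed
  qed
qed

end

theorem corollary5:
  fixes A :: "real^'n^'n" and B :: "real^'d^'n" and b :: "real^'d" and Q :: "real^'d^'d"
    and \<nu> \<mu> :: "(real^'d) measure" and r0 \<alpha> :: real
    and M :: "'w measure" and Z :: "real \<Rightarrow> 'w \<Rightarrow> real^'d" and Y :: "real \<Rightarrow> 'w \<Rightarrow> real^'n"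
    and S :: "nat \<Rightarrow> (real^'n) set"
    and \<beta> \<gamma> :: real
  assumes dims: "CARD('d) \<le> CARD('n)"
    and rank_B: "rank B = CARD('d)"
    and Q_symmetric: "transpose Q = Q"
    and Q_nonneg: "\<And>p. 0 \<le> p \<bullet> (Q *v p)"
    and levy_measure: "levy_measure \<nu>"
    and r0: "0 < r0"
    and alpha: "0 < \<alpha>" "\<alpha> < 2"
    and mu: "nondegenerate_spherical \<alpha> \<mu>"
    and ND: "stable_lower_bound \<nu> r0 \<alpha> \<mu>"
    and K: "kalman_rank A B CARD('n) = CARD('n)"
    and levy_process: "levy_process M Z"
    and symbol: "\<And>t p. 0 \<le> t \<Longrightarrow>
      (\<integral>\<omega>. iexp (p \<bullet> Z t \<omega>) \<partial>M) = exp (- (complex_of_real t * levy_symbol b Q \<nu> p))"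
    and convolution: "\<And>t. 0 \<le> t \<Longrightarrow>
      is_stoch_integral M Z (\<lambda>s. mat_exp ((t - s) *\<^sub>R A) ** B) t (Y t)"
    and bases: "\<And>h. h \<in> {1..kalman_index A B} \<Longrightarrow> orthonormal_basis_of (S h) (E_space A B h)"
    and beta: "0 \<le> \<beta>" "\<beta> < 1 + \<alpha>"
    and gamma: "0 \<le> \<gamma>" "\<gamma> < 1 + \<alpha>"
    and beta_le_gamma: "\<beta> \<le> \<gamma>"
  shows "\<exists>C>0. \<forall>t>0.
    (\<forall>\<phi>\<in>aniso_space A B \<alpha> S \<beta>. ou_semigroup M A Y t \<phi> \<in> aniso_space A B \<alpha> S \<gamma>) \<and>
    operator_norm (aniso_space A B \<alpha> S \<beta>) (aniso_norm A B \<alpha> S \<beta>) (aniso_norm A B \<alpha> S \<gamma>)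
        (ou_semigroup M A Y t)
      \<le> ennreal (C * (1 + t powr ((\<beta> - \<gamma>) / \<alpha>)))"
proof -
  have "prob_space M" using levy_process by (simp add: levy_process_def)
  then interpret prob_space M .
  interpret ou A B S \<mu> \<alpha> M b Q \<nu> Z r0 Y
    by unfold_locales
      (use assms in \<open>auto simp: levy_process_def\<close>)
  show ?thesis by (rule ou_semigroup_operator_norm[OF beta(1) gamma beta_le_gamma])
qed

end
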